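(* Let $T$ be an algebraic torus over $\mathbb{C}$ of dimension $k$, with character group $X(T)$ freely generated by $x_1,\dots,x_k$, so that $\mathcal{O}(T)=\mathbb{C}[X(T)]=\mathbb{C}[x_1^{\pm1},\dots,x_k^{\pm1}]$. Let $J$ be a Hopf $2$-cocycle for $\mathcal{O}(T)$, let $S$ be its support, and let $l$ be the dimension of $S$. Let $S^0$ be the identity component of $S$. Fix a splitting of the inclusion $S^0\hookrightarrow T$, and use it to embed $\mathcal{O}(S^0)$ in $\mathcal{O}(T)$. Set $\lambda_{ij}:=R^J(x_i,x_j)$ for $1\le i,j\le k$, let $\lambda=\{\lambda_{ij}\}$, and let $\lambda^0$ be the $l\times l$ matrix corresponding to the restriction of $R^J$ to $\mathcal{O}(S^0)$. The following hold: 1) $\mathcal{O}(T)_J\cong E(\lambda)$ is a Noetherian domain with center $\mathcal{O}(T/S)$. 2) $S$ is the Zariski closure of the image of the map $\tilde\lambda:X(T)\to\mathrm{Hom}(X(T),\mathbb{C}^* )=T$, $x\mapsto\lambda(x,?)$ (viewing $\lambda$ as an alternating bicharacter on $X(T)$). 3) $\mathcal{O}(S)_J\cong\mathbb{C}^{R^J}[X(S)]\cong E(\lambda^0)\#_J\mathbb{C}[X(S/S^0)]$ (a crossed product with $2$-cocycle $J$) is a simple algebra. 4) $(\mathcal{O}(T)_J)^{op}\cong{}_{J^{-1}}\mathcal{O}(T)$.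
   Context: Everything is over $\mathbb{C}$; Sweedler notation $\Delta(a)=\sum a_1\otimes a_2$ is used. A Hopf $2$-cocycle for a Hopf algebra $A$ is a linear map $J:A\otimes A\to\mathbb{C}$, invertible under the convolution product $*$ of $\mathrm{Hom}_{\mathbb{C}}(A\otimes A,\mathbb{C})$, such that $\sum J(a_1b_1,c)J(a_2,b_2)=\sum J(a,b_1c_1)J(b_2,c_2)$ and $J(a,1)=\varepsilon(a)=J(1,a)$. Two Hopf $2$-cocycles $J,J'$ for $A$ are gauge equivalent if $J'=(\chi\circ m)*J*(\chi^{-1}\otimes\chi^{-1})$ for some convolution-invertible linear $\chi:A\to\mathbb{C}$ with $\chi(1)=1$. For an affine algebraic group $G$ and a Hopf $2$-cocycle $J$ for $\mathcal{O}(G)$: $\mathcal{O}(G)_J$ is $\mathcal{O}(G)$ with multiplication $m_J(a\otimes b)=\sum a_1b_1J(a_2,b_2)$, and ${}_{J^{-1}}\mathcal{O}(G)$ is $\mathcal{O}(G)$ with multiplication ${}_{J^{-1}}m(a\otimes b)=\sum J^{-1}(a_1,b_1)a_2b_2$. Put $J_{21}(a,b):=J(b,a)$, $R^J:=J_{21}^{-1}*J$. $J$ is minimal if $R^J$ is nondegenerate, i.e. $\{a\mid R^J(b,a)=0\ \forall b\}=0$. The support of $J$ is the closed subgroup $H\subseteq G$ (well defined up to conjugation) such that $J$ is gauge equivalent to a minimal Hopf $2$-cocycle for $\mathcal{O}(H)$, viewed as a Hopf $2$-cocycle for $\mathcal{O}(G)$ via restriction $\mathcal{O}(G)\twoheadrightarrow\mathcal{O}(H)$;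 $\mathcal{O}(H)_J$ denotes $\mathcal{O}(H)$ twisted on the right by this minimal cocycle. For an $n\times n$ matrix $q=\{q_{ij}\}$ with $q_{ii}=1$, $q_{ji}=q_{ij}^{-1}$, $E(q)$ is the algebra generated by $x_1^{\pm1},\dots,x_n^{\pm1}$ subject to $x_ix_j=q_{ij}x_jx_i$. Via the splitting, $X(S^0)$ is a subgroup of $X(T)$; $\lambda^0$ is the matrix of values of $R^J$ on a basis of $X(S^0)\cong\mathbb{Z}^l$. The alternating bicharacter $\lambda$ is the one on $X(T)$ with $\lambda(x_i,x_j)=\lambda_{ij}$. $\mathbb{C}^{R^J}[X(S)]$ denotes the twisted group algebra of $X(S)$ whose cocycle class corresponds to the alternating bicharacter $R^J$ on $X(S)$, i.e. it has a basis of invertible elements $u_x$, $x\in X(S)$, with $u_xu_y\in\mathbb{C}^*u_{xy}$ and $u_xu_y=R^J(x,y)u_yu_x$. In the crossed product, $X(S)=X(S^0)\times X(S/S^0)$, the group $X(S/S^0)$ acts on $E(\lambda^0)=\mathcal{O}(S^0)_J$ by conjugation inside $\mathcal{O}(S)_J$ (so $x\triangleright y=R^J(x,y)y$ for $x\in X(S/S^0)$, $y\in X(S^0)$), and the multiplication on $E(\lambda^0)\otimes\mathbb{C}[X(S/S^0)]$ is $(f\#x)(g\#y)=f\,(x\triangleright g)\,J(x,y)\#xy$. *)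

theory Defs
  imports
    "HOL-Algebra.QuotRing"
    "HOL-Algebra.Module"
    "HOL-Library.Function_Algebras"
    "HOL-Library.Extended_Nat"
    "HOL-Analysis.Abstract_Topology_2"
begin

section \<open>Affine algebraic groups as groups with a ring of regular functions\<close>

text \<open>
  The coordinate ring of \<open>G\<close> is a set of genuine functions on \<open>carrier G\<close>, extended by \<open>0\<close> outside
  \<open>carrier G\<close>; so its unit is \<open>indicator (carrier G)\<close>, and pointwise \<open>+\<close>, \<open>*\<close> and \<open>0\<close> are those of
  the algebra.
\<close>

record 'g alg_group = "'g monoid" +
  coord_ring :: "('g \<Rightarrow> complex) set"  (\<open>\<O>\<index>\<close>)

definition pullback :: "'a set \<Rightarrow> ('a \<Rightarrow> 'b) \<Rightarrow> ('b \<Rightarrow> complex) \<Rightarrow> 'a \<Rightarrow> complex" where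
  "pullback A \<phi> f = (\<lambda>a. if a \<in> A then f (\<phi> a) else 0)"

abbreviation fun_restrict :: "'a set \<Rightarrow> ('a \<Rightarrow> complex) \<Rightarrow> 'a \<Rightarrow> complex" where
  "fun_restrict A \<equiv> pullback A (\<lambda>a. a)"

definition fun_smult :: "complex \<Rightarrow> ('a \<Rightarrow> complex) \<Rightarrow> 'a \<Rightarrow> complex" where
  "fun_smult c f = (\<lambda>a. c * f a)"

definition zariski :: "'g alg_group \<Rightarrow> 'g topology" where
  "zariski G = topology_generated_by {{g \<in> carrier G. f g \<noteq> 0} | f. f \<in> \<O>\<^bsub>G\<^esub>}"

definition closed_subgroup :: "'g alg_group \<Rightarrow> 'g set \<Rightarrow> bool" where
  "closed_subgroup G H \<longleftrightarrow> subgroup H G \<and> closedin (zariski G) H"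

definition sub_group :: "'g alg_group \<Rightarrow> 'g set \<Rightarrow> 'g alg_group" where
  "sub_group G H = G\<lparr>carrier := H, coord_ring := fun_restrict H ` \<O>\<^bsub>G\<^esub>\<rparr>"

text \<open>For \<open>H\<close> a normal closed subgroup, the regular functions on \<open>G/H\<close> are those functions whose
  pullback to \<open>G\<close> is regular, i.e. \<open>\<O>(G/H) = \<O>(G)\<^sup>H\<close>.\<close>

definition quot_group :: "'g alg_group \<Rightarrow> 'g set \<Rightarrow> 'g set alg_group" where
  "quot_group G H =
     \<lparr>carrier = carrier (G Mod H), mult = mult (G Mod H), one = one (G Mod H),
      coord_ring = {f. (\<forall>X. X \<notin> carrier (G Mod H) \<longrightarrow> f X = 0) \<and>
                       pullback (carrier G) (\<lambda>g. H #>\<^bsub>G\<^esub> g) f \<in> \<O>\<^bsub>G\<^esub>}\<rparr>"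

definition alg_group_hom :: "'g alg_group \<Rightarrow> 'h alg_group \<Rightarrow> ('g \<Rightarrow> 'h) \<Rightarrow> bool" where
  "alg_group_hom G H \<phi> \<longleftrightarrow> \<phi> \<in> hom G H \<and> (\<forall>f\<in>\<O>\<^bsub>H\<^esub>. pullback (carrier G) \<phi> f \<in> \<O>\<^bsub>G\<^esub>)"

definition alg_group_iso :: "'g alg_group \<Rightarrow> 'h alg_group \<Rightarrow> ('g \<Rightarrow> 'h) \<Rightarrow> bool" where
  "alg_group_iso G H \<phi> \<longleftrightarrow> \<phi> \<in> iso G H \<and> \<O>\<^bsub>G\<^esub> = pullback (carrier G) \<phi> ` \<O>\<^bsub>H\<^esub>"

definition identity_component :: "'g alg_group \<Rightarrow> 'g set" where
  "identity_component G = connected_component_of_set (zariski G) \<one>\<^bsub>G\<^esub>"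

definition irreducible_closed :: "'a topology \<Rightarrow> 'a set \<Rightarrow> bool" where
  "irreducible_closed X Z \<longleftrightarrow> closedin X Z \<and> Z \<noteq> {} \<and>
     (\<forall>A B. closedin X A \<and> closedin X B \<and> Z = A \<union> B \<longrightarrow> Z = A \<or> Z = B)"

definition krull_dim :: "'a topology \<Rightarrow> enat" where
  "krull_dim X = Sup {enat n | n. \<exists>Z :: nat \<Rightarrow> 'a set.
     (\<forall>i\<le>n. irreducible_closed X (Z i)) \<and> (\<forall>i<n. Z i \<subset> Z (Suc i))}"

definition mult_group_power :: "nat \<Rightarrow> (nat \<Rightarrow> complex) alg_group" where
  "mult_group_power k =
     \<lparr>carrier = {1..k} \<rightarrow>\<^sub>E (UNIV - {0}),
      mult = (\<lambda>z w. \<lambda>i\<in>{1..k}. z i * w i),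
      one = (\<lambda>i\<in>{1..k}. 1),
      coord_ring = {fun_restrict ({1..k} \<rightarrow>\<^sub>E (UNIV - {0}))
                      (\<lambda>z. \<Sum>n\<in>N. c n * (\<Prod>i=1..k. z i powi n i))
                    | (N :: (nat \<Rightarrow> int) set) c. finite N}\<rparr>"

definition torus :: "'g alg_group \<Rightarrow> nat \<Rightarrow> bool" where
  "torus T k \<longleftrightarrow> group T \<and> (\<exists>\<phi>. alg_group_iso T (mult_group_power k) \<phi>)"

definition char_group :: "'g alg_group \<Rightarrow> ('g \<Rightarrow> complex) monoid" where
  "char_group G =
     \<lparr>carrier = {\<chi> \<in> \<O>\<^bsub>G\<^esub>. (\<forall>g\<in>carrier G. \<chi> g \<noteq> 0) \<and>
                  (\<forall>g\<in>carrier G. \<forall>h\<in>carrier G. \<chi> (g \<otimes>\<^bsub>G\<^esub> h) = \<chi> g * \<chi> h)},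
      mult = (*), one = indicator (carrier G)\<rparr>"

definition freely_generates :: "('a, 'm) monoid_scheme \<Rightarrow> nat \<Rightarrow> (nat \<Rightarrow> 'a) \<Rightarrow> bool" where
  "freely_generates X k x \<longleftrightarrow> x \<in> {1..k} \<rightarrow> carrier X \<and>
     bij_betw (\<lambda>n. \<Otimes>\<^bsub>X\<^esub>i\<in>{1..k}. x i [^]\<^bsub>X\<^esub> n i) ({1..k} \<rightarrow>\<^sub>E (UNIV :: int set)) (carrier X)"

definition alternating_bicharacter ::
  "('a, 'm) monoid_scheme \<Rightarrow> ('a \<Rightarrow> 'a \<Rightarrow> complex) \<Rightarrow> bool" where
  "alternating_bicharacter X b \<longleftrightarrow>
     (\<forall>x\<in>carrier X. \<forall>y\<in>carrier X. b x y \<noteq> 0) \<and>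
     (\<forall>x\<in>carrier X. \<forall>y\<in>carrier X. \<forall>z\<in>carrier X.
        b (x \<otimes>\<^bsub>X\<^esub> y) z = b x z * b y z \<and> b x (y \<otimes>\<^bsub>X\<^esub> z) = b x y * b x z) \<and>
     (\<forall>x\<in>carrier X. b x x = 1)"

text \<open>The identification \<open>Hom(X(T), \<complex>\<^sup>*) = T\<close>: the point at which evaluation of characters is \<open>\<phi>\<close>.\<close>

definition dual_point :: "'g alg_group \<Rightarrow> (('g \<Rightarrow> complex) \<Rightarrow> complex) \<Rightarrow> 'g" where
  "dual_point T \<phi> = (THE t. t \<in> carrier T \<and> (\<forall>\<psi>\<in>carrier (char_group T). \<psi> t = \<phi> \<psi>))"

section \<open>Hopf 2-cocycles\<close>

text \<open>
  A list of pairs \<open>(a\<^sub>1, a\<^sub>2)\<close> stands for the tensor \<open>\<Sum> a\<^sub>1 \<otimes> a\<^sub>2\<close>. As \<open>\<O>(G) \<otimes> \<O>(G)\<close> embeds into the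
  functions on \<open>G \<times> G\<close>, any list as below represents \<open>\<Delta>(a)\<close>, and (bi)linear expressions in Sweedler
  notation do not depend on the choice. Linear maps \<open>A \<otimes> A \<rightarrow> \<complex>\<close> are rendered as bilinear maps; only
  their values on \<open>\<O>(G)\<close> matter.
\<close>

definition coproduct :: "'g alg_group \<Rightarrow> ('g \<Rightarrow> complex) \<Rightarrow> (('g \<Rightarrow> complex) \<times> ('g \<Rightarrow> complex)) list" where
  "coproduct G a = (SOME ps. set ps \<subseteq> \<O>\<^bsub>G\<^esub> \<times> \<O>\<^bsub>G\<^esub> \<and>
     (\<forall>g\<in>carrier G. \<forall>h\<in>carrier G. a (g \<otimes>\<^bsub>G\<^esub> h) = (\<Sum>(a1, a2)\<leftarrow>ps. a1 g * a2 h)))"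

definition counit :: "'g alg_group \<Rightarrow> ('g \<Rightarrow> complex) \<Rightarrow> complex" where
  "counit G a = a \<one>\<^bsub>G\<^esub>"

definition linear_form :: "'g alg_group \<Rightarrow> (('g \<Rightarrow> complex) \<Rightarrow> complex) \<Rightarrow> bool" where
  "linear_form G \<chi> \<longleftrightarrow>
     (\<forall>a\<in>\<O>\<^bsub>G\<^esub>. \<forall>b\<in>\<O>\<^bsub>G\<^esub>. \<chi> (a + b) = \<chi> a + \<chi> b) \<and>
     (\<forall>c. \<forall>a\<in>\<O>\<^bsub>G\<^esub>. \<chi> (fun_smult c a) = c * \<chi> a)"

type_synonym 'g form2 = "('g \<Rightarrow> complex) \<Rightarrow> ('g \<Rightarrow> complex) \<Rightarrow> complex"

definition bilinear_form :: "'g alg_group \<Rightarrow> 'g form2 \<Rightarrow> bool" where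
  "bilinear_form G J \<longleftrightarrow>
     (\<forall>a\<in>\<O>\<^bsub>G\<^esub>. linear_form G (J a)) \<and> (\<forall>b\<in>\<O>\<^bsub>G\<^esub>. linear_form G (\<lambda>a. J a b))"

definition conv1 :: "'g alg_group \<Rightarrow> (('g \<Rightarrow> complex) \<Rightarrow> complex) \<Rightarrow> (('g \<Rightarrow> complex) \<Rightarrow> complex) \<Rightarrow>
    ('g \<Rightarrow> complex) \<Rightarrow> complex" where
  "conv1 G \<chi> \<psi> a = (\<Sum>(a1, a2)\<leftarrow>coproduct G a. \<chi> a1 * \<psi> a2)"

definition conv2 :: "'g alg_group \<Rightarrow> 'g form2 \<Rightarrow> 'g form2 \<Rightarrow> 'g form2" where
  "conv2 G J K a b =
     (\<Sum>(a1, a2)\<leftarrow>coproduct G a. \<Sum>(b1, b2)\<leftarrow>coproduct G b. J a1 b1 * K a2 b2)"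

definition conv2_inverse :: "'g alg_group \<Rightarrow> 'g form2 \<Rightarrow> 'g form2 \<Rightarrow> bool" where
  "conv2_inverse G J K \<longleftrightarrow> bilinear_form G K \<and>
     (\<forall>a\<in>\<O>\<^bsub>G\<^esub>. \<forall>b\<in>\<O>\<^bsub>G\<^esub>. conv2 G J K a b = counit G a * counit G b \<and>
                          conv2 G K J a b = counit G a * counit G b)"

definition conv2_inv :: "'g alg_group \<Rightarrow> 'g form2 \<Rightarrow> 'g form2" where
  "conv2_inv G J = (SOME K. conv2_inverse G J K)"

definition hopf_2_cocycle :: "'g alg_group \<Rightarrow> 'g form2 \<Rightarrow> bool" where
  "hopf_2_cocycle G J \<longleftrightarrow> bilinear_form G J \<and> (\<exists>K. conv2_inverse G J K) \<and>
     (\<forall>a\<in>\<O>\<^bsub>G\<^esub>. \<forall>b\<in>\<O>\<^bsub>G\<^esub>. \<forall>c\<in>\<O>\<^bsub>G\<^esub>.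
        (\<Sum>(a1, a2)\<leftarrow>coproduct G a. \<Sum>(b1, b2)\<leftarrow>coproduct G b. J (a1 * b1) c * J a2 b2) =
        (\<Sum>(b1, b2)\<leftarrow>coproduct G b. \<Sum>(c1, c2)\<leftarrow>coproduct G c. J a (b1 * c1) * J b2 c2)) \<and>
     (\<forall>a\<in>\<O>\<^bsub>G\<^esub>. J a (indicator (carrier G)) = counit G a \<and>
                   J (indicator (carrier G)) a = counit G a)"

definition gauge_equivalent :: "'g alg_group \<Rightarrow> 'g form2 \<Rightarrow> 'g form2 \<Rightarrow> bool" where
  "gauge_equivalent G J J' \<longleftrightarrow> (\<exists>\<chi> \<chi>'. linear_form G \<chi> \<and> linear_form G \<chi>' \<and>
     (\<forall>a\<in>\<O>\<^bsub>G\<^esub>. conv1 G \<chi> \<chi>' a = counit G a \<and> conv1 G \<chi>' \<chi> a = counit G a) \<and>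
     \<chi> (indicator (carrier G)) = 1 \<and>
     (\<forall>a\<in>\<O>\<^bsub>G\<^esub>. \<forall>b\<in>\<O>\<^bsub>G\<^esub>.
        J' a b = conv2 G (conv2 G (\<lambda>a b. \<chi> (a * b)) J) (\<lambda>a b. \<chi>' a * \<chi>' b) a b))"

definition R_form :: "'g alg_group \<Rightarrow> 'g form2 \<Rightarrow> 'g form2" where
  "R_form G J = conv2 G (conv2_inv G (\<lambda>a b. J b a)) J"

definition minimal_cocycle :: "'g alg_group \<Rightarrow> 'g form2 \<Rightarrow> bool" where
  "minimal_cocycle G J \<longleftrightarrow> hopf_2_cocycle G J \<and>
     {a \<in> \<O>\<^bsub>G\<^esub>. \<forall>b\<in>\<O>\<^bsub>G\<^esub>. R_form G J b a = 0} = {0}"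

text \<open>\<open>H\<close> is the support of \<open>J\<close>, as witnessed by the minimal Hopf 2-cocycle \<open>JH\<close> for \<open>\<O>(H)\<close>; the
  pair \<open>(H, JH)\<close> is what \<open>\<O>(H)\<^sub>J\<close> refers to.\<close>

definition support_with :: "'g alg_group \<Rightarrow> 'g form2 \<Rightarrow> 'g set \<Rightarrow> 'g form2 \<Rightarrow> bool" where
  "support_with G J H JH \<longleftrightarrow> closed_subgroup G H \<and> minimal_cocycle (sub_group G H) JH \<and>
     gauge_equivalent G J (\<lambda>a b. JH (fun_restrict H a) (fun_restrict H b))"

section \<open>Associative algebras over the complex numbers\<close>

type_synonym 'a calg = "(complex, 'a) module"

definition alg_isomorphic :: "'a calg \<Rightarrow> 'b calg \<Rightarrow> bool"  (infix \<open>\<cong>\<^sub>a\<^sub>l\<^sub>g\<close> 50) where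
  "A \<cong>\<^sub>a\<^sub>l\<^sub>g B \<longleftrightarrow> (\<exists>h \<in> ring_hom A B. bij_betw h (carrier A) (carrier B) \<and>
     (\<forall>c. \<forall>a\<in>carrier A. h (c \<odot>\<^bsub>A\<^esub> a) = c \<odot>\<^bsub>B\<^esub> h a))"

definition opposite :: "'a calg \<Rightarrow> 'a calg" where
  "opposite A = A\<lparr>mult := (\<lambda>a b. b \<otimes>\<^bsub>A\<^esub> a)\<rparr>"

definition alg_center :: "'a calg \<Rightarrow> 'a calg" where
  "alg_center A = A\<lparr>carrier := {z \<in> carrier A. \<forall>a\<in>carrier A. z \<otimes>\<^bsub>A\<^esub> a = a \<otimes>\<^bsub>A\<^esub> z}\<rparr>"

text \<open>The library's \<open>domain\<close> is commutative, and its \<open>noetherian_ring\<close> speaks of two-sided ideals.\<close>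

definition nc_domain :: "'a calg \<Rightarrow> bool" where
  "nc_domain A \<longleftrightarrow> ring A \<and> \<one>\<^bsub>A\<^esub> \<noteq> \<zero>\<^bsub>A\<^esub> \<and>
     (\<forall>a\<in>carrier A. \<forall>b\<in>carrier A. a \<otimes>\<^bsub>A\<^esub> b = \<zero>\<^bsub>A\<^esub> \<longrightarrow> a = \<zero>\<^bsub>A\<^esub> \<or> b = \<zero>\<^bsub>A\<^esub>)"

definition left_ideal :: "'a set \<Rightarrow> 'a calg \<Rightarrow> bool" where
  "left_ideal I A \<longleftrightarrow> additive_subgroup I A \<and> (\<forall>r\<in>carrier A. \<forall>a\<in>I. r \<otimes>\<^bsub>A\<^esub> a \<in> I)"

definition left_noetherian :: "'a calg \<Rightarrow> bool" where
  "left_noetherian A \<longleftrightarrow> ring A \<and> (\<forall>I. left_ideal I A \<longrightarrow>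
     (\<exists>F. finite F \<and> F \<subseteq> carrier A \<and> I = \<Inter>{K. left_ideal K A \<and> F \<subseteq> K}))"

definition nc_noetherian :: "'a calg \<Rightarrow> bool" where
  "nc_noetherian A \<longleftrightarrow> left_noetherian A \<and> left_noetherian (opposite A)"

definition simple_algebra :: "'a calg \<Rightarrow> bool" where
  "simple_algebra A \<longleftrightarrow> ring A \<and> \<one>\<^bsub>A\<^esub> \<noteq> \<zero>\<^bsub>A\<^esub> \<and>
     (\<forall>I. ideal I A \<longrightarrow> I = {\<zero>\<^bsub>A\<^esub>} \<or> I = carrier A)"

definition quot_algebra :: "'a calg \<Rightarrow> 'a set \<Rightarrow> 'a set calg" where
  "quot_algebra A I =
     \<lparr>carrier = carrier (A Quot I), mult = mult (A Quot I), one = one (A Quot I),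
      zero = zero (A Quot I), add = add (A Quot I),
      smult = (\<lambda>c X. \<Union>a\<in>X. I +>\<^bsub>A\<^esub> (c \<odot>\<^bsub>A\<^esub> a))\<rparr>"

definition coord_algebra :: "'g alg_group \<Rightarrow> ('g \<Rightarrow> complex) calg" where
  "coord_algebra G =
     \<lparr>carrier = \<O>\<^bsub>G\<^esub>, mult = (*), one = indicator (carrier G), zero = 0, add = (+),
      smult = fun_smult\<rparr>"

text \<open>\<open>right_twist G J\<close> is \<open>\<O>(G)\<^sub>J\<close>, and \<open>left_twist G K\<close> is \<open>\<^sub>K\<O>(G)\<close>.\<close>

definition right_twist :: "'g alg_group \<Rightarrow> 'g form2 \<Rightarrow> ('g \<Rightarrow> complex) calg" where
  "right_twist G J = (coord_algebra G)\<lparr>mult := (\<lambda>a b.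
     \<Sum>(a1, a2)\<leftarrow>coproduct G a. \<Sum>(b1, b2)\<leftarrow>coproduct G b. fun_smult (J a2 b2) (a1 * b1))\<rparr>"

definition left_twist :: "'g alg_group \<Rightarrow> 'g form2 \<Rightarrow> ('g \<Rightarrow> complex) calg" where
  "left_twist G K = (coord_algebra G)\<lparr>mult := (\<lambda>a b.
     \<Sum>(a1, a2)\<leftarrow>coproduct G a. \<Sum>(b1, b2)\<leftarrow>coproduct G b. fun_smult (K a1 b1) (a2 * b2))\<rparr>"

subsection \<open>The algebra E(q)\<close>

text \<open>Words in the letters \<open>(i, True)\<close> for \<open>x\<^sub>i\<close> and \<open>(i, False)\<close> for the inverse of \<open>x\<^sub>i\<close>; elements of
  the free algebra are finitely supported functions on words.\<close>

type_synonym word = "(nat \<times> bool) list"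

definition free_algebra :: "nat \<Rightarrow> (word \<Rightarrow> complex) calg" where
  "free_algebra n =
     \<lparr>carrier = {f. finite {w. f w \<noteq> 0} \<and> (\<forall>w. f w \<noteq> 0 \<longrightarrow> fst ` set w \<subseteq> {1..n})},
      mult = (\<lambda>f g w. \<Sum>i\<le>length w. f (take i w) * g (drop i w)),
      one = indicator {[]}, zero = 0, add = (+), smult = fun_smult\<rparr>"

definition E_relations :: "nat \<Rightarrow> (nat \<Rightarrow> nat \<Rightarrow> complex) \<Rightarrow> (word \<Rightarrow> complex) set" where
  "E_relations n q =
     {indicator {[(i, True), (i, False)]} - indicator {[]} | i. i \<in> {1..n}} \<union>
     {indicator {[(i, False), (i, True)]} - indicator {[]} | i. i \<in> {1..n}} \<union>
     {indicator {[(i, True), (j, True)]} - fun_smult (q i j) (indicator {[(j, True), (i, True)]})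
      | i j. i \<in> {1..n} \<and> j \<in> {1..n}}"

definition E_ideal :: "nat \<Rightarrow> (nat \<Rightarrow> nat \<Rightarrow> complex) \<Rightarrow> (word \<Rightarrow> complex) set" where
  "E_ideal n q = Idl\<^bsub>free_algebra n\<^esub> (E_relations n q)"

definition E_alg :: "nat \<Rightarrow> (nat \<Rightarrow> nat \<Rightarrow> complex) \<Rightarrow> (word \<Rightarrow> complex) set calg" where
  "E_alg n q = quot_algebra (free_algebra n) (E_ideal n q)"

text \<open>The endomorphism of \<open>E(q)\<close> with \<open>x\<^sub>i \<mapsto> c\<^sub>i x\<^sub>i\<close> (for nonzero \<open>c\<^sub>i\<close>), computed on representatives.\<close>

definition E_scale ::
  "nat \<Rightarrow> (nat \<Rightarrow> nat \<Rightarrow> complex) \<Rightarrow> (nat \<Rightarrow> complex) \<Rightarrow> (word \<Rightarrow> complex) set \<Rightarrow> (word \<Rightarrow> complex) set" where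
  "E_scale n q c X = (\<Union>f\<in>X. E_ideal n q +>\<^bsub>free_algebra n\<^esub>
     (\<lambda>w. (\<Prod>(i, s)\<leftarrow>w. if s then c i else inverse (c i)) * f w))"

subsection \<open>Twisted group algebras and crossed products\<close>

definition group_2_cocycle :: "('x, 'm) monoid_scheme \<Rightarrow> ('x \<Rightarrow> 'x \<Rightarrow> complex) \<Rightarrow> bool" where
  "group_2_cocycle X \<sigma> \<longleftrightarrow>
     (\<forall>x\<in>carrier X. \<forall>y\<in>carrier X. \<sigma> x y \<noteq> 0) \<and>
     (\<forall>x\<in>carrier X. \<forall>y\<in>carrier X. \<forall>z\<in>carrier X.
        \<sigma> x y * \<sigma> (x \<otimes>\<^bsub>X\<^esub> y) z = \<sigma> x (y \<otimes>\<^bsub>X\<^esub> z) * \<sigma> y z) \<and>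
     (\<forall>x\<in>carrier X. \<sigma> x \<one>\<^bsub>X\<^esub> = 1 \<and> \<sigma> \<one>\<^bsub>X\<^esub> x = 1)"

text \<open>Basis \<open>u\<^sub>x = indicator {x}\<close> with \<open>u\<^sub>x u\<^sub>y = \<sigma>(x, y) u\<^sub>x\<^sub>y\<close>.\<close>

definition twisted_group_algebra ::
  "('x, 'm) monoid_scheme \<Rightarrow> ('x \<Rightarrow> 'x \<Rightarrow> complex) \<Rightarrow> ('x \<Rightarrow> complex) calg" where
  "twisted_group_algebra X \<sigma> =
     \<lparr>carrier = {f. finite {x. f x \<noteq> 0} \<and> {x. f x \<noteq> 0} \<subseteq> carrier X},
      mult = (\<lambda>f g z. \<Sum>(x, y) \<in> {(x, y). f x \<noteq> 0 \<and> g y \<noteq> 0 \<and> x \<otimes>\<^bsub>X\<^esub> y = z}. \<sigma> x y * f x * g y),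
      one = indicator {\<one>\<^bsub>X\<^esub>}, zero = 0, add = (+), smult = fun_smult\<rparr>"

text \<open>\<open>A \<otimes> \<complex>[X]\<close> as finitely supported functions \<open>F : X \<rightarrow> A\<close>, where \<open>f # x\<close> is the function with value
  \<open>f\<close> at \<open>x\<close> and \<open>0\<close> elsewhere; \<open>(f # x)(g # y) = f (\<alpha> x g) \<sigma>(x, y) # xy\<close>.\<close>

definition crossed_product ::
  "'a calg \<Rightarrow> ('x, 'm) monoid_scheme \<Rightarrow> ('x \<Rightarrow> 'a \<Rightarrow> 'a) \<Rightarrow> ('x \<Rightarrow> 'x \<Rightarrow> complex) \<Rightarrow> ('x \<Rightarrow> 'a) calg" where
  "crossed_product A X \<alpha> \<sigma> =
     \<lparr>carrier = {F. (\<forall>x. F x \<in> carrier A) \<and> finite {x. F x \<noteq> \<zero>\<^bsub>A\<^esub>} \<and> {x. F x \<noteq> \<zero>\<^bsub>A\<^esub>} \<subseteq> carrier X},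
      mult = (\<lambda>F G z. \<Oplus>\<^bsub>A\<^esub>p \<in> {(x, y). F x \<noteq> \<zero>\<^bsub>A\<^esub> \<and> G y \<noteq> \<zero>\<^bsub>A\<^esub> \<and> x \<otimes>\<^bsub>X\<^esub> y = z}.
                \<sigma> (fst p) (snd p) \<odot>\<^bsub>A\<^esub> (F (fst p) \<otimes>\<^bsub>A\<^esub> \<alpha> (fst p) (G (snd p)))),
      one = (\<lambda>x. if x = \<one>\<^bsub>X\<^esub> then \<one>\<^bsub>A\<^esub> else \<zero>\<^bsub>A\<^esub>),
      zero = (\<lambda>x. \<zero>\<^bsub>A\<^esub>),
      add = (\<lambda>F G x. F x \<oplus>\<^bsub>A\<^esub> G x),
      smult = (\<lambda>c F x. c \<odot>\<^bsub>A\<^esub> F x)\<rparr>"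

end

theory Submission
  imports Defs "HOL-Algebra.Generated_Groups" "HOL-Computational_Algebra.Primes"
begin

text \<open>
  Let \<open>G\<close> be a torus or a closed subgroup of one. The characters of \<open>G\<close> are group-like and form a
  basis of \<open>\<O>(G)\<close>, so a Hopf 2-cocycle \<open>J\<close> is the bilinear extension of a group 2-cocycle on \<open>X(G)\<close>,
  \<open>\<O>(G)\<^sub>J\<close> is the twisted group algebra of \<open>X(G)\<close>, and \<open>R\<^sup>J\<close> restricts to the antisymmetrization of the
  cocycle. The latter is invariant under gauge equivalence and, \<open>\<complex>\<^sup>*\<close> being divisible, determines the
  cocycle up to coboundaries; hence \<open>\<O>(T)\<^sub>J\<close> is \<open>E(\<lambda>)\<close>, and transposing the cocycle gives the opposite
  algebra. Minimality of \<open>J\<close> on the support \<open>S\<close> says that the characters trivial on \<open>S\<close> are exactly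
  the radical of \<open>R\<^sup>J\<close>. The center of a twisted group algebra is spanned by this radical, and a
  nondegenerate form makes the algebra simple.
\<close>

section \<open>Homomorphisms into \<open>\<complex>\<^sup>*\<close> and 2-cocycles of abelian groups\<close>

text \<open>Elements of the algebras are finitely supported functions, and sorting iterated products
  by degree is unwieldy. Identities are therefore tested by pairing with an arbitrary weight, which
  turns products into iterated sums whose terms match by the cocycle identity alone. The free
  algebra, as the algebra of the monoid of words with constant cocycle, obeys the same rules. Three
  points need more than the correspondence between cocycles and alternating forms. The presentation
  of \<open>E(q)\<close> must have no further kernel: its relations commute only the generators, so
  inverses and longer words have to be ordered modulo the ideal. For the noetherian property, a
  multiplicative weight built from distinct primes gives both the term order and, being integral on
  the positive cone, the termination of division. The center is the set of functions on
  \<open>T/S\<close>, but with the product twisted by \<open>J\<close>; the gauge transformation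
  linking \<open>J\<close> to its support makes \<open>J\<close> a coboundary there, and rescaling
  by it removes the twist.\<close>

lemma (in comm_group) int_pow_subset_consistent_root:
  fixes M :: "('a \<times> complex) set"
  assumes M: "M \<subseteq> carrier G \<times> (UNIV - {0})" "M \<noteq> {}"
    and mult: "\<And>a b c d. (a, b) \<in> M \<Longrightarrow> (c, d) \<in> M \<Longrightarrow> (a \<otimes> c, b * d) \<in> M"
    and inv: "\<And>a b. (a, b) \<in> M \<Longrightarrow> (inv a, inverse b) \<in> M"
    and fn: "\<And>c. (\<one>, c) \<in> M \<Longrightarrow> c = 1"
    and g: "g \<in> carrier G"
  shows "\<exists>c. c \<noteq> 0 \<and> (\<forall>n::int. \<forall>e. (g [^] n, e) \<in> M \<longrightarrow> c powi n = e)"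
proof -
  \<comment> \<open>\<open>M\<close> is the graph of a partial homomorphism: a subgroup of the
    product that meets the fibre over \<one> only in 1 is single-valued, since the quotient of two
    values over \<open>a\<close> lies over \<one>.\<close>
  have uniq: "b = d" if "(a, b) \<in> M" "(a, d) \<in> M" for a b d
  proof -
    have "(a \<otimes> inv a, b * inverse d) \<in> M" using mult[OF that(1) inv[OF that(2)]] .
    moreover have "a \<in> carrier G" "d \<noteq> 0" using that M by auto
    ultimately have "b * inverse d = 1" using fn by (simp add: r_inv)
    thus ?thesis using \<open>d \<noteq> 0\<close> by (simp add: field_simps)
  qed
  obtain a0 b0 where "(a0, b0) \<in> M" using M(2) by fast
  hence one: "(\<one>, 1) \<in> M"
    using mult[OF \<open>(a0, b0) \<in> M\<close> inv[OF \<open>(a0, b0) \<in> M\<close>]] subsetD[OF M(1) \<open>(a0, b0) \<in> M\<close>]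
    by (simp add: r_inv)
  have powM: "(a [^] m, e ^ m) \<in> M" if "(a, e) \<in> M" for a e and m :: nat
  proof (induction m)
    case 0 show ?case using one by simp
  next
    case (Suc m)
    show ?case using mult[OF Suc that] by (simp add: mult.commute)
  qed
  have powiM: "(a [^] m, e powi m) \<in> M" if "(a, e) \<in> M" for a e and m :: int
  proof (cases "m \<ge> 0")
    case True
    then show ?thesis using powM[OF that, of "nat m"] int_pow_int[of G a "nat m"]
      by (simp add: power_int_def)
  next
    case False
    have aG: "a \<in> carrier G" using that M by auto
    have "(inv a [^] nat (-m), inverse e ^ nat (-m)) \<in> M" by (rule powM[OF inv[OF that]])
    moreover have "inv a [^] nat (-m) = a [^] m"
      using False int_pow_int[of G "inv a" "nat (-m)"] aG by (simp add: int_pow_inv int_pow_neg)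
    ultimately show ?thesis using False by (simp add: power_int_def)
  qed
  show ?thesis
  \<comment> \<open>The exponents \<open>n\<close> with \<open>g [^] n\<close> in the domain of
    \<open>M\<close> form a subgroup of the integers. If it is trivial, there is no constraint
    besides \<open>c powi 0 = 1\<close>, and 1 is taken; otherwise \<open>c\<close> has to be a
    \<open>d\<close>-th root of the value at the least positive exponent \<open>d\<close>.\<close>
  proof (cases "\<exists>n::nat. n > 0 \<and> (\<exists>e. (g [^] n, e) \<in> M)")
    case False
    have "1 powi n = e" if "(g [^] n, e) \<in> M" for n :: int and e
    proof -
      have "n = 0"
      proof (rule ccontr)
        assume "n \<noteq> 0"
        have "(g [^] nat \<bar>n\<bar>, if n > 0 then e else inverse e) \<in> M"
          using that inv[OF that] g int_pow_int[of G g "nat \<bar>n\<bar>"]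
          by (auto simp: int_pow_neg abs_if)
        thus False using False \<open>n \<noteq> 0\<close> by (metis zero_less_abs_iff zero_less_nat_eq)
      qed
      thus ?thesis using that fn by simp
    qed
    thus ?thesis by (intro exI[of _ 1]) auto
  next
    case True
    define d where "d = (LEAST n::nat. n > 0 \<and> (\<exists>e. (g [^] n, e) \<in> M))"
    have d: "d > 0" "\<exists>e. (g [^] d, e) \<in> M"
      using LeastI_ex[OF True] unfolding d_def by auto
    have dmin: "d \<le> n" if "n > 0" "(g [^] n, e) \<in> M" for n e
      unfolding d_def using that by (auto intro: Least_le)
    obtain e0 where e0: "(g [^] d, e0) \<in> M" using d by blast
    have e0nz: "e0 \<noteq> 0" using e0 M by auto
    \<comment> \<open>De Moivre's formula makes this a \<open>d\<close>-th root of
      \<open>e0\<close>; here divisibility of the multiplicative group enters.\<close>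
    define c where "c = rcis (root d (cmod e0)) (Arg e0 / d)"
    have c: "c ^ d = e0" unfolding c_def DeMoivre2 using d by (simp add: rcis_cmod_Arg)
    have cnz: "c \<noteq> 0" using c e0nz d by auto
    have "c powi n = e" if ne: "(g [^] n, e) \<in> M" for n :: int and e
    proof -
      let ?q = "n div int d" and ?r = "n mod int d"
      have e0': "(g [^] (int d), e0) \<in> M" using e0 by (simp add: int_pow_int)
      have q: "((g [^] int d) [^] ?q, e0 powi ?q) \<in> M" using powiM[OF e0'] .
      have gq: "(g [^] int d) [^] ?q = g [^] (int d * ?q)"
        using g by (simp add: int_pow_pow mult.commute)
      \<comment> \<open>Dividing out the multiple of \<open>d\<close> leaves the remainder as an
        exponent in the domain; it is smaller than \<open>d\<close>, so minimality makes it
        zero.\<close>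
      have "(g [^] n \<otimes> inv (g [^] (int d * ?q)), e * inverse (e0 powi ?q)) \<in> M"
        using mult[OF ne inv[OF q]] gq by simp
      moreover have "g [^] n \<otimes> inv (g [^] (int d * ?q)) = g [^] (n - int d * ?q)"
        using g by (simp add: int_pow_diff)
      moreover have "n - int d * ?q = int (nat ?r)"
        using d by (simp add: minus_mult_div_eq_mod)
      ultimately have "(g [^] nat ?r, e * inverse (e0 powi ?q)) \<in> M"
        by (simp only: int_pow_int)
      hence "nat ?r > 0 \<Longrightarrow> d \<le> nat ?r" using dmin by blast
      hence r0: "?r = 0"
        using d(1) pos_mod_bound[of "int d" n] pos_mod_sign[of "int d" n] by linarith
      hence nd: "n = int d * ?q" using mult_div_mod_eq[of "int d" n] by simp
      have "e = e0 powi ?q" using uniq[OF ne] q gq nd by metis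
      also have "\<dots> = c powi n" using c nd by (metis power_int_mult power_int_of_nat)
      finally show ?thesis by simp
    qed
    thus ?thesis using cnz by blast
  qed
qed

text \<open>\<open>\<complex>\<^sup>*\<close> is divisible, hence an injective abelian group.\<close>

theorem (in comm_group) hom_extension:
  fixes \<phi> :: "'a \<Rightarrow> complex"
  assumes H: "subgroup H G"
    and nz: "\<And>h. h \<in> H \<Longrightarrow> \<phi> h \<noteq> 0"
    and hom: "\<And>h h'. h \<in> H \<Longrightarrow> h' \<in> H \<Longrightarrow> \<phi> (h \<otimes> h') = \<phi> h * \<phi> h'"
  shows "\<exists>\<psi>. (\<forall>g\<in>carrier G. \<psi> g \<noteq> 0) \<and>
    (\<forall>g\<in>carrier G. \<forall>g'\<in>carrier G. \<psi> (g \<otimes> g') = \<psi> g * \<psi> g') \<and> (\<forall>h\<in>H. \<psi> h = \<phi> h)"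
proof -
  interpret H: subgroup H G by fact
  \<comment> \<open>Extensions of \<open>\<phi>\<close> are ordered by inclusion of their graphs. As
    the graphs are subgroups, single-valuedness is expressed over \<one> alone, a condition that
    passes to unions of chains.\<close>
  define P where "P = {M. M \<subseteq> carrier G \<times> (UNIV - {0::complex}) \<and> (\<lambda>h. (h, \<phi> h)) ` H \<subseteq> M \<and>
     (\<forall>a b c d. (a, b) \<in> M \<longrightarrow> (c, d) \<in> M \<longrightarrow> (a \<otimes> c, b * d) \<in> M) \<and>
     (\<forall>a b. (a, b) \<in> M \<longrightarrow> (inv a, inverse b) \<in> M) \<and>
     (\<forall>c. (\<one>, c) \<in> M \<longrightarrow> c = 1)}"
  have phi1: "\<phi> \<one> = 1"
    using hom[of \<one> \<one>] nz[of \<one>] by simp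
  have phiinv: "\<phi> (inv h) = inverse (\<phi> h)" if "h \<in> H" for h
    using hom[of h "inv h"] that phi1 nz[OF that] by (simp add: field_simps)
  have "(\<lambda>h. (h, \<phi> h)) ` H \<in> P"
    unfolding P_def using nz hom phi1 phiinv by auto
  hence ne: "P \<noteq> {}" by auto
  have "\<exists>M\<in>P. \<forall>N\<in>P. M \<subseteq> N \<longrightarrow> N = M"
  proof (rule subset_Zorn_nonempty[OF ne])
    fix C assume C: "C \<noteq> {}" "subset.chain P C"
    have CP: "C \<subseteq> P" and ch: "\<And>M N. M \<in> C \<Longrightarrow> N \<in> C \<Longrightarrow> M \<subseteq> N \<or> N \<subseteq> M"
      using C(2) by (auto simp: subset_chain_def)
    have mult: "(a \<otimes> c, b * d) \<in> \<Union>C" if mem: "(a, b) \<in> M" "M \<in> C" "(c, d) \<in> N" "N \<in> C" for a b c d M N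
    proof -
      obtain K where "K \<in> C" "(a, b) \<in> K" "(c, d) \<in> K" using ch[OF mem(2,4)] mem by blast
      thus ?thesis using CP unfolding P_def by blast
    qed
    show "\<Union>C \<in> P"
      unfolding P_def mem_Collect_eq
    proof (intro conjI allI impI)
      show "\<Union>C \<subseteq> carrier G \<times> (UNIV - {0})" using CP unfolding P_def by blast
      show "(\<lambda>h. (h, \<phi> h)) ` H \<subseteq> \<Union>C" using CP C(1) unfolding P_def by blast
      show "(a \<otimes> c, b * d) \<in> \<Union>C" if "(a, b) \<in> \<Union>C" "(c, d) \<in> \<Union>C" for a b c d
        using that mult by (meson UnionE)
      show "(inv a, inverse b) \<in> \<Union>C" if "(a, b) \<in> \<Union>C" for a b
        using that CP unfolding P_def by blast
      show "c = 1" if "(\<one>, c) \<in> \<Union>C" for c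
        using that CP unfolding P_def by blast
    qed
  qed
  then obtain M where MP: "M \<in> P" and max: "\<And>N. N \<in> P \<Longrightarrow> M \<subseteq> N \<Longrightarrow> N = M" by blast
  have M: "M \<subseteq> carrier G \<times> (UNIV - {0})" "(\<lambda>h. (h, \<phi> h)) ` H \<subseteq> M"
    and mult: "\<And>a b c d. (a, b) \<in> M \<Longrightarrow> (c, d) \<in> M \<Longrightarrow> (a \<otimes> c, b * d) \<in> M"
    and inv: "\<And>a b. (a, b) \<in> M \<Longrightarrow> (inv a, inverse b) \<in> M"
    and fn: "\<And>c. (\<one>, c) \<in> M \<Longrightarrow> c = 1"
    using MP unfolding P_def by blast+
  have oneM: "(\<one>, 1) \<in> M" using M(2) phi1 H.one_closed by (force simp: image_iff)
  have total: "\<exists>b. (g, b) \<in> M" if g: "g \<in> carrier G" for g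
  proof -
    obtain c where c: "c \<noteq> 0" "\<And>n::int. \<And>e. (g [^] n, e) \<in> M \<Longrightarrow> c powi n = e"
      using int_pow_subset_consistent_root[OF M(1) _ mult inv fn g] oneM by blast
    \<comment> \<open>\<open>N\<close> adjoins \<open>g\<close> with value \<open>c\<close> to
      \<open>M\<close>. The choice of \<open>c\<close> keeps \<open>N\<close> single-valued: a
      relation \<open>u \<otimes> g [^] n = \<one>\<close> puts \<open>g [^] n\<close> into the
      domain of \<open>M\<close>, where its value agrees with \<open>c powi n\<close>.\<close>
    define N where "N = {(a \<otimes> g [^] n, b * c powi n) | a b (n::int). (a, b) \<in> M}"
    have NI: "(a \<otimes> g [^] n, b * c powi n) \<in> N" if "(a, b) \<in> M" for a b and n :: int
      unfolding N_def using that by blast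
    have ND: "\<exists>u v. \<exists>n::int. a = u \<otimes> g [^] n \<and> b = v * c powi n \<and> (u, v) \<in> M" if "(a, b) \<in> N" for a b
      using that unfolding N_def by simp blast
    have MN: "M \<subseteq> N"
    proof
      fix z assume "z \<in> M"
      then show "z \<in> N" using NI[of "fst z" "snd z" 0] M(1) by (auto simp: mem_Times_iff subset_eq)
    qed
    have "N \<in> P"
      unfolding P_def mem_Collect_eq
    proof (intro conjI allI impI)
      show "N \<subseteq> carrier G \<times> (UNIV - {0})"
        unfolding N_def using M(1) c(1) g by auto
      show "(\<lambda>h. (h, \<phi> h)) ` H \<subseteq> N" using M(2) MN by blast
      show "(a \<otimes> a', b * b') \<in> N" if mem: "(a, b) \<in> N" "(a', b') \<in> N" for a b a' b'
      proof -
        obtain u v and n :: int where 1: "a = u \<otimes> g [^] n" "b = v * c powi n" "(u, v) \<in> M"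
          using ND[OF mem(1)] by blast
        obtain u' v' and n' :: int where 2: "a' = u' \<otimes> g [^] n'" "b' = v' * c powi n'" "(u', v') \<in> M"
          using ND[OF mem(2)] by blast
        have "u \<in> carrier G" "u' \<in> carrier G" using 1 2 M(1) by auto
        hence "a \<otimes> a' = (u \<otimes> u') \<otimes> g [^] (n + n')" using 1 2 g
          by (simp add: int_pow_mult m_ac)
        moreover have "b * b' = (v * v') * c powi (n + n')" using 1 2 c(1) by (simp add: power_int_add)
        ultimately show ?thesis using NI[OF mult[OF 1(3) 2(3)], of "n + n'"] by simp
      qed
      show "(inv a, inverse b) \<in> N" if mem: "(a, b) \<in> N" for a b
      proof -
        obtain u v and n :: int where 1: "a = u \<otimes> g [^] n" "b = v * c powi n" "(u, v) \<in> M"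
          using ND[OF mem(1)] by blast
        have "u \<in> carrier G" using 1 M(1) by auto
        hence "inv a = inv u \<otimes> g [^] (-n)" using 1 g by (simp add: inv_mult int_pow_neg)
        moreover have "inverse b = inverse v * c powi (-n)" using 1 by (simp add: power_int_minus)
        ultimately show ?thesis using NI[OF inv[OF 1(3)], of "-n"] by simp
      qed
      show "z = 1" if mem: "(\<one>, z) \<in> N" for z
      proof -
        obtain u v and n :: int where 1: "\<one> = u \<otimes> g [^] n" "z = v * c powi n" "(u, v) \<in> M"
          using ND[OF mem(1)] by blast
        have u: "u \<in> carrier G" "v \<noteq> 0" using 1 M(1) by auto
        have "g [^] n = inv u" using 1(1) u g by (metis comm_inv_char int_pow_closed)
        hence "c powi n = inverse v" using c(2) inv[OF 1(3)] by metis
        thus ?thesis using 1 u by simp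
      qed
    qed
    hence "N = M" using max MN by blast
    moreover have "(\<one> \<otimes> g [^] (1::int), 1 * c powi 1) \<in> N" by (rule NI[OF oneM])
    ultimately show ?thesis using g by auto
  qed
  have uniq: "b = d" if "(a, b) \<in> M" "(a, d) \<in> M" for a b d
  proof -
    have "(a \<otimes> inv a, b * inverse d) \<in> M" using mult[OF that(1) inv[OF that(2)]] .
    moreover have "a \<in> carrier G" "d \<noteq> 0" using that M by auto
    ultimately have "b * inverse d = 1" using fn by (simp add: r_inv)
    thus ?thesis using \<open>d \<noteq> 0\<close> by (simp add: field_simps)
  qed
  define \<psi> where "\<psi> g = (SOME b. (g, b) \<in> M)" for g
  have psi: "(g, \<psi> g) \<in> M" if "g \<in> carrier G" for g
    unfolding \<psi>_def using total[OF that] by (rule someI_ex)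
  show ?thesis
  proof (intro exI[of _ \<psi>] conjI ballI)
    show "\<psi> g \<noteq> 0" if "g \<in> carrier G" for g using psi[OF that] M(1) by auto
    show "\<psi> (g \<otimes> g') = \<psi> g * \<psi> g'" if "g \<in> carrier G" "g' \<in> carrier G" for g g'
      using uniq[OF psi mult[OF psi psi]] that by simp
    show "\<psi> h = \<phi> h" if "h \<in> H" for h
    proof (rule uniq[OF psi])
      show "h \<in> carrier G" using that by (rule H.mem_carrier)
      show "(h, \<phi> h) \<in> M" using M(2) that by auto
    qed
  qed
qed

text \<open>Stated for monoids so that the free algebra is covered too, as the algebra of the monoid
  of words with constant cocycle.\<close>

locale twisted_monoid = monoid X for X (structure) +
  fixes \<sigma> :: "'a \<Rightarrow> 'a \<Rightarrow> complex"
  assumes cocycle: "group_2_cocycle X \<sigma>"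
begin

lemma nonzero [simp]: "x \<in> carrier X \<Longrightarrow> y \<in> carrier X \<Longrightarrow> \<sigma> x y \<noteq> 0"
  using cocycle by (simp add: group_2_cocycle_def)

lemma cocycle_eq:
  "x \<in> carrier X \<Longrightarrow> y \<in> carrier X \<Longrightarrow> z \<in> carrier X \<Longrightarrow>
    \<sigma> x y * \<sigma> (x \<otimes> y) z = \<sigma> x (y \<otimes> z) * \<sigma> y z"
  using cocycle by (simp add: group_2_cocycle_def)

lemma normalized [simp]: "x \<in> carrier X \<Longrightarrow> \<sigma> x \<one> = 1" "x \<in> carrier X \<Longrightarrow> \<sigma> \<one> x = 1"
  using cocycle by (simp_all add: group_2_cocycle_def)

end

locale twisted_group = comm_group X + twisted_monoid X \<sigma> for X (structure) and \<sigma>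
begin

definition antisym :: "'a \<Rightarrow> 'a \<Rightarrow> complex" where
  "antisym x y = \<sigma> x y / \<sigma> y x"

text \<open>The cocycle identities for \<open>(x, y, z)\<close>, \<open>(z, x, y)\<close> and
  \<open>(x, z, y)\<close> share values once products are commuted; combined they give the claim
  after cancelling \<open>\<sigma> x y\<close> and
  \<open>\<sigma> (x \<otimes> z) y\<close>.\<close>

lemma antisym_mult_left:
  assumes "x \<in> carrier X" "y \<in> carrier X" "z \<in> carrier X"
  shows "antisym (x \<otimes> y) z = antisym x z * antisym y z"
proof -
  have 1: "\<sigma> x y * \<sigma> (x \<otimes> y) z = \<sigma> x (y \<otimes> z) * \<sigma> y z"
    and 2: "\<sigma> z x * \<sigma> (x \<otimes> z) y = \<sigma> z (x \<otimes> y) * \<sigma> x y"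
    and 3: "\<sigma> x z * \<sigma> (x \<otimes> z) y = \<sigma> x (y \<otimes> z) * \<sigma> z y"
    using cocycle_eq[of x y z] cocycle_eq[of z x y] cocycle_eq[of x z y] assms
    by (simp_all add: m_comm[of z])
  have aux: "a * b * e * i * f = a * g * h * d * f"
    if "a * b = c * d" "e * f = g * a" "h * f = c * i" for a b c d e f g h i :: complex
  proof -
    have "a * b * e * i * f = (c * i) * d * (e * f)" using that by simp
    also have "\<dots> = a * g * h * d * f" by (simp add: that flip: that(3))
    finally show ?thesis .
  qed
  have "\<sigma> x y * \<sigma> (x \<otimes> y) z * \<sigma> z x * \<sigma> z y * \<sigma> (x \<otimes> z) y
    = \<sigma> x y * \<sigma> z (x \<otimes> y) * \<sigma> x z * \<sigma> y z * \<sigma> (x \<otimes> z) y"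
    by (rule aux[OF 1 2 3])
  hence "\<sigma> (x \<otimes> y) z * (\<sigma> z x * \<sigma> z y) = \<sigma> z (x \<otimes> y) * (\<sigma> x z * \<sigma> y z)"
    using assms by simp
  thus ?thesis using assms unfolding antisym_def by (simp add: field_simps)
qed

lemma antisym_swap: "antisym x y = inverse (antisym y x)"
  by (simp add: antisym_def)

lemma antisym_mult_right:
  "x \<in> carrier X \<Longrightarrow> y \<in> carrier X \<Longrightarrow> z \<in> carrier X \<Longrightarrow>
    antisym x (y \<otimes> z) = antisym x y * antisym x z"
  using antisym_mult_left[of y z x] by (metis antisym_swap inverse_mult_distrib)

lemma antisym_nonzero [simp]: "x \<in> carrier X \<Longrightarrow> y \<in> carrier X \<Longrightarrow> antisym x y \<noteq> 0"
  by (simp add: antisym_def)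

lemma antisym_self [simp]: "x \<in> carrier X \<Longrightarrow> antisym x x = 1"
  by (simp add: antisym_def)

lemma alternating_antisym: "alternating_bicharacter X antisym"
  by (simp add: alternating_bicharacter_def antisym_mult_left antisym_mult_right)

lemma antisym_one [simp]: "x \<in> carrier X \<Longrightarrow> antisym \<one> x = 1" "x \<in> carrier X \<Longrightarrow> antisym x \<one> = 1"
  by (simp_all add: antisym_def)

text \<open>Normalization leaves two factors of the cocycle identity at \<open>x\<close>,
  \<open>inv x\<close>, \<open>x\<close>. In consequence one scalar normalizes both products of a
  basis element with that of the inverse.\<close>

lemma cocycle_inv_comm: "x \<in> carrier X \<Longrightarrow> \<sigma> (inv x) x = \<sigma> x (inv x)"
  using cocycle_eq[of x "inv x" x] by (simp add: l_inv r_inv)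

text \<open>A symmetric cocycle defines an abelian extension of \<open>X\<close> by \<open>\<complex>\<^sup>*\<close>; extending the identity of
  \<open>\<complex>\<^sup>*\<close> to the extension splits it.\<close>

theorem symmetric_cocycle_coboundary:
  assumes sym: "\<And>x y. x \<in> carrier X \<Longrightarrow> y \<in> carrier X \<Longrightarrow> \<sigma> x y = \<sigma> y x"
  shows "\<exists>f. (\<forall>x\<in>carrier X. f x \<noteq> 0) \<and>
    (\<forall>x\<in>carrier X. \<forall>y\<in>carrier X. \<sigma> x y * f (x \<otimes> y) = f x * f y)"
proof -
  define E :: "(complex \<times> 'a) monoid" where
    "E = \<lparr>carrier = (UNIV - {0}) \<times> carrier X,
          monoid.mult = (\<lambda>(a, x) (b, y). (a * b * \<sigma> x y, x \<otimes> y)), one = (1, \<one>)\<rparr>"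
  have E: "comm_group E"
  proof (rule comm_groupI)
    show "u \<otimes>\<^bsub>E\<^esub> v \<otimes>\<^bsub>E\<^esub> w = u \<otimes>\<^bsub>E\<^esub> (v \<otimes>\<^bsub>E\<^esub> w)"
      if "u \<in> carrier E" "v \<in> carrier E" "w \<in> carrier E" for u v w
      using that cocycle_eq[of "snd u" "snd v" "snd w"]
      by (auto simp: E_def m_assoc)
    show "\<exists>v\<in>carrier E. v \<otimes>\<^bsub>E\<^esub> u = \<one>\<^bsub>E\<^esub>" if "u \<in> carrier E" for u
    proof
      \<comment> \<open>The first component must also cancel the cocycle value introduced by the
        multiplication of the extension.\<close>
      let ?v = "(inverse (fst u * \<sigma> (inv (snd u)) (snd u)), inv (snd u))"
      show "?v \<in> carrier E" "?v \<otimes>\<^bsub>E\<^esub> u = \<one>\<^bsub>E\<^esub>" using that by (auto simp: E_def l_inv field_simps)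
    qed
  qed (auto simp: E_def sym m_comm)
  interpret E: comm_group E by fact
  let ?H = "(UNIV - {0 :: complex}) \<times> {\<one>}"
  have invE: "inv\<^bsub>E\<^esub> (a, \<one>) = (inverse a, \<one>)" if "a \<noteq> 0" for a
    using that by (intro E.inv_equality) (auto simp: E_def)
  have H: "subgroup ?H E"
  proof (rule E.subgroupI)
    show "?H \<noteq> {}" by (metis Diff_iff SigmaI UNIV_I empty_iff insert_iff one_neq_zero)
    show "inv\<^bsub>E\<^esub> u \<in> ?H" if u: "u \<in> ?H" for u
    proof -
      obtain a where a: "u = (a, \<one>)" "a \<noteq> 0" using u by auto
      show ?thesis unfolding a(1) invE[OF a(2)] using a(2) by simp
    qed
  qed (auto simp: E_def)
  have nzH: "\<And>u. u \<in> ?H \<Longrightarrow> fst u \<noteq> 0"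
    and homH: "\<And>u v. u \<in> ?H \<Longrightarrow> v \<in> ?H \<Longrightarrow> fst (u \<otimes>\<^bsub>E\<^esub> v) = fst u * fst v"
    by (auto simp: E_def)
  obtain h where h: "\<And>u. u \<in> carrier E \<Longrightarrow> h u \<noteq> 0"
    "\<And>u v. u \<in> carrier E \<Longrightarrow> v \<in> carrier E \<Longrightarrow> h (u \<otimes>\<^bsub>E\<^esub> v) = h u * h v"
    "\<And>u. u \<in> ?H \<Longrightarrow> h u = fst u"
    using E.hom_extension[OF H nzH homH] by blast
  show ?thesis
  proof (intro exI[of _ "\<lambda>x. h (1, x)"] conjI ballI)
    show "h (1, x) \<noteq> 0" if "x \<in> carrier X" for x using h(1) that by (simp add: E_def)
    fix x y assume xy: "x \<in> carrier X" "y \<in> carrier X"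
    have "h (1, x) * h (1, y) = h (\<sigma> x y, x \<otimes> y)"
      using h(2)[of "(1, x)" "(1, y)"] xy by (simp add: E_def)
    also have "\<dots> = h ((\<sigma> x y, \<one>) \<otimes>\<^bsub>E\<^esub> (1, x \<otimes> y))" using xy by (simp add: E_def)
    also have "\<dots> = \<sigma> x y * h (1, x \<otimes> y)"
      using h(2)[of "(\<sigma> x y, \<one>)" "(1, x \<otimes> y)"] h(3)[of "(\<sigma> x y, \<one>)"] xy by (simp add: E_def)
    finally show "\<sigma> x y * h (1, x \<otimes> y) = h (1, x) * h (1, y)" by simp
  qed
qed

end

text \<open>The hypothesis says that the quotient of the two cocycles is symmetric, and
  \<open>f\<close> cobounds that quotient. This is how an alternating form determines a twisted
  group algebra.\<close>

corollary (in comm_group) cocycles_cohomologous: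
  assumes \<sigma>: "group_2_cocycle G \<sigma>" and \<tau>: "group_2_cocycle G \<tau>"
    and eq: "\<And>x y. x \<in> carrier G \<Longrightarrow> y \<in> carrier G \<Longrightarrow> \<sigma> x y * \<tau> y x = \<sigma> y x * \<tau> x y"
  shows "\<exists>f. (\<forall>x\<in>carrier G. f x \<noteq> 0) \<and>
    (\<forall>x\<in>carrier G. \<forall>y\<in>carrier G. \<sigma> x y * f (x \<otimes> y) = f x * f y * \<tau> x y)"
proof -
  interpret S: twisted_group G \<sigma> by unfold_locales fact
  interpret T: twisted_group G \<tau> by unfold_locales fact
  interpret Q: twisted_group G "\<lambda>x y. \<sigma> x y / \<tau> x y"
  proof (unfold_locales, unfold group_2_cocycle_def, intro conjI ballI)
    fix x y z assume "x \<in> carrier G" "y \<in> carrier G" "z \<in> carrier G"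
    thus "\<sigma> x y / \<tau> x y * (\<sigma> (x \<otimes> y) z / \<tau> (x \<otimes> y) z) = \<sigma> x (y \<otimes> z) / \<tau> x (y \<otimes> z) * (\<sigma> y z / \<tau> y z)"
      using S.cocycle_eq[of x y z] T.cocycle_eq[of x y z] by simp
  qed auto
  have "\<sigma> x y / \<tau> x y = \<sigma> y x / \<tau> y x" if "x \<in> carrier G" "y \<in> carrier G" for x y
    using eq[OF that] that by (simp add: field_simps)
  then obtain f where f: "\<And>x. x \<in> carrier G \<Longrightarrow> f x \<noteq> 0"
    "\<And>x y. x \<in> carrier G \<Longrightarrow> y \<in> carrier G \<Longrightarrow> \<sigma> x y / \<tau> x y * f (x \<otimes> y) = f x * f y"
    using Q.symmetric_cocycle_coboundary by blast
  show ?thesis by (intro exI[of _ f] conjI ballI) (use f in \<open>simp_all add: field_simps\<close>)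
qed

section \<open>Isomorphisms of algebras\<close>

text \<open>The map is kept explicit so that isomorphisms can be composed, inverted and used for
  transport. Zero is listed separately because \<open>ring_hom\<close> does not mention it, while
  the image ring in \<open>calg_iso_ring\<close> has the image of zero as its zero.\<close>

definition calg_iso :: "('a \<Rightarrow> 'b) \<Rightarrow> 'a calg \<Rightarrow> 'b calg \<Rightarrow> bool" where
  "calg_iso h A B \<longleftrightarrow> h \<in> ring_hom A B \<and> bij_betw h (carrier A) (carrier B) \<and>
     (\<forall>c. \<forall>a\<in>carrier A. h (c \<odot>\<^bsub>A\<^esub> a) = c \<odot>\<^bsub>B\<^esub> h a) \<and> h \<zero>\<^bsub>A\<^esub> = \<zero>\<^bsub>B\<^esub>"

definition smult_closed :: "'a calg \<Rightarrow> bool" where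
  "smult_closed A \<longleftrightarrow> (\<forall>c. \<forall>a\<in>carrier A. c \<odot>\<^bsub>A\<^esub> a \<in> carrier A)"

lemma calg_isoI:
  assumes "bij_betw h (carrier A) (carrier B)"
    and "\<And>a b. a \<in> carrier A \<Longrightarrow> b \<in> carrier A \<Longrightarrow> h (a \<otimes>\<^bsub>A\<^esub> b) = h a \<otimes>\<^bsub>B\<^esub> h b"
    and "\<And>a b. a \<in> carrier A \<Longrightarrow> b \<in> carrier A \<Longrightarrow> h (a \<oplus>\<^bsub>A\<^esub> b) = h a \<oplus>\<^bsub>B\<^esub> h b"
    and "h \<one>\<^bsub>A\<^esub> = \<one>\<^bsub>B\<^esub>" "h \<zero>\<^bsub>A\<^esub> = \<zero>\<^bsub>B\<^esub>"
    and "\<And>c a. a \<in> carrier A \<Longrightarrow> h (c \<odot>\<^bsub>A\<^esub> a) = c \<odot>\<^bsub>B\<^esub> h a"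
  shows "calg_iso h A B"
  using assms by (auto simp: calg_iso_def ring_hom_def bij_betw_def)

lemma calg_iso_imp_isomorphic: "calg_iso h A B \<Longrightarrow> A \<cong>\<^sub>a\<^sub>l\<^sub>g B"
  by (auto simp: calg_iso_def alg_isomorphic_def)

lemma calg_isoD:
  assumes "calg_iso h A B"
  shows "bij_betw h (carrier A) (carrier B)"
    and "\<And>a. a \<in> carrier A \<Longrightarrow> h a \<in> carrier B"
    and "\<And>a b. a \<in> carrier A \<Longrightarrow> b \<in> carrier A \<Longrightarrow> h (a \<otimes>\<^bsub>A\<^esub> b) = h a \<otimes>\<^bsub>B\<^esub> h b"
    and "\<And>a b. a \<in> carrier A \<Longrightarrow> b \<in> carrier A \<Longrightarrow> h (a \<oplus>\<^bsub>A\<^esub> b) = h a \<oplus>\<^bsub>B\<^esub> h b"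
    and "h \<one>\<^bsub>A\<^esub> = \<one>\<^bsub>B\<^esub>" "h \<zero>\<^bsub>A\<^esub> = \<zero>\<^bsub>B\<^esub>"
    and "\<And>c a. a \<in> carrier A \<Longrightarrow> h (c \<odot>\<^bsub>A\<^esub> a) = c \<odot>\<^bsub>B\<^esub> h a"
    and "\<And>a b. a \<in> carrier A \<Longrightarrow> b \<in> carrier A \<Longrightarrow> h a = h b \<Longrightarrow> a = b"
    and "\<And>b. b \<in> carrier B \<Longrightarrow> \<exists>a\<in>carrier A. b = h a"
  using assms by (auto simp: calg_iso_def ring_hom_def bij_betw_def dest: inj_onD)

lemma calg_iso_trans:
  assumes h: "calg_iso h A B" and k: "calg_iso k B C"
  shows "calg_iso (k \<circ> h) A C"
  by (rule calg_isoI)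
    (use bij_betw_trans[OF calg_isoD(1)[OF h] calg_isoD(1)[OF k]] calg_isoD(2-7)[OF h]
      calg_isoD(3-7)[OF k] in auto)

text \<open>Phrased with closure under the operations so that it applies to the crossed product,
  whose ring axioms are not checked directly.\<close>

lemma calg_iso_inv:
  assumes cl: "\<And>a b. a \<in> carrier A \<Longrightarrow> b \<in> carrier A \<Longrightarrow> a \<otimes>\<^bsub>A\<^esub> b \<in> carrier A"
      "\<And>a b. a \<in> carrier A \<Longrightarrow> b \<in> carrier A \<Longrightarrow> a \<oplus>\<^bsub>A\<^esub> b \<in> carrier A"
      "\<one>\<^bsub>A\<^esub> \<in> carrier A" "\<zero>\<^bsub>A\<^esub> \<in> carrier A" "smult_closed A"
    and h: "calg_iso h A B"
  shows "calg_iso (inv_into (carrier A) h) B A"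
proof -
  let ?g = "inv_into (carrier A) h"
  have inj: "inj_on h (carrier A)" using calg_isoD(1)[OF h] by (simp add: bij_betw_def)
  have gh: "?g (h a) = a" if "a \<in> carrier A" for a using inj that by simp
  show ?thesis
  proof (rule calg_isoI)
    show "bij_betw ?g (carrier B) (carrier A)" by (rule bij_betw_inv_into[OF calg_isoD(1)[OF h]])
    show "?g \<one>\<^bsub>B\<^esub> = \<one>\<^bsub>A\<^esub>" "?g \<zero>\<^bsub>B\<^esub> = \<zero>\<^bsub>A\<^esub>"
      using gh[OF cl(3)] gh[OF cl(4)] calg_isoD(5,6)[OF h] by auto
    fix b assume b: "b \<in> carrier B"
    obtain a where a: "a \<in> carrier A" "b = h a" using calg_isoD(9)[OF h b] by blast
    show "?g (c \<odot>\<^bsub>B\<^esub> b) = c \<odot>\<^bsub>A\<^esub> ?g b" for c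
      using a cl(5) by (simp add: gh smult_closed_def flip: calg_isoD(7)[OF h])
    fix b' assume b': "b' \<in> carrier B"
    obtain a' where a': "a' \<in> carrier A" "b' = h a'" using calg_isoD(9)[OF h b'] by blast
    show "?g (b \<otimes>\<^bsub>B\<^esub> b') = ?g b \<otimes>\<^bsub>A\<^esub> ?g b'" "?g (b \<oplus>\<^bsub>B\<^esub> b') = ?g b \<oplus>\<^bsub>A\<^esub> ?g b'"
      using a a' by (simp_all add: gh cl(1,2) flip: calg_isoD(3,4)[OF h])
  qed
qed

corollary calg_iso_sym:
  assumes "ring A" "smult_closed A" "calg_iso h A B"
  shows "calg_iso (inv_into (carrier A) h) B A"
proof -
  interpret ring A by fact
  show ?thesis by (rule calg_iso_inv[OF m_closed a_closed one_closed zero_closed assms(2,3)])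
qed

lemma calg_iso_opposite: "calg_iso h A B \<Longrightarrow> calg_iso h (opposite A) (opposite B)"
  by (auto simp: calg_iso_def opposite_def ring_hom_def)

lemma calg_iso_ring:
  assumes "ring A" "calg_iso h A B"
  shows "ring B"
proof -
  have "ring (B\<lparr>zero := h \<zero>\<^bsub>A\<^esub>\<rparr>)"
    using assms by (intro ring.ring_iso_imp_img_ring) (auto simp: calg_iso_def ring_iso_def)
  thus ?thesis using calg_isoD(6)[OF assms(2)] by simp
qed

section \<open>Transfer of ring properties along isomorphisms\<close>

lemma nc_domain_transfer:
  assumes A: "nc_domain A" and h: "calg_iso h A B"
  shows "nc_domain B"
  unfolding nc_domain_def
proof (intro conjI ballI impI)
  interpret ring A using A by (simp add: nc_domain_def)
  show "ring B" by (rule calg_iso_ring[OF _ h]) unfold_locales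
  show "\<one>\<^bsub>B\<^esub> \<noteq> \<zero>\<^bsub>B\<^esub>"
    using calg_isoD(8)[OF h one_closed zero_closed] A calg_isoD(5,6)[OF h] by (auto simp: nc_domain_def)
  fix b b' assume b: "b \<in> carrier B" "b' \<in> carrier B" "b \<otimes>\<^bsub>B\<^esub> b' = \<zero>\<^bsub>B\<^esub>"
  obtain a where a: "a \<in> carrier A" "b = h a" using calg_isoD(9)[OF h b(1)] by blast
  obtain a' where a': "a' \<in> carrier A" "b' = h a'" using calg_isoD(9)[OF h b(2)] by blast
  note a = a a'
  have "h (a \<otimes>\<^bsub>A\<^esub> a') = h \<zero>\<^bsub>A\<^esub>" using b a calg_isoD(3,6)[OF h] by simp
  hence "a \<otimes>\<^bsub>A\<^esub> a' = \<zero>\<^bsub>A\<^esub>" using calg_isoD(8)[OF h] a by blast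
  hence "a = \<zero>\<^bsub>A\<^esub> \<or> a' = \<zero>\<^bsub>A\<^esub>" using A a by (auto simp: nc_domain_def)
  thus "b = \<zero>\<^bsub>B\<^esub> \<or> b' = \<zero>\<^bsub>B\<^esub>" using a calg_isoD(6)[OF h] by auto
qed

lemma left_idealI:
  assumes "ring A" and I: "I \<subseteq> carrier A" "\<zero>\<^bsub>A\<^esub> \<in> I"
    and add: "\<And>a b. a \<in> I \<Longrightarrow> b \<in> I \<Longrightarrow> a \<oplus>\<^bsub>A\<^esub> b \<in> I"
    and mult: "\<And>r a. r \<in> carrier A \<Longrightarrow> a \<in> I \<Longrightarrow> r \<otimes>\<^bsub>A\<^esub> a \<in> I"
  shows "left_ideal I A"
proof -
  interpret ring A by fact
  have minus: "\<ominus>\<^bsub>A\<^esub> a \<in> I" if "a \<in> I" for a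
  proof -
    have "\<ominus>\<^bsub>A\<^esub> a = (\<ominus>\<^bsub>A\<^esub> \<one>\<^bsub>A\<^esub>) \<otimes>\<^bsub>A\<^esub> a" using that I by (simp add: l_minus subset_eq)
    thus ?thesis using mult[OF _ that, of "\<ominus>\<^bsub>A\<^esub> \<one>\<^bsub>A\<^esub>"] by simp
  qed
  have "subgroup I (add_monoid A)"
    by (rule group.subgroupI[OF a_group])
      (use I add minus in \<open>auto simp: a_inv_def\<close>)
  thus ?thesis using mult by (simp add: left_ideal_def additive_subgroup_def)
qed

lemma left_idealD:
  assumes "ring A" "left_ideal I A"
  shows "I \<subseteq> carrier A" "\<zero>\<^bsub>A\<^esub> \<in> I"
    "\<And>a b. a \<in> I \<Longrightarrow> b \<in> I \<Longrightarrow> a \<oplus>\<^bsub>A\<^esub> b \<in> I"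
    "\<And>r a. r \<in> carrier A \<Longrightarrow> a \<in> I \<Longrightarrow> r \<otimes>\<^bsub>A\<^esub> a \<in> I"
proof -
  interpret additive_subgroup I A using assms by (simp add: left_ideal_def)
  show "I \<subseteq> carrier A" by (rule a_subset)
  show "\<zero>\<^bsub>A\<^esub> \<in> I" by simp
  show "\<And>a b. a \<in> I \<Longrightarrow> b \<in> I \<Longrightarrow> a \<oplus>\<^bsub>A\<^esub> b \<in> I" by simp
  show "\<And>r a. r \<in> carrier A \<Longrightarrow> a \<in> I \<Longrightarrow> r \<otimes>\<^bsub>A\<^esub> a \<in> I" using assms(2) by (simp add: left_ideal_def)
qed

text \<open>Minimality among left ideals replaces the intersection in the definition; in this form
  finite generation is easily moved along a homomorphism.\<close>

lemma left_noetherian_iff: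
  assumes "ring A"
  shows "left_noetherian A \<longleftrightarrow>
    (\<forall>I. left_ideal I A \<longrightarrow> (\<exists>F. finite F \<and> F \<subseteq> I \<and> (\<forall>K. left_ideal K A \<and> F \<subseteq> K \<longrightarrow> I \<subseteq> K)))"
    (is "_ \<longleftrightarrow> (\<forall>I. _ \<longrightarrow> ?fg I)")
proof -
  have "(F \<subseteq> carrier A \<and> I = \<Inter>{K. left_ideal K A \<and> F \<subseteq> K}) \<longleftrightarrow>
      (F \<subseteq> I \<and> (\<forall>K. left_ideal K A \<and> F \<subseteq> K \<longrightarrow> I \<subseteq> K))"
    if I: "left_ideal I A" for I F
  proof
    assume F: "F \<subseteq> I \<and> (\<forall>K. left_ideal K A \<and> F \<subseteq> K \<longrightarrow> I \<subseteq> K)"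
    have "F \<subseteq> carrier A" using F left_idealD(1)[OF assms I] by (metis order_trans)
    moreover have "I = \<Inter>{K. left_ideal K A \<and> F \<subseteq> K}"
      by (rule equalityI[OF Inter_greatest Inter_lower]) (use F I in auto)
    ultimately show "F \<subseteq> carrier A \<and> I = \<Inter>{K. left_ideal K A \<and> F \<subseteq> K}" by blast
  next
    assume F: "F \<subseteq> carrier A \<and> I = \<Inter>{K. left_ideal K A \<and> F \<subseteq> K}"
    have "F \<subseteq> \<Inter>{K. left_ideal K A \<and> F \<subseteq> K}" by (rule Inter_greatest) simp
    moreover have "\<Inter>{K. left_ideal K A \<and> F \<subseteq> K} \<subseteq> K" if "left_ideal K A \<and> F \<subseteq> K" for K
      by (rule Inter_lower) (use that in simp)
    ultimately show "F \<subseteq> I \<and> (\<forall>K. left_ideal K A \<and> F \<subseteq> K \<longrightarrow> I \<subseteq> K)" using F by metis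
  qed
  thus ?thesis using assms unfolding left_noetherian_def by meson
qed

text \<open>Left ideals are pulled back along \<open>h\<close>, and their finite generating sets are
  pushed forward.\<close>

lemma left_noetherian_transfer:
  assumes A: "left_noetherian A" and h: "calg_iso h A B"
  shows "left_noetherian B"
proof -
  have rA: "ring A" using A by (simp add: left_noetherian_def)
  interpret ring A by fact
  have rB: "ring B" by (rule calg_iso_ring[OF rA h])
  have pre: "left_ideal {a \<in> carrier A. h a \<in> I} A" if I: "left_ideal I B" for I
    by (rule left_idealI[OF rA])
      (use left_idealD[OF rB I] calg_isoD(2-6)[OF h] in auto)
  show ?thesis unfolding left_noetherian_iff[OF rB]
  proof (intro allI impI)
    fix I assume I: "left_ideal I B"
    define I' where "I' = {a \<in> carrier A. h a \<in> I}"
    have "left_ideal I' A" unfolding I'_def by (rule pre[OF I])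
    then obtain F where F: "finite F" "F \<subseteq> I'" "\<And>K. left_ideal K A \<Longrightarrow> F \<subseteq> K \<Longrightarrow> I' \<subseteq> K"
      using A unfolding left_noetherian_iff[OF rA] by meson
    show "\<exists>F. finite F \<and> F \<subseteq> I \<and> (\<forall>K. left_ideal K B \<and> F \<subseteq> K \<longrightarrow> I \<subseteq> K)"
    proof (intro exI[of _ "h ` F"] conjI allI impI)
      show "finite (h ` F)" "h ` F \<subseteq> I" using F(1,2) unfolding I'_def by auto
      fix K assume "left_ideal K B \<and> h ` F \<subseteq> K"
      hence IK: "I' \<subseteq> {a \<in> carrier A. h a \<in> K}"
        using F(2) by (intro F(3) pre) (auto simp: I'_def)
      show "I \<subseteq> K"
      proof
        fix b assume b: "b \<in> I"
        obtain a where "a \<in> carrier A" "b = h a"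
          using calg_isoD(9)[OF h] left_idealD(1)[OF rB I] b by (meson subsetD)
        thus "b \<in> K" using IK b unfolding I'_def by auto
      qed
    qed
  qed
qed

lemma nc_noetherian_transfer:
  "nc_noetherian A \<Longrightarrow> calg_iso h A B \<Longrightarrow> nc_noetherian B"
  unfolding nc_noetherian_def by (blast intro: left_noetherian_transfer calg_iso_opposite)

lemma simple_algebra_transfer:
  assumes A: "simple_algebra A" and h: "calg_iso h A B"
  shows "simple_algebra B"
proof -
  have rA: "ring A" using A by (simp add: simple_algebra_def)
  interpret A: ring A by fact
  have rB: "ring B" by (rule calg_iso_ring[OF rA h])
  interpret hom: ring_hom_ring A B h
    using rA rB h by (auto intro!: ring_hom_ringI2 simp: calg_iso_def)
  have "I = {\<zero>\<^bsub>B\<^esub>} \<or> I = carrier B" if I: "ideal I B" for I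
  proof -
    interpret I: ideal I B by fact
    define I' where "I' = {a \<in> carrier A. h a \<in> I}"
    have "ideal I' A" unfolding I'_def by (rule hom.ideal_vimage[OF I])
    hence "I' = {\<zero>\<^bsub>A\<^esub>} \<or> I' = carrier A" using A by (simp add: simple_algebra_def)
    moreover have "h ` I' = I"
    proof
      show "I \<subseteq> h ` I'"
      proof
        fix b assume b: "b \<in> I"
        obtain a where "a \<in> carrier A" "b = h a" using calg_isoD(9)[OF h I.Icarr[OF b]] by blast
        thus "b \<in> h ` I'" using b unfolding I'_def by simp
      qed
    qed (auto simp: I'_def)
    moreover have "h ` carrier A = carrier B" using calg_isoD(1)[OF h] by (simp add: bij_betw_def)
    ultimately show ?thesis using calg_isoD(6)[OF h] by force
  qed
  moreover have "\<one>\<^bsub>B\<^esub> \<noteq> \<zero>\<^bsub>B\<^esub>"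
    using calg_isoD(8)[OF h A.one_closed A.zero_closed] A calg_isoD(5,6)[OF h]
    by (auto simp: simple_algebra_def)
  ultimately show ?thesis using rB by (simp add: simple_algebra_def)
qed

section \<open>Finite linear combinations\<close>

text \<open>The linear extension of the weight \<open>k\<close>, evaluated at the formal combination
  \<open>f\<close>. Since delta functions are among the weights, these pairings separate finitely
  supported functions (\<open>lsum_eqI\<close>).\<close>

definition lsum :: "('x \<Rightarrow> complex) \<Rightarrow> ('x \<Rightarrow> complex) \<Rightarrow> complex" where
  "lsum f k = (\<Sum>x | f x \<noteq> 0. f x * k x)"

lemma lsum_superset:
  "finite F \<Longrightarrow> {x. f x \<noteq> 0} \<subseteq> F \<Longrightarrow> lsum f k = (\<Sum>x\<in>F. f x * k x)"
  unfolding lsum_def by (rule sum.mono_neutral_left) auto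

lemma lsum_0 [simp]: "lsum 0 k = 0" "lsum (\<lambda>x. 0) k = 0" "lsum f (\<lambda>x. 0) = 0"
  by (simp_all add: lsum_def)

lemma lsum_add:
  assumes "finite {x. f x \<noteq> 0}" "finite {x. g x \<noteq> 0}"
  shows "lsum (f + g) k = lsum f k + lsum g k"
proof -
  let ?F = "{x. f x \<noteq> 0} \<union> {x. g x \<noteq> 0}"
  have "finite ?F" using assms by simp
  thus ?thesis
    by (subst (1 2 3) lsum_superset[of ?F]) (auto simp: algebra_simps sum.distrib)
qed

lemma lsum_smult: "lsum (fun_smult c f) k = c * lsum f k"
  by (cases "c = 0") (simp_all add: lsum_def fun_smult_def sum_distrib_left mult.assoc)

lemma lsum_indicator [simp]: "lsum (indicator {x}) k = k x"
  by (simp add: lsum_def indicator_def)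

lemma lsum_cong: "(\<And>x. f x \<noteq> 0 \<Longrightarrow> k x = k' x) \<Longrightarrow> lsum f k = lsum f k'"
  unfolding lsum_def by (rule sum.cong) auto

lemma lsum_mult_right: "lsum f (\<lambda>x. c * k x) = c * lsum f k" "lsum f (\<lambda>x. k x * c) = lsum f k * c"
  by (simp_all add: lsum_def sum_distrib_left sum_distrib_right mult_ac)

lemma lsum_point: "finite {x. f x \<noteq> 0} \<Longrightarrow> lsum f (\<lambda>x. if x = z then 1 else 0) = f z"
  by (cases "f z = 0") (auto simp: lsum_def if_distrib sum.If_cases cong: if_cong)

lemma lsum_swap: "lsum f (\<lambda>x. lsum g (k x)) = lsum g (\<lambda>y. lsum f (\<lambda>x. k x y))"
proof -
  have "lsum f (\<lambda>x. lsum g (k x)) = (\<Sum>x | f x \<noteq> 0. \<Sum>y | g y \<noteq> 0. f x * (g y * k x y))"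
    by (simp add: lsum_def sum_distrib_left)
  also have "\<dots> = (\<Sum>y | g y \<noteq> 0. \<Sum>x | f x \<noteq> 0. f x * (g y * k x y))" by (rule sum.swap)
  also have "\<dots> = lsum g (\<lambda>y. lsum f (\<lambda>x. k x y))"
    by (simp add: lsum_def sum_distrib_left mult_ac)
  finally show ?thesis .
qed

lemma lsum_eqI:
  assumes "finite {x. f x \<noteq> 0}" "finite {x. g x \<noteq> 0}" "\<And>k. lsum f k = lsum g k"
  shows "f = g"
proof
  fix z show "f z = g z" using assms(3)[of "\<lambda>x. if x = z then 1 else 0"] assms(1,2)
    by (simp add: lsum_point)
qed

text \<open>Nonvanishing of \<open>w\<close> on the support makes both sums run over the same
  set.\<close>

lemma lsum_weight:
  assumes "\<And>x. f x \<noteq> 0 \<Longrightarrow> w x \<noteq> 0"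
  shows "lsum (\<lambda>x. w x * f x) k = lsum f (\<lambda>x. w x * k x)"
proof -
  have "{x. w x * f x \<noteq> 0} = {x. f x \<noteq> 0}" using assms by auto
  thus ?thesis unfolding lsum_def by (simp add: mult_ac)
qed

section \<open>Twisted group algebras\<close>

context twisted_monoid
begin

abbreviation A where "A \<equiv> twisted_group_algebra X \<sigma>"

abbreviation u :: "'a \<Rightarrow> 'a \<Rightarrow> complex" where "u x \<equiv> indicator {x}"

lemma mem_carrier: "f \<in> carrier A \<longleftrightarrow> finite {x. f x \<noteq> 0} \<and> {x. f x \<noteq> 0} \<subseteq> carrier X"
  by (simp add: twisted_group_algebra_def)

lemma finite_support: "f \<in> carrier A \<Longrightarrow> finite {x. f x \<noteq> 0}"
  by (simp add: mem_carrier)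

lemma support_closed: "f \<in> carrier A \<Longrightarrow> f x \<noteq> 0 \<Longrightarrow> x \<in> carrier X"
  by (auto simp: mem_carrier)

lemma A_simps [simp]: "\<one>\<^bsub>A\<^esub> = u \<one>" "\<zero>\<^bsub>A\<^esub> = 0" "f \<oplus>\<^bsub>A\<^esub> g = f + g" "c \<odot>\<^bsub>A\<^esub> f = fun_smult c f"
  by (simp_all add: twisted_group_algebra_def)

lemma add_closed: "f \<in> carrier A \<Longrightarrow> g \<in> carrier A \<Longrightarrow> f + g \<in> carrier A"
proof -
  assume fg: "f \<in> carrier A" "g \<in> carrier A"
  have "{x. (f + g) x \<noteq> 0} \<subseteq> {x. f x \<noteq> 0} \<union> {x. g x \<noteq> 0}" by auto
  with fg show ?thesis unfolding mem_carrier by (meson finite_UnI finite_subset Un_least order_trans)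
qed

lemma smult_closed_A: "f \<in> carrier A \<Longrightarrow> fun_smult c f \<in> carrier A"
  unfolding mem_carrier fun_smult_def by (auto intro: finite_subset)

lemma u_closed: "x \<in> carrier X \<Longrightarrow> u x \<in> carrier A"
  by (auto simp: mem_carrier indicator_def)

text \<open>The index set becomes part of a finite product, ready to be grouped by the fibres of
  multiplication.\<close>

lemma mult_alt:
  "(f \<otimes>\<^bsub>A\<^esub> g) z = (\<Sum>p | p \<in> {x. f x \<noteq> 0} \<times> {y. g y \<noteq> 0} \<and> fst p \<otimes> snd p = z.
     \<sigma> (fst p) (snd p) * f (fst p) * g (snd p))"
  unfolding twisted_group_algebra_def by (auto intro!: sum.cong)

lemma mult_support:
  "{z. (f \<otimes>\<^bsub>A\<^esub> g) z \<noteq> 0} \<subseteq> (\<lambda>p. fst p \<otimes> snd p) ` ({x. f x \<noteq> 0} \<times> {y. g y \<noteq> 0})"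
proof
  fix z assume "z \<in> {z. (f \<otimes>\<^bsub>A\<^esub> g) z \<noteq> 0}"
  then obtain p where "p \<in> {x. f x \<noteq> 0} \<times> {y. g y \<noteq> 0}" "fst p \<otimes> snd p = z"
    unfolding mult_alt mem_Collect_eq by (auto elim: sum.not_neutral_contains_not_neutral)
  thus "z \<in> (\<lambda>p. fst p \<otimes> snd p) ` ({x. f x \<noteq> 0} \<times> {y. g y \<noteq> 0})" by blast
qed

lemma mult_closed:
  assumes "f \<in> carrier A" "g \<in> carrier A"
  shows "f \<otimes>\<^bsub>A\<^esub> g \<in> carrier A"
  unfolding mem_carrier[of "f \<otimes>\<^bsub>A\<^esub> g"]
proof
  show "finite {z. (f \<otimes>\<^bsub>A\<^esub> g) z \<noteq> 0}"
    by (rule finite_subset[OF mult_support]) (use assms in \<open>simp add: mem_carrier\<close>)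
  show "{z. (f \<otimes>\<^bsub>A\<^esub> g) z \<noteq> 0} \<subseteq> carrier X"
    by (rule order_trans[OF mult_support])
      (use support_closed[OF assms(1)] support_closed[OF assms(2)] in auto)
qed

text \<open>Summing over \<open>z\<close> the terms of product \<open>z\<close> is summing over all
  pairs. Later identities between products are read off from this double sum.\<close>

lemma lsum_mult:
  assumes "f \<in> carrier A" "g \<in> carrier A"
  shows "lsum (f \<otimes>\<^bsub>A\<^esub> g) k = lsum f (\<lambda>x. lsum g (\<lambda>y. \<sigma> x y * k (x \<otimes> y)))"
proof -
  let ?P = "{x. f x \<noteq> 0} \<times> {y. g y \<noteq> 0}"
  let ?m = "\<lambda>p. fst p \<otimes> snd p"
  let ?c = "\<lambda>p. \<sigma> (fst p) (snd p) * f (fst p) * g (snd p)"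
  have fin: "finite ?P" using assms by (simp add: mem_carrier)
  have "lsum (f \<otimes>\<^bsub>A\<^esub> g) k = (\<Sum>z\<in>?m ` ?P. (f \<otimes>\<^bsub>A\<^esub> g) z * k z)"
    by (rule lsum_superset[OF _ mult_support]) (use fin in simp)
  also have "\<dots> = (\<Sum>z\<in>?m ` ?P. \<Sum>p\<in>{p. p \<in> ?P \<and> ?m p = z}. ?c p * k (?m p))"
    by (intro sum.cong refl) (simp add: mult_alt sum_distrib_right)
  also have "\<dots> = (\<Sum>p\<in>?P. ?c p * k (?m p))"
    by (rule sum.group[OF fin]) (use fin in auto)
  also have "\<dots> = (\<Sum>x | f x \<noteq> 0. \<Sum>y | g y \<noteq> 0. ?c (x, y) * k (x \<otimes> y))"
    by (simp add: sum.cartesian_product case_prod_unfold)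
  also have "\<dots> = lsum f (\<lambda>x. lsum g (\<lambda>y. \<sigma> x y * k (x \<otimes> y)))"
    by (simp add: lsum_def sum_distrib_left mult_ac)
  finally show ?thesis .
qed

text \<open>After pairing with a weight, associativity is the cocycle identity term by term, and the
  unit laws are the normalization.\<close>

lemma ring_A: "ring A"
proof (rule ringI)
  show "abelian_group A"
  proof (rule abelian_groupI)
    show "\<exists>g\<in>carrier A. g \<oplus>\<^bsub>A\<^esub> f = \<zero>\<^bsub>A\<^esub>" if "f \<in> carrier A" for f
      using smult_closed_A[OF that, of "-1"]
      by (intro bexI[of _ "fun_smult (-1) f"]) (auto simp: fun_smult_def)
    show "\<zero>\<^bsub>A\<^esub> \<in> carrier A" by (simp add: mem_carrier)
  qed (simp_all add: add_closed add_ac)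
  show "monoid A"
  proof (rule monoidI)
    fix f g h assume fgh: "f \<in> carrier A" "g \<in> carrier A" "h \<in> carrier A"
    show "f \<otimes>\<^bsub>A\<^esub> g \<otimes>\<^bsub>A\<^esub> h = f \<otimes>\<^bsub>A\<^esub> (g \<otimes>\<^bsub>A\<^esub> h)"
    proof (rule lsum_eqI)
      fix k
      have "lsum (f \<otimes>\<^bsub>A\<^esub> g \<otimes>\<^bsub>A\<^esub> h) k =
        lsum f (\<lambda>x. lsum g (\<lambda>y. \<sigma> x y * lsum h (\<lambda>z. \<sigma> (x \<otimes> y) z * k (x \<otimes> y \<otimes> z))))"
        using fgh by (simp add: lsum_mult mult_closed)
      also have "\<dots> = lsum f (\<lambda>x. lsum g (\<lambda>y. lsum h (\<lambda>z. \<sigma> y z * (\<sigma> x (y \<otimes> z) * k (x \<otimes> (y \<otimes> z))))))"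
      proof (intro lsum_cong)
        fix x y assume "f x \<noteq> 0" "g y \<noteq> 0"
        hence xy: "x \<in> carrier X" "y \<in> carrier X" using fgh support_closed by auto
        show "\<sigma> x y * lsum h (\<lambda>z. \<sigma> (x \<otimes> y) z * k (x \<otimes> y \<otimes> z)) =
          lsum h (\<lambda>z. \<sigma> y z * (\<sigma> x (y \<otimes> z) * k (x \<otimes> (y \<otimes> z))))"
          unfolding lsum_mult_right(1)[symmetric]
        proof (intro lsum_cong)
          fix z assume "h z \<noteq> 0"
          hence "z \<in> carrier X" using fgh support_closed by auto
          thus "\<sigma> x y * (\<sigma> (x \<otimes> y) z * k (x \<otimes> y \<otimes> z)) = \<sigma> y z * (\<sigma> x (y \<otimes> z) * k (x \<otimes> (y \<otimes> z)))"
            using cocycle_eq[OF xy] xy by (simp add: m_assoc)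
        qed
      qed
      also have "\<dots> = lsum (f \<otimes>\<^bsub>A\<^esub> (g \<otimes>\<^bsub>A\<^esub> h)) k"
        using fgh by (simp add: lsum_mult mult_closed)
      finally show "lsum (f \<otimes>\<^bsub>A\<^esub> g \<otimes>\<^bsub>A\<^esub> h) k = lsum (f \<otimes>\<^bsub>A\<^esub> (g \<otimes>\<^bsub>A\<^esub> h)) k" .
    qed (use fgh mult_closed finite_support in auto)
  next
    fix f assume f: "f \<in> carrier A"
    show "\<one>\<^bsub>A\<^esub> \<otimes>\<^bsub>A\<^esub> f = f" "f \<otimes>\<^bsub>A\<^esub> \<one>\<^bsub>A\<^esub> = f"
      using f u_closed[OF one_closed] support_closed[OF f]
      by (auto intro!: lsum_eqI finite_support mult_closed lsum_cong simp: lsum_mult)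
  qed (simp_all add: mult_closed u_closed)
  fix f g h assume fgh: "f \<in> carrier A" "g \<in> carrier A" "h \<in> carrier A"
  show "(f \<oplus>\<^bsub>A\<^esub> g) \<otimes>\<^bsub>A\<^esub> h = f \<otimes>\<^bsub>A\<^esub> h \<oplus>\<^bsub>A\<^esub> g \<otimes>\<^bsub>A\<^esub> h"
    using fgh by (auto intro!: lsum_eqI finite_support add_closed mult_closed
        simp: lsum_mult lsum_add add_closed mult_closed finite_support)
  have aux: "lsum f (\<lambda>x. p x + q x) = lsum f p + lsum f q" for f :: "'a \<Rightarrow> complex" and p q
    by (simp add: lsum_def sum.distrib algebra_simps)
  show "h \<otimes>\<^bsub>A\<^esub> (f \<oplus>\<^bsub>A\<^esub> g) = h \<otimes>\<^bsub>A\<^esub> f \<oplus>\<^bsub>A\<^esub> h \<otimes>\<^bsub>A\<^esub> g"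
    using fgh by (auto intro!: lsum_eqI finite_support add_closed mult_closed
        simp: lsum_mult lsum_add add_closed mult_closed finite_support aux)
qed

lemma smult_closed_twisted: "smult_closed A"
  by (simp add: smult_closed_def smult_closed_A)

lemma mult_entry:
  assumes "f \<in> carrier A" "g \<in> carrier A"
  shows "(f \<otimes>\<^bsub>A\<^esub> g) z = lsum f (\<lambda>x. lsum g (\<lambda>y. \<sigma> x y * (if x \<otimes> y = z then 1 else 0)))"
  using lsum_mult[OF assms, of "\<lambda>x. if x = z then 1 else 0"] assms
  by (simp add: lsum_point finite_support mult_closed)

lemma u_mult_u:
  assumes "x \<in> carrier X" "y \<in> carrier X"
  shows "u x \<otimes>\<^bsub>A\<^esub> u y = fun_smult (\<sigma> x y) (u (x \<otimes> y))"
  by (rule lsum_eqI) (use assms in \<open>auto intro!: finite_support mult_closed u_closed smult_closed_A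
      simp: lsum_mult u_closed lsum_smult\<close>)

lemma smult_mult:
  assumes "f \<in> carrier A" "g \<in> carrier A"
  shows "fun_smult c f \<otimes>\<^bsub>A\<^esub> g = fun_smult c (f \<otimes>\<^bsub>A\<^esub> g)" "f \<otimes>\<^bsub>A\<^esub> fun_smult c g = fun_smult c (f \<otimes>\<^bsub>A\<^esub> g)"
  using assms by (auto intro!: lsum_eqI finite_support mult_closed smult_closed_A
      simp: lsum_mult lsum_smult smult_closed_A lsum_mult_right)

lemma span_induct [consumes 1, case_names zero step]:
  assumes "f \<in> carrier A" and "P 0"
    and step: "\<And>x c g. x \<in> carrier X \<Longrightarrow> g \<in> carrier A \<Longrightarrow> P g \<Longrightarrow> P (fun_smult c (u x) + g)"
  shows "P f"
  using assms(1)
proof (induction "card {x. f x \<noteq> 0}" arbitrary: f)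
  case 0
  hence "f = 0" by (auto simp: mem_carrier fun_eq_iff)
  thus ?case using assms(2) by (simp only:)
next
  case (Suc n)
  have fin: "finite {x. f x \<noteq> 0}" using Suc(3) by (rule finite_support)
  obtain x where x: "f x \<noteq> 0" using Suc(2) by (metis (mono_tags, lifting) Collect_empty_eq card.empty nat.distinct(1))
  let ?g = "f(x := 0)"
  have eq: "{y. ?g y \<noteq> 0} = {y. f y \<noteq> 0} - {x}" by auto
  have g: "?g \<in> carrier A" using Suc(3) unfolding mem_carrier eq by blast
  have "n = card {y. ?g y \<noteq> 0}" unfolding eq using Suc(2) x fin by simp
  hence "P (fun_smult (f x) (u x) + ?g)"
    by (intro step g Suc(1)) (use support_closed[OF Suc(3) x] in auto)
  also have "fun_smult (f x) (u x) + ?g = f" by (auto simp: fun_eq_iff fun_smult_def indicator_def)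
  finally show ?case .
qed

end

section \<open>Opposite, coboundaries, center and simplicity over an abelian group\<close>

context twisted_group
begin

text \<open>By cancellation a single pair of basis elements contributes in this degree.\<close>

lemma u_mult_entry:
  assumes "x \<in> carrier X" "y \<in> carrier X" "f \<in> carrier A"
  shows "(u x \<otimes>\<^bsub>A\<^esub> f) (x \<otimes> y) = \<sigma> x y * f y" "(f \<otimes>\<^bsub>A\<^esub> u x) (y \<otimes> x) = \<sigma> y x * f y"
proof -
  have "(u x \<otimes>\<^bsub>A\<^esub> f) (x \<otimes> y) = lsum f (\<lambda>z. \<sigma> x y * (if z = y then 1 else 0))"
    using assms by (auto simp: mult_entry u_closed intro!: lsum_cong dest: support_closed)
  thus "(u x \<otimes>\<^bsub>A\<^esub> f) (x \<otimes> y) = \<sigma> x y * f y"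
    using assms by (simp add: lsum_mult_right lsum_point finite_support)
  have "(f \<otimes>\<^bsub>A\<^esub> u x) (y \<otimes> x) = lsum f (\<lambda>z. \<sigma> y x * (if z = y then 1 else 0))"
    using assms by (auto simp: mult_entry u_closed intro!: lsum_cong dest: support_closed)
  thus "(f \<otimes>\<^bsub>A\<^esub> u x) (y \<otimes> x) = \<sigma> y x * f y"
    using assms by (simp add: lsum_mult_right lsum_point finite_support)
qed

lemma u_mult_support:
  assumes "x \<in> carrier X" "f \<in> carrier A"
  shows "{z. (u x \<otimes>\<^bsub>A\<^esub> f) z \<noteq> 0} = (\<lambda>y. x \<otimes> y) ` {y. f y \<noteq> 0}"
proof
  show "{z. (u x \<otimes>\<^bsub>A\<^esub> f) z \<noteq> 0} \<subseteq> (\<lambda>y. x \<otimes> y) ` {y. f y \<noteq> 0}"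
    by (rule order_trans[OF mult_support]) (auto simp: indicator_def split: if_splits)
  show "(\<lambda>y. x \<otimes> y) ` {y. f y \<noteq> 0} \<subseteq> {z. (u x \<otimes>\<^bsub>A\<^esub> f) z \<noteq> 0}"
    using assms support_closed[OF assms(2)] by (auto simp: u_mult_entry)
qed

text \<open>Commutativity turns the identity for the reversed triple \<open>(z, y, x)\<close> into
  the required one.\<close>

lemma twisted_group_flip: "twisted_group X (\<lambda>x y. \<sigma> y x)"
proof (unfold_locales, unfold group_2_cocycle_def, intro conjI ballI)
  fix x y z assume "x \<in> carrier X" "y \<in> carrier X" "z \<in> carrier X"
  thus "\<sigma> y x * \<sigma> z (x \<otimes> y) = \<sigma> (y \<otimes> z) x * \<sigma> z y"
    using cocycle_eq[of z y x] by (simp add: m_comm mult.commute)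
qed auto

text \<open>Since \<open>y \<otimes> x = x \<otimes> y\<close>, reversing a product of basis
  elements changes only the scalar, from \<open>\<sigma> x y\<close> to
  \<open>\<sigma> y x\<close>.\<close>

lemma opposite_iso: "calg_iso id (opposite A) (twisted_group_algebra X (\<lambda>x y. \<sigma> y x))"
proof -
  interpret F: twisted_group X "\<lambda>x y. \<sigma> y x" by (rule twisted_group_flip)
  have *: "carrier F.A = carrier A" by (simp add: twisted_group_algebra_def)
  show ?thesis
  proof (rule calg_isoI)
    fix f g assume "f \<in> carrier (opposite A)" "g \<in> carrier (opposite A)"
    hence fg: "f \<in> carrier A" "g \<in> carrier A" by (auto simp: opposite_def)
    have "g \<otimes>\<^bsub>A\<^esub> f = f \<otimes>\<^bsub>F.A\<^esub> g"
    proof (rule lsum_eqI)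
      fix k
      have "lsum (g \<otimes>\<^bsub>A\<^esub> f) k = lsum f (\<lambda>x. lsum g (\<lambda>y. \<sigma> y x * k (y \<otimes> x)))"
        by (simp add: lsum_mult fg lsum_swap[of g])
      also have "\<dots> = lsum (f \<otimes>\<^bsub>F.A\<^esub> g) k"
        using fg by (auto simp: F.lsum_mult * m_comm support_closed intro!: lsum_cong)
      finally show "lsum (g \<otimes>\<^bsub>A\<^esub> f) k = lsum (f \<otimes>\<^bsub>F.A\<^esub> g) k" .
    qed (use fg in \<open>auto intro!: finite_support mult_closed F.finite_support F.mult_closed simp: *\<close>)
    thus "id (f \<otimes>\<^bsub>opposite A\<^esub> g) = id f \<otimes>\<^bsub>F.A\<^esub> id g" by (simp add: opposite_def)
  qed (simp_all add: opposite_def twisted_group_algebra_def)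
qed

text \<open>The basis element at \<open>x\<close> is rescaled by \<open>f x\<close>; the assumption
  on \<open>f\<close> is multiplicativity on basis elements.\<close>

lemma coboundary_iso:
  assumes \<tau>: "group_2_cocycle X \<tau>"
    and f: "\<And>x. x \<in> carrier X \<Longrightarrow> f x \<noteq> 0"
      "\<And>x y. x \<in> carrier X \<Longrightarrow> y \<in> carrier X \<Longrightarrow> \<sigma> x y * f (x \<otimes> y) = f x * f y * \<tau> x y"
  shows "calg_iso (\<lambda>a x. f x * a x) A (twisted_group_algebra X \<tau>)"
proof -
  interpret T: twisted_group X \<tau> by unfold_locales fact
  have *: "carrier T.A = carrier A" by (simp add: twisted_group_algebra_def)
  let ?h = "\<lambda>a x. f x * a x :: complex"
  have supp: "{x. f x * a x \<noteq> 0} = {x. a x \<noteq> 0}" if "a \<in> carrier A" for a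
    using f(1) support_closed[OF that] by auto
  have closed: "?h a \<in> carrier A" if "a \<in> carrier A" for a
    using that unfolding mem_carrier[of "?h a"] supp[OF that] mem_carrier .
  have lsum_h: "lsum (?h a) k = lsum a (\<lambda>x. f x * k x)" if "a \<in> carrier A" for a k
    using f(1) support_closed[OF that] by (intro lsum_weight) auto
  have f1: "f \<one> = 1" using f(2)[of \<one> \<one>] f(1)[of \<one>] T.normalized by simp
  show ?thesis
  proof (rule calg_isoI)
    show "bij_betw ?h (carrier A) (carrier T.A)" unfolding *
    proof (rule bij_betw_byWitness[where f' = "\<lambda>a x. inverse (f x) * a x"])
      show "\<forall>a\<in>carrier A. (\<lambda>x. inverse (f x) * (f x * a x)) = a"
      proof (intro ballI ext)
        fix a x assume "a \<in> carrier A"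
        thus "inverse (f x) * (f x * a x) = a x"
          using f(1)[of x] support_closed[of a x] by (cases "a x = 0") auto
      qed
      show "\<forall>a\<in>carrier A. (\<lambda>x. f x * (inverse (f x) * a x)) = a"
      proof (intro ballI ext)
        fix a x assume "a \<in> carrier A"
        thus "f x * (inverse (f x) * a x) = a x"
          using f(1)[of x] support_closed[of a x] by (cases "a x = 0") auto
      qed
      show "?h ` carrier A \<subseteq> carrier A" using closed by auto
      show "(\<lambda>a x. inverse (f x) * a x) ` carrier A \<subseteq> carrier A"
        by (auto simp: mem_carrier intro: finite_subset)
    qed
    fix a b assume ab: "a \<in> carrier A" "b \<in> carrier A"
    show "?h (a \<otimes>\<^bsub>A\<^esub> b) = ?h a \<otimes>\<^bsub>T.A\<^esub> ?h b"
    proof (rule lsum_eqI)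
      fix k
      have "lsum (?h (a \<otimes>\<^bsub>A\<^esub> b)) k = lsum a (\<lambda>x. lsum b (\<lambda>y. \<sigma> x y * (f (x \<otimes> y) * k (x \<otimes> y))))"
        using ab by (simp add: lsum_h mult_closed lsum_mult)
      also have "\<dots> = lsum a (\<lambda>x. lsum b (\<lambda>y. f x * (f y * (\<tau> x y * k (x \<otimes> y)))))"
      proof (intro lsum_cong)
        fix x y assume "a x \<noteq> 0" "b y \<noteq> 0"
        hence "x \<in> carrier X" "y \<in> carrier X" using ab support_closed by auto
        thus "\<sigma> x y * (f (x \<otimes> y) * k (x \<otimes> y)) = f x * (f y * (\<tau> x y * k (x \<otimes> y)))"
          using f(2)[of x y] by simp
      qed
      also have "\<dots> = lsum (?h a \<otimes>\<^bsub>T.A\<^esub> ?h b) k"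
        using ab by (simp add: T.lsum_mult * closed lsum_h lsum_mult_right)
      finally show "lsum (?h (a \<otimes>\<^bsub>A\<^esub> b)) k = lsum (?h a \<otimes>\<^bsub>T.A\<^esub> ?h b) k" .
    qed (use ab in \<open>auto intro!: finite_support closed mult_closed T.finite_support T.mult_closed simp: *\<close>)
  qed (auto simp: fun_eq_iff algebra_simps fun_smult_def indicator_def f1)
qed

text \<open>Commuting with \<open>u y\<close> is tested in degree \<open>x \<otimes> y\<close>,
  where both products have a single term, a multiple of \<open>f x\<close>. Conversely the double
  sums of the two products agree term by term.\<close>

lemma mem_center:
  assumes f: "f \<in> carrier A"
  shows "(\<forall>g\<in>carrier A. f \<otimes>\<^bsub>A\<^esub> g = g \<otimes>\<^bsub>A\<^esub> f) \<longleftrightarrow> (\<forall>x y. f x \<noteq> 0 \<longrightarrow> y \<in> carrier X \<longrightarrow> \<sigma> x y = \<sigma> y x)"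
proof (intro iffI allI impI ballI)
  fix x y assume "\<forall>g\<in>carrier A. f \<otimes>\<^bsub>A\<^esub> g = g \<otimes>\<^bsub>A\<^esub> f" and fx: "f x \<noteq> 0" and y: "y \<in> carrier X"
  hence "(f \<otimes>\<^bsub>A\<^esub> u y) (x \<otimes> y) = (u y \<otimes>\<^bsub>A\<^esub> f) (y \<otimes> x)"
    using u_closed support_closed[OF f fx] by (simp add: m_comm)
  thus "\<sigma> x y = \<sigma> y x" using f fx y support_closed[OF f fx] by (simp add: u_mult_entry)
next
  fix g assume c: "\<forall>x y. f x \<noteq> 0 \<longrightarrow> y \<in> carrier X \<longrightarrow> \<sigma> x y = \<sigma> y x" and g: "g \<in> carrier A"
  show "f \<otimes>\<^bsub>A\<^esub> g = g \<otimes>\<^bsub>A\<^esub> f"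
  proof (rule lsum_eqI)
    fix k
    have "lsum (f \<otimes>\<^bsub>A\<^esub> g) k = lsum f (\<lambda>x. lsum g (\<lambda>y. \<sigma> y x * k (y \<otimes> x)))"
      using c f g by (auto simp: lsum_mult m_comm support_closed intro!: lsum_cong)
    also have "\<dots> = lsum (g \<otimes>\<^bsub>A\<^esub> f) k" using f g by (simp add: lsum_mult lsum_swap[of g])
    finally show "lsum (f \<otimes>\<^bsub>A\<^esub> g) k = lsum (g \<otimes>\<^bsub>A\<^esub> f) k" .
  qed (use f g in \<open>auto intro!: finite_support mult_closed\<close>)
qed

text \<open>An element of minimal support in a nonzero ideal can be shifted to contain \<open>\<one>\<close> in its support;
  its commutators with the basis elements have smaller support, so they vanish.\<close>

theorem simple_A:
  assumes nondeg: "\<And>x. x \<in> carrier X \<Longrightarrow> (\<And>y. y \<in> carrier X \<Longrightarrow> \<sigma> x y = \<sigma> y x) \<Longrightarrow> x = \<one>"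
  shows "simple_algebra A"
  unfolding simple_algebra_def
proof (intro conjI allI impI)
  interpret R: ring A by (rule ring_A)
  show "ring A" by (rule ring_A)
  show "\<one>\<^bsub>A\<^esub> \<noteq> \<zero>\<^bsub>A\<^esub>" by (auto simp: fun_eq_iff indicator_def)
  fix I assume "ideal I A"
  then interpret I: ideal I A .
  show "I = {\<zero>\<^bsub>A\<^esub>} \<or> I = carrier A"
  proof (cases "\<exists>f. f \<in> I \<and> f \<noteq> 0")
    case False
    thus ?thesis using I.zero_closed by auto
  next
    case True
    let ?card = "\<lambda>f :: 'a \<Rightarrow> complex. card {x. f x \<noteq> 0}"
    obtain f0 where "f0 \<in> I \<and> f0 \<noteq> 0" using True by (elim exE)
    from ex_has_least_nat[of "\<lambda>f. f \<in> I \<and> f \<noteq> 0", OF this, of ?card]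
    obtain f where f': "(f \<in> I \<and> f \<noteq> 0) \<and> (\<forall>g. g \<in> I \<and> g \<noteq> 0 \<longrightarrow> ?card f \<le> ?card g)"
      by (elim exE)
    have f: "f \<in> I" "f \<noteq> 0" using f' by simp_all
    have fmin: "?card f \<le> ?card g" if "g \<in> I" "g \<noteq> 0" for g using f' that by simp
    have fA: "f \<in> carrier A" using f(1) by (rule I.Icarr)
    obtain x0 where x0: "f x0 \<noteq> 0" using f(2) by (auto simp: fun_eq_iff)
    have x0X: "x0 \<in> carrier X" using x0 fA support_closed by blast
    \<comment> \<open>The shift moves \<open>x0\<close> to \<one> and does not increase the number
      of terms, so \<open>g\<close> still has minimal support.\<close>
    define g where "g = u (inv x0) \<otimes>\<^bsub>A\<^esub> f"
    have gI: "g \<in> I" unfolding g_def using x0X f(1) by (intro I.I_l_closed u_closed) auto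
    have gA: "g \<in> carrier A" using gI by (rule I.Icarr)
    have supp: "{z. g z \<noteq> 0} = (\<lambda>y. inv x0 \<otimes> y) ` {y. f y \<noteq> 0}"
      unfolding g_def using x0X fA by (intro u_mult_support) auto
    have card_g: "?card g \<le> ?card f"
      unfolding supp by (rule card_image_le) (rule finite_support[OF fA])
    have g1: "g \<one> \<noteq> 0" using supp x0 x0X by (force simp: l_inv)
    have supp1: "x = \<one>" if gx: "g x \<noteq> 0" for x
    proof (rule nondeg)
      show xX: "x \<in> carrier X" using gx gA support_closed by blast
      fix y assume y: "y \<in> carrier X"
      \<comment> \<open>The commutator of \<open>u y\<close> and \<open>g\<close>. The subtracted
        term is written as a product with a multiple of the unit, which shows at once that
        \<open>h\<close> lies in the ideal.\<close>
      define h where "h = u y \<otimes>\<^bsub>A\<^esub> g \<oplus>\<^bsub>A\<^esub> fun_smult (-1) (u \<one>) \<otimes>\<^bsub>A\<^esub> (g \<otimes>\<^bsub>A\<^esub> u y)"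
      have gy: "g \<otimes>\<^bsub>A\<^esub> u y \<in> I" by (rule I.I_r_closed[OF gI u_closed[OF y]])
      have hI: "h \<in> I" unfolding h_def
        by (intro I.a_closed I.I_l_closed[OF gI] I.I_l_closed[OF gy] u_closed smult_closed_A y one_closed)
      have "fun_smult (-1) (u \<one>) \<otimes>\<^bsub>A\<^esub> (g \<otimes>\<^bsub>A\<^esub> u y) = fun_smult (-1) (g \<otimes>\<^bsub>A\<^esub> u y)"
        using I.Icarr[OF gy] R.l_one[OF I.Icarr[OF gy]] u_closed by (simp add: smult_mult)
      hence h: "h + g \<otimes>\<^bsub>A\<^esub> u y = u y \<otimes>\<^bsub>A\<^esub> g"
        unfolding h_def by (simp add: fun_eq_iff fun_smult_def)
      have hent: "h (z \<otimes> y) = (\<sigma> y z - \<sigma> z y) * g z" if z: "z \<in> carrier X" for z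
      proof -
        have "h (z \<otimes> y) + (g \<otimes>\<^bsub>A\<^esub> u y) (z \<otimes> y) = (u y \<otimes>\<^bsub>A\<^esub> g) (y \<otimes> z)"
          using h z y by (metis m_comm plus_fun_apply)
        thus ?thesis using z y gA by (simp add: u_mult_entry algebra_simps)
      qed
      \<comment> \<open>\<open>u \<one>\<close> is central, so the term at \<one> contributes
        nothing to the commutator, and \<open>h\<close> has fewer terms than the minimal
        \<open>f\<close>.\<close>
      have "{z. h z \<noteq> 0} \<subseteq> (\<lambda>z. z \<otimes> y) ` ({z. g z \<noteq> 0} - {\<one>})"
      proof
        fix w assume w: "w \<in> {z. h z \<noteq> 0}"
        hence wX: "w \<in> carrier X" using I.Icarr[OF hI] support_closed by blast
        let ?z = "w \<otimes> inv y"
        have z: "?z \<in> carrier X" "w = ?z \<otimes> y" using wX y by (simp_all add: m_assoc l_inv)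
        have "g ?z \<noteq> 0" "\<sigma> y ?z \<noteq> \<sigma> ?z y" using hent[OF z(1)] w z(2) by auto
        moreover hence "?z \<noteq> \<one>" using y by auto
        ultimately show "w \<in> (\<lambda>z. z \<otimes> y) ` ({z. g z \<noteq> 0} - {\<one>})" using z(2) by blast
      qed
      hence "?card h \<le> card ({z. g z \<noteq> 0} - {\<one>})"
        by (rule surj_card_le[rotated]) (use finite_support[OF gA] in simp)
      also have "\<dots> < ?card g" using g1 finite_support[OF gA] by (intro card_Diff1_less) auto
      finally have "?card h < ?card f" using card_g by (rule less_le_trans)
      hence "h = 0" using fmin[OF hI] by (cases "h = 0") simp_all
      thus "\<sigma> x y = \<sigma> y x" using hent[OF xX] gx by simp
    qed
    have "g = fun_smult (g \<one>) (u \<one>)"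
      using supp1 by (auto simp: fun_eq_iff fun_smult_def indicator_def)
    hence "fun_smult (inverse (g \<one>)) g = u \<one>"
      using g1 by (metis (no_types, lifting) ext fun_smult_def left_inverse mult.assoc mult_1)
    moreover have "fun_smult (inverse (g \<one>)) (u \<one>) \<otimes>\<^bsub>A\<^esub> g = fun_smult (inverse (g \<one>)) g"
      using R.l_one[OF gA] gA u_closed[OF one_closed] by (simp add: smult_mult)
    ultimately have "fun_smult (inverse (g \<one>)) (u \<one>) \<otimes>\<^bsub>A\<^esub> g = \<one>\<^bsub>A\<^esub>" by simp
    hence "\<one>\<^bsub>A\<^esub> \<in> I"
      using I.I_l_closed[OF gI, of "fun_smult (inverse (g \<one>)) (u \<one>)"] smult_closed_A u_closed by simp
    hence "I = carrier A" by (rule I.one_imp_carrier)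
    thus ?thesis by simp
  qed
qed

end

section \<open>Domains and noetherian rings from weights\<close>

context twisted_group
begin

text \<open>An injective multiplicative weight is a compatible total order on \<open>X\<close>; leading terms multiply.\<close>

definition leads :: "('a \<Rightarrow> real) \<Rightarrow> ('a \<Rightarrow> complex) \<Rightarrow> 'a \<Rightarrow> bool" where
  "leads W f x \<longleftrightarrow> f x \<noteq> 0 \<and> (\<forall>y. f y \<noteq> 0 \<longrightarrow> W y \<le> W x)"

lemma leads_exists:
  assumes "f \<in> carrier A" "f \<noteq> 0"
  obtains x where "leads W f x"
proof -
  have S: "finite {x. f x \<noteq> 0}" "{x. f x \<noteq> 0} \<noteq> {}"
    using assms finite_support by (auto simp: fun_eq_iff)
  have "Max (W ` {x. f x \<noteq> 0}) \<in> W ` {x. f x \<noteq> 0}" using S by (intro Max_in) auto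
  then obtain x where x: "f x \<noteq> 0" "W x = Max (W ` {x. f x \<noteq> 0})" by auto
  have "leads W f x" unfolding leads_def using x S by (auto intro!: Max_ge)
  thus ?thesis by (rule that)
qed

context
  fixes W :: "'a \<Rightarrow> real"
  assumes W_inj: "inj_on W (carrier X)"
    and W_pos: "\<And>x. x \<in> carrier X \<Longrightarrow> W x > 0"
    and W_mult: "\<And>x y. x \<in> carrier X \<Longrightarrow> y \<in> carrier X \<Longrightarrow> W (x \<otimes> y) = W x * W y"
begin

text \<open>A pair from the supports with the same product as the leading pair must have equal
  weights in both coordinates, hence be the leading pair by injectivity of \<open>W\<close>. So the
  top coefficient is one nonzero product without cancellation.\<close>

lemma leads_mult:
  assumes f: "f \<in> carrier A" "leads W f x" and g: "g \<in> carrier A" "leads W g y"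
  shows "(f \<otimes>\<^bsub>A\<^esub> g) (x \<otimes> y) = \<sigma> x y * f x * g y" "leads W (f \<otimes>\<^bsub>A\<^esub> g) (x \<otimes> y)"
proof -
  have X: "x \<in> carrier X" "y \<in> carrier X"
    using f g support_closed by (auto simp: leads_def)
  have le: "W (a \<otimes> b) \<le> W (x \<otimes> y)" "a \<otimes> b = x \<otimes> y \<longleftrightarrow> a = x \<and> b = y" if "f a \<noteq> 0" "g b \<noteq> 0" for a b
  proof -
    have ab: "a \<in> carrier X" "b \<in> carrier X" "W a \<le> W x" "W b \<le> W y"
      using that f g support_closed by (auto simp: leads_def)
    show "W (a \<otimes> b) \<le> W (x \<otimes> y)"
      unfolding W_mult[OF ab(1,2)] W_mult[OF X]
      by (intro mult_mono ab(3,4) less_imp_le[OF W_pos] ab(2) X(1))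
    have "a = x \<and> b = y" if "a \<otimes> b = x \<otimes> y"
    proof -
      have eq: "W a * W b = W x * W y" using that ab X by (metis W_mult)
      have "W a = W x"
      proof (rule ccontr)
        assume "W a \<noteq> W x"
        hence "W a < W x" using ab by simp
        hence "W a * W b < W x * W y"
          using ab X W_pos by (intro mult_less_le_imp_less) (auto intro: less_imp_le)
        thus False using eq by simp
      qed
      hence "a = x" using W_inj ab X by (auto dest: inj_onD)
      thus ?thesis using that ab X by simp
    qed
    thus "a \<otimes> b = x \<otimes> y \<longleftrightarrow> a = x \<and> b = y" by blast
  qed
  have "(f \<otimes>\<^bsub>A\<^esub> g) (x \<otimes> y) =
      lsum f (\<lambda>a. lsum g (\<lambda>b. \<sigma> x y * ((if a = x then 1 else 0) * (if b = y then 1 else 0))))"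
    unfolding mult_entry[OF f(1) g(1)] by (intro lsum_cong) (use le(2) in auto)
  also have "\<dots> = \<sigma> x y * f x * g y"
    using f g by (simp add: lsum_mult_right lsum_point finite_support)
  finally show 1: "(f \<otimes>\<^bsub>A\<^esub> g) (x \<otimes> y) = \<sigma> x y * f x * g y" .
  have "W z \<le> W (x \<otimes> y)" if "(f \<otimes>\<^bsub>A\<^esub> g) z \<noteq> 0" for z
  proof -
    have "z \<in> (\<lambda>p. fst p \<otimes> snd p) ` ({x. f x \<noteq> 0} \<times> {y. g y \<noteq> 0})"
      using that mult_support[of f g] by blast
    thus ?thesis using le(1) by auto
  qed
  thus "leads W (f \<otimes>\<^bsub>A\<^esub> g) (x \<otimes> y)"
    using 1 X f(2) g(2) by (simp add: leads_def)
qed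

theorem domain_A: "nc_domain A"
  unfolding nc_domain_def
proof (intro conjI ballI impI)
  show "ring A" by (rule ring_A)
  show "\<one>\<^bsub>A\<^esub> \<noteq> \<zero>\<^bsub>A\<^esub>" by (auto simp: fun_eq_iff indicator_def)
  fix f g assume fg: "f \<in> carrier A" "g \<in> carrier A" "f \<otimes>\<^bsub>A\<^esub> g = \<zero>\<^bsub>A\<^esub>"
  show "f = \<zero>\<^bsub>A\<^esub> \<or> g = \<zero>\<^bsub>A\<^esub>"
  proof (rule ccontr)
    assume "\<not> (f = \<zero>\<^bsub>A\<^esub> \<or> g = \<zero>\<^bsub>A\<^esub>)"
    then obtain x y where "leads W f x" "leads W g y"
      using leads_exists[OF fg(1)] leads_exists[OF fg(2)] by (metis A_simps(2))
    thus False using leads_mult(2)[OF fg(1) _ fg(2)] fg(3) by (simp add: leads_def)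
  qed
qed

text \<open>A Groebner basis argument, with Dickson's lemma as hypothesis \<open>dickson\<close>.\<close>

theorem left_noetherian_A:
  assumes N: "N \<subseteq> carrier X" "\<And>x y. x \<in> N \<Longrightarrow> y \<in> N \<Longrightarrow> x \<otimes> y \<in> N"
    and W_nat: "\<And>x. x \<in> N \<Longrightarrow> W x \<in> \<nat>"
    and cofinal: "\<And>F. finite F \<Longrightarrow> F \<subseteq> carrier X \<Longrightarrow> \<exists>m\<in>carrier X. \<forall>x\<in>F. m \<otimes> x \<in> N"
    and dickson: "\<And>L. L \<subseteq> N \<Longrightarrow> \<exists>B\<subseteq>L. finite B \<and> (\<forall>a\<in>L. \<exists>b\<in>B. \<exists>n\<in>N. a = n \<otimes> b)"
  shows "left_noetherian A"
  unfolding left_noetherian_iff[OF ring_A]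
proof (intro allI impI)
  interpret R: ring A by (rule ring_A)
  fix I assume I: "left_ideal I A"
  note ID = left_idealD[OF ring_A I]
  \<comment> \<open>Leading exponents of the elements of \<open>I\<close> supported in the positive
    cone \<open>N\<close>. Below, \<open>B\<close> generates them under multiplication by
    \<open>N\<close>, and \<open>F\<close> realizes the members of \<open>B\<close> by elements of
    \<open>I\<close>.\<close>
  define L where "L = {x. \<exists>f\<in>I. {x. f x \<noteq> 0} \<subseteq> N \<and> leads W f x}"
  have "L \<subseteq> N" unfolding L_def leads_def by blast
  then obtain B where B: "B \<subseteq> L" "finite B" "\<And>a. a \<in> L \<Longrightarrow> \<exists>b\<in>B. \<exists>n\<in>N. a = n \<otimes> b"
    using dickson by meson
  have "\<forall>b\<in>B. \<exists>f. f \<in> I \<and> {x. f x \<noteq> 0} \<subseteq> N \<and> leads W f b" using B(1) unfolding L_def by blast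
  then obtain F where F: "\<forall>b\<in>B. F b \<in> I \<and> {x. F b x \<noteq> 0} \<subseteq> N \<and> leads W (F b) b"
    by (rule bchoice[THEN exE])
  have smult: "fun_smult c f \<in> K" if K: "left_ideal K A" and f: "f \<in> K" for c f K
  proof -
    have fA: "f \<in> carrier A" using left_idealD(1)[OF ring_A K] f by blast
    have "fun_smult c (u \<one>) \<otimes>\<^bsub>A\<^esub> f = fun_smult c f"
      using R.l_one[OF fA] fA u_closed[OF one_closed] by (simp add: smult_mult)
    moreover have "fun_smult c (u \<one>) \<otimes>\<^bsub>A\<^esub> f \<in> K"
      by (intro left_idealD(4)[OF ring_A K] smult_closed_A u_closed one_closed f)
    ultimately show ?thesis by simp
  qed
  show "\<exists>F. finite F \<and> F \<subseteq> I \<and> (\<forall>K. left_ideal K A \<and> F \<subseteq> K \<longrightarrow> I \<subseteq> K)"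
  proof (intro exI[of _ "F ` B"] conjI allI impI)
    show "finite (F ` B)" "F ` B \<subseteq> I" using B(2) F by auto
    fix K assume K': "left_ideal K A \<and> F ` B \<subseteq> K"
    hence K: "left_ideal K A" and FK: "F ` B \<subseteq> K" by auto
    note KD = left_idealD[OF ring_A K]
    \<comment> \<open>Division with remainder. The induction is on a bound for the weights: each
      subtraction removes the leading term, and integrality on \<open>N\<close> makes the bound drop
      by a whole unit.\<close>
    have bounded: "f \<in> K" if "f \<in> I" "{x. f x \<noteq> 0} \<subseteq> N" "\<And>x. f x \<noteq> 0 \<Longrightarrow> W x < real m" for f m
      using that
    proof (induction m arbitrary: f)
      case 0
      have "f x = 0" for x using 0(3)[of x] 0(2) N(1) W_pos[of x] by force
      hence "f = \<zero>\<^bsub>A\<^esub>" by (intro ext) simp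
      thus ?case using KD(2) by (simp only:)
    next
      case (Suc m)
      show ?case
      proof (cases "f = 0")
        case True
        hence "f = \<zero>\<^bsub>A\<^esub>" by simp
        thus ?thesis using KD(2) by (simp only:)
      next
        case False
        have fA: "f \<in> carrier A" using Suc.prems(1) ID(1) by blast
        obtain x where x: "leads W f x" using leads_exists[OF fA False] .
        have "x \<in> L" unfolding L_def using x Suc.prems by blast
        then obtain b n where bn: "b \<in> B" "n \<in> N" "x = n \<otimes> b" using B(3) by blast
        have Fb: "F b \<in> I" "{x. F b x \<noteq> 0} \<subseteq> N" "leads W (F b) b" using F bn by auto
        have FbA: "F b \<in> carrier A" using Fb(1) ID(1) by blast
        have X: "n \<in> carrier X" "b \<in> carrier X" "x \<in> carrier X"
          using bn N(1) Fb(3) support_closed[OF FbA] by (auto simp: leads_def)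
        \<comment> \<open>The scalar for which \<open>c\<close> times \<open>u n\<close> times
          \<open>F b\<close> has the same leading coefficient as \<open>f\<close>.\<close>
        define c where "c = f x / (\<sigma> n b * F b b)"
        have nz: "f x \<noteq> 0" "F b b \<noteq> 0" using x Fb(3) by (auto simp: leads_def)
        have c: "c \<noteq> 0" "c * \<sigma> n b * F b b = f x" using nz X by (simp_all add: c_def)
        define v where "v = fun_smult c (u n)"
        have vA: "v \<in> carrier A" unfolding v_def using X by (intro smult_closed_A u_closed)
        have v: "leads W v n" "v n = c" "{x. v x \<noteq> 0} = {n}"
          using c(1) by (auto simp: leads_def v_def fun_smult_def indicator_def)
        define g where "g = v \<otimes>\<^bsub>A\<^esub> F b"
        have gI: "g \<in> I" unfolding g_def by (rule ID(4)[OF vA Fb(1)])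
        have gK: "g \<in> K" unfolding g_def by (rule KD(4)[OF vA]) (use FK bn in auto)
        have gx: "g x = f x" "leads W g x"
          using leads_mult[OF vA v(1) FbA Fb(3)] v(2) c(2) unfolding g_def bn(3)
          by (simp_all add: mult_ac)
        have gN: "{x. g x \<noteq> 0} \<subseteq> N"
          unfolding g_def by (rule order_trans[OF mult_support]) (use v(3) bn(2) Fb(2) N(2) in auto)
        \<comment> \<open>Integrality turns the strict bound \<open>Suc m\<close> into the bound
          \<open>m\<close>.\<close>
        have Wx: "W x \<le> real m"
        proof -
          have "x \<in> N" using Suc.prems(2) nz by blast
          then obtain j where "W x = real j" using W_nat by (auto elim: Nats_cases)
          thus ?thesis using Suc.prems(3)[OF nz(1)] by simp
        qed
        have "f \<oplus>\<^bsub>A\<^esub> fun_smult (-1) g = f - g" by (rule ext) (simp add: fun_smult_def)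
        hence dI: "f - g \<in> I" using ID(3)[OF Suc.prems(1) smult[OF I gI]] by metis
        have "f - g \<in> K"
        proof (rule Suc.IH[OF dI])
          have "{x. (f - g) x \<noteq> 0} \<subseteq> {x. f x \<noteq> 0} \<union> {x. g x \<noteq> 0}" by auto
          thus "{x. (f - g) x \<noteq> 0} \<subseteq> N" using Suc.prems(2) gN by blast
          fix z assume z: "(f - g) z \<noteq> 0"
          have "z \<noteq> x" using z gx(1) by auto
          have "f z \<noteq> 0 \<or> g z \<noteq> 0" using z by auto
          hence "W z \<le> W x" using x gx(2) unfolding leads_def by blast
          moreover have "z \<in> carrier X"
            using \<open>f z \<noteq> 0 \<or> g z \<noteq> 0\<close> Suc.prems(2) gN N(1) by blast
          moreover have "W z \<noteq> W x" using \<open>z \<noteq> x\<close> W_inj X(3) calculation(2) by (auto dest: inj_onD)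
          ultimately show "W z < real m" using Wx by simp
        qed
        hence "(f - g) \<oplus>\<^bsub>A\<^esub> g \<in> K" using gK by (rule KD(3))
        thus ?thesis by simp
      qed
    qed
    show "I \<subseteq> K"
    proof
      fix f assume f: "f \<in> I"
      have fA: "f \<in> carrier A" using f ID(1) by blast
      \<comment> \<open>Multiplication by \<open>u m\<close> clears negative exponents. As
        \<open>u m\<close> is invertible up to the scalar \<open>\<sigma> (inv m) m\<close>,
        membership in \<open>K\<close> can be carried back to \<open>f\<close>.\<close>
      obtain m where m: "m \<in> carrier X" "\<And>x. f x \<noteq> 0 \<Longrightarrow> m \<otimes> x \<in> N"
        using cofinal[of "{x. f x \<noteq> 0}"] fA unfolding mem_carrier by blast
      define g where "g = u m \<otimes>\<^bsub>A\<^esub> f"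
      have gI: "g \<in> I" unfolding g_def by (rule ID(4)[OF u_closed[OF m(1)] f])
      have gA: "g \<in> carrier A" using gI ID(1) by blast
      have gN: "{x. g x \<noteq> 0} \<subseteq> N" unfolding g_def u_mult_support[OF m(1) fA] using m(2) by auto
      obtain j where j: "real j > Max (insert 0 (W ` {x. g x \<noteq> 0}))" using reals_Archimedean2 by blast
      have "g \<in> K"
        by (rule bounded[OF gI gN, of j]) (use j finite_support[OF gA] in auto)
      hence *: "fun_smult (inverse (\<sigma> (inv m) m)) (u (inv m)) \<otimes>\<^bsub>A\<^esub> g \<in> K"
        using m by (intro KD(4) smult_closed_A u_closed) auto
      have "fun_smult (inverse (\<sigma> (inv m) m)) (u (inv m)) \<otimes>\<^bsub>A\<^esub> g =
          fun_smult (inverse (\<sigma> (inv m) m)) ((u (inv m) \<otimes>\<^bsub>A\<^esub> u m) \<otimes>\<^bsub>A\<^esub> f)"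
        unfolding g_def using m fA by (simp add: smult_mult u_closed mult_closed R.m_assoc)
      also have "u (inv m) \<otimes>\<^bsub>A\<^esub> u m = fun_smult (\<sigma> (inv m) m) \<one>\<^bsub>A\<^esub>"
        using m by (simp add: u_mult_u l_inv)
      also have "fun_smult (inverse (\<sigma> (inv m) m)) (fun_smult (\<sigma> (inv m) m) \<one>\<^bsub>A\<^esub> \<otimes>\<^bsub>A\<^esub> f) = f"
        using m fA R.l_one[OF fA] by (simp add: smult_mult u_closed) (simp add: fun_smult_def field_simps)
      finally show "f \<in> K" using * by simp
    qed
  qed
qed

end

end

text \<open>Induction on the coordinates. A set \<open>B0\<close> that works for \<open>I\<close>
  fails for \<open>a\<close> only if \<open>a j\<close> is smaller than some \<open>b j\<close> with
  \<open>b\<close> in \<open>B0\<close>; this leaves finitely many values of \<open>a j\<close>, and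
  each slice is handled by the induction hypothesis again.\<close>

lemma dickson:
  fixes L :: "('i \<Rightarrow> nat) set"
  assumes "finite I"
  shows "\<exists>B\<subseteq>L. finite B \<and> (\<forall>a\<in>L. \<exists>b\<in>B. \<forall>i\<in>I. b i \<le> a i)"
  using assms
proof (induction I arbitrary: L rule: finite_induct)
  case empty
  show ?case
  proof (cases "L = {}")
    case False
    then obtain a where "a \<in> L" by blast
    thus ?thesis by (intro exI[of _ "{a}"]) auto
  qed auto
next
  case (insert j I)
  obtain B0 where B0: "B0 \<subseteq> L" "finite B0" "\<And>a. a \<in> L \<Longrightarrow> \<exists>b\<in>B0. \<forall>i\<in>I. b i \<le> a i"
    using insert.IH[of L] by meson
  have "\<forall>m. \<exists>B. B \<subseteq> {a \<in> L. a j = m} \<and> finite B \<and> (\<forall>a\<in>{a \<in> L. a j = m}. \<exists>b\<in>B. \<forall>i\<in>I. b i \<le> a i)"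
    using insert.IH by meson
  then obtain C where "\<forall>m. C m \<subseteq> {a \<in> L. a j = m} \<and> finite (C m) \<and>
      (\<forall>a\<in>{a \<in> L. a j = m}. \<exists>b\<in>C m. \<forall>i\<in>I. b i \<le> a i)"
    by (rule choice[THEN exE])
  hence C: "\<And>m. C m \<subseteq> {a \<in> L. a j = m}" "\<And>m. finite (C m)"
    "\<And>m a. a \<in> L \<Longrightarrow> a j = m \<Longrightarrow> \<exists>b\<in>C m. \<forall>i\<in>I. b i \<le> a i"
    by auto
  \<comment> \<open>The sum serves as a common upper bound of all \<open>b j\<close> with
    \<open>b\<close> in \<open>B0\<close>.\<close>
  define B where "B = B0 \<union> (\<Union>m\<in>{..\<Sum>b\<in>B0. b j}. C m)"
  have "\<exists>b\<in>B. \<forall>i\<in>insert j I. b i \<le> a i" if a: "a \<in> L" for a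
  proof -
    obtain b where b: "b \<in> B0" "\<forall>i\<in>I. b i \<le> a i" using B0(3)[OF a] by blast
    show ?thesis
    proof (cases "b j \<le> a j")
      case True
      thus ?thesis using b unfolding B_def by auto
    next
      case False
      have "b j \<le> (\<Sum>b\<in>B0. b j)" using B0(2) b(1) by (intro member_le_sum) auto
      hence "a j \<le> (\<Sum>b\<in>B0. b j)" using False by simp
      moreover obtain b' where b': "b' \<in> C (a j)" "\<forall>i\<in>I. b' i \<le> a i" using C(3)[OF a refl] by blast
      moreover have "b' j = a j" using C(1)[of "a j"] b'(1) by blast
      ultimately show ?thesis unfolding B_def by (intro bexI[of _ b']) auto
    qed
  qed
  moreover have "finite B" unfolding B_def using B0(2) C(2) by auto
  moreover have "B \<subseteq> L" unfolding B_def using B0(1) C(1) by blast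
  ultimately show ?case by blast
qed

text \<open>Moving negative exponents to the other side gives two equal products of natural numbers.
  Each prime occurs on at most one side, since \<open>m i\<close> and \<open>- m i\<close> are not
  both positive, so by unique factorization it does not occur at all.\<close>

lemma prime_powers_independent:
  fixes p :: "nat \<Rightarrow> nat" and m :: "nat \<Rightarrow> int"
  assumes I: "finite I" and p: "inj_on p I" "\<And>i. i \<in> I \<Longrightarrow> prime (p i)"
    and eq: "(\<Prod>i\<in>I. real (p i) powi m i) = 1" and j: "j \<in> I"
  shows "m j = 0"
proof -
  have pos: "p i > 0" if "i \<in> I" for i using p(2)[OF that] by (rule prime_gt_0_nat)
  have "real (p i) powi m i * real (p i ^ nat (- m i)) = real (p i ^ nat (m i))" if "i \<in> I" for i
    using pos[OF that] by (auto simp: power_int_def field_simps)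
  hence "(\<Prod>i\<in>I. real (p i) powi m i) * (\<Prod>i\<in>I. real (p i ^ nat (- m i))) = (\<Prod>i\<in>I. real (p i ^ nat (m i)))"
    unfolding prod.distrib[symmetric] by (rule prod.cong[OF refl])
  hence "real (\<Prod>i\<in>I. p i ^ nat (- m i)) = real (\<Prod>i\<in>I. p i ^ nat (m i))"
    using eq by (simp only: of_nat_prod mult_1_left)
  hence eq': "(\<Prod>i\<in>I. p i ^ nat (- m i)) = (\<Prod>i\<in>I. p i ^ nat (m i))"
    using of_nat_eq_iff by blast
  have zero: "b j = 0" if ab: "(\<Prod>i\<in>I. p i ^ a i) = (\<Prod>i\<in>I. p i ^ b i)" "a j = 0" for a b :: "nat \<Rightarrow> nat"
  proof (rule ccontr)
    assume "b j \<noteq> 0"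
    hence "p j dvd p j ^ b j" by simp
    also have "\<dots> dvd (\<Prod>i\<in>I. p i ^ b i)" using I j by (rule dvd_prodI)
    finally have "p j dvd (\<Prod>i\<in>I. p i ^ a i)" using ab(1) by simp
    then obtain i where i: "i \<in> I" "p j dvd p i ^ a i"
      using prime_dvd_prod_iff[OF I p(2)[OF j]] by auto
    hence "p j dvd p i" using p(2)[OF j] by (auto dest: prime_dvd_power)
    hence "p j = p i" using p(2) i(1) j by (simp add: primes_dvd_imp_eq)
    hence "i = j" using p(1) i(1) j by (auto dest: inj_onD)
    thus False using i(2) ab(2) p(2)[OF j] by simp
  qed
  show ?thesis
    using zero[OF eq'] zero[OF eq'[symmetric]] by (cases "m j \<ge> 0") auto
qed

section \<open>Free abelian groups\<close>

locale free_comm_group = comm_group X for X (structure) +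
  fixes k :: nat and x :: "nat \<Rightarrow> 'a"
  assumes free: "freely_generates X k x"
begin

definition monomial :: "(nat \<Rightarrow> int) \<Rightarrow> 'a" where
  "monomial n = (\<Otimes>i\<in>{1..k}. x i [^] n i)"

definition exponent :: "'a \<Rightarrow> nat \<Rightarrow> int" where
  "exponent a = inv_into ({1..k} \<rightarrow>\<^sub>E UNIV) monomial a"

lemma gen_closed [simp]: "i \<in> {1..k} \<Longrightarrow> x i \<in> carrier X"
  using free by (auto simp: freely_generates_def)

lemma bij_monomial: "bij_betw monomial ({1..k} \<rightarrow>\<^sub>E UNIV) (carrier X)"
  using free by (simp add: freely_generates_def monomial_def[abs_def])

lemma monomial_closed [simp]: "monomial n \<in> carrier X"
  unfolding monomial_def by (rule finprod_closed) auto

lemma monomial_cong: "(\<And>i. i \<in> {1..k} \<Longrightarrow> n i = m i) \<Longrightarrow> monomial n = monomial m"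
  unfolding monomial_def by (rule finprod_cong') auto

lemma monomial_exponent: "a \<in> carrier X \<Longrightarrow> monomial (exponent a) = a"
  using bij_monomial unfolding exponent_def bij_betw_def by (metis f_inv_into_f)

lemma exponent_monomial: "i \<in> {1..k} \<Longrightarrow> exponent (monomial n) i = n i"
proof -
  assume i: "i \<in> {1..k}"
  have "monomial n = monomial (restrict n {1..k})" by (rule monomial_cong) simp
  hence "exponent (monomial n) = restrict n {1..k}"
    using bij_monomial unfolding exponent_def bij_betw_def by (simp add: inv_into_f_f)
  thus ?thesis using i by simp
qed

lemma exponent_eqI:
  assumes "a \<in> carrier X" "b \<in> carrier X" "\<And>i. i \<in> {1..k} \<Longrightarrow> exponent a i = exponent b i"
  shows "a = b"
  using monomial_cong[of "exponent a" "exponent b"] assms by (simp add: monomial_exponent)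

lemma monomial_add: "monomial (\<lambda>i. n i + m i) = monomial n \<otimes> monomial m"
proof -
  have "monomial (\<lambda>i. n i + m i) = (\<Otimes>i\<in>{1..k}. x i [^] n i \<otimes> x i [^] m i)"
    unfolding monomial_def by (rule finprod_cong') (auto simp: int_pow_mult)
  also have "\<dots> = monomial n \<otimes> monomial m"
    unfolding monomial_def by (rule finprod_multf) auto
  finally show ?thesis .
qed

lemma exponent_mult:
  assumes "a \<in> carrier X" "b \<in> carrier X" "i \<in> {1..k}"
  shows "exponent (a \<otimes> b) i = exponent a i + exponent b i"
proof -
  have "a \<otimes> b = monomial (\<lambda>i. exponent a i + exponent b i)"
    using assms by (simp add: monomial_add monomial_exponent)
  thus ?thesis using exponent_monomial[OF assms(3), of "\<lambda>i. exponent a i + exponent b i"] by simp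
qed

lemma exponent_one: "i \<in> {1..k} \<Longrightarrow> exponent \<one> i = 0"
  using exponent_mult[of \<one> \<one> i] by simp

lemma exponent_gen:
  assumes "i \<in> {1..k}" "j \<in> {1..k}"
  shows "exponent (x i) j = (if j = i then 1 else 0)"
proof -
  have "monomial (\<lambda>j. if j = i then 1 else 0) = (\<Otimes>j\<in>{1..k}. if i = j then x j else \<one>)"
    unfolding monomial_def by (rule finprod_cong') auto
  also have "\<dots> = x i" using assms by (intro finprod_singleton) auto
  finally show ?thesis using exponent_monomial[OF assms(2), of "\<lambda>j. if j = i then 1 else 0"] by simp
qed

text \<open>The weight \<open>\<Prod> p\<^sub>i\<^sup>n\<^sup>i\<close> with distinct primes \<open>p\<^sub>i\<close> is injective by unique factorization.\<close>

theorem twisted_noetherian_domain: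
  assumes "group_2_cocycle X \<sigma>"
  shows "left_noetherian (twisted_group_algebra X \<sigma>)" "nc_domain (twisted_group_algebra X \<sigma>)"
proof -
  interpret twisted_group X \<sigma> by unfold_locales fact
  define p :: "nat \<Rightarrow> nat" where "p = enumerate {p. prime p}"
  have p: "inj p" "\<And>i. prime (p i)"
    unfolding p_def using primes_infinite strict_mono_enumerate[of "{p::nat. prime p}"]
      enumerate_in_set[of "{p::nat. prime p}"] by (auto simp: strict_mono_imp_inj_on)
  have p0: "real (p i) > 0" for i using prime_gt_0_nat[OF p(2)] by simp
  define W where "W a = (\<Prod>i\<in>{1..k}. real (p i) powi exponent a i)" for a
  have W_pos: "W a > 0" for a unfolding W_def using p0 by (intro prod_pos) simp
  have W_mult: "W (a \<otimes> b) = W a * W b" if "a \<in> carrier X" "b \<in> carrier X" for a b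
    unfolding W_def prod.distrib[symmetric] using that p0
    by (intro prod.cong) (auto simp: exponent_mult power_int_add less_imp_neq[THEN not_sym])
  have W_inj: "inj_on W (carrier X)"
  proof (rule inj_onI)
    fix a b assume ab: "a \<in> carrier X" "b \<in> carrier X" "W a = W b"
    let ?d = "a \<otimes> inv b"
    have "a = ?d \<otimes> b" using ab by (simp add: m_assoc l_inv)
    hence "W ?d * W b = W b" using ab W_mult[of ?d b] by simp
    hence "W ?d = 1" using W_pos[of b] by simp
    hence "exponent ?d i = 0" if "i \<in> {1..k}" for i
      unfolding W_def using prime_powers_independent[of "{1..k}" p "exponent ?d" i] p that
      by (auto intro: inj_on_subset)
    hence "?d = \<one>" using ab by (intro exponent_eqI) (auto simp: exponent_one)
    thus "a = b" using ab \<open>a = ?d \<otimes> b\<close> by simp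
  qed
  \<comment> \<open>On this cone the weight is integral and divisibility is comparison of exponents,
    as the Groebner basis argument asks.\<close>
  define N where "N = {a \<in> carrier X. \<forall>i\<in>{1..k}. exponent a i \<ge> 0}"
  show "nc_domain A" by (rule domain_A[OF W_inj W_pos W_mult])
  show "left_noetherian A"
  proof (rule left_noetherian_A[OF W_inj W_pos W_mult, where N = N])
    show "N \<subseteq> carrier X" "\<And>a b. a \<in> N \<Longrightarrow> b \<in> N \<Longrightarrow> a \<otimes> b \<in> N"
      by (auto simp: N_def exponent_mult)
    show "W a \<in> \<nat>" if "a \<in> N" for a
    proof -
      have "W a = real (\<Prod>i\<in>{1..k}. p i ^ nat (exponent a i))"
        unfolding W_def using that by (auto simp: N_def power_int_def intro!: prod.cong)
      thus ?thesis by (simp only: of_nat_in_Nats)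
    qed
    show "\<exists>m\<in>carrier X. \<forall>a\<in>F. m \<otimes> a \<in> N" if F: "finite F" "F \<subseteq> carrier X" for F
    proof (intro bexI ballI)
      \<comment> \<open>The sum of absolute values compensates every negative exponent occurring in
        \<open>F\<close>.\<close>
      let ?m = "monomial (\<lambda>i. \<Sum>a\<in>F. \<bar>exponent a i\<bar>)"
      fix a assume a: "a \<in> F"
      have "0 \<le> (\<Sum>a\<in>F. \<bar>exponent a i\<bar>) + exponent a i" for i
        using member_le_sum[of a F "\<lambda>a. \<bar>exponent a i\<bar>"] F a by simp
      thus "?m \<otimes> a \<in> N" using a F by (auto simp: N_def exponent_mult exponent_monomial)
    qed simp
    show "\<exists>B\<subseteq>L. finite B \<and> (\<forall>a\<in>L. \<exists>b\<in>B. \<exists>n\<in>N. a = n \<otimes> b)" if L: "L \<subseteq> N" for L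
    proof -
      \<comment> \<open>Exponents are nonnegative on \<open>N\<close>, so \<open>nat\<close> is
        faithful there, and domination of exponent vectors puts the quotient into
        \<open>N\<close>.\<close>
      let ?e = "\<lambda>a i. nat (exponent a i)"
      obtain B' where B': "B' \<subseteq> ?e ` L" "finite B'" "\<And>a. a \<in> ?e ` L \<Longrightarrow> \<exists>b\<in>B'. \<forall>i\<in>{1..k}. b i \<le> a i"
        using dickson[of "{1..k}" "?e ` L"] by auto
      obtain B where B: "B \<subseteq> L" "finite B" "B' = ?e ` B"
        using finite_subset_image[OF B'(2,1)] by auto
      have "\<exists>b\<in>B. \<exists>n\<in>N. a = n \<otimes> b" if a: "a \<in> L" for a
      proof -
        obtain b where b: "b \<in> B" "\<forall>i\<in>{1..k}. ?e b i \<le> ?e a i" using B'(3)[of "?e a"] a B(3) by auto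
        have ab: "a \<in> N" "b \<in> N" "a \<in> carrier X" "b \<in> carrier X"
          using a b(1) L B(1) by (auto simp: N_def)
        have eq: "a = (a \<otimes> inv b) \<otimes> b" using ab by (simp add: m_assoc l_inv)
        have "exponent a i = exponent (a \<otimes> inv b) i + exponent b i" if "i \<in> {1..k}" for i
          using exponent_mult[of "a \<otimes> inv b" b i] eq ab that by simp
        moreover have "exponent b i \<le> exponent a i" if "i \<in> {1..k}" for i
        proof -
          have "0 \<le> exponent a i" "nat (exponent b i) \<le> nat (exponent a i)"
            using ab b(2) that unfolding N_def by blast+
          thus ?thesis by linarith
        qed
        ultimately have "a \<otimes> inv b \<in> N" using ab by (force simp: N_def)
        thus ?thesis using eq b(1) by blast
      qed
      thus ?thesis using B by blast
    qed
  qed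
qed

text \<open>The opposite algebra is the twisted algebra of the flipped cocycle, so right ideals are
  covered by the statement on left ideals.\<close>

corollary twisted_nc_noetherian:
  assumes "group_2_cocycle X \<sigma>"
  shows "nc_noetherian (twisted_group_algebra X \<sigma>)"
proof -
  interpret twisted_group X \<sigma> by unfold_locales fact
  interpret F: twisted_group X "\<lambda>x y. \<sigma> y x" by (rule twisted_group_flip)
  have "opposite (opposite F.A) = F.A" by (simp add: opposite_def)
  hence "calg_iso id F.A (opposite A)" using calg_iso_opposite[OF F.opposite_iso] by simp
  hence "left_noetherian (opposite A)"
    using twisted_noetherian_domain(1)[OF F.cocycle] by (rule left_noetherian_transfer[rotated])
  thus ?thesis using twisted_noetherian_domain(1)[OF assms] by (simp add: nc_noetherian_def)
qed

end

section \<open>The algebra \<open>E(q)\<close> as a twisted group algebra\<close>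

definition words :: "nat \<Rightarrow> word monoid" where
  "words n = \<lparr>carrier = {w. fst ` set w \<subseteq> {1..n}}, monoid.mult = (@), one = []\<rparr>"

lemma words_simps [simp]:
  "w \<in> carrier (words n) \<longleftrightarrow> fst ` set w \<subseteq> {1..n}" "v \<otimes>\<^bsub>words n\<^esub> w = v @ w" "\<one>\<^bsub>words n\<^esub> = []"
  by (simp_all add: words_def)

lemma twisted_monoid_words: "twisted_monoid (words n) (\<lambda>_ _. 1)"
proof -
  interpret monoid "words n" by (rule monoidI) auto
  show ?thesis by unfold_locales (simp add: group_2_cocycle_def)
qed

text \<open>The pairs with \<open>x @ y = w\<close> are the splittings of \<open>w\<close>. The
  identification makes the ring laws and the pairing formula available for the free algebra.\<close>

lemma free_algebra_eq: "free_algebra n = twisted_group_algebra (words n) (\<lambda>_ _. 1)"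
proof -
  have "(\<Sum>i\<le>length w. f (take i w) * g (drop i w)) =
      (\<Sum>(x, y) \<in> {(x, y). f x \<noteq> 0 \<and> g y \<noteq> 0 \<and> x @ y = w}. f x * g y)" for f g :: "word \<Rightarrow> complex" and w
  proof -
    let ?s = "\<lambda>i. (take i w, drop i w)"
    have inj: "inj_on ?s {..length w}"
      by (rule inj_on_inverseI[where g = "\<lambda>p. length (fst p)"]) simp
    have sub: "{(x, y). f x \<noteq> 0 \<and> g y \<noteq> 0 \<and> x @ y = w} \<subseteq> ?s ` {..length w}"
    proof
      fix p assume "p \<in> {(x, y). f x \<noteq> 0 \<and> g y \<noteq> 0 \<and> x @ y = w}"
      hence "w = fst p @ snd p" by auto
      thus "p \<in> ?s ` {..length w}" by (intro image_eqI[of _ _ "length (fst p)"]) auto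
    qed
    have "(\<Sum>i\<le>length w. f (take i w) * g (drop i w)) = (\<Sum>p\<in>?s ` {..length w}. f (fst p) * g (snd p))"
      by (subst sum.reindex[OF inj]) simp
    also have "\<dots> = (\<Sum>p \<in> {(x, y). f x \<noteq> 0 \<and> g y \<noteq> 0 \<and> x @ y = w}. f (fst p) * g (snd p))"
      by (rule sum.mono_neutral_right[OF _ sub]) auto
    finally show ?thesis by (simp add: case_prod_unfold)
  qed
  moreover have "(\<forall>w. f w \<noteq> 0 \<longrightarrow> fst ` set w \<subseteq> {1..n}) \<longleftrightarrow> {w. f w \<noteq> 0} \<subseteq> {w. fst ` set w \<subseteq> {1..n}}"
    for f :: "word \<Rightarrow> complex" by (simp only: subset_eq mem_Collect_eq) blast
  ultimately show ?thesis
    by (simp only: free_algebra_def twisted_group_algebra_def words_def monoid.simps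
        partial_object.simps mult_1)
qed

text \<open>\<open>q\<close> is a parameter constrained on \<open>{1..k}\<close> only, because the
  matrices of the theorem are specified only there.\<close>

locale free_twisted = free_comm_group X k x + twisted_group X \<sigma>
  for X (structure) and k x \<sigma> +
  fixes q :: "nat \<Rightarrow> nat \<Rightarrow> complex"
  assumes q: "\<And>i j. i \<in> {1..k} \<Longrightarrow> j \<in> {1..k} \<Longrightarrow> q i j = antisym (x i) (x j)"
begin

sublocale Fr: twisted_monoid "words k" "\<lambda>_ _. 1"
  by (rule twisted_monoid_words)

text \<open>With a constant cocycle these rules have unconstrained premises, on which the simplifier loops.\<close>

declare Fr.nonzero [simp del] Fr.normalized [simp del]

abbreviation F where "F \<equiv> Fr.A"

abbreviation letters where "letters \<equiv> {1..k} \<times> (UNIV :: bool set)"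

definition ldeg :: "nat \<times> bool \<Rightarrow> 'a" where
  "ldeg a = (if snd a then x (fst a) else inv (x (fst a)))"

text \<open>With this factor, the inverse letter is sent to the two-sided inverse of
  \<open>u (x i)\<close>, a multiple of \<open>u (inv (x i))\<close>.\<close>

definition lcoef :: "nat \<times> bool \<Rightarrow> complex" where
  "lcoef a = (if snd a then 1 else inverse (\<sigma> (x (fst a)) (inv (x (fst a)))))"

fun deg :: "word \<Rightarrow> 'a" where
  "deg [] = \<one>"
| "deg (a # w) = ldeg a \<otimes> deg w"

text \<open>\<open>\<rho> w \<cdot> u (deg w)\<close> is the product of the letters of \<open>w\<close> in the twisted group algebra.\<close>

fun \<rho> :: "word \<Rightarrow> complex" where
  "\<rho> [] = 1"
| "\<rho> (a # w) = lcoef a * \<sigma> (ldeg a) (deg w) * \<rho> w"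

lemma ldeg_closed [simp]: "fst a \<in> {1..k} \<Longrightarrow> ldeg a \<in> carrier X"
  by (simp add: ldeg_def)

lemma lcoef_nonzero [simp]: "fst a \<in> {1..k} \<Longrightarrow> lcoef a \<noteq> 0"
  by (simp add: lcoef_def)

lemma deg_closed [simp]: "fst ` set w \<subseteq> {1..k} \<Longrightarrow> deg w \<in> carrier X"
  by (induction w) auto

lemma \<rho>_nonzero [simp]: "fst ` set w \<subseteq> {1..k} \<Longrightarrow> \<rho> w \<noteq> 0"
  by (induction w) auto

lemma deg_append:
  "fst ` set v \<subseteq> {1..k} \<Longrightarrow> fst ` set w \<subseteq> {1..k} \<Longrightarrow> deg (v @ w) = deg v \<otimes> deg w"
  by (induction v) (auto simp: m_assoc)

text \<open>The cocycle identity allows the product of letters to be bracketed at any place.\<close>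

lemma \<rho>_append:
  assumes "fst ` set v \<subseteq> {1..k}" "fst ` set w \<subseteq> {1..k}"
  shows "\<rho> (v @ w) = \<rho> v * \<rho> w * \<sigma> (deg v) (deg w)"
  using assms(1)
proof (induction v)
  case Nil
  have "deg w \<in> carrier X" using assms(2) by (rule deg_closed)
  thus ?case by simp
next
  case (Cons a v)
  have c: "ldeg a \<in> carrier X" "deg v \<in> carrier X" "deg w \<in> carrier X"
    using Cons.prems assms(2) by auto
  have IH: "\<rho> (v @ w) = \<rho> v * \<rho> w * \<sigma> (deg v) (deg w)" using Cons.IH Cons.prems by simp
  have dvw: "deg (v @ w) = deg v \<otimes> deg w" using Cons.prems assms(2) by (intro deg_append) auto
  have "\<rho> ((a # v) @ w) = lcoef a * \<rho> v * \<rho> w * (\<sigma> (ldeg a) (deg v \<otimes> deg w) * \<sigma> (deg v) (deg w))"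
    by (simp add: IH dvw)
  also have "\<dots> = lcoef a * \<rho> v * \<rho> w * (\<sigma> (ldeg a) (deg v) * \<sigma> (ldeg a \<otimes> deg v) (deg w))"
    by (simp only: cocycle_eq[OF c])
  finally show ?case by (simp add: mult_ac)
qed

text \<open>The homomorphism from the free algebra that multiplies out the letters of each word,
  given by its coefficient in degree \<open>z\<close>.\<close>

definition ev :: "(word \<Rightarrow> complex) \<Rightarrow> 'a \<Rightarrow> complex" where
  "ev f z = lsum f (\<lambda>w. \<rho> w * (if deg w = z then 1 else 0))"

lemma ev_support: "{z. ev f z \<noteq> 0} \<subseteq> deg ` {w. f w \<noteq> 0}"
proof
  fix z assume "z \<in> {z. ev f z \<noteq> 0}"
  then obtain w where "f w \<noteq> 0" "deg w = z"
    unfolding ev_def lsum_def mem_Collect_eq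
    by (auto elim!: sum.not_neutral_contains_not_neutral split: if_splits)
  thus "z \<in> deg ` {w. f w \<noteq> 0}" by blast
qed

lemma ev_closed:
  assumes "f \<in> carrier F" shows "ev f \<in> carrier A"
proof -
  have "finite (deg ` {w. f w \<noteq> 0})" "deg ` {w. f w \<noteq> 0} \<subseteq> carrier X"
    using Fr.finite_support[OF assms] Fr.support_closed[OF assms] by auto
  thus ?thesis unfolding mem_carrier using ev_support[of f] by (meson finite_subset order_trans)
qed

text \<open>Dual description of \<open>ev\<close>: weights on the group are pulled back to words
  along \<open>deg\<close>. Multiplicativity of \<open>ev\<close> then reduces to
  \<open>\<rho>_append\<close>.\<close>

lemma lsum_ev:
  assumes "f \<in> carrier F" shows "lsum (ev f) h = lsum f (\<lambda>w. \<rho> w * h (deg w))"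
proof -
  let ?S = "{w. f w \<noteq> 0}"
  have fin: "finite ?S" using assms by (rule Fr.finite_support)
  have "lsum (ev f) h = (\<Sum>z\<in>deg ` ?S. ev f z * h z)"
    by (rule lsum_superset[OF _ ev_support]) (use fin in simp)
  also have "\<dots> = (\<Sum>z\<in>deg ` ?S. \<Sum>w\<in>?S. if deg w = z then f w * \<rho> w * h z else 0)"
    by (auto simp: ev_def lsum_def sum_distrib_right intro!: sum.cong)
  also have "\<dots> = (\<Sum>w\<in>?S. \<Sum>z\<in>deg ` ?S. if deg w = z then f w * \<rho> w * h z else 0)"
    by (rule sum.swap)
  also have "\<dots> = (\<Sum>w\<in>?S. f w * \<rho> w * h (deg w))"
    using fin by (intro sum.cong refl) simp
  finally show ?thesis by (simp add: lsum_def mult_ac)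
qed

lemma ev_eqI:
  assumes "f \<in> carrier F" "g \<in> carrier A" "\<And>h. lsum f (\<lambda>w. \<rho> w * h (deg w)) = lsum g h"
  shows "ev f = g"
  by (rule lsum_eqI) (use assms in \<open>auto intro: finite_support ev_closed simp: lsum_ev\<close>)

lemma ev_u: "fst ` set w \<subseteq> {1..k} \<Longrightarrow> ev (Fr.u w) = fun_smult (\<rho> w) (u (deg w))"
  by (intro ev_eqI Fr.u_closed smult_closed_A u_closed) (auto simp: lsum_smult)

lemma ev_add: "f \<in> carrier F \<Longrightarrow> g \<in> carrier F \<Longrightarrow> ev (f + g) = ev f + ev g"
  by (intro ev_eqI Fr.add_closed add_closed ev_closed)
    (simp_all add: lsum_add Fr.finite_support finite_support ev_closed lsum_ev)

lemma ev_smult: "f \<in> carrier F \<Longrightarrow> ev (fun_smult c f) = fun_smult c (ev f)"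
  by (intro ev_eqI Fr.smult_closed_A smult_closed_A ev_closed) (simp_all add: lsum_smult lsum_ev)

lemma ev_mult:
  assumes "f \<in> carrier F" "g \<in> carrier F"
  shows "ev (f \<otimes>\<^bsub>F\<^esub> g) = ev f \<otimes>\<^bsub>A\<^esub> ev g"
proof (rule ev_eqI)
  fix h
  have "lsum f (\<lambda>v. lsum g (\<lambda>w. \<rho> (v @ w) * h (deg (v @ w)))) =
      lsum f (\<lambda>v. \<rho> v * lsum g (\<lambda>w. \<rho> w * (\<sigma> (deg v) (deg w) * h (deg v \<otimes> deg w))))"
    unfolding lsum_mult_right(1)[symmetric]
  proof (intro lsum_cong)
    fix v w assume "f v \<noteq> 0" "g w \<noteq> 0"
    hence "fst ` set v \<subseteq> {1..k}" "fst ` set w \<subseteq> {1..k}"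
      using Fr.support_closed[OF assms(1), of v] Fr.support_closed[OF assms(2), of w] by auto
    thus "\<rho> (v @ w) * h (deg (v @ w)) = \<rho> v * (\<rho> w * (\<sigma> (deg v) (deg w) * h (deg v \<otimes> deg w)))"
      by (simp add: \<rho>_append deg_append)
  qed
  thus "lsum (f \<otimes>\<^bsub>F\<^esub> g) (\<lambda>w. \<rho> w * h (deg w)) = lsum (ev f \<otimes>\<^bsub>A\<^esub> ev g) h"
    using assms by (simp add: Fr.lsum_mult lsum_mult ev_closed lsum_ev)
qed (use assms in \<open>auto intro: Fr.mult_closed mult_closed ev_closed\<close>)

lemma ev_hom: "ring_hom_ring F A ev"
  by (rule ring_hom_ringI[OF Fr.ring_A ring_A])
    (simp_all add: ev_closed ev_mult ev_add ev_u fun_smult_def)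

text \<open>The degrees of words form a subgroup containing the generators; as the group is abelian,
  an inverse degree is obtained letter by letter without reversing the word.\<close>

lemma ex_word:
  assumes "a \<in> carrier X" shows "\<exists>w. fst ` set w \<subseteq> {1..k} \<and> deg w = a"
proof -
  let ?H = "deg ` {w. fst ` set w \<subseteq> {1..k}}"
  have conv: "ldeg (i, \<not> s) = inv (ldeg (i, s))" if "i \<in> {1..k}" for i s
    using that by (simp add: ldeg_def)
  have inv: "inv (deg w) \<in> ?H" if "fst ` set w \<subseteq> {1..k}" for w
    using that
  proof (induction w)
    case Nil
    show ?case by (intro image_eqI[of _ _ "[]"]) auto
  next
    case (Cons a w)
    then obtain v where v: "inv (deg w) = deg v" "fst ` set v \<subseteq> {1..k}" by auto
    have "inv (deg (a # w)) = deg ((fst a, \<not> snd a) # v)"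
      using Cons.prems v conv[of "fst a" "snd a"] by (simp add: inv_mult)
    thus ?case using Cons.prems v(2) by (intro image_eqI[of _ _ "(fst a, \<not> snd a) # v"]) auto
  qed
  have H: "subgroup ?H X"
  proof (rule subgroupI)
    show "?H \<subseteq> carrier X" by auto
    show "?H \<noteq> {}" by (auto intro!: exI[of _ "[]"])
    show "inv b \<in> ?H" if "b \<in> ?H" for b using that inv by auto
    show "b \<otimes> c \<in> ?H" if bc: "b \<in> ?H" "c \<in> ?H" for b c
    proof -
      obtain v w where "b = deg v" "c = deg w" "fst ` set v \<subseteq> {1..k}" "fst ` set w \<subseteq> {1..k}"
        using bc by auto
      thus ?thesis by (intro image_eqI[of _ _ "v @ w"]) (auto simp: deg_append)
    qed
  qed
  interpret H: subgroup ?H X by fact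
  have gen: "x i \<in> ?H" if "i \<in> {1..k}" for i
    using that by (intro image_eqI[of _ _ "[(i, True)]"]) (auto simp: ldeg_def)
  have "(\<Otimes>i\<in>I. x i [^] n i) \<in> ?H" if "finite I" "I \<subseteq> {1..k}" for I and n :: "nat \<Rightarrow> int"
    using that
  proof (induction I)
    case (insert i I)
    hence eq: "(\<Otimes>i\<in>insert i I. x i [^] n i) = x i [^] n i \<otimes> (\<Otimes>i\<in>I. x i [^] n i)"
      by (intro finprod_insert) (auto simp: subset_eq)
    have m1: "x i [^] n i \<in> ?H"
      using insert.prems by (intro subgroup_int_pow_closed[OF H gen]) auto
    have m2: "(\<Otimes>i\<in>I. x i [^] n i) \<in> ?H" using insert by simp
    show ?case unfolding eq by (rule H.m_closed[OF m1 m2])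
  qed (use H.one_closed in simp)
  from this[of "{1..k}" "exponent a"] have "a \<in> ?H"
    using monomial_exponent[OF assms] by (simp add: monomial_def)
  thus ?thesis by auto
qed

lemma ev_surj: "ev ` carrier F = carrier A"
proof
  show "ev ` carrier F \<subseteq> carrier A" using ev_closed by auto
  show "carrier A \<subseteq> ev ` carrier F"
  proof
    fix f assume "f \<in> carrier A"
    thus "f \<in> ev ` carrier F"
    proof (induction f rule: span_induct)
      case zero
      have "ev 0 = 0" by (rule ext) (simp add: ev_def)
      moreover have "0 \<in> carrier F" using ring.ring_simprules(2)[OF Fr.ring_A] by (simp only: Fr.A_simps)
      ultimately show ?case by (intro image_eqI[of _ _ 0]) (simp_all only:)
    next
      case (step a c g)
      obtain w where w: "fst ` set w \<subseteq> {1..k}" "deg w = a" using ex_word[OF step(1)] by blast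
      obtain g' where g': "g' \<in> carrier F" "g = ev g'" using step(3) by blast
      \<comment> \<open>Dividing by \<open>\<rho> w\<close> corrects the scalar that evaluation of
        the word introduces.\<close>
      let ?f = "fun_smult (c / \<rho> w) (Fr.u w)"
      have "?f \<in> carrier F" using w by (intro Fr.smult_closed_A Fr.u_closed) simp
      moreover have "ev ?f = fun_smult c (u a)"
      proof -
        have "ev ?f = fun_smult (c / \<rho> w) (ev (Fr.u w))"
          by (rule ev_smult[OF Fr.u_closed]) (use w in simp)
        also have "ev (Fr.u w) = fun_smult (\<rho> w) (u a)" using ev_u[OF w(1)] w(2) by (simp only:)
        also have "fun_smult (c / \<rho> w) (fun_smult (\<rho> w) (u a)) = fun_smult c (u a)"
          by (rule ext) (simp add: fun_smult_def \<rho>_nonzero[OF w(1)])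
        finally show ?thesis .
      qed
      ultimately have "fun_smult c (u a) + g = ev (?f + g')" "?f + g' \<in> carrier F"
        using g' ev_add[of ?f g'] Fr.add_closed[of ?f g'] by (simp_all only:)
      thus ?case by (rule image_eqI)
    qed
  qed
qed

text \<open>Equality modulo the ideal up to a nonzero scalar. Forgetting the scalar turns rewriting
  of words into an equivalence relation; the kernel argument never has to know its value.\<close>

definition equiv_words :: "word \<Rightarrow> word \<Rightarrow> bool" (infix "\<sim>" 50) where
  "v \<sim> w \<longleftrightarrow> fst ` set v \<subseteq> {1..k} \<and> fst ` set w \<subseteq> {1..k} \<and>
    (\<exists>c. c \<noteq> 0 \<and> Fr.u v + fun_smult (- c) (Fr.u w) \<in> E_ideal k q)"

section \<open>The defining relations and rewriting modulo their ideal\<close>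

lemma E_ideal_alt: "E_ideal k q = Idl\<^bsub>F\<^esub> (E_relations k q)"
  by (simp add: E_ideal_def free_algebra_eq)

lemma E_relation_cases:
  assumes "r \<in> E_relations k q"
  obtains i j where "i \<in> {1..k}" "j \<in> {1..k}"
    "r = Fr.u [(i, True), (j, True)] + fun_smult (- q i j) (Fr.u [(j, True), (i, True)])"
  | i s where "i \<in> {1..k}" "r = Fr.u [(i, s), (i, \<not> s)] + fun_smult (- 1) (Fr.u [])"
proof -
  have minus: "f - fun_smult c g = f + fun_smult (- c) g" "f - g = f + fun_smult (- 1) g"
    for f g :: "word \<Rightarrow> complex" and c
    by (simp_all add: fun_eq_iff fun_smult_def)
  from assms consider
      (L) i where "i \<in> {1..k}" "r = Fr.u [(i, True), (i, False)] - Fr.u []"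
    | (R) i where "i \<in> {1..k}" "r = Fr.u [(i, False), (i, True)] - Fr.u []"
    | (C) i j where "i \<in> {1..k}" "j \<in> {1..k}"
      "r = Fr.u [(i, True), (j, True)] - fun_smult (q i j) (Fr.u [(j, True), (i, True)])"
    unfolding E_relations_def by blast
  thus thesis
  proof cases
    case L
    thus ?thesis by (intro that(2)[of i True]) (simp_all only: minus(2) not_True_eq_False)
  next
    case R
    thus ?thesis by (intro that(2)[of i False]) (simp_all only: minus(2) not_False_eq_True)
  next
    case C
    thus ?thesis by (intro that(1)[of i j]) (simp_all only: minus(1))
  qed
qed

lemma E_relationI:
  "i \<in> {1..k} \<Longrightarrow> j \<in> {1..k} \<Longrightarrow>
    Fr.u [(i, True), (j, True)] + fun_smult (- q i j) (Fr.u [(j, True), (i, True)]) \<in> E_relations k q"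
  "i \<in> {1..k} \<Longrightarrow> Fr.u [(i, s), (i, \<not> s)] + fun_smult (- 1) (Fr.u []) \<in> E_relations k q"
proof -
  assume ij: "i \<in> {1..k}" "j \<in> {1..k}"
  have "Fr.u [(i, True), (j, True)] + fun_smult (- q i j) (Fr.u [(j, True), (i, True)]) =
    Fr.u [(i, True), (j, True)] - fun_smult (q i j) (Fr.u [(j, True), (i, True)])"
    by (simp add: fun_eq_iff fun_smult_def)
  thus "Fr.u [(i, True), (j, True)] + fun_smult (- q i j) (Fr.u [(j, True), (i, True)]) \<in> E_relations k q"
    unfolding E_relations_def using ij by blast
next
  assume i: "i \<in> {1..k}"
  have "Fr.u [(i, s), (i, \<not> s)] + fun_smult (- 1) (Fr.u []) = Fr.u [(i, s), (i, \<not> s)] - Fr.u []"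
    by (simp add: fun_eq_iff fun_smult_def)
  thus "Fr.u [(i, s), (i, \<not> s)] + fun_smult (- 1) (Fr.u []) \<in> E_relations k q"
    unfolding E_relations_def using i by (cases s) auto
qed

lemma E_relations_closed: "E_relations k q \<subseteq> carrier F"
proof
  fix r assume "r \<in> E_relations k q"
  thus "r \<in> carrier F"
    by (cases rule: E_relation_cases) (auto intro!: Fr.add_closed Fr.smult_closed_A Fr.u_closed)
qed

lemma ideal_E: "ideal (E_ideal k q) F"
  unfolding E_ideal_alt by (rule ring.genideal_ideal[OF Fr.ring_A E_relations_closed])

lemma ev_zero: "ev 0 = 0"
  by (rule ext) (simp add: ev_def)

lemma kernel_alt: "a_kernel F A ev = {f \<in> carrier F. ev f = 0}"
  by (simp add: a_kernel_def')

lemma E_ideal_subset_kernel: "E_ideal k q \<subseteq> {f \<in> carrier F. ev f = 0}"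
  unfolding E_ideal_alt kernel_alt[symmetric]
proof (rule ring.genideal_minimal[OF Fr.ring_A ring_hom_ring.kernel_is_ideal[OF ev_hom]])
  show "E_relations k q \<subseteq> a_kernel F A ev" unfolding kernel_alt
  proof
    fix r assume r: "r \<in> E_relations k q"
    have "ev r = 0" using r
    proof (cases rule: E_relation_cases)
      case (1 i j)
      let ?v = "[(i, True), (j, True)]" and ?w = "[(j, True), (i, True)]"
      have "ev r = fun_smult (\<rho> ?v) (u (deg ?v)) + fun_smult (- q i j) (fun_smult (\<rho> ?w) (u (deg ?w)))"
        using 1 by (simp add: ev_add ev_smult ev_u Fr.u_closed Fr.smult_closed_A)
      \<comment> \<open>Both words have the same degree, and the ratio of their coefficients is
        \<open>antisym (x i) (x j)\<close>, which is \<open>q i j\<close>.\<close>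
      also have "\<dots> = 0"
        using 1 q[of i j] by (simp add: ldeg_def lcoef_def m_comm[of "x j"] antisym_def fun_eq_iff fun_smult_def)
      finally show ?thesis .
    next
      case (2 i s)
      let ?v = "[(i, s), (i, \<not> s)]"
      have "ev r = fun_smult (\<rho> ?v) (u (deg ?v)) + fun_smult (- 1) (fun_smult (\<rho> []) (u (deg [])))"
        using 2 by (simp add: ev_add ev_smult ev_u Fr.u_closed Fr.smult_closed_A)
      \<comment> \<open>\<open>lcoef\<close> is normalized for a generator followed by its inverse;
        in the other order the cocycle value is the same by \<open>cocycle_inv_comm\<close>.\<close>
      also have "\<dots> = 0"
        using 2 cocycle_inv_comm[of "x i"]
        by (cases s) (simp_all add: ldeg_def lcoef_def fun_eq_iff fun_smult_def l_inv r_inv)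
      finally show ?thesis .
    qed
    thus "r \<in> {f \<in> carrier F. ev f = 0}" using r E_relations_closed by auto
  qed
qed

lemma zero_ideal: "0 \<in> E_ideal k q"
  using additive_subgroup.zero_closed[OF ideal.axioms(1)[OF ideal_E]] by (simp only: Fr.A_simps)

lemma equiv_refl: "fst ` set v \<subseteq> {1..k} \<Longrightarrow> v \<sim> v"
proof -
  assume v: "fst ` set v \<subseteq> {1..k}"
  have "Fr.u v + fun_smult (- 1) (Fr.u v) = 0" by (simp add: fun_eq_iff fun_smult_def)
  hence "Fr.u v + fun_smult (- 1) (Fr.u v) \<in> E_ideal k q" using zero_ideal by (simp only:)
  thus ?thesis unfolding equiv_words_def using v zero_neq_one by (metis (no_types))
qed

lemma smult_ideal:
  assumes "f \<in> E_ideal k q" shows "fun_smult c f \<in> E_ideal k q"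
proof -
  interpret ideal "E_ideal k q" F by (rule ideal_E)
  have f: "f \<in> carrier F" using assms by (rule Icarr)
  have "fun_smult c (Fr.u []) \<otimes>\<^bsub>F\<^esub> f = fun_smult c f"
    using ring.ring_simprules(12)[OF Fr.ring_A f] f Fr.u_closed[of "[]"] by (simp add: Fr.smult_mult)
  moreover have "fun_smult c (Fr.u []) \<otimes>\<^bsub>F\<^esub> f \<in> E_ideal k q"
    by (intro I_l_closed assms Fr.smult_closed_A Fr.u_closed) simp
  ultimately show ?thesis by simp
qed

lemma add_ideal: "f \<in> E_ideal k q \<Longrightarrow> g \<in> E_ideal k q \<Longrightarrow> f + g \<in> E_ideal k q"
  using additive_subgroup.a_closed[OF ideal.axioms(1)[OF ideal_E], of f g] by (simp only: Fr.A_simps)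

lemma equiv_sym: assumes "v \<sim> w" shows "w \<sim> v"
proof -
  obtain c where c: "c \<noteq> 0" "Fr.u v + fun_smult (- c) (Fr.u w) \<in> E_ideal k q"
    using assms by (auto simp: equiv_words_def)
  have "fun_smult (- inverse c) (Fr.u v + fun_smult (- c) (Fr.u w)) = Fr.u w + fun_smult (- inverse c) (Fr.u v)"
    using c(1) by (simp add: fun_eq_iff fun_smult_def field_simps)
  hence "Fr.u w + fun_smult (- inverse c) (Fr.u v) \<in> E_ideal k q"
    using smult_ideal[OF c(2), of "- inverse c"] by simp
  thus ?thesis using assms c(1) unfolding equiv_words_def by (metis inverse_zero_imp_zero)
qed

lemma equiv_trans [trans]: assumes "v \<sim> w" "w \<sim> z" shows "v \<sim> z"
proof -
  obtain c where c: "c \<noteq> 0" "Fr.u v + fun_smult (- c) (Fr.u w) \<in> E_ideal k q"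
    using assms(1) by (auto simp: equiv_words_def)
  obtain d where d: "d \<noteq> 0" "Fr.u w + fun_smult (- d) (Fr.u z) \<in> E_ideal k q"
    using assms(2) by (auto simp: equiv_words_def)
  have "(Fr.u v + fun_smult (- c) (Fr.u w)) + fun_smult c (Fr.u w + fun_smult (- d) (Fr.u z))
      = Fr.u v + fun_smult (- (c * d)) (Fr.u z)"
    by (simp add: fun_eq_iff fun_smult_def field_simps)
  hence "Fr.u v + fun_smult (- (c * d)) (Fr.u z) \<in> E_ideal k q"
    using add_ideal[OF c(2) smult_ideal[OF d(2)]] by metis
  thus ?thesis using assms c(1) d(1) unfolding equiv_words_def by (metis no_zero_divisors)
qed

lemma word_closed: "fst ` set w \<subseteq> {1..k} \<Longrightarrow> Fr.u w \<in> carrier F"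
  by (rule Fr.u_closed) simp

lemma equiv_append:
  assumes "v \<sim> w" and p: "fst ` set p \<subseteq> {1..k}" and r: "fst ` set r \<subseteq> {1..k}"
  shows "p @ v @ r \<sim> p @ w @ r"
proof -
  interpret ideal "E_ideal k q" F by (rule ideal_E)
  obtain c where c: "c \<noteq> 0" "Fr.u v + fun_smult (- c) (Fr.u w) \<in> E_ideal k q"
    and vw: "fst ` set v \<subseteq> {1..k}" "fst ` set w \<subseteq> {1..k}"
    using assms(1) by (auto simp: equiv_words_def)
  let ?d = "Fr.u v \<oplus>\<^bsub>F\<^esub> fun_smult (- c) (Fr.u w)"
  have pu: "Fr.u p \<in> carrier F" "Fr.u r \<in> carrier F" "Fr.u v \<in> carrier F" "Fr.u w \<in> carrier F"
    by (rule word_closed[OF p] word_closed[OF r] word_closed[OF vw(1)] word_closed[OF vw(2)])+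
  have one: "fun_smult 1 f = f" for f :: "word \<Rightarrow> complex" by (simp add: fun_smult_def)
  have cat: "Fr.u a \<otimes>\<^bsub>F\<^esub> Fr.u b = Fr.u (a @ b)" if "fst ` set a \<subseteq> {1..k}" "fst ` set b \<subseteq> {1..k}" for a b
    using Fr.u_mult_u[of a b] that by (simp add: one)
  have "Fr.u p \<otimes>\<^bsub>F\<^esub> (?d \<otimes>\<^bsub>F\<^esub> Fr.u r) \<in> E_ideal k q"
    using c(2) pu by (intro I_l_closed I_r_closed) auto
  also have "?d \<otimes>\<^bsub>F\<^esub> Fr.u r = Fr.u (v @ r) \<oplus>\<^bsub>F\<^esub> fun_smult (- c) (Fr.u (w @ r))"
    using pu vw r Fr.smult_closed_A[OF pu(4)]
    by (simp only: ring.ring_simprules(13)[OF Fr.ring_A] Fr.smult_mult cat)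
  also have "Fr.u p \<otimes>\<^bsub>F\<^esub> (Fr.u (v @ r) \<oplus>\<^bsub>F\<^esub> fun_smult (- c) (Fr.u (w @ r)))
      = Fr.u (p @ v @ r) \<oplus>\<^bsub>F\<^esub> fun_smult (- c) (Fr.u (p @ w @ r))"
  proof -
    have a: "fst ` set (v @ r) \<subseteq> {1..k}" "fst ` set (w @ r) \<subseteq> {1..k}" using vw r by auto
    have b: "Fr.u (v @ r) \<in> carrier F" "Fr.u (w @ r) \<in> carrier F" using a by (simp_all only: word_closed)
    show ?thesis using pu(1) b Fr.smult_closed_A[OF b(2)]
      by (simp only: ring.ring_simprules(23)[OF Fr.ring_A] Fr.smult_mult cat[OF p a(1)] cat[OF p a(2)])
  qed
  finally have "Fr.u (p @ v @ r) + fun_smult (- c) (Fr.u (p @ w @ r)) \<in> E_ideal k q"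
    by (simp only: Fr.A_simps)
  moreover have "fst ` set (p @ v @ r) \<subseteq> {1..k}" "fst ` set (p @ w @ r) \<subseteq> {1..k}"
    using p r vw by auto
  ultimately show ?thesis unfolding equiv_words_def using c(1) by blast
qed

lemma equiv_cancel: "i \<in> {1..k} \<Longrightarrow> [(i, s), (i, \<not> s)] \<sim> []"
proof -
  assume i: "i \<in> {1..k}"
  have "Fr.u [(i, s), (i, \<not> s)] + fun_smult (- 1) (Fr.u []) \<in> E_ideal k q"
    unfolding E_ideal_alt using ring.genideal_self[OF Fr.ring_A E_relations_closed] E_relationI(2)[OF i] by blast
  thus ?thesis unfolding equiv_words_def using i by (intro conjI exI[of _ 1]) auto
qed

lemma equiv_cancel': "i \<in> {1..k} \<Longrightarrow> [(i, \<not> s), (i, s)] \<sim> []"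
  using equiv_cancel[of i "\<not> s"] by simp

lemma equiv_insert:
  assumes "i \<in> {1..k}" "fst ` set v \<subseteq> {1..k}" "fst ` set w \<subseteq> {1..k}"
  shows "v @ w \<sim> v @ [(i, s), (i, \<not> s)] @ w"
  using equiv_append[OF equiv_cancel[OF assms(1), of s] assms(2,3)] by (auto intro: equiv_sym)

text \<open>Insert a cancelling pair on the right, move the letter across \<open>a\<close>, and
  cancel on the left. This supplies the commutations of inverses, which are not among the defining
  relations.\<close>

lemma equiv_inverse_comm:
  assumes i: "i \<in> {1..k}" and a: "fst a \<in> {1..k}" and c: "[(i, s), a] \<sim> [a, (i, s)]"
  shows "[(i, \<not> s), a] \<sim> [a, (i, \<not> s)]"
proof -
  have "[(i, \<not> s), a] \<sim> [(i, \<not> s)] @ [a, (i, s)] @ [(i, \<not> s)]"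
    using equiv_insert[of i "[(i, \<not> s), a]" "[]" s] i a by simp
  also have "\<dots> \<sim> [(i, \<not> s)] @ [(i, s), a] @ [(i, \<not> s)]"
    using i by (intro equiv_append equiv_sym[OF c]) auto
  also have "\<dots> \<sim> [a, (i, \<not> s)]"
    using equiv_append[OF equiv_cancel'[OF i, of s], of "[]" "[a, (i, \<not> s)]"] i a by simp
  finally show ?thesis .
qed

text \<open>\<open>equiv_inverse_comm\<close> changes the sign of the first letter and then, with
  the roles exchanged, that of the second.\<close>

lemma equiv_letters_comm:
  assumes "fst a \<in> {1..k}" "fst b \<in> {1..k}"
  shows "[a, b] \<sim> [b, a]"
proof -
  have TT: "[(i, True), (j, True)] \<sim> [(j, True), (i, True)]" if ij: "i \<in> {1..k}" "j \<in> {1..k}" for i j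
  proof -
    have "Fr.u [(i, True), (j, True)] + fun_smult (- q i j) (Fr.u [(j, True), (i, True)]) \<in> E_ideal k q"
      unfolding E_ideal_alt using ring.genideal_self[OF Fr.ring_A E_relations_closed] E_relationI(1)[OF ij] by blast
    thus ?thesis unfolding equiv_words_def using ij q[OF ij] by (intro conjI exI[of _ "q i j"]) auto
  qed
  have ST: "[(i, s), (j, True)] \<sim> [(j, True), (i, s)]" if ij: "i \<in> {1..k}" "j \<in> {1..k}" for i j s
    using equiv_inverse_comm[of i "(j, True)" True] TT[OF ij] ij by (cases s) auto
  have "[(j, t), (i, s)] \<sim> [(i, s), (j, t)]" if ij: "i \<in> {1..k}" "j \<in> {1..k}" for i j s t
    using equiv_inverse_comm[of j "(i, s)" True] equiv_sym[OF ST[OF ij, of s]] ij by (cases t) auto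
  from this[of "fst b" "fst a" "snd a" "snd b"] show ?thesis using assms by simp
qed

lemma equiv_letter_word_comm:
  assumes a: "fst a \<in> {1..k}" and w: "fst ` set w \<subseteq> {1..k}"
  shows "a # w \<sim> w @ [a]"
  using w
proof (induction w)
  case Nil
  thus ?case using equiv_refl[of "[a]"] a by simp
next
  case (Cons b w)
  have "[] @ [a, b] @ w \<sim> [] @ [b, a] @ w"
    using Cons.prems a by (intro equiv_append equiv_letters_comm) auto
  also have "[] @ [b, a] @ w \<sim> [b] @ (w @ [a]) @ []"
    using equiv_append[of "a # w" "w @ [a]" "[b]" "[]"] Cons by simp
  finally show ?case by simp
qed

section \<open>Words of equal degree and the kernel of evaluation\<close>

lemma exponent_inv: "a \<in> carrier X \<Longrightarrow> i \<in> {1..k} \<Longrightarrow> exponent (inv a) i = - exponent a i"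
  using exponent_mult[of a "inv a" i] exponent_one[of i] by (simp add: r_inv)

lemma exponent_ldeg:
  assumes "fst a \<in> {1..k}" "i \<in> {1..k}"
  shows "exponent (ldeg a) i = (if fst a = i then (if snd a then 1 else -1) else 0)"
  using assms by (simp add: ldeg_def exponent_inv exponent_gen)

text \<open>Letters of one sign cannot cancel. Read contrapositively, a word of trivial degree that
  contains a letter also contains its inverse.\<close>

lemma exponent_deg_sign:
  assumes "fst ` set w \<subseteq> {1..k}" "i \<in> {1..k}" "(i, \<not> s) \<notin> set w"
  shows "(if s then 1 else -1) * exponent (deg w) i \<ge> (if (i, s) \<in> set w then 1 else 0)"
  using assms(1,3)
proof (induction w)
  case Nil
  thus ?case using assms(2) by (simp add: exponent_one)
next
  case (Cons a w)
  have "exponent (deg (a # w)) i = exponent (ldeg a) i + exponent (deg w) i"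
    using Cons assms(2) by (simp add: exponent_mult)
  moreover have "exponent (ldeg a) i = (if fst a = i then (if snd a then 1 else -1) else 0)"
    using Cons assms(2) by (intro exponent_ldeg) auto
  moreover have "a \<noteq> (i, \<not> s)" using Cons.prems by auto
  ultimately show ?case using Cons by (cases a; cases s) (auto split: if_splits)
qed

text \<open>The inverse of the first letter occurs later, by \<open>exponent_deg_sign\<close>. Move
  the first letter next to it and cancel; the shorter word has the same degree.\<close>

lemma equiv_Nil:
  assumes "fst ` set w \<subseteq> {1..k}" "deg w = \<one>"
  shows "w \<sim> []"
  using assms
proof (induction "length w" arbitrary: w rule: less_induct)
  case less
  show ?case
  proof (cases w)
    case Nil
    thus ?thesis using equiv_refl[of "[]"] by simp
  next
    case (Cons a v)
    obtain i s where a: "a = (i, s)" by (cases a)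
    have i: "i \<in> {1..k}" and v: "fst ` set v \<subseteq> {1..k}" using less.prems Cons a by auto
    have "(i, \<not> s) \<in> set w"
      using exponent_deg_sign[OF less.prems(1) i, of s] less.prems(2) Cons a exponent_one[OF i] by auto
    hence "(i, \<not> s) \<in> set v" using Cons a by auto
    then obtain p r where pr: "v = p @ (i, \<not> s) # r" by (auto dest: split_list)
    have p: "fst ` set p \<subseteq> {1..k}" and r: "fst ` set r \<subseteq> {1..k}" using v pr by auto
    have "w \<sim> [] @ (p @ [a]) @ (i, \<not> s) # r"
      using equiv_append[OF equiv_letter_word_comm[of a p], of "[]" "(i, \<not> s) # r"] i p r a
      unfolding Cons pr by simp
    also have "\<dots> \<sim> p @ r"
      using equiv_sym[OF equiv_insert[OF i p r, of s]] a by simp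
    also have "p @ r \<sim> []"
    proof (rule less.hyps)
      show "length (p @ r) < length w" using Cons pr by simp
      show "fst ` set (p @ r) \<subseteq> {1..k}" using p r by auto
      have "ldeg (i, \<not> s) = inv (ldeg a)" using i a by (simp add: ldeg_def)
      hence "deg w = ldeg a \<otimes> (deg p \<otimes> (inv (ldeg a) \<otimes> deg r))"
        unfolding Cons pr using p r i by (simp add: deg_append)
      also have "\<dots> = deg p \<otimes> deg r"
      proof -
        have c: "ldeg a \<in> carrier X" "deg p \<in> carrier X" "deg r \<in> carrier X" using i a p r by auto
        have "ldeg a \<otimes> (deg p \<otimes> (inv (ldeg a) \<otimes> deg r)) = (ldeg a \<otimes> inv (ldeg a)) \<otimes> (deg p \<otimes> deg r)"
          using c by (simp add: m_ac)
        thus ?thesis using c by (simp add: r_inv)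
      qed
      finally show "deg (p @ r) = \<one>" using less.prems(2) p r by (simp add: deg_append)
    qed
    finally show ?thesis .
  qed
qed

text \<open>With a word \<open>z\<close> of the inverse degree, \<open>v @ z @ w\<close> reduces to
  \<open>v\<close> on one side and to \<open>w\<close> on the other.\<close>

lemma equiv_if_deg_eq:
  assumes v: "fst ` set v \<subseteq> {1..k}" and w: "fst ` set w \<subseteq> {1..k}" and eq: "deg v = deg w"
  shows "v \<sim> w"
proof -
  obtain z where z: "fst ` set z \<subseteq> {1..k}" "deg z = inv (deg w)" using ex_word[of "inv (deg w)"] w by auto
  have "v @ [] @ [] \<sim> v @ (z @ w) @ []"
    using v w z by (intro equiv_append equiv_sym[OF equiv_Nil]) (auto simp: deg_append l_inv)
  also have "v @ (z @ w) @ [] = [] @ (v @ z) @ w" by simp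
  also have "[] @ (v @ z) @ w \<sim> [] @ [] @ w"
    using v w z eq by (intro equiv_append equiv_Nil) (auto simp: deg_append r_inv)
  finally show ?thesis by simp
qed

text \<open>The contribution of a word \<open>v\<close> to degree \<open>deg v\<close> must cancel,
  so another word \<open>w\<close> of the same degree occurs in \<open>f\<close>. Subtracting a
  multiple of the relation between them removes \<open>v\<close> and creates no new word.\<close>

lemma kernel_subset_E_ideal:
  assumes "f \<in> carrier F" "ev f = 0" shows "f \<in> E_ideal k q"
  using assms
proof (induction "card {w. f w \<noteq> 0}" arbitrary: f rule: less_induct)
  case less
  interpret I: ideal "E_ideal k q" F by (rule ideal_E)
  have fin: "finite {w. f w \<noteq> 0}" using less.prems(1) by (rule Fr.finite_support)
  show ?case
  proof (cases "\<exists>v. f v \<noteq> 0")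
    case False
    hence "f = 0" by (intro ext) simp
    thus ?thesis using zero_ideal by (simp only:)
  next
    case True
    then obtain v where v: "f v \<noteq> 0" by blast
    have vk: "fst ` set v \<subseteq> {1..k}" using Fr.support_closed[OF less.prems(1) v] by simp
    have "\<exists>w. f w \<noteq> 0 \<and> w \<noteq> v \<and> deg w = deg v"
    proof (rule ccontr)
      assume "\<not> (\<exists>w. f w \<noteq> 0 \<and> w \<noteq> v \<and> deg w = deg v)"
      hence "ev f (deg v) = lsum f (\<lambda>w. \<rho> v * (if w = v then 1 else 0))"
        unfolding ev_def by (intro lsum_cong) auto
      also have "\<dots> = \<rho> v * f v" using fin by (simp add: lsum_mult_right lsum_point)
      finally show False using less.prems(2) v vk by simp
    qed
    then obtain w where w: "f w \<noteq> 0" "w \<noteq> v" "deg w = deg v" by blast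
    have wk: "fst ` set w \<subseteq> {1..k}" using Fr.support_closed[OF less.prems(1) w(1)] by simp
    obtain c where c: "Fr.u v + fun_smult (- c) (Fr.u w) \<in> E_ideal k q"
      using equiv_if_deg_eq[OF vk wk] w(3) by (auto simp: equiv_words_def)
    \<comment> \<open>The scalar \<open>c\<close> stays unidentified: membership in the ideal
      already puts the relation into the kernel, so subtracting it preserves the vanishing of
      \<open>ev\<close>.\<close>
    let ?d = "fun_smult (f v) (Fr.u v + fun_smult (- c) (Fr.u w))"
    have d: "?d \<in> E_ideal k q" by (rule smult_ideal[OF c])
    hence dk: "?d \<in> carrier F" "ev ?d = 0" using E_ideal_subset_kernel by blast+
    define g where "g = f + fun_smult (- 1) ?d"
    have gF: "g \<in> carrier F" unfolding g_def by (intro Fr.add_closed Fr.smult_closed_A dk less.prems)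
    have "ev g = 0"
      unfolding g_def using less.prems dk by (simp add: ev_add ev_smult Fr.smult_closed_A)
        (simp add: fun_smult_def fun_eq_iff)
    have "{z. g z \<noteq> 0} \<subseteq> {z. f z \<noteq> 0} - {v}"
      using w by (auto simp: g_def fun_smult_def indicator_def)
    hence "card {z. g z \<noteq> 0} \<le> card ({z. f z \<noteq> 0} - {v})" using fin by (intro card_mono) auto
    also have "\<dots> < card {z. f z \<noteq> 0}" using fin v by (intro card_Diff1_less) auto
    finally have "g \<in> E_ideal k q" using less.hyps gF \<open>ev g = 0\<close> by blast
    hence "g + ?d \<in> E_ideal k q" using d by (rule add_ideal)
    also have "g + ?d = f" by (rule ext) (simp add: g_def fun_smult_def)
    finally show ?thesis .
  qed
qed

lemma E_ideal_eq_kernel: "E_ideal k q = a_kernel F A ev"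
  unfolding kernel_alt using E_ideal_subset_kernel kernel_subset_E_ideal by blast

section \<open>Passage to the quotient\<close>

definition E_iso :: "(word \<Rightarrow> complex) set \<Rightarrow> 'a \<Rightarrow> complex" where
  "E_iso Y = the_elem (ev ` Y)"

lemma coset_eq_fiber: "f \<in> carrier F \<Longrightarrow> E_ideal k q +>\<^bsub>F\<^esub> f = {g \<in> carrier F. ev g = ev f}"
  unfolding E_ideal_eq_kernel by (rule ring_hom_ring.rcos_eq_homeq[OF ev_hom])

lemma E_iso_coset: "f \<in> carrier F \<Longrightarrow> E_iso (E_ideal k q +>\<^bsub>F\<^esub> f) = ev f"
proof -
  assume f: "f \<in> carrier F"
  have "ev ` {g \<in> carrier F. ev g = ev f} = {ev f}" using f by auto
  thus ?thesis by (simp add: E_iso_def coset_eq_fiber[OF f])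
qed

lemma E_alg_simps:
  "carrier (E_alg k q) = a_rcosets\<^bsub>F\<^esub> (E_ideal k q)"
  "monoid.mult (E_alg k q) = monoid.mult (F Quot (E_ideal k q))"
  "ring.add (E_alg k q) = ring.add (F Quot (E_ideal k q))"
  "monoid.one (E_alg k q) = E_ideal k q +>\<^bsub>F\<^esub> \<one>\<^bsub>F\<^esub>" "ring.zero (E_alg k q) = E_ideal k q"
  "module.smult (E_alg k q) c Y = (\<Union>a\<in>Y. E_ideal k q +>\<^bsub>F\<^esub> fun_smult c a)"
  by (simp_all add: E_alg_def quot_algebra_def FactRing_def free_algebra_eq)

lemma E_alg_carrier: "Y \<in> carrier (E_alg k q) \<longleftrightarrow> (\<exists>f\<in>carrier F. Y = E_ideal k q +>\<^bsub>F\<^esub> f)"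
  by (auto simp: E_alg_simps(1) A_RCOSETS_def')

text \<open>Scalar multiplication and \<open>E_scale\<close> on the quotient are unions over all
  representatives; the union is a single coset as soon as \<open>t\<close> respects the fibres of
  \<open>ev\<close>.\<close>

lemma Union_coset:
  assumes f: "f \<in> carrier F"
    and g: "\<And>g. g \<in> carrier F \<Longrightarrow> ev g = ev f \<Longrightarrow> t g \<in> carrier F \<and> ev (t g) = ev (t f)"
  shows "(\<Union>a\<in>E_ideal k q +>\<^bsub>F\<^esub> f. E_ideal k q +>\<^bsub>F\<^esub> t a) = E_ideal k q +>\<^bsub>F\<^esub> t f"
proof -
  have "E_ideal k q +>\<^bsub>F\<^esub> t a = E_ideal k q +>\<^bsub>F\<^esub> t f" if "a \<in> E_ideal k q +>\<^bsub>F\<^esub> f" for a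
    using that g[of a] g[OF f refl] by (simp add: coset_eq_fiber f)
  moreover have "f \<in> E_ideal k q +>\<^bsub>F\<^esub> f" using f by (simp add: coset_eq_fiber)
  ultimately show ?thesis by blast
qed

lemma smult_coset:
  "f \<in> carrier F \<Longrightarrow> c \<odot>\<^bsub>E_alg k q\<^esub> (E_ideal k q +>\<^bsub>F\<^esub> f) = E_ideal k q +>\<^bsub>F\<^esub> fun_smult c f"
  unfolding E_alg_simps(6) by (rule Union_coset) (auto simp: ev_smult Fr.smult_closed_A)

theorem calg_iso_E: "calg_iso E_iso (E_alg k q) A"
proof -
  have "(\<lambda>Y. the_elem (ev ` Y)) \<in> ring_iso (F Quot (a_kernel F A ev)) A"
    by (rule ring_hom_ring.FactRing_iso_set[OF ev_hom ev_surj])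
  hence iso: "E_iso \<in> ring_iso (F Quot (E_ideal k q)) A"
    by (simp add: E_iso_def[abs_def] E_ideal_eq_kernel)
  show ?thesis unfolding calg_iso_def
  proof (intro conjI allI ballI)
    show "E_iso \<in> ring_hom (E_alg k q) A"
      using iso unfolding ring_iso_def ring_hom_def by (auto simp: E_alg_simps FactRing_def)
    show "bij_betw E_iso (carrier (E_alg k q)) (carrier A)"
      using iso unfolding ring_iso_def by (auto simp: E_alg_simps FactRing_def)
    have z: "0 \<in> carrier F" using ring.ring_simprules(2)[OF Fr.ring_A] by simp
    have "E_ideal k q +>\<^bsub>F\<^esub> 0 = E_ideal k q"
      unfolding coset_eq_fiber[OF z] unfolding E_ideal_eq_kernel kernel_alt using ev_zero by simp
    thus "E_iso \<zero>\<^bsub>E_alg k q\<^esub> = \<zero>\<^bsub>A\<^esub>" using E_iso_coset[OF z] ev_zero by (simp add: E_alg_simps)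
    fix c Y assume "Y \<in> carrier (E_alg k q)"
    then obtain f where "f \<in> carrier F" "Y = E_ideal k q +>\<^bsub>F\<^esub> f" by (auto simp: E_alg_carrier)
    thus "E_iso (c \<odot>\<^bsub>E_alg k q\<^esub> Y) = c \<odot>\<^bsub>A\<^esub> E_iso Y"
      by (simp add: smult_coset E_iso_coset Fr.smult_closed_A ev_smult)
  qed
qed

text \<open>\<open>E_alg\<close> copies the factor ring into a record with scalar multiplication, so
  the ring axioms are transported along the identity.\<close>

lemma ring_E: "ring (E_alg k q)"
proof -
  interpret I: ideal "E_ideal k q" F by (rule ideal_E)
  have R: "ring (F Quot (E_ideal k q))" by (rule I.quotient_is_ring)
  have "id \<in> ring_iso (F Quot (E_ideal k q)) (E_alg k q)"
    unfolding ring_iso_def ring_hom_def by (simp add: E_alg_simps FactRing_def)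
  from ring.ring_iso_imp_img_ring[OF R this]
  have "ring (E_alg k q\<lparr>zero := E_ideal k q\<rparr>)" by (simp add: FactRing_def)
  moreover have "E_alg k q\<lparr>zero := E_ideal k q\<rparr> = E_alg k q"
    using E_alg_simps(5) by (metis ring.surjective ring.update_convs(1))
  ultimately show ?thesis by simp
qed

lemma smult_closed_E: "smult_closed (E_alg k q)"
  unfolding smult_closed_def
proof (intro allI ballI)
  fix c Y assume "Y \<in> carrier (E_alg k q)"
  then obtain f where f: "f \<in> carrier F" "Y = E_ideal k q +>\<^bsub>F\<^esub> f" by (auto simp: E_alg_carrier)
  show "c \<odot>\<^bsub>E_alg k q\<^esub> Y \<in> carrier (E_alg k q)"
    unfolding f(2) smult_coset[OF f(1)] E_alg_carrier using Fr.smult_closed_A[OF f(1)] by blast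
qed

text \<open>The scalars attached to a word multiply up to \<open>\<theta>\<close> of its degree,
  because \<open>\<theta>\<close> is a character. Seen through \<open>E_iso\<close>, the
  substitution is therefore diagonal in the degrees.\<close>

lemma E_scale_iso:
  assumes Y: "Y \<in> carrier (E_alg k q)"
    and \<theta>: "\<And>a b. a \<in> carrier X \<Longrightarrow> b \<in> carrier X \<Longrightarrow> \<theta> (a \<otimes> b) = \<theta> a * \<theta> b"
      "\<And>a. a \<in> carrier X \<Longrightarrow> \<theta> a \<noteq> 0"
    and c: "\<And>i. i \<in> {1..k} \<Longrightarrow> c i = \<theta> (x i)"
  shows "E_scale k q c Y \<in> carrier (E_alg k q)"
    and "E_iso (E_scale k q c Y) = (\<lambda>z. \<theta> z * E_iso Y z)"
proof -
  have \<theta>1: "\<theta> \<one> = 1" using \<theta>(1)[of \<one> \<one>] \<theta>(2)[of \<one>] by simp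
  have \<theta>inv: "\<theta> (inv a) = inverse (\<theta> a)" if "a \<in> carrier X" for a
    using \<theta>(1)[of a "inv a"] that \<theta>1 \<theta>(2)[OF that] by (simp add: r_inv field_simps)
  have prod: "(\<Prod>(i, s)\<leftarrow>w. if s then c i else inverse (c i)) = \<theta> (deg w)"
    if "fst ` set w \<subseteq> {1..k}" for w
    using that
  proof (induction w)
    case (Cons a w)
    thus ?case by (cases a) (auto simp: \<theta> \<theta>inv ldeg_def c)
  qed (simp add: \<theta>1)
  define t where "t f w = (\<Prod>(i, s)\<leftarrow>w. if s then c i else inverse (c i)) * f w"
    for f :: "word \<Rightarrow> complex" and w
  have tF: "t f \<in> carrier F" if "f \<in> carrier F" for f
    using that unfolding Fr.mem_carrier t_def by (auto intro: finite_subset)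
  have evt: "ev (t f) = (\<lambda>z. \<theta> z * ev f z)" if f: "f \<in> carrier F" for f
  proof
    fix z
    have w: "fst ` set w \<subseteq> {1..k}" if "f w \<noteq> 0" for w using Fr.support_closed[OF f that] by simp
    have "t f = (\<lambda>w. \<theta> (deg w) * f w)"
      unfolding t_def using prod w by (auto simp: fun_eq_iff)
    hence "ev (t f) z = lsum f (\<lambda>w. \<theta> (deg w) * (\<rho> w * (if deg w = z then 1 else 0)))"
      unfolding ev_def using w \<theta>(2) by (subst lsum_weight[symmetric]) auto
    also have "\<dots> = \<theta> z * ev f z"
      unfolding ev_def lsum_mult_right(1)[symmetric] by (intro lsum_cong) auto
    finally show "ev (t f) z = \<theta> z * ev f z" .
  qed
  obtain f where f: "f \<in> carrier F" "Y = E_ideal k q +>\<^bsub>F\<^esub> f" using Y by (auto simp: E_alg_carrier)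
  have "E_scale k q c Y = (\<Union>a\<in>Y. E_ideal k q +>\<^bsub>F\<^esub> t a)"
    unfolding E_scale_def t_def[abs_def] free_algebra_eq ..
  also have "\<dots> = E_ideal k q +>\<^bsub>F\<^esub> t f"
    unfolding f(2) by (rule Union_coset[OF f(1)]) (simp add: tF evt f(1))
  finally have eq: "E_scale k q c Y = E_ideal k q +>\<^bsub>F\<^esub> t f" .
  show "E_scale k q c Y \<in> carrier (E_alg k q)"
    unfolding eq E_alg_carrier using tF[OF f(1)] by blast
  show "E_iso (E_scale k q c Y) = (\<lambda>z. \<theta> z * E_iso Y z)"
    by (subst eq) (simp add: f E_iso_coset tF evt)
qed

end

section \<open>Twisted group algebras as crossed products\<close>

lemma sum_lsum_swap: "(\<Sum>z\<in>S. lsum f (k z)) = lsum f (\<lambda>a. \<Sum>z\<in>S. k z a)"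
proof -
  have "(\<Sum>z\<in>S. lsum f (k z)) = (\<Sum>z\<in>S. \<Sum>a | f a \<noteq> 0. f a * k z a)" by (simp add: lsum_def)
  also have "\<dots> = (\<Sum>a | f a \<noteq> 0. \<Sum>z\<in>S. f a * k z a)" by (rule sum.swap)
  finally show ?thesis by (simp add: lsum_def sum_distrib_left)
qed

text \<open>The group is the internal product of the images of \<open>Y\<close> and
  \<open>Z\<close>. The data \<open>c\<close> and \<open>\<tau>\<close> are parameters so that the
  expressions of the theorem can be inserted literally.\<close>

locale crossed_split = twisted_group X \<sigma> +
  E: free_twisted Y l y "\<lambda>a b. \<sigma> (\<iota> a) (\<iota> b)" q + Z: comm_group Z
  for X :: "('a, 'm) monoid_scheme" (structure) and \<sigma> and Y :: "('b, 'n) monoid_scheme" (structure)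
    and l y and \<iota> :: "'b \<Rightarrow> 'a" and q and Z :: "('c, 'o) monoid_scheme" (structure) +
  fixes \<kappa> :: "'c \<Rightarrow> 'a" and c :: "'c \<Rightarrow> nat \<Rightarrow> complex" and \<tau> :: "'c \<Rightarrow> 'c \<Rightarrow> complex"
  assumes \<iota>_closed [simp]: "\<And>a. a \<in> carrier Y \<Longrightarrow> \<iota> a \<in> carrier X"
    and \<iota>_mult [simp]: "\<And>a b. a \<in> carrier Y \<Longrightarrow> b \<in> carrier Y \<Longrightarrow> \<iota> (a \<otimes>\<^bsub>Y\<^esub> b) = \<iota> a \<otimes> \<iota> b"
    and \<kappa>_closed [simp]: "\<And>z. z \<in> carrier Z \<Longrightarrow> \<kappa> z \<in> carrier X"
    and \<kappa>_mult [simp]: "\<And>z w. z \<in> carrier Z \<Longrightarrow> w \<in> carrier Z \<Longrightarrow> \<kappa> (z \<otimes>\<^bsub>Z\<^esub> w) = \<kappa> z \<otimes> \<kappa> w"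
    and split: "bij_betw (\<lambda>(a, z). \<iota> a \<otimes> \<kappa> z) (carrier Y \<times> carrier Z) (carrier X)"
    and c: "\<And>z i. z \<in> carrier Z \<Longrightarrow> i \<in> {1..l} \<Longrightarrow> c z i = antisym (\<kappa> z) (\<iota> (y i))"
    and \<tau>: "\<And>z w. z \<in> carrier Z \<Longrightarrow> w \<in> carrier Z \<Longrightarrow> \<tau> z w = \<sigma> (\<kappa> z) (\<kappa> w)"
begin

abbreviation EA where "EA \<equiv> E_alg l q"

abbreviation act where "act z \<equiv> E_scale l q (c z)"

abbreviation CP where "CP \<equiv> crossed_product EA Z act \<tau>"

lemma E_carrier: "a \<in> carrier EA \<Longrightarrow> E.E_iso a \<in> carrier E.A"
  by (rule calg_isoD(2)[OF E.calg_iso_E])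

lemma \<iota>_one [simp]: "\<iota> \<one>\<^bsub>Y\<^esub> = \<one>"
proof -
  have "\<iota> \<one>\<^bsub>Y\<^esub> \<otimes> \<iota> \<one>\<^bsub>Y\<^esub> = \<iota> \<one>\<^bsub>Y\<^esub>" using \<iota>_mult[OF E.one_closed E.one_closed] by simp
  thus ?thesis using \<iota>_closed[OF E.one_closed] by (metis l_cancel_one')
qed

lemma \<kappa>_one [simp]: "\<kappa> \<one>\<^bsub>Z\<^esub> = \<one>"
proof -
  have "\<kappa> \<one>\<^bsub>Z\<^esub> \<otimes> \<kappa> \<one>\<^bsub>Z\<^esub> = \<kappa> \<one>\<^bsub>Z\<^esub>" using \<kappa>_mult[OF Z.one_closed Z.one_closed] by simp
  thus ?thesis using \<kappa>_closed[OF Z.one_closed] by (metis l_cancel_one')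
qed

lemma split_eq_iff:
  assumes "a \<in> carrier Y" "z \<in> carrier Z" "b \<in> carrier Y" "w \<in> carrier Z"
  shows "\<iota> a \<otimes> \<kappa> z = \<iota> b \<otimes> \<kappa> w \<longleftrightarrow> a = b \<and> z = w"
proof
  assume "\<iota> a \<otimes> \<kappa> z = \<iota> b \<otimes> \<kappa> w"
  thus "a = b \<and> z = w"
    using inj_onD[OF bij_betw_imp_inj_on[OF split], of "(a, z)" "(b, w)"] assms by simp
qed simp

lemma split_ex:
  assumes "w \<in> carrier X"
  obtains a z where "a \<in> carrier Y" "z \<in> carrier Z" "w = \<iota> a \<otimes> \<kappa> z"
proof -
  have "w \<in> (\<lambda>(a, z). \<iota> a \<otimes> \<kappa> z) ` (carrier Y \<times> carrier Z)"
    using split assms by (simp add: bij_betw_def)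
  thus ?thesis using that by auto
qed

definition dec :: "'a \<Rightarrow> 'b \<times> 'c" where
  "dec = inv_into (carrier Y \<times> carrier Z) (\<lambda>(a, z). \<iota> a \<otimes> \<kappa> z)"

lemma dec [simp]: "a \<in> carrier Y \<Longrightarrow> z \<in> carrier Z \<Longrightarrow> dec (\<iota> a \<otimes> \<kappa> z) = (a, z)"
  unfolding dec_def using inv_into_f_f[OF bij_betw_imp_inj_on[OF split], of "(a, z)"] by simp

text \<open>\<open>f # z\<close> is mapped to \<open>f \<cdot> u (\<kappa> z)\<close>, where \<open>u (\<iota> a) \<cdot> u (\<kappa> z) = \<sigma> (\<iota> a) (\<kappa> z) u (\<iota> a \<otimes> \<kappa> z)\<close>.\<close>

definition H :: "('c \<Rightarrow> (word \<Rightarrow> complex) set) \<Rightarrow> 'a \<Rightarrow> complex" where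
  "H G w = (if w \<in> carrier X then
     \<sigma> (\<iota> (fst (dec w))) (\<kappa> (snd (dec w))) * E.E_iso (G (snd (dec w))) (fst (dec w)) else 0)"

lemma H_split:
  "a \<in> carrier Y \<Longrightarrow> z \<in> carrier Z \<Longrightarrow> H G (\<iota> a \<otimes> \<kappa> z) = \<sigma> (\<iota> a) (\<kappa> z) * E.E_iso (G z) a"
  by (simp add: H_def)

abbreviation S where "S G \<equiv> {z. G z \<noteq> \<zero>\<^bsub>EA\<^esub>}"

lemma CP_carrier:
  "G \<in> carrier CP \<longleftrightarrow> (\<forall>z. G z \<in> carrier EA) \<and> finite (S G) \<and> S G \<subseteq> carrier Z"
  by (simp add: crossed_product_def)

lemma CP_closed: "G \<in> carrier CP \<Longrightarrow> G z \<in> carrier EA"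
  by (simp add: CP_carrier)

lemma CP_support: "G \<in> carrier CP \<Longrightarrow> G z \<noteq> \<zero>\<^bsub>EA\<^esub> \<Longrightarrow> z \<in> carrier Z"
  by (auto simp: CP_carrier)

lemma E_iso_zero: "E.E_iso \<zero>\<^bsub>EA\<^esub> = 0"
  using calg_isoD(6)[OF E.calg_iso_E] by (simp only: E.A_simps)

text \<open>Only the summand at the \<open>Z\<close>-component of \<open>w\<close> contributes. In
  this form \<open>dec\<close> has disappeared and the sum can be interchanged with others.\<close>

lemma H_eq_sum:
  assumes G: "G \<in> carrier CP" and w: "w \<in> carrier X"
  shows "H G w = (\<Sum>z\<in>S G. lsum (E.E_iso (G z)) (\<lambda>a. \<sigma> (\<iota> a) (\<kappa> z) * (if \<iota> a \<otimes> \<kappa> z = w then 1 else 0)))"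
proof -
  obtain a z where az: "a \<in> carrier Y" "z \<in> carrier Z" "w = \<iota> a \<otimes> \<kappa> z" using split_ex[OF w] .
  have fin: "finite (S G)" using G by (simp add: CP_carrier)
  have "lsum (E.E_iso (G v)) (\<lambda>b. \<sigma> (\<iota> b) (\<kappa> v) * (if \<iota> b \<otimes> \<kappa> v = w then 1 else 0)) =
      (if v = z then \<sigma> (\<iota> a) (\<kappa> z) * E.E_iso (G z) a else 0)" if v: "v \<in> S G" for v
  proof -
    have GA: "E.E_iso (G v) \<in> carrier E.A" by (rule E_carrier[OF CP_closed[OF G]])
    have vZ: "v \<in> carrier Z" using v CP_support[OF G] by blast
    have "lsum (E.E_iso (G v)) (\<lambda>b. \<sigma> (\<iota> b) (\<kappa> v) * (if \<iota> b \<otimes> \<kappa> v = w then 1 else 0)) =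
      lsum (E.E_iso (G v)) (\<lambda>b. (if v = z then \<sigma> (\<iota> a) (\<kappa> z) else 0) * (if b = a then 1 else 0))"
      by (intro lsum_cong) (use split_eq_iff[OF _ vZ az(1,2)] az(3) E.support_closed[OF GA] in auto)
    thus ?thesis using E.finite_support[OF GA] by (simp add: lsum_mult_right(1) lsum_point)
  qed
  hence "(\<Sum>v\<in>S G. lsum (E.E_iso (G v)) (\<lambda>b. \<sigma> (\<iota> b) (\<kappa> v) * (if \<iota> b \<otimes> \<kappa> v = w then 1 else 0))) =
      (\<Sum>v\<in>S G. if v = z then \<sigma> (\<iota> a) (\<kappa> z) * E.E_iso (G z) a else 0)"
    by (intro sum.cong refl) blast
  also have "\<dots> = \<sigma> (\<iota> a) (\<kappa> z) * E.E_iso (G z) a"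
    using fin E_iso_zero by (simp only: sum.delta) (cases "z \<in> S G", simp_all)
  finally show ?thesis using az by (simp add: H_split)
qed

lemma H_support:
  assumes G: "G \<in> carrier CP"
  shows "{w. H G w \<noteq> 0} \<subseteq> (\<Union>z\<in>S G. (\<lambda>a. \<iota> a \<otimes> \<kappa> z) ` {a. E.E_iso (G z) a \<noteq> 0})"
proof
  fix w assume w: "w \<in> {w. H G w \<noteq> 0}"
  hence wX: "w \<in> carrier X" by (auto simp: H_def split: if_splits)
  obtain a z where az: "a \<in> carrier Y" "z \<in> carrier Z" "w = \<iota> a \<otimes> \<kappa> z" using split_ex[OF wX] .
  hence a: "E.E_iso (G z) a \<noteq> 0" using w by (auto simp: H_split)
  hence "G z \<noteq> \<zero>\<^bsub>EA\<^esub>" using E_iso_zero by (metis zero_fun_apply)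
  thus "w \<in> (\<Union>z\<in>S G. (\<lambda>a. \<iota> a \<otimes> \<kappa> z) ` {a. E.E_iso (G z) a \<noteq> 0})" using az(3) a by blast
qed

lemma H_closed:
  assumes G: "G \<in> carrier CP" shows "H G \<in> carrier A"
  unfolding mem_carrier
proof
  have "finite {a. E.E_iso (G z) a \<noteq> 0}" for z by (rule E.finite_support[OF E_carrier[OF CP_closed[OF G]]])
  hence "finite (\<Union>z\<in>S G. (\<lambda>a. \<iota> a \<otimes> \<kappa> z) ` {a. E.E_iso (G z) a \<noteq> 0})"
    using G by (auto simp: CP_carrier)
  thus "finite {w. H G w \<noteq> 0}" using H_support[OF G] by (rule rev_finite_subset)
  show "{w. H G w \<noteq> 0} \<subseteq> carrier X" by (auto simp: H_def split: if_splits)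
qed

text \<open>The pairing formula for \<open>H\<close>: as \<open>(a, z)\<close> determines its
  product in the group, each delta function in \<open>H_eq_sum\<close> is hit once.\<close>

lemma lsum_H:
  assumes G: "G \<in> carrier CP"
  shows "lsum (H G) k = (\<Sum>z\<in>S G. lsum (E.E_iso (G z)) (\<lambda>a. \<sigma> (\<iota> a) (\<kappa> z) * k (\<iota> a \<otimes> \<kappa> z)))"
proof -
  have "lsum (H G) k = (\<Sum>w | H G w \<noteq> 0. (\<Sum>z\<in>S G. lsum (E.E_iso (G z))
      (\<lambda>a. \<sigma> (\<iota> a) (\<kappa> z) * (if \<iota> a \<otimes> \<kappa> z = w then 1 else 0))) * k w)"
    unfolding lsum_def[of "H G"]
    by (intro sum.cong refl arg_cong2[of _ _ _ _ "(*)"] H_eq_sum[OF G]) (auto simp: H_def split: if_splits)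
  also have "\<dots> = (\<Sum>z\<in>S G. \<Sum>w | H G w \<noteq> 0. lsum (E.E_iso (G z))
      (\<lambda>a. \<sigma> (\<iota> a) (\<kappa> z) * (if \<iota> a \<otimes> \<kappa> z = w then k w else 0)))"
  proof -
    have "lsum f (\<lambda>a. t a * (if e a = w then 1 else 0)) * k w = lsum f (\<lambda>a. t a * (if e a = w then k w else 0))"
      for f :: "'b \<Rightarrow> complex" and t and e :: "'b \<Rightarrow> 'a" and w
      unfolding lsum_mult_right(2)[symmetric] by (intro lsum_cong) simp
    thus ?thesis unfolding sum_distrib_right by (subst sum.swap) (simp only:)
  qed
  also have "\<dots> = (\<Sum>z\<in>S G. lsum (E.E_iso (G z)) (\<lambda>a. \<sigma> (\<iota> a) (\<kappa> z) * k (\<iota> a \<otimes> \<kappa> z)))"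
    unfolding sum_lsum_swap
  proof (intro sum.cong refl lsum_cong)
    fix z a assume z: "z \<in> S G" and a: "E.E_iso (G z) a \<noteq> 0"
    have az: "z \<in> carrier Z" "a \<in> carrier Y"
      using z CP_support[OF G] E.support_closed[OF E_carrier[OF CP_closed[OF G]] a] by auto
    hence "H G (\<iota> a \<otimes> \<kappa> z) \<noteq> 0" using a by (simp add: H_split)
    thus "(\<Sum>w | H G w \<noteq> 0. \<sigma> (\<iota> a) (\<kappa> z) * (if \<iota> a \<otimes> \<kappa> z = w then k w else 0)) =
        \<sigma> (\<iota> a) (\<kappa> z) * k (\<iota> a \<otimes> \<kappa> z)"
      using finite_support[OF H_closed[OF G]] by (simp add: sum_distrib_left[symmetric])
  qed
  finally show ?thesis .
qed

lemma act_closed: "z \<in> carrier Z \<Longrightarrow> Q \<in> carrier EA \<Longrightarrow> act z Q \<in> carrier EA"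
  and E_iso_act: "z \<in> carrier Z \<Longrightarrow> Q \<in> carrier EA \<Longrightarrow>
    E.E_iso (act z Q) = (\<lambda>b. antisym (\<kappa> z) (\<iota> b) * E.E_iso Q b)"
  using E.E_scale_iso[where \<theta> = "\<lambda>b. antisym (\<kappa> z) (\<iota> b)" and c = "c z"]
  by (simp_all add: c antisym_mult_right)

lemma lsum_E_finsum:
  assumes "finite P" "g \<in> P \<rightarrow> carrier EA"
  shows "lsum (E.E_iso (\<Oplus>\<^bsub>EA\<^esub>p\<in>P. g p)) k = (\<Sum>p\<in>P. lsum (E.E_iso (g p)) k)"
proof -
  interpret R: ring EA by (rule E.ring_E)
  show ?thesis using assms
  proof (induction P)
    case empty
    show ?case by (simp add: E_iso_zero)
  next
    case (insert p P)
    have cl: "g p \<in> carrier EA" "(\<Oplus>\<^bsub>EA\<^esub>p\<in>P. g p) \<in> carrier EA"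
      using insert by (auto intro!: R.finsum_closed)
    have "(\<Oplus>\<^bsub>EA\<^esub>p\<in>insert p P. g p) = g p \<oplus>\<^bsub>EA\<^esub> (\<Oplus>\<^bsub>EA\<^esub>p\<in>P. g p)"
      using insert by (intro R.finsum_insert) auto
    hence "E.E_iso (\<Oplus>\<^bsub>EA\<^esub>p\<in>insert p P. g p) = E.E_iso (g p) + E.E_iso (\<Oplus>\<^bsub>EA\<^esub>p\<in>P. g p)"
      using calg_isoD(4)[OF E.calg_iso_E cl] by (simp only: E.A_simps)
    hence "lsum (E.E_iso (\<Oplus>\<^bsub>EA\<^esub>p\<in>insert p P. g p)) k =
        lsum (E.E_iso (g p)) k + lsum (E.E_iso (\<Oplus>\<^bsub>EA\<^esub>p\<in>P. g p)) k"
      by (simp only: lsum_add E.finite_support E_carrier cl)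
    thus ?case using insert by simp
  qed
qed

text \<open>Both sides are the coefficient of the product of the basis elements at \<open>a\<close>,
  \<open>z\<close>, \<open>b\<close>, \<open>w\<close>. On the left the one at \<open>z\<close> has
  been moved past the one at \<open>b\<close>, which costs \<open>antisym z b\<close>, and then
  joined with the one at \<open>w\<close>.\<close>

lemma cocycle_shuffle:
  assumes "a \<in> carrier X" "b \<in> carrier X" "z \<in> carrier X" "w \<in> carrier X"
  shows "\<sigma> z w * (antisym z b * \<sigma> a b * \<sigma> (a \<otimes> b) (z \<otimes> w)) =
    \<sigma> a z * (\<sigma> b w * \<sigma> (a \<otimes> z) (b \<otimes> w))"
proof -
  have cl: "b \<otimes> w \<in> carrier X" "z \<otimes> w \<in> carrier X" using assms by auto
  have 1: "\<sigma> a z * \<sigma> (a \<otimes> z) (b \<otimes> w) = \<sigma> a (z \<otimes> (b \<otimes> w)) * \<sigma> z (b \<otimes> w)"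
    by (rule cocycle_eq[OF assms(1,3) cl(1)])
  have 2: "\<sigma> z b * \<sigma> (z \<otimes> b) w = \<sigma> z (b \<otimes> w) * \<sigma> b w"
    by (rule cocycle_eq[OF assms(3,2,4)])
  have 3: "\<sigma> a b * \<sigma> (a \<otimes> b) (z \<otimes> w) = \<sigma> a (b \<otimes> (z \<otimes> w)) * \<sigma> b (z \<otimes> w)"
    by (rule cocycle_eq[OF assms(1,2) cl(2)])
  have 4: "\<sigma> b z * \<sigma> (b \<otimes> z) w = \<sigma> b (z \<otimes> w) * \<sigma> z w"
    by (rule cocycle_eq[OF assms(2,3,4)])
  have eqs: "b \<otimes> (z \<otimes> w) = z \<otimes> (b \<otimes> w)" "b \<otimes> z = z \<otimes> b" using assms by (simp_all add: m_ac)
  have "\<sigma> z w * (antisym z b * \<sigma> a b * \<sigma> (a \<otimes> b) (z \<otimes> w))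
      = \<sigma> z w * antisym z b * (\<sigma> a b * \<sigma> (a \<otimes> b) (z \<otimes> w))" by (simp only: mult_ac)
  also have "\<dots> = antisym z b * \<sigma> a (b \<otimes> (z \<otimes> w)) * (\<sigma> b (z \<otimes> w) * \<sigma> z w)"
    unfolding 3 by (simp only: mult_ac)
  also have "\<dots> = (antisym z b * \<sigma> b z) * (\<sigma> a (b \<otimes> (z \<otimes> w)) * \<sigma> (b \<otimes> z) w)"
    unfolding 4[symmetric] by (simp only: mult_ac)
  also have "antisym z b * \<sigma> b z = \<sigma> z b" using assms by (simp add: antisym_def)
  also have "\<sigma> z b * (\<sigma> a (b \<otimes> (z \<otimes> w)) * \<sigma> (b \<otimes> z) w) = \<sigma> a (z \<otimes> (b \<otimes> w)) * (\<sigma> z b * \<sigma> (z \<otimes> b) w)"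
    unfolding eqs by (simp only: mult_ac)
  also have "\<dots> = (\<sigma> a (z \<otimes> (b \<otimes> w)) * \<sigma> z (b \<otimes> w)) * \<sigma> b w"
    unfolding 2 by (simp only: mult_ac)
  also have "\<dots> = \<sigma> a z * (\<sigma> b w * \<sigma> (a \<otimes> z) (b \<otimes> w))"
    unfolding 1[symmetric] by (simp only: mult_ac)
  finally show ?thesis .
qed

lemma CP_mult_alt:
  "(G \<otimes>\<^bsub>CP\<^esub> K) z = (\<Oplus>\<^bsub>EA\<^esub>p \<in> {p \<in> S G \<times> S K. fst p \<otimes>\<^bsub>Z\<^esub> snd p = z}.
     \<tau> (fst p) (snd p) \<odot>\<^bsub>EA\<^esub> (G (fst p) \<otimes>\<^bsub>EA\<^esub> act (fst p) (K (snd p))))"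
proof -
  have "{(x, y). G x \<noteq> \<zero>\<^bsub>EA\<^esub> \<and> K y \<noteq> \<zero>\<^bsub>EA\<^esub> \<and> x \<otimes>\<^bsub>Z\<^esub> y = z} = {p \<in> S G \<times> S K. fst p \<otimes>\<^bsub>Z\<^esub> snd p = z}"
    by auto
  thus ?thesis by (simp add: crossed_product_def)
qed

context
  fixes G K :: "'c \<Rightarrow> (word \<Rightarrow> complex) set"
  assumes G: "G \<in> carrier CP" and K: "K \<in> carrier CP"
begin

abbreviation (input) summand where
  "summand p \<equiv> \<tau> (fst p) (snd p) \<odot>\<^bsub>EA\<^esub> (G (fst p) \<otimes>\<^bsub>EA\<^esub> act (fst p) (K (snd p)))"

lemma summand_closed:
  assumes "p \<in> S G \<times> S K" shows "summand p \<in> carrier EA"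
proof -
  interpret R: ring EA by (rule E.ring_E)
  have "fst p \<in> carrier Z" using assms CP_support[OF G, of "fst p"] by (simp add: mem_Times_iff)
  thus ?thesis using E.smult_closed_E CP_closed[OF G] CP_closed[OF K] act_closed
    unfolding smult_closed_def by blast
qed

lemma CP_mult_support:
  "S (G \<otimes>\<^bsub>CP\<^esub> K) \<subseteq> (\<lambda>p. fst p \<otimes>\<^bsub>Z\<^esub> snd p) ` (S G \<times> S K)"
proof
  fix z assume z: "z \<in> S (G \<otimes>\<^bsub>CP\<^esub> K)"
  interpret R: ring EA by (rule E.ring_E)
  have "{p \<in> S G \<times> S K. fst p \<otimes>\<^bsub>Z\<^esub> snd p = z} \<noteq> {}"
  proof
    assume e: "{p \<in> S G \<times> S K. fst p \<otimes>\<^bsub>Z\<^esub> snd p = z} = {}"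
    show False using z unfolding mem_Collect_eq CP_mult_alt e by simp
  qed
  thus "z \<in> (\<lambda>p. fst p \<otimes>\<^bsub>Z\<^esub> snd p) ` (S G \<times> S K)" by blast
qed

lemma CP_mult_closed: "G \<otimes>\<^bsub>CP\<^esub> K \<in> carrier CP"
  unfolding CP_carrier
proof (intro conjI allI)
  interpret R: ring EA by (rule E.ring_E)
  have fin: "finite (S G \<times> S K)" using G K by (simp add: CP_carrier)
  show "(G \<otimes>\<^bsub>CP\<^esub> K) z \<in> carrier EA" for z
    unfolding CP_mult_alt by (rule R.finsum_closed) (use summand_closed in blast)
  show "finite (S (G \<otimes>\<^bsub>CP\<^esub> K))"
    by (rule finite_subset[OF CP_mult_support]) (use fin in simp)
  show "S (G \<otimes>\<^bsub>CP\<^esub> K) \<subseteq> carrier Z"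
  proof (rule order_trans[OF CP_mult_support image_subsetI])
    fix p assume "p \<in> S G \<times> S K"
    thus "fst p \<otimes>\<^bsub>Z\<^esub> snd p \<in> carrier Z"
      using CP_support[OF G, of "fst p"] CP_support[OF K, of "snd p"] by (simp add: mem_Times_iff)
  qed
qed

lemma H_mult: "H (G \<otimes>\<^bsub>CP\<^esub> K) = H G \<otimes>\<^bsub>A\<^esub> H K"
proof (rule lsum_eqI)
  fix k
  interpret R: ring EA by (rule E.ring_E)
  let ?P = "S G \<times> S K"
  let ?m = "\<lambda>p. fst p \<otimes>\<^bsub>Z\<^esub> snd p"
  have fin: "finite ?P" using G K by (simp add: CP_carrier)
  let ?h = "\<lambda>z a. \<sigma> (\<iota> a) (\<kappa> z) * k (\<iota> a \<otimes> \<kappa> z)"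
  have "lsum (H (G \<otimes>\<^bsub>CP\<^esub> K)) k = (\<Sum>z\<in>?m ` ?P. lsum (E.E_iso ((G \<otimes>\<^bsub>CP\<^esub> K) z)) (?h z))"
    unfolding lsum_H[OF CP_mult_closed]
  proof (rule sum.mono_neutral_left[OF _ CP_mult_support])
    show "finite (?m ` ?P)" using fin by simp
    show "\<forall>z\<in>?m ` ?P - S (G \<otimes>\<^bsub>CP\<^esub> K). lsum (E.E_iso ((G \<otimes>\<^bsub>CP\<^esub> K) z)) (?h z) = 0"
      by (auto simp: E_iso_zero)
  qed
  also have "\<dots> = (\<Sum>z\<in>?m ` ?P. \<Sum>p\<in>{p \<in> ?P. ?m p = z}. lsum (E.E_iso (summand p)) (?h (?m p)))"
  proof (rule sum.cong[OF refl])
    fix z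
    have "lsum (E.E_iso ((G \<otimes>\<^bsub>CP\<^esub> K) z)) (?h z) = (\<Sum>p\<in>{p \<in> ?P. ?m p = z}. lsum (E.E_iso (summand p)) (?h z))"
      unfolding CP_mult_alt using fin summand_closed by (intro lsum_E_finsum) auto
    thus "lsum (E.E_iso ((G \<otimes>\<^bsub>CP\<^esub> K) z)) (?h z) =
        (\<Sum>p\<in>{p \<in> ?P. ?m p = z}. lsum (E.E_iso (summand p)) (?h (?m p)))" by simp
  qed
  also have "\<dots> = (\<Sum>p\<in>?P. lsum (E.E_iso (summand p)) (?h (?m p)))"
    by (rule sum.group[OF fin]) (use fin in auto)
  also have "\<dots> = (\<Sum>p\<in>?P. lsum (E.E_iso (G (fst p))) (\<lambda>a. lsum (E.E_iso (K (snd p))) (\<lambda>b.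
      \<sigma> (\<iota> a) (\<kappa> (fst p)) * (\<sigma> (\<iota> b) (\<kappa> (snd p)) * (\<sigma> (\<iota> a \<otimes> \<kappa> (fst p)) (\<iota> b \<otimes> \<kappa> (snd p)) *
        k (\<iota> a \<otimes> \<kappa> (fst p) \<otimes> (\<iota> b \<otimes> \<kappa> (snd p))))))))"
  proof (rule sum.cong[OF refl])
    fix p assume p: "p \<in> ?P"
    obtain z w where pzw: "p = (z, w)" by (cases p)
    have zw: "z \<in> carrier Z" "w \<in> carrier Z"
      using p pzw CP_support[OF G] CP_support[OF K] by auto
    note Gz = CP_closed[OF G, of z] and Kw = CP_closed[OF K, of w]
    note aK = act_closed[OF zw(1) Kw]
    let ?g = "E.E_iso (G z)" and ?k = "E.E_iso (K w)"
    have gA: "?g \<in> carrier E.A" and kA: "?k \<in> carrier E.A" and akA: "E.E_iso (act z (K w)) \<in> carrier E.A"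
      by (rule E_carrier[OF Gz] E_carrier[OF Kw] E_carrier[OF aK])+
    have "E.E_iso (summand p) = fun_smult (\<tau> z w) (?g \<otimes>\<^bsub>E.A\<^esub> E.E_iso (act z (K w)))"
      using calg_isoD(7)[OF E.calg_iso_E R.m_closed[OF Gz aK]] calg_isoD(3)[OF E.calg_iso_E Gz aK]
      unfolding pzw by (simp only: fst_conv snd_conv E.A_simps)
    hence "lsum (E.E_iso (summand p)) (?h (?m p)) = \<tau> z w * lsum ?g (\<lambda>a. lsum (E.E_iso (act z (K w)))
        (\<lambda>b. \<sigma> (\<iota> a) (\<iota> b) * ?h (z \<otimes>\<^bsub>Z\<^esub> w) (a \<otimes>\<^bsub>Y\<^esub> b)))"
      using gA akA by (simp only: lsum_smult E.lsum_mult pzw fst_conv snd_conv)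
    \<comment> \<open>Conjugation is diagonal in the degrees, so passing from
      \<open>act z (K w)\<close> to \<open>K w\<close> only inserts the factor
      \<open>antisym\<close>.\<close>
    also have "\<dots> = \<tau> z w * lsum ?g (\<lambda>a. lsum ?k
        (\<lambda>b. antisym (\<kappa> z) (\<iota> b) * (\<sigma> (\<iota> a) (\<iota> b) * ?h (z \<otimes>\<^bsub>Z\<^esub> w) (a \<otimes>\<^bsub>Y\<^esub> b))))"
      unfolding E_iso_act[OF zw(1) Kw]
      using E.support_closed[OF kA] zw
      by (intro arg_cong2[of _ _ _ _ "(*)"] refl lsum_cong lsum_weight) auto
    also have "\<dots> = lsum ?g (\<lambda>a. lsum ?k (\<lambda>b.
      \<sigma> (\<iota> a) (\<kappa> z) * (\<sigma> (\<iota> b) (\<kappa> w) * (\<sigma> (\<iota> a \<otimes> \<kappa> z) (\<iota> b \<otimes> \<kappa> w) *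
        k (\<iota> a \<otimes> \<kappa> z \<otimes> (\<iota> b \<otimes> \<kappa> w))))))"
      unfolding lsum_mult_right(1)[symmetric]
    proof (intro lsum_cong)
      fix a b assume "?g a \<noteq> 0" "?k b \<noteq> 0"
      hence ab: "a \<in> carrier Y" "b \<in> carrier Y" using E.support_closed[OF gA] E.support_closed[OF kA] by auto
      have k: "\<iota> a \<otimes> \<iota> b \<otimes> (\<kappa> z \<otimes> \<kappa> w) = \<iota> a \<otimes> \<kappa> z \<otimes> (\<iota> b \<otimes> \<kappa> w)"
        using ab zw by (simp add: m_ac)
      have "\<tau> z w * (antisym (\<kappa> z) (\<iota> b) * (\<sigma> (\<iota> a) (\<iota> b) * ?h (z \<otimes>\<^bsub>Z\<^esub> w) (a \<otimes>\<^bsub>Y\<^esub> b)))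
        = (\<sigma> (\<kappa> z) (\<kappa> w) * (antisym (\<kappa> z) (\<iota> b) * \<sigma> (\<iota> a) (\<iota> b) * \<sigma> (\<iota> a \<otimes> \<iota> b) (\<kappa> z \<otimes> \<kappa> w))) *
          k (\<iota> a \<otimes> \<kappa> z \<otimes> (\<iota> b \<otimes> \<kappa> w))"
        using ab zw by (simp add: \<tau> k mult_ac)
      also have "\<dots> = \<sigma> (\<iota> a) (\<kappa> z) * (\<sigma> (\<iota> b) (\<kappa> w) * (\<sigma> (\<iota> a \<otimes> \<kappa> z) (\<iota> b \<otimes> \<kappa> w) *
        k (\<iota> a \<otimes> \<kappa> z \<otimes> (\<iota> b \<otimes> \<kappa> w))))"
        using ab zw by (subst cocycle_shuffle) (simp_all add: mult_ac)
      finally show "\<tau> z w * (antisym (\<kappa> z) (\<iota> b) * (\<sigma> (\<iota> a) (\<iota> b) * ?h (z \<otimes>\<^bsub>Z\<^esub> w) (a \<otimes>\<^bsub>Y\<^esub> b))) =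
        \<sigma> (\<iota> a) (\<kappa> z) * (\<sigma> (\<iota> b) (\<kappa> w) * (\<sigma> (\<iota> a \<otimes> \<kappa> z) (\<iota> b \<otimes> \<kappa> w) *
        k (\<iota> a \<otimes> \<kappa> z \<otimes> (\<iota> b \<otimes> \<kappa> w))))" .
    qed
    finally show "lsum (E.E_iso (summand p)) (?h (?m p)) = lsum (E.E_iso (G (fst p))) (\<lambda>a. lsum (E.E_iso (K (snd p))) (\<lambda>b.
      \<sigma> (\<iota> a) (\<kappa> (fst p)) * (\<sigma> (\<iota> b) (\<kappa> (snd p)) * (\<sigma> (\<iota> a \<otimes> \<kappa> (fst p)) (\<iota> b \<otimes> \<kappa> (snd p)) *
        k (\<iota> a \<otimes> \<kappa> (fst p) \<otimes> (\<iota> b \<otimes> \<kappa> (snd p)))))))"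
      unfolding pzw by (simp only: fst_conv snd_conv)
  qed
  also have "\<dots> = (\<Sum>z\<in>S G. \<Sum>w\<in>S K. lsum (E.E_iso (G z)) (\<lambda>a. lsum (E.E_iso (K w)) (\<lambda>b.
      \<sigma> (\<iota> a) (\<kappa> z) * (\<sigma> (\<iota> b) (\<kappa> w) * (\<sigma> (\<iota> a \<otimes> \<kappa> z) (\<iota> b \<otimes> \<kappa> w) *
        k (\<iota> a \<otimes> \<kappa> z \<otimes> (\<iota> b \<otimes> \<kappa> w)))))))"
    unfolding sum.cartesian_product by (rule sum.cong) auto
  also have "\<dots> = lsum (H G \<otimes>\<^bsub>A\<^esub> H K) k"
    unfolding lsum_mult[OF H_closed[OF G] H_closed[OF K]] lsum_H[OF G] lsum_H[OF K]
    by (simp only: sum_lsum_swap lsum_mult_right(1) sum_distrib_left)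
  finally show "lsum (H (G \<otimes>\<^bsub>CP\<^esub> K)) k = lsum (H G \<otimes>\<^bsub>A\<^esub> H K) k" .
qed (intro finite_support H_closed CP_mult_closed mult_closed G K)+

end

lemma H_bij: "bij_betw H (carrier CP) (carrier A)"
  unfolding bij_betw_def
proof
  show "inj_on H (carrier CP)"
  proof (rule inj_onI)
    fix G K assume G: "G \<in> carrier CP" and K: "K \<in> carrier CP" and eq: "H G = H K"
    show "G = K"
    proof
      fix z
      show "G z = K z"
      proof (cases "z \<in> carrier Z")
        case False
        hence "G z = \<zero>\<^bsub>EA\<^esub>" "K z = \<zero>\<^bsub>EA\<^esub>" using CP_support[OF G] CP_support[OF K] by blast+
        thus ?thesis by simp
      next
        case z: True
        have "E.E_iso (G z) a = E.E_iso (K z) a" for a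
        proof (cases "a \<in> carrier Y")
          case True
          have "H G (\<iota> a \<otimes> \<kappa> z) = H K (\<iota> a \<otimes> \<kappa> z)" using eq by simp
          thus ?thesis using True z by (simp add: H_split)
        next
          case False
          thus ?thesis
            using E.support_closed[OF E_carrier[OF CP_closed[OF G]]] E.support_closed[OF E_carrier[OF CP_closed[OF K]]]
            by metis
        qed
        hence "E.E_iso (G z) = E.E_iso (K z)" by (rule ext)
        thus ?thesis by (rule calg_isoD(8)[OF E.calg_iso_E CP_closed[OF G] CP_closed[OF K]])
      qed
    qed
  qed
  show "H ` carrier CP = carrier A"
  proof
    show "H ` carrier CP \<subseteq> carrier A" using H_closed by blast
    show "carrier A \<subseteq> H ` carrier CP"
    proof
      fix f assume f: "f \<in> carrier A"
      interpret R: ring EA by (rule E.ring_E)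
      \<comment> \<open>The \<open>z\<close>-component of \<open>f\<close> with the cocycle factor
        of \<open>H\<close> divided out, so that \<open>H\<close> restores it.\<close>
      define g where "g z a = (if a \<in> carrier Y then f (\<iota> a \<otimes> \<kappa> z) / \<sigma> (\<iota> a) (\<kappa> z) else 0)" for z a
      have gA: "g z \<in> carrier E.A" if z: "z \<in> carrier Z" for z
        unfolding E.mem_carrier
      proof
        have "{a. g z a \<noteq> 0} \<subseteq> (\<lambda>w. fst (dec w)) ` {w. f w \<noteq> 0}"
        proof
          fix a assume "a \<in> {a. g z a \<noteq> 0}"
          hence a: "a \<in> carrier Y" "f (\<iota> a \<otimes> \<kappa> z) \<noteq> 0" by (auto simp: g_def split: if_splits)
          thus "a \<in> (\<lambda>w. fst (dec w)) ` {w. f w \<noteq> 0}"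
            using z by (intro image_eqI[of _ _ "\<iota> a \<otimes> \<kappa> z"]) auto
        qed
        thus "finite {a. g z a \<noteq> 0}" using finite_support[OF f] by (meson finite_imageI finite_subset)
        show "{a. g z a \<noteq> 0} \<subseteq> carrier Y" by (auto simp: g_def split: if_splits)
      qed
      define e where "e = inv_into (carrier EA) E.E_iso"
      have surj: "E.E_iso ` carrier EA = carrier E.A"
        using calg_isoD(1)[OF E.calg_iso_E] by (simp add: bij_betw_def)
      have e: "e h \<in> carrier EA" "E.E_iso (e h) = h" if "h \<in> carrier E.A" for h
        using inv_into_into[of h E.E_iso "carrier EA"] f_inv_into_f[of h E.E_iso "carrier EA"] surj that
        unfolding e_def by (simp_all only:)
      define G where "G z = (if z \<in> carrier Z then e (g z) else \<zero>\<^bsub>EA\<^esub>)" for z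
      have GC: "G \<in> carrier CP" unfolding CP_carrier
      proof (intro conjI allI)
        show "G z \<in> carrier EA" for z unfolding G_def using e gA by simp
        have "S G \<subseteq> (\<lambda>w. snd (dec w)) ` {w. f w \<noteq> 0}"
        proof
          fix z assume z: "z \<in> S G"
          hence zZ: "z \<in> carrier Z" by (auto simp: G_def split: if_splits)
          have "\<exists>a. g z a \<noteq> 0"
          proof (rule ccontr)
            assume "\<not> (\<exists>a. g z a \<noteq> 0)"
            hence g0: "g z = 0" by (intro ext) simp
            have "E.E_iso (e (g z)) = E.E_iso \<zero>\<^bsub>EA\<^esub>" using e(2)[OF gA[OF zZ]] g0 E_iso_zero by (simp only:)
            hence "e (g z) = \<zero>\<^bsub>EA\<^esub>"
              using calg_isoD(8)[OF E.calg_iso_E e(1)[OF gA[OF zZ]] R.zero_closed] by blast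
            thus False using z zZ by (simp add: G_def)
          qed
          then obtain a where "g z a \<noteq> 0" by blast
          hence a: "a \<in> carrier Y" "f (\<iota> a \<otimes> \<kappa> z) \<noteq> 0" by (auto simp: g_def split: if_splits)
          thus "z \<in> (\<lambda>w. snd (dec w)) ` {w. f w \<noteq> 0}"
            using zZ by (intro image_eqI[of _ _ "\<iota> a \<otimes> \<kappa> z"]) auto
        qed
        thus "finite (S G)" using finite_support[OF f] by (meson finite_imageI finite_subset)
        show "S G \<subseteq> carrier Z" by (auto simp: G_def split: if_splits)
      qed
      have "f w = H G w" for w
      proof (cases "w \<in> carrier X")
        case False
        thus ?thesis using support_closed[OF f] by (auto simp: H_def)
      next
        case True
        obtain a z where az: "a \<in> carrier Y" "z \<in> carrier Z" "w = \<iota> a \<otimes> \<kappa> z" using split_ex[OF True] .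
        have "E.E_iso (G z) a = f w / \<sigma> (\<iota> a) (\<kappa> z)"
          using az e(2)[OF gA[OF az(2)]] by (simp add: G_def g_def)
        thus ?thesis using az by (simp add: H_split)
      qed
      thus "f \<in> H ` carrier CP" using GC by blast
    qed
  qed
qed

theorem crossed_product_iso: "calg_iso H CP A"
proof (rule calg_isoI)
  show "bij_betw H (carrier CP) (carrier A)" by (rule H_bij)
  show "H (G \<otimes>\<^bsub>CP\<^esub> K) = H G \<otimes>\<^bsub>A\<^esub> H K" if "G \<in> carrier CP" "K \<in> carrier CP" for G K
    using that by (rule H_mult)
  interpret R: ring EA by (rule E.ring_E)
  note Ehom = calg_isoD[OF E.calg_iso_E]
  fix G K assume G: "G \<in> carrier CP" and K: "K \<in> carrier CP"
  have "E.E_iso (G z \<oplus>\<^bsub>EA\<^esub> K z) = E.E_iso (G z) + E.E_iso (K z)" for z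
    using Ehom(4)[OF CP_closed[OF G] CP_closed[OF K]] by (simp only: E.A_simps)
  hence "H (\<lambda>z. G z \<oplus>\<^bsub>EA\<^esub> K z) w = H G w + H K w" for w
    by (simp add: H_def algebra_simps)
  thus "H (G \<oplus>\<^bsub>CP\<^esub> K) = H G \<oplus>\<^bsub>A\<^esub> H K" by (auto simp: crossed_product_def)
next
  interpret R: ring EA by (rule E.ring_E)
  note Ehom = calg_isoD[OF E.calg_iso_E]
  have one: "E.E_iso \<one>\<^bsub>EA\<^esub> = E.u \<one>\<^bsub>Y\<^esub>" using Ehom(5) by (simp only: E.A_simps)
  have "H (\<lambda>z. if z = \<one>\<^bsub>Z\<^esub> then \<one>\<^bsub>EA\<^esub> else \<zero>\<^bsub>EA\<^esub>) w = u \<one> w" for w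
  proof (cases "w \<in> carrier X")
    case True
    obtain a z where az: "a \<in> carrier Y" "z \<in> carrier Z" "w = \<iota> a \<otimes> \<kappa> z" using split_ex[OF True] .
    have "w = \<one> \<longleftrightarrow> a = \<one>\<^bsub>Y\<^esub> \<and> z = \<one>\<^bsub>Z\<^esub>"
      using split_eq_iff[OF az(1,2) E.one_closed Z.one_closed] az(3) by simp
    thus ?thesis using az by (auto simp: H_split one E_iso_zero indicator_def)
  qed (auto simp: H_def indicator_def)
  thus "H \<one>\<^bsub>CP\<^esub> = \<one>\<^bsub>A\<^esub>" by (auto simp: crossed_product_def)
  have "H (\<lambda>z. \<zero>\<^bsub>EA\<^esub>) w = 0" for w by (simp add: H_def E_iso_zero)
  thus "H \<zero>\<^bsub>CP\<^esub> = \<zero>\<^bsub>A\<^esub>" by (auto simp: crossed_product_def)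
  fix d G assume G: "G \<in> carrier CP"
  have "E.E_iso (d \<odot>\<^bsub>EA\<^esub> G z) = fun_smult d (E.E_iso (G z))" for z
    using Ehom(7)[OF CP_closed[OF G]] by (simp only: E.A_simps)
  hence "H (\<lambda>z. d \<odot>\<^bsub>EA\<^esub> G z) w = d * H G w" for w by (simp add: H_def fun_smult_def)
  thus "H (d \<odot>\<^bsub>CP\<^esub> G) = d \<odot>\<^bsub>A\<^esub> H G" by (auto simp: crossed_product_def fun_smult_def)
qed

lemma CP_ops_closed:
  "G \<in> carrier CP \<Longrightarrow> K \<in> carrier CP \<Longrightarrow> G \<oplus>\<^bsub>CP\<^esub> K \<in> carrier CP"
  "\<one>\<^bsub>CP\<^esub> \<in> carrier CP" "\<zero>\<^bsub>CP\<^esub> \<in> carrier CP" "smult_closed CP"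
proof -
  interpret R: ring EA by (rule E.ring_E)
  show "G \<oplus>\<^bsub>CP\<^esub> K \<in> carrier CP" if G: "G \<in> carrier CP" and K: "K \<in> carrier CP"
  proof -
    have eq: "G \<oplus>\<^bsub>CP\<^esub> K = (\<lambda>z. G z \<oplus>\<^bsub>EA\<^esub> K z)" by (simp add: crossed_product_def)
    have sub: "S (\<lambda>z. G z \<oplus>\<^bsub>EA\<^esub> K z) \<subseteq> S G \<union> S K"
    proof
      fix z assume "z \<in> S (\<lambda>z. G z \<oplus>\<^bsub>EA\<^esub> K z)"
      thus "z \<in> S G \<union> S K" using R.l_zero[OF R.zero_closed] by (cases "G z = \<zero>\<^bsub>EA\<^esub>"; cases "K z = \<zero>\<^bsub>EA\<^esub>") simp_all
    qed
    have fin: "finite (S G)" "S G \<subseteq> carrier Z" "finite (S K)" "S K \<subseteq> carrier Z"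
      using G K unfolding CP_carrier by simp_all
    have "S (\<lambda>z. G z \<oplus>\<^bsub>EA\<^esub> K z) \<subseteq> carrier Z" by (rule order_trans[OF sub Un_least[OF fin(2,4)]])
    moreover have "finite (S (\<lambda>z. G z \<oplus>\<^bsub>EA\<^esub> K z))" by (rule finite_subset[OF sub]) (simp add: fin(1,3))
    ultimately show ?thesis
      unfolding eq CP_carrier using R.a_closed[OF CP_closed[OF G] CP_closed[OF K]] by (intro conjI allI)
  qed
  have one: "\<one>\<^bsub>CP\<^esub> = (\<lambda>z. if z = \<one>\<^bsub>Z\<^esub> then \<one>\<^bsub>EA\<^esub> else \<zero>\<^bsub>EA\<^esub>)" by (simp add: crossed_product_def)
  have "S (\<lambda>z. if z = \<one>\<^bsub>Z\<^esub> then \<one>\<^bsub>EA\<^esub> else \<zero>\<^bsub>EA\<^esub>) \<subseteq> {\<one>\<^bsub>Z\<^esub>}"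
    by (rule subsetI) (metis (mono_tags, lifting) mem_Collect_eq singletonI)
  hence "finite (S (\<lambda>z. if z = \<one>\<^bsub>Z\<^esub> then \<one>\<^bsub>EA\<^esub> else \<zero>\<^bsub>EA\<^esub>))"
    "S (\<lambda>z. if z = \<one>\<^bsub>Z\<^esub> then \<one>\<^bsub>EA\<^esub> else \<zero>\<^bsub>EA\<^esub>) \<subseteq> carrier Z"
    using Z.one_closed by (auto intro: finite_subset)
  thus "\<one>\<^bsub>CP\<^esub> \<in> carrier CP" unfolding one CP_carrier by (simp add: R.zero_closed R.one_closed)
  have zero: "\<zero>\<^bsub>CP\<^esub> = (\<lambda>z. \<zero>\<^bsub>EA\<^esub>)" by (simp add: crossed_product_def)
  show "\<zero>\<^bsub>CP\<^esub> \<in> carrier CP" unfolding zero CP_carrier by (simp add: R.zero_closed)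
  show "smult_closed CP" unfolding smult_closed_def
  proof (intro allI ballI)
    fix d G assume G: "G \<in> carrier CP"
    have eq: "d \<odot>\<^bsub>CP\<^esub> G = (\<lambda>z. d \<odot>\<^bsub>EA\<^esub> G z)" by (simp add: crossed_product_def)
    have cl: "d \<odot>\<^bsub>EA\<^esub> Q \<in> carrier EA" if "Q \<in> carrier EA" for Q
      using E.smult_closed_E that unfolding smult_closed_def by blast
    have "E.E_iso (d \<odot>\<^bsub>EA\<^esub> \<zero>\<^bsub>EA\<^esub>) = E.E_iso \<zero>\<^bsub>EA\<^esub>"
      unfolding calg_isoD(7)[OF E.calg_iso_E R.zero_closed] E_iso_zero
      by (rule ext) (simp add: fun_smult_def)
    hence d0: "d \<odot>\<^bsub>EA\<^esub> \<zero>\<^bsub>EA\<^esub> = \<zero>\<^bsub>EA\<^esub>"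
      by (rule calg_isoD(8)[OF E.calg_iso_E cl[OF R.zero_closed] R.zero_closed])
    have sub: "S (\<lambda>z. d \<odot>\<^bsub>EA\<^esub> G z) \<subseteq> S G" by (rule subsetI) (metis (mono_tags, lifting) d0 mem_Collect_eq)
    have fin: "finite (S G)" "S G \<subseteq> carrier Z" using G unfolding CP_carrier by simp_all
    show "d \<odot>\<^bsub>CP\<^esub> G \<in> carrier CP"
      unfolding eq CP_carrier
      using cl[OF CP_closed[OF G]] finite_subset[OF sub fin(1)] order_trans[OF sub fin(2)] by (intro conjI allI)
  qed
qed

corollary crossed_product_iso_inv: "calg_iso (inv_into (carrier CP) H) A CP"
  by (rule calg_iso_inv[OF CP_mult_closed CP_ops_closed crossed_product_iso])

end

section \<open>Independence of characters\<close>

text \<open>No regularity is demanded, which lets the independence of characters be proved for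
  arbitrary groups. Vanishing outside the carrier makes equality on the carrier an equality of
  functions.\<close>

definition is_char :: "'g alg_group \<Rightarrow> ('g \<Rightarrow> complex) \<Rightarrow> bool" where
  "is_char G \<chi> \<longleftrightarrow> (\<forall>g. g \<notin> carrier G \<longrightarrow> \<chi> g = 0) \<and> (\<forall>g\<in>carrier G. \<chi> g \<noteq> 0) \<and>
     (\<forall>g\<in>carrier G. \<forall>h\<in>carrier G. \<chi> (g \<otimes>\<^bsub>G\<^esub> h) = \<chi> g * \<chi> h)"

lemma is_charD:
  assumes "is_char G \<chi>"
  shows "g \<notin> carrier G \<Longrightarrow> \<chi> g = 0" "g \<in> carrier G \<Longrightarrow> \<chi> g \<noteq> 0"
    "g \<in> carrier G \<Longrightarrow> h \<in> carrier G \<Longrightarrow> \<chi> (g \<otimes>\<^bsub>G\<^esub> h) = \<chi> g * \<chi> h"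
  using assms by (auto simp: is_char_def)

lemma is_char_one:
  assumes "group G" "is_char G \<chi>" shows "\<chi> \<one>\<^bsub>G\<^esub> = 1"
proof -
  interpret group G by fact
  show ?thesis
    using is_charD(3)[OF assms(2) one_closed one_closed] is_charD(2)[OF assms(2) one_closed] by simp
qed

lemma is_char_ext:
  "is_char G \<chi> \<Longrightarrow> is_char G \<psi> \<Longrightarrow> (\<And>g. g \<in> carrier G \<Longrightarrow> \<chi> g = \<psi> g) \<Longrightarrow> \<chi> = \<psi>"
  by (rule ext) (metis is_charD(1))

text \<open>Dedekind's argument: subtracting \<open>\<psi> h\<close> times the relation from its
  translate by \<open>h\<close> removes \<open>\<psi>\<close> and multiplies each other coefficient
  by \<open>\<chi> h - \<psi> h\<close>, which is nonzero for a suitable \<open>h\<close>.\<close>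

theorem characters_independent:
  assumes G: "group G" and N: "finite N" "\<And>\<chi>. \<chi> \<in> N \<Longrightarrow> is_char G \<chi>"
    and eq: "\<And>g. g \<in> carrier G \<Longrightarrow> (\<Sum>\<chi>\<in>N. c \<chi> * \<chi> g) = 0" and "\<chi> \<in> N"
  shows "c \<chi> = 0"
proof -
  interpret group G by fact
  have "\<forall>\<chi>\<in>N. c \<chi> = 0" using N eq
  proof (induction N arbitrary: c)
    case (insert \<psi> N)
    have \<psi>: "is_char G \<psi>" using insert.prems(1) by simp
    have sum: "c \<psi> * \<psi> g + (\<Sum>\<chi>\<in>N. c \<chi> * \<chi> g) = 0" if "g \<in> carrier G" for g
      using insert.prems(2)[OF that] insert.hyps by simp
    have zero: "c \<chi> * (\<chi> h - \<psi> h) = 0" if h: "h \<in> carrier G" and \<chi>: "\<chi> \<in> N" for h \<chi>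
    proof -
      have "(\<Sum>\<chi>\<in>N. c \<chi> * (\<chi> h - \<psi> h) * \<chi> g) = 0" if g: "g \<in> carrier G" for g
      proof -
        have "(\<Sum>\<chi>\<in>N. c \<chi> * (\<chi> h - \<psi> h) * \<chi> g) = (\<Sum>\<chi>\<in>N. c \<chi> * \<chi> (h \<otimes>\<^bsub>G\<^esub> g)) - \<psi> h * (\<Sum>\<chi>\<in>N. c \<chi> * \<chi> g)"
          unfolding sum_distrib_left sum_subtractf[symmetric]
          using insert.prems(1) g h by (intro sum.cong) (auto simp: is_charD(3) algebra_simps)
        also have "\<dots> = - (c \<psi> * \<psi> (h \<otimes>\<^bsub>G\<^esub> g)) + \<psi> h * (c \<psi> * \<psi> g)"
          using sum[of "h \<otimes>\<^bsub>G\<^esub> g"] sum[OF g] g h by (simp add: add_eq_0_iff)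
        also have "\<dots> = 0" using g h \<psi> by (simp add: is_charD(3))
        finally show ?thesis .
      qed
      thus ?thesis using insert.IH[of "\<lambda>\<chi>. c \<chi> * (\<chi> h - \<psi> h)"] insert.prems(1) \<chi> by blast
    qed
    have N0: "c \<chi> = 0" if \<chi>: "\<chi> \<in> N" for \<chi>
    proof -
      have "\<chi> \<noteq> \<psi>" using \<chi> insert.hyps by blast
      then obtain h where "h \<in> carrier G" "\<chi> h \<noteq> \<psi> h"
        using is_char_ext[of G \<chi> \<psi>] \<psi> insert.prems(1) \<chi> by blast
      thus ?thesis using zero[OF _ \<chi>, of h] by simp
    qed
    hence "c \<psi> * \<psi> \<one>\<^bsub>G\<^esub> = 0" using sum[OF one_closed] by simp
    hence "c \<psi> = 0" using is_char_one[OF G \<psi>] by simp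
    thus ?case using N0 by blast
  qed simp
  thus ?thesis using \<open>\<chi> \<in> N\<close> by blast
qed

lemma sum_fibers:
  fixes c :: "'i \<Rightarrow> complex"
  assumes "finite I"
  shows "(\<Sum>i\<in>I. c i * \<psi> i) = (\<Sum>v\<in>r ` I. \<Sum>i\<in>{i \<in> I. r i = v}. c i * \<psi> i)"
  by (rule sum.group[symmetric]) (use assms in auto)

text \<open>Restrictions of distinct characters to a subgroup may coincide; independence then kills
  the sum of the coefficients over each class.\<close>

corollary characters_fiber_sums_zero:
  assumes G: "group G" and I: "finite I" "\<And>i. i \<in> I \<Longrightarrow> is_char G (\<psi> i)"
    and eq: "\<And>g. g \<in> carrier G \<Longrightarrow> (\<Sum>i\<in>I. c i * \<psi> i g) = 0" and "j \<in> I"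
  shows "(\<Sum>i\<in>{i \<in> I. \<psi> i = \<psi> j}. c i) = 0"
proof (rule characters_independent[OF G, where N = "\<psi> ` I" and c = "\<lambda>v. \<Sum>i\<in>{i \<in> I. \<psi> i = v}. c i"])
  fix g assume "g \<in> carrier G"
  hence "0 = (\<Sum>v\<in>\<psi> ` I. \<Sum>i\<in>{i \<in> I. \<psi> i = v}. c i * \<psi> i g)"
    using eq sum_fibers[OF I(1), of c "\<lambda>i. \<psi> i g" \<psi>] by simp
  also have "\<dots> = (\<Sum>v\<in>\<psi> ` I. (\<Sum>i\<in>{i \<in> I. \<psi> i = v}. c i) * v g)"
    by (simp add: sum_distrib_right)
  finally show "(\<Sum>v\<in>\<psi> ` I. (\<Sum>i\<in>{i \<in> I. \<psi> i = v}. c i) * v g) = 0" by simp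
qed (use I \<open>j \<in> I\<close> in auto)

section \<open>Diagonalizable groups\<close>

text \<open>Evaluates a formal combination of functions to a function. Restricted to combinations of
  characters it becomes the isomorphism from twisted group algebras to twisted coordinate
  algebras.\<close>

definition \<Lambda> :: "(('g \<Rightarrow> complex) \<Rightarrow> complex) \<Rightarrow> 'g \<Rightarrow> complex" where
  "\<Lambda> a g = lsum a (\<lambda>\<chi>. \<chi> g)"

definition lin_span :: "('g \<Rightarrow> complex) set \<Rightarrow> ('g \<Rightarrow> complex) set" where
  "lin_span C = \<Lambda> ` {a. finite {x. a x \<noteq> 0} \<and> {x. a x \<noteq> 0} \<subseteq> C}"

lemma \<Lambda>_indicator: "\<Lambda> (indicator {x}) = x"
  by (rule ext) (simp add: \<Lambda>_def)

lemma \<Lambda>_smult: "\<Lambda> (fun_smult c a) = fun_smult c (\<Lambda> a)"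
  by (rule ext) (simp add: \<Lambda>_def lsum_smult, simp add: fun_smult_def \<Lambda>_def)

lemma \<Lambda>_add: "finite {x. a x \<noteq> 0} \<Longrightarrow> finite {x. b x \<noteq> 0} \<Longrightarrow> \<Lambda> (a + b) = \<Lambda> a + \<Lambda> b"
  by (rule ext) (simp only: \<Lambda>_def lsum_add plus_fun_apply)

lemma \<Lambda>_zero: "\<Lambda> 0 = 0"
  by (rule ext) (simp add: \<Lambda>_def)

lemma lin_span_base: "x \<in> C \<Longrightarrow> x \<in> lin_span C"
  unfolding lin_span_def by (rule image_eqI[of _ _ "indicator {x}"]) (auto simp: \<Lambda>_indicator indicator_def)

lemma lin_span_0: "0 \<in> lin_span C"
proof -
  have "\<Lambda> 0 \<in> lin_span C" unfolding lin_span_def by (rule imageI) simp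
  thus ?thesis by (simp only: \<Lambda>_zero)
qed

lemma lin_span_add:
  assumes "f \<in> lin_span C" "g \<in> lin_span C" shows "f + g \<in> lin_span C"
proof -
  obtain a b where ab: "finite {x. a x \<noteq> 0}" "{x. a x \<noteq> 0} \<subseteq> C" "f = \<Lambda> a"
      "finite {x. b x \<noteq> 0}" "{x. b x \<noteq> 0} \<subseteq> C" "g = \<Lambda> b"
    using assms unfolding lin_span_def by blast
  have "{x. (a + b) x \<noteq> 0} \<subseteq> {x. a x \<noteq> 0} \<union> {x. b x \<noteq> 0}" by auto
  hence "finite {x. (a + b) x \<noteq> 0} \<and> {x. (a + b) x \<noteq> 0} \<subseteq> C"
    using ab by (meson finite_UnI finite_subset Un_least order_trans)
  thus ?thesis unfolding lin_span_def ab(3,6) \<Lambda>_add[OF ab(1,4), symmetric] by blast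
qed

lemma lin_span_smult:
  assumes "f \<in> lin_span C" shows "fun_smult c f \<in> lin_span C"
proof -
  obtain a where a: "finite {x. a x \<noteq> 0}" "{x. a x \<noteq> 0} \<subseteq> C" "f = \<Lambda> a"
    using assms unfolding lin_span_def by blast
  have "{x. fun_smult c a x \<noteq> 0} \<subseteq> {x. a x \<noteq> 0}" by (auto simp: fun_smult_def)
  hence "finite {x. fun_smult c a x \<noteq> 0} \<and> {x. fun_smult c a x \<noteq> 0} \<subseteq> C"
    using a by (meson finite_subset order_trans)
  thus ?thesis unfolding lin_span_def a(3) \<Lambda>_smult[symmetric] by blast
qed

lemma lin_span_induct [consumes 1, case_names zero step]:
  assumes "f \<in> lin_span C" and "P 0"
    and step: "\<And>x c g. x \<in> C \<Longrightarrow> g \<in> lin_span C \<Longrightarrow> P g \<Longrightarrow> P (fun_smult c x + g)"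
  shows "P f"
proof -
  obtain a where a: "finite {x. a x \<noteq> 0}" "{x. a x \<noteq> 0} \<subseteq> C" "f = \<Lambda> a"
    using assms unfolding lin_span_def by blast
  define h where "h N g = (\<Sum>x\<in>N. a x * x g)" for N g
  have "h N \<in> lin_span C \<and> P (h N)" if "finite N" "N \<subseteq> C" for N
    using that
  proof (induction N)
    case empty
    have "h {} = 0" by (rule ext) (simp add: h_def)
    thus ?case using assms(2) lin_span_0 by (simp only: simp_thms)
  next
    case (insert x N)
    have eq: "h (insert x N) = fun_smult (a x) x + h N"
      using insert by (intro ext) (simp add: h_def fun_smult_def)
    have x: "x \<in> C" and h: "h N \<in> lin_span C" "P (h N)" using insert by auto
    show ?case unfolding eq
      by (intro conjI step[OF x h] lin_span_add lin_span_smult lin_span_base x h)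
  qed
  moreover have "f = h {x. a x \<noteq> 0}"
    unfolding a(3) by (rule ext) (simp add: h_def \<Lambda>_def lsum_def)
  ultimately show ?thesis using a by (simp only:)
qed

lemma lin_span_minimal:
  assumes "C \<subseteq> V" "0 \<in> V" "\<And>f g. f \<in> V \<Longrightarrow> g \<in> V \<Longrightarrow> f + g \<in> V"
    "\<And>c f. f \<in> V \<Longrightarrow> fun_smult c f \<in> V"
  shows "lin_span C \<subseteq> V"
proof
  fix f assume "f \<in> lin_span C"
  thus "f \<in> V" by (induction rule: lin_span_induct) (use assms in blast)+
qed

text \<open>A further character in the span would satisfy a nontrivial linear relation with members
  of \<open>C\<close>.\<close>

lemma char_in_span:
  assumes G: "group G" and C: "\<And>x. x \<in> C \<Longrightarrow> is_char G x" and \<chi>: "is_char G \<chi>" "\<chi> \<in> lin_span C"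
  shows "\<chi> \<in> C"
proof (rule ccontr)
  assume nC: "\<chi> \<notin> C"
  obtain a where a: "finite {x. a x \<noteq> 0}" "{x. a x \<noteq> 0} \<subseteq> C" "\<chi> = \<Lambda> a"
    using \<chi>(2) unfolding lin_span_def by blast
  let ?N = "{x. a x \<noteq> 0}"
  have n: "\<chi> \<notin> ?N" using nC a(2) by blast
  \<comment> \<open>Independence is applied to the relation \<open>\<Lambda> a - \<chi> = 0\<close>;
    the conditional spells out the coefficient of \<open>\<chi>\<close>, which is -1.\<close>
  have "(if \<chi> = \<chi> then -1 else a \<chi>) = 0"
  proof (rule characters_independent[OF G, where N = "insert \<chi> ?N" and c = "\<lambda>x. if x = \<chi> then -1 else a x"])
    fix g
    have "(\<Sum>x\<in>?N. (if x = \<chi> then -1 else a x) * x g) = \<Lambda> a g"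
      unfolding \<Lambda>_def lsum_def using n by (intro sum.cong) auto
    thus "(\<Sum>x\<in>insert \<chi> ?N. (if x = \<chi> then -1 else a x) * x g) = 0"
      using a(1) n by (simp add: a(3)[symmetric])
  qed (use a C \<chi> in auto)
  thus False by simp
qed

text \<open>The setting shared by tori and their subgroups: cocycles and twists are read off from a
  coordinate ring spanned by characters.\<close>

locale diagonalizable = comm_group G for G :: "'g alg_group" (structure) +
  assumes char_comm_group: "comm_group (char_group G)"
    and char_is_char: "\<And>\<chi>. \<chi> \<in> carrier (char_group G) \<Longrightarrow> is_char G \<chi>"
    and coord_ring_eq: "\<O>\<^bsub>G\<^esub> = lin_span (carrier (char_group G))"

lemma char_group_simps [simp]:
  "\<chi> \<otimes>\<^bsub>char_group G\<^esub> \<psi> = \<chi> * \<psi>" "\<one>\<^bsub>char_group G\<^esub> = indicator (carrier G)"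
  by (simp_all add: char_group_def)

text \<open>Independence keeps further characters out of the span, so the given set is the whole
  character group, and its closure properties are the group axioms.\<close>

lemma diagonalizableI:
  assumes G: "comm_group G"
    and C: "\<And>x. x \<in> C \<Longrightarrow> is_char G x" "\<And>x y. x \<in> C \<Longrightarrow> y \<in> C \<Longrightarrow> x * y \<in> C"
      "indicator (carrier G) \<in> C" "\<And>x. x \<in> C \<Longrightarrow> (\<lambda>g. inverse (x g)) \<in> C"
    and O: "\<O>\<^bsub>G\<^esub> = lin_span C"
  shows "diagonalizable G" "carrier (char_group G) = C"
proof -
  interpret comm_group G by fact
  have zero: "f g = 0" if "f \<in> lin_span C" "g \<notin> carrier G" for f g
    using that
  proof (induction rule: lin_span_induct)
    case (step x c f)
    thus ?case using is_charD(1)[OF C(1)[OF step(1)], of g] by (simp add: fun_smult_def)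
  qed simp
  show X: "carrier (char_group G) = C"
  proof
    show "carrier (char_group G) \<subseteq> C"
    proof
      fix \<chi> assume \<chi>: "\<chi> \<in> carrier (char_group G)"
      hence "is_char G \<chi>" unfolding is_char_def char_group_def using zero O by auto
      thus "\<chi> \<in> C" using char_in_span[OF is_group C(1)] \<chi> O by (auto simp: char_group_def)
    qed
    show "C \<subseteq> carrier (char_group G)"
    proof
      fix x assume x: "x \<in> C"
      thus "x \<in> carrier (char_group G)"
        using is_charD(2,3)[OF C(1)[OF x]] lin_span_base[OF x] O by (auto simp: char_group_def)
    qed
  qed
  have "comm_group (char_group G)"
  proof (rule comm_groupI)
    fix x assume x: "x \<in> carrier (char_group G)"
    hence xC: "x \<in> C" by (simp add: X)
    show "\<one>\<^bsub>char_group G\<^esub> \<otimes>\<^bsub>char_group G\<^esub> x = x"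
      using is_charD(1)[OF C(1)[OF xC]] by (auto simp: indicator_def fun_eq_iff)
    show "\<exists>y\<in>carrier (char_group G). y \<otimes>\<^bsub>char_group G\<^esub> x = \<one>\<^bsub>char_group G\<^esub>"
      using C(4)[OF xC] is_charD(1,2)[OF C(1)[OF xC]] unfolding X
      by (intro bexI[of _ "\<lambda>g. inverse (x g)"]) (auto simp: indicator_def fun_eq_iff)
  qed (use C(2,3) in \<open>auto simp: X mult_ac\<close>)
  thus "diagonalizable G"
    by (intro diagonalizable.intro diagonalizable_axioms.intro G) (use C(1) O X in auto)
qed

section \<open>Coordinates in the basis of characters and the coproduct\<close>

context diagonalizable
begin

abbreviation X where "X \<equiv> char_group G"

sublocale X: comm_group X
  by (rule char_comm_group)

definition coef :: "('g \<Rightarrow> complex) \<Rightarrow> ('g \<Rightarrow> complex) \<Rightarrow> complex" where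
  "coef f = (SOME a. finite {x. a x \<noteq> 0} \<and> {x. a x \<noteq> 0} \<subseteq> carrier X \<and> f = \<Lambda> a)"

lemma coef:
  assumes "f \<in> \<O>\<^bsub>G\<^esub>"
  shows "finite {x. coef f x \<noteq> 0}" "{x. coef f x \<noteq> 0} \<subseteq> carrier X" "\<Lambda> (coef f) = f"
proof -
  have "\<exists>a. finite {x. a x \<noteq> 0} \<and> {x. a x \<noteq> 0} \<subseteq> carrier X \<and> f = \<Lambda> a"
    using assms unfolding coord_ring_eq lin_span_def by blast
  from someI_ex[OF this] show "finite {x. coef f x \<noteq> 0}" "{x. coef f x \<noteq> 0} \<subseteq> carrier X" "\<Lambda> (coef f) = f"
    unfolding coef_def by auto
qed

lemma coef_char: "f \<in> \<O>\<^bsub>G\<^esub> \<Longrightarrow> coef f x \<noteq> 0 \<Longrightarrow> x \<in> carrier X"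
  using coef(2) by blast

lemma sum_chars_unique:
  assumes N: "finite N" "N \<subseteq> carrier X"
    and eq: "\<And>g. g \<in> carrier G \<Longrightarrow> (\<Sum>x\<in>N. a x * x g) = (\<Sum>x\<in>N. b x * x g)" and x: "x \<in> N"
  shows "a x = b x"
proof -
  have "a x - b x = 0"
  proof (rule characters_independent[OF is_group, where N = N and c = "\<lambda>x. a x - b x"])
    fix g assume "g \<in> carrier G"
    thus "(\<Sum>x\<in>N. (a x - b x) * x g) = 0" using eq by (simp add: left_diff_distrib sum_subtractf)
  qed (use N x char_is_char in auto)
  thus ?thesis by simp
qed

lemma \<Lambda>_inj:
  assumes "finite {x. a x \<noteq> 0}" "{x. a x \<noteq> 0} \<subseteq> carrier X"
    "finite {x. b x \<noteq> 0}" "{x. b x \<noteq> 0} \<subseteq> carrier X"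
    and eq: "\<And>g. g \<in> carrier G \<Longrightarrow> \<Lambda> a g = \<Lambda> b g"
  shows "a = b"
proof
  fix x
  let ?N = "{x. a x \<noteq> 0} \<union> {x. b x \<noteq> 0}"
  show "a x = b x"
  proof (cases "x \<in> ?N")
    case True
    show ?thesis
    proof (rule sum_chars_unique[of ?N a b x])
      fix g assume "g \<in> carrier G"
      hence "lsum a (\<lambda>x. x g) = lsum b (\<lambda>x. x g)" using eq unfolding \<Lambda>_def by blast
      moreover have "lsum a (\<lambda>x. x g) = (\<Sum>x\<in>?N. a x * x g)" "lsum b (\<lambda>x. x g) = (\<Sum>x\<in>?N. b x * x g)"
        using assms(1,3) by (intro lsum_superset; blast)+
      ultimately show "(\<Sum>x\<in>?N. a x * x g) = (\<Sum>x\<in>?N. b x * x g)" by (simp only:)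
    qed (use assms True in auto)
  qed auto
qed

lemma coef_\<Lambda>:
  assumes "finite {x. a x \<noteq> 0}" "{x. a x \<noteq> 0} \<subseteq> carrier X"
  shows "coef (\<Lambda> a) = a"
proof -
  have "\<Lambda> a \<in> \<O>\<^bsub>G\<^esub>" using assms unfolding coord_ring_eq lin_span_def by blast
  from coef[OF this] show ?thesis by (intro \<Lambda>_inj) (use assms in auto)
qed

lemma char_coord: "x \<in> carrier X \<Longrightarrow> x \<in> \<O>\<^bsub>G\<^esub>"
  unfolding coord_ring_eq by (rule lin_span_base)

lemma coef_of_char: "x \<in> carrier X \<Longrightarrow> coef x = indicator {x}"
  using coef_\<Lambda>[of "indicator {x}"] by (auto simp: \<Lambda>_indicator indicator_def)

lemma coord_add: "f \<in> \<O>\<^bsub>G\<^esub> \<Longrightarrow> h \<in> \<O>\<^bsub>G\<^esub> \<Longrightarrow> f + h \<in> \<O>\<^bsub>G\<^esub>"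
  unfolding coord_ring_eq by (rule lin_span_add)

lemma coord_smult: "f \<in> \<O>\<^bsub>G\<^esub> \<Longrightarrow> fun_smult c f \<in> \<O>\<^bsub>G\<^esub>"
  unfolding coord_ring_eq by (rule lin_span_smult)

lemma coord_0: "0 \<in> \<O>\<^bsub>G\<^esub>"
  unfolding coord_ring_eq by (rule lin_span_0)

lemma coord_outside:
  assumes "f \<in> \<O>\<^bsub>G\<^esub>" "g \<notin> carrier G" shows "f g = 0"
  using assms(1) unfolding coord_ring_eq
proof (induction rule: lin_span_induct)
  case (step x c f)
  thus ?case using is_charD(1)[OF char_is_char[OF step(1)] assms(2)] by (simp add: fun_smult_def)
qed simp

lemma coord_mult:
  assumes "f \<in> \<O>\<^bsub>G\<^esub>" "h \<in> \<O>\<^bsub>G\<^esub>" shows "f * h \<in> \<O>\<^bsub>G\<^esub>"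
  using assms(1) unfolding coord_ring_eq
proof (induction rule: lin_span_induct)
  case zero
  have "0 * h = 0" by simp
  thus ?case using lin_span_0 by (simp only:)
next
  case (step x c f)
  have "x * h \<in> lin_span (carrier X)" using assms(2) unfolding coord_ring_eq
  proof (induction rule: lin_span_induct)
    case zero
    have "x * 0 = 0" by simp
    thus ?case using lin_span_0 by (simp only:)
  next
    case (step y d k)
    have "x * (fun_smult d y + k) = fun_smult d (x * y) + x * k"
      by (rule ext) (simp add: fun_smult_def algebra_simps)
    moreover have "x * y \<in> carrier X" using X.m_closed[OF \<open>x \<in> carrier X\<close> step(1)] by simp
    ultimately show ?case using step by (simp only: lin_span_add lin_span_smult lin_span_base)
  qed
  moreover have "(fun_smult c x + f) * h = fun_smult c (x * h) + f * h"
    by (rule ext) (simp add: fun_smult_def algebra_simps)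
  ultimately show ?case using step by (simp only: lin_span_add lin_span_smult)
qed

lemma coord_one: "indicator (carrier G) \<in> \<O>\<^bsub>G\<^esub>"
  using char_coord[OF X.one_closed] by simp

lemma counit_char: "x \<in> carrier X \<Longrightarrow> counit G x = 1"
  unfolding counit_def by (rule is_char_one[OF is_group char_is_char])

lemma linear_formD:
  assumes "linear_form G L"
  shows "f \<in> \<O>\<^bsub>G\<^esub> \<Longrightarrow> h \<in> \<O>\<^bsub>G\<^esub> \<Longrightarrow> L (f + h) = L f + L h" "f \<in> \<O>\<^bsub>G\<^esub> \<Longrightarrow> L (fun_smult c f) = c * L f"
    "L 0 = 0"
proof -
  show "f \<in> \<O>\<^bsub>G\<^esub> \<Longrightarrow> h \<in> \<O>\<^bsub>G\<^esub> \<Longrightarrow> L (f + h) = L f + L h" "f \<in> \<O>\<^bsub>G\<^esub> \<Longrightarrow> L (fun_smult c f) = c * L f"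
    using assms by (auto simp: linear_form_def)
  have "L (fun_smult 0 0) = 0 * L 0" using assms coord_0 unfolding linear_form_def by blast
  moreover have "fun_smult 0 0 = (0 :: 'g \<Rightarrow> complex)" by (rule ext) (simp add: fun_smult_def)
  ultimately show "L 0 = 0" by (metis mult_zero_left)
qed

lemma coef_add:
  assumes "f \<in> \<O>\<^bsub>G\<^esub>" "h \<in> \<O>\<^bsub>G\<^esub>" shows "coef (f + h) = coef f + coef h"
proof -
  have "{x. (coef f + coef h) x \<noteq> 0} \<subseteq> {x. coef f x \<noteq> 0} \<union> {x. coef h x \<noteq> 0}" by auto
  hence "coef (\<Lambda> (coef f + coef h)) = coef f + coef h"
    using coef(1,2)[OF assms(1)] coef(1,2)[OF assms(2)]
    by (intro coef_\<Lambda>) (meson finite_UnI finite_subset Un_least order_trans)+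
  moreover have "\<Lambda> (coef f + coef h) = f + h"
    using \<Lambda>_add[OF coef(1)[OF assms(1)] coef(1)[OF assms(2)]] coef(3) assms by (simp only:)
  ultimately show ?thesis by (simp only:)
qed

lemma coef_smult:
  assumes "f \<in> \<O>\<^bsub>G\<^esub>" shows "coef (fun_smult c f) = fun_smult c (coef f)"
proof -
  have "{x. fun_smult c (coef f) x \<noteq> 0} \<subseteq> {x. coef f x \<noteq> 0}" by (auto simp: fun_smult_def)
  hence "coef (\<Lambda> (fun_smult c (coef f))) = fun_smult c (coef f)"
    using coef(1,2)[OF assms(1)] by (intro coef_\<Lambda>) (meson finite_subset order_trans)+
  thus ?thesis using coef(3)[OF assms] by (simp only: \<Lambda>_smult)
qed

lemma linear_form_lsum:
  assumes L: "linear_form G L" and f: "f \<in> \<O>\<^bsub>G\<^esub>"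
  shows "L f = lsum (coef f) L"
  using f unfolding coord_ring_eq
proof (induction rule: lin_span_induct)
  case zero
  have "coef (\<Lambda> 0) = 0" by (rule coef_\<Lambda>) simp_all
  hence "coef 0 = 0" by (simp only: \<Lambda>_zero)
  thus ?case using linear_formD(3)[OF L] by (simp only: lsum_0)
next
  case (step x c f)
  hence xf: "x \<in> \<O>\<^bsub>G\<^esub>" "f \<in> \<O>\<^bsub>G\<^esub>" using char_coord coord_ring_eq by auto
  have cx: "fun_smult c x \<in> \<O>\<^bsub>G\<^esub>" by (rule coord_smult[OF xf(1)])
  have "lsum (coef (fun_smult c x + f)) L = c * lsum (coef x) L + lsum (coef f) L"
    using coef(1)[OF cx] coef(1)[OF xf(2)]
    by (simp only: coef_add[OF cx xf(2)] lsum_add) (simp only: coef_smult[OF xf(1)] lsum_smult)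
  also have "lsum (coef x) L = L x" by (simp add: coef_of_char[OF step(1)])
  also have "c * L x + lsum (coef f) L = L (fun_smult c x + f)"
    using step(3) linear_formD(1)[OF L cx xf(2)] linear_formD(2)[OF L xf(1)] by (simp only:)
  finally show ?case by (rule sym)
qed

lemma linear_formI_lsum: "linear_form G (\<lambda>f. lsum (coef f) k)"
  unfolding linear_form_def
proof (intro conjI ballI allI)
  fix f h assume "f \<in> \<O>\<^bsub>G\<^esub>" "h \<in> \<O>\<^bsub>G\<^esub>"
  thus "lsum (coef (f + h)) k = lsum (coef f) k + lsum (coef h) k"
    using coef(1) by (simp only: coef_add lsum_add)
qed (simp add: coef_smult lsum_smult)

lemma linear_form_eval: "linear_form G (\<lambda>f. f g)"
  by (simp add: linear_form_def fun_smult_def)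

lemma linear_form_cmult: "linear_form G L \<Longrightarrow> linear_form G (\<lambda>f. L f * c)"
  "linear_form G L \<Longrightarrow> linear_form G (\<lambda>f. c * L f)"
  by (simp_all add: linear_form_def algebra_simps)

lemma linear_form_mult_arg: "linear_form G L \<Longrightarrow> h \<in> \<O>\<^bsub>G\<^esub> \<Longrightarrow> linear_form G (\<lambda>f. L (f * h))"
  and linear_form_mult_arg': "linear_form G L \<Longrightarrow> h \<in> \<O>\<^bsub>G\<^esub> \<Longrightarrow> linear_form G (\<lambda>f. L (h * f))"
proof -
  have *: "linear_form G (\<lambda>f. L (f * h))" if L: "linear_form G L" and h: "h \<in> \<O>\<^bsub>G\<^esub>"
    unfolding linear_form_def
  proof (intro conjI ballI allI)
    fix f f' assume f: "f \<in> \<O>\<^bsub>G\<^esub>" "f' \<in> \<O>\<^bsub>G\<^esub>"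
    have "(f + f') * h = f * h + f' * h" by (simp add: algebra_simps)
    thus "L ((f + f') * h) = L (f * h) + L (f' * h)"
      using linear_formD(1)[OF L coord_mult[OF f(1) h] coord_mult[OF f(2) h]] by (simp only:)
  next
    fix c f assume f: "f \<in> \<O>\<^bsub>G\<^esub>"
    have "fun_smult c f * h = fun_smult c (f * h)" by (simp add: fun_smult_def fun_eq_iff)
    thus "L (fun_smult c f * h) = c * L (f * h)"
      using linear_formD(2)[OF L coord_mult[OF f h]] by (simp only:)
  qed
  show "linear_form G L \<Longrightarrow> h \<in> \<O>\<^bsub>G\<^esub> \<Longrightarrow> linear_form G (\<lambda>f. L (f * h))" by (rule *)
  show "linear_form G L \<Longrightarrow> h \<in> \<O>\<^bsub>G\<^esub> \<Longrightarrow> linear_form G (\<lambda>f. L (h * f))" using * by (simp add: mult.commute)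
qed

lemma bilinear_lsum:
  assumes B: "bilinear_form G B" and f: "f \<in> \<O>\<^bsub>G\<^esub>" "h \<in> \<O>\<^bsub>G\<^esub>"
  shows "B f h = lsum (coef f) (\<lambda>x. lsum (coef h) (\<lambda>y. B x y))"
proof -
  have "B f h = lsum (coef f) (\<lambda>x. B x h)"
    by (rule linear_form_lsum[OF _ f(1)]) (use B f in \<open>simp add: bilinear_form_def\<close>)
  also have "\<dots> = lsum (coef f) (\<lambda>x. lsum (coef h) (\<lambda>y. B x y))"
    by (intro lsum_cong linear_form_lsum f)
      (use B coef_char[OF f(1)] char_coord in \<open>auto simp: bilinear_form_def\<close>)
  finally show ?thesis .
qed

text \<open>The definition chooses a representing list; the list of \<open>coef f x\<close> times
  \<open>x\<close>, paired with \<open>x\<close>, shows that there is one.\<close>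

lemma coproduct:
  assumes f: "f \<in> \<O>\<^bsub>G\<^esub>"
  shows "set (coproduct G f) \<subseteq> \<O>\<^bsub>G\<^esub> \<times> \<O>\<^bsub>G\<^esub>"
    "\<And>g h. g \<in> carrier G \<Longrightarrow> h \<in> carrier G \<Longrightarrow> f (g \<otimes>\<^bsub>G\<^esub> h) = (\<Sum>(a1, a2)\<leftarrow>coproduct G f. a1 g * a2 h)"
proof -
  obtain xs where xs: "set xs = {x. coef f x \<noteq> 0}" "distinct xs"
    using finite_distinct_list[OF coef(1)[OF f]] by blast
  let ?ps = "map (\<lambda>x. (fun_smult (coef f x) x, x)) xs"
  have "set ?ps \<subseteq> \<O>\<^bsub>G\<^esub> \<times> \<O>\<^bsub>G\<^esub>"
    using xs coef(2)[OF f] char_coord coord_smult by auto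
  moreover have "f (g \<otimes>\<^bsub>G\<^esub> h) = (\<Sum>(a1, a2)\<leftarrow>?ps. a1 g * a2 h)" if gh: "g \<in> carrier G" "h \<in> carrier G" for g h
  proof -
    have "f (g \<otimes>\<^bsub>G\<^esub> h) = lsum (coef f) (\<lambda>x. x g * x h)"
      using linear_form_lsum[OF linear_form_eval f, of "g \<otimes>\<^bsub>G\<^esub> h"] gh
      by (auto intro!: lsum_cong simp: is_charD(3)[OF char_is_char[OF coef_char[OF f]]])
    also have "\<dots> = (\<Sum>x\<leftarrow>xs. coef f x * (x g * x h))"
      using xs by (simp add: lsum_def sum_list_distinct_conv_sum_set)
    finally show ?thesis by (simp add: comp_def fun_smult_def mult.assoc)
  qed
  ultimately have "\<exists>ps. set ps \<subseteq> \<O>\<^bsub>G\<^esub> \<times> \<O>\<^bsub>G\<^esub> \<and>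
     (\<forall>g\<in>carrier G. \<forall>h\<in>carrier G. f (g \<otimes>\<^bsub>G\<^esub> h) = (\<Sum>(a1, a2)\<leftarrow>ps. a1 g * a2 h))"
    by blast
  from someI_ex[OF this]
  show "set (coproduct G f) \<subseteq> \<O>\<^bsub>G\<^esub> \<times> \<O>\<^bsub>G\<^esub>"
    "\<And>g h. g \<in> carrier G \<Longrightarrow> h \<in> carrier G \<Longrightarrow> f (g \<otimes>\<^bsub>G\<^esub> h) = (\<Sum>(a1, a2)\<leftarrow>coproduct G f. a1 g * a2 h)"
    unfolding coproduct_def by blast+
qed

lemma sum_list_sum: "(\<Sum>p\<leftarrow>ps. \<Sum>x\<in>N. F p x) = (\<Sum>x\<in>N. \<Sum>p\<leftarrow>ps. F p x :: complex)"
  by (induction ps) (simp_all add: sum.distrib)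

text \<open>Characters are group-like: by independence \<open>\<Delta>(\<Sum> c\<^sub>x x) = \<Sum> c\<^sub>x x \<otimes> x\<close>, whatever list represents it.\<close>

theorem sum_coproduct:
  assumes B: "bilinear_form G B" and f: "f \<in> \<O>\<^bsub>G\<^esub>"
  shows "(\<Sum>(a1, a2)\<leftarrow>coproduct G f. B a1 a2) = lsum (coef f) (\<lambda>x. B x x)"
proof -
  let ?ps = "coproduct G f"
  have ps: "fst p \<in> \<O>\<^bsub>G\<^esub>" "snd p \<in> \<O>\<^bsub>G\<^esub>" if "p \<in> set ?ps" for p
    using coproduct(1)[OF f] that by auto
  define N where "N = {x. coef f x \<noteq> 0} \<union>
     (\<Union>p\<in>set ?ps. {x. coef (fst p) x \<noteq> 0} \<union> {x. coef (snd p) x \<noteq> 0})"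
  have N: "finite N" "N \<subseteq> carrier X"
    unfolding N_def using coef(1,2)[OF f] coef(1,2)[OF ps(1)] coef(1,2)[OF ps(2)] by blast+
  have supN: "{x. coef f x \<noteq> 0} \<subseteq> N"
    "\<And>p. p \<in> set ?ps \<Longrightarrow> {x. coef (fst p) x \<noteq> 0} \<subseteq> N" "\<And>p. p \<in> set ?ps \<Longrightarrow> {x. coef (snd p) x \<noteq> 0} \<subseteq> N"
    unfolding N_def by blast+
  \<comment> \<open>Coefficients of the chosen tensor with respect to the tensors of two
    characters.\<close>
  define M where "M x y = (\<Sum>p\<leftarrow>?ps. coef (fst p) x * coef (snd p) y)" for x y
  have expand: "(\<Sum>p\<leftarrow>?ps. C (fst p) (snd p)) = (\<Sum>x\<in>N. \<Sum>y\<in>N. M x y * C x y)"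
    if C: "bilinear_form G C" for C
  proof -
    have "(\<Sum>p\<leftarrow>?ps. C (fst p) (snd p)) =
        (\<Sum>p\<leftarrow>?ps. \<Sum>x\<in>N. \<Sum>y\<in>N. coef (fst p) x * coef (snd p) y * C x y)"
    proof (intro arg_cong[of _ _ sum_list] map_cong refl)
      fix p assume p: "p \<in> set ?ps"
      have "C (fst p) (snd p) = lsum (coef (fst p)) (\<lambda>x. lsum (coef (snd p)) (\<lambda>y. C x y))"
        by (rule bilinear_lsum[OF C ps[OF p]])
      also have "\<dots> = (\<Sum>x\<in>N. \<Sum>y\<in>N. coef (fst p) x * coef (snd p) y * C x y)"
        by (simp add: lsum_superset[OF N(1) supN(2)[OF p]] lsum_superset[OF N(1) supN(3)[OF p]]
            sum_distrib_left mult.assoc)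
      finally show "C (fst p) (snd p) = (\<Sum>x\<in>N. \<Sum>y\<in>N. coef (fst p) x * coef (snd p) y * C x y)" .
    qed
    also have "\<dots> = (\<Sum>x\<in>N. \<Sum>y\<in>N. M x y * C x y)"
      unfolding sum_list_sum M_def by (simp add: sum_list_mult_const)
    finally show ?thesis .
  qed
  \<comment> \<open>Independence is used twice: in the first variable with the second evaluated at
    \<open>h\<close>, and then in the second.\<close>
  have M: "M x y = (if x = y then coef f x else 0)" if xy: "x \<in> N" "y \<in> N" for x y
  proof -
    have 1: "(\<Sum>y\<in>N. M x y * y h) = coef f x * x h" if h: "h \<in> carrier G" and x: "x \<in> N" for x h
    proof (rule sum_chars_unique[OF N _ x])
      fix g assume g: "g \<in> carrier G"
      have bil: "bilinear_form G (\<lambda>a b. a g * b h)"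
        by (simp add: bilinear_form_def linear_form_def fun_smult_def algebra_simps)
      have "(\<Sum>x\<in>N. (\<Sum>y\<in>N. M x y * y h) * x g) = (\<Sum>x\<in>N. \<Sum>y\<in>N. M x y * (x g * y h))"
        by (simp add: sum_distrib_right sum_distrib_left mult_ac)
      also have "\<dots> = f (g \<otimes>\<^bsub>G\<^esub> h)"
        using expand[OF bil] coproduct(2)[OF f g h] by (simp add: case_prod_unfold)
      also have "\<dots> = lsum (coef f) (\<lambda>x. x h * x g)"
        using linear_form_lsum[OF linear_form_eval f, of "g \<otimes>\<^bsub>G\<^esub> h"] g h
        by (auto intro!: lsum_cong simp: is_charD(3)[OF char_is_char[OF coef_char[OF f]]])
      also have "\<dots> = (\<Sum>x\<in>N. (coef f x * x h) * x g)"
        by (simp add: lsum_superset[OF N(1) supN(1)] mult.assoc)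
      finally show "(\<Sum>x\<in>N. (\<Sum>y\<in>N. M x y * y h) * x g) = (\<Sum>x\<in>N. (coef f x * x h) * x g)" .
    qed
    show ?thesis
    proof (rule sum_chars_unique[OF N _ xy(2)])
      fix h assume h: "h \<in> carrier G"
      have "(\<Sum>y\<in>N. (if x = y then coef f x else 0) * y h) = (\<Sum>y\<in>N. if x = y then coef f x * y h else 0)"
        by (rule sum.cong) auto
      thus "(\<Sum>y\<in>N. M x y * y h) = (\<Sum>y\<in>N. (if x = y then coef f x else 0) * y h)"
        using 1[OF h xy(1)] xy(1) N(1) by simp
    qed
  qed
  have "(\<Sum>(a1, a2)\<leftarrow>?ps. B a1 a2) = (\<Sum>x\<in>N. \<Sum>y\<in>N. M x y * B x y)"
    using expand[OF B] by (simp add: case_prod_unfold)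
  also have "\<dots> = (\<Sum>x\<in>N. \<Sum>y\<in>N. if x = y then coef f x * B x y else 0)"
    by (intro sum.cong refl) (simp add: M)
  also have "\<dots> = (\<Sum>x\<in>N. coef f x * B x x)" using N(1) by simp
  also have "\<dots> = lsum (coef f) (\<lambda>x. B x x)" by (simp add: lsum_superset[OF N(1) supN(1)])
  finally show ?thesis .
qed

section \<open>Convolution of forms and the cocycle on characters\<close>

lemma bilinear_formI:
  assumes "\<And>f. f \<in> \<O>\<^bsub>G\<^esub> \<Longrightarrow> linear_form G (B f)" "\<And>f. f \<in> \<O>\<^bsub>G\<^esub> \<Longrightarrow> linear_form G (\<lambda>h. B h f)"
  shows "bilinear_form G B"
  using assms by (simp add: bilinear_form_def)

lemma bilinear_formD:
  "bilinear_form G B \<Longrightarrow> f \<in> \<O>\<^bsub>G\<^esub> \<Longrightarrow> linear_form G (B f)"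
  "bilinear_form G B \<Longrightarrow> f \<in> \<O>\<^bsub>G\<^esub> \<Longrightarrow> linear_form G (\<lambda>h. B h f)"
  by (simp_all add: bilinear_form_def)

lemma linear_form_lsum_family:
  assumes "\<And>y. a y \<noteq> 0 \<Longrightarrow> linear_form G (\<lambda>f. L f y)"
  shows "linear_form G (\<lambda>f. lsum a (L f))"
  unfolding linear_form_def
proof (intro conjI ballI allI)
  fix f h assume fh: "f \<in> \<O>\<^bsub>G\<^esub>" "h \<in> \<O>\<^bsub>G\<^esub>"
  have "lsum a (L (f + h)) = lsum a (\<lambda>y. L f y + L h y)"
    using assms fh by (intro lsum_cong) (simp add: linear_form_def)
  thus "lsum a (L (f + h)) = lsum a (L f) + lsum a (L h)"
    by (simp add: lsum_def sum.distrib algebra_simps)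
next
  fix c f assume f: "f \<in> \<O>\<^bsub>G\<^esub>"
  have "lsum a (L (fun_smult c f)) = lsum a (\<lambda>y. c * L f y)"
    using assms f by (intro lsum_cong) (simp add: linear_form_def)
  thus "lsum a (L (fun_smult c f)) = c * lsum a (L f)" by (simp add: lsum_mult_right(1))
qed

lemma sum_coproduct2:
  assumes f: "f \<in> \<O>\<^bsub>G\<^esub>" "h \<in> \<O>\<^bsub>G\<^esub>"
    and B1: "\<And>b1 b2. b1 \<in> \<O>\<^bsub>G\<^esub> \<Longrightarrow> b2 \<in> \<O>\<^bsub>G\<^esub> \<Longrightarrow> bilinear_form G (\<lambda>a1 a2. B a1 a2 b1 b2)"
    and B2: "\<And>a1 a2. a1 \<in> \<O>\<^bsub>G\<^esub> \<Longrightarrow> a2 \<in> \<O>\<^bsub>G\<^esub> \<Longrightarrow> bilinear_form G (B a1 a2)"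
  shows "(\<Sum>(a1, a2)\<leftarrow>coproduct G f. \<Sum>(b1, b2)\<leftarrow>coproduct G h. B a1 a2 b1 b2) =
    lsum (coef f) (\<lambda>x. lsum (coef h) (\<lambda>y. B x x y y))"
proof -
  have "(\<Sum>(a1, a2)\<leftarrow>coproduct G f. \<Sum>(b1, b2)\<leftarrow>coproduct G h. B a1 a2 b1 b2) =
      (\<Sum>(a1, a2)\<leftarrow>coproduct G f. lsum (coef h) (\<lambda>y. B a1 a2 y y))"
  proof (intro arg_cong[of _ _ sum_list] map_cong refl)
    fix p assume "p \<in> set (coproduct G f)"
    hence "fst p \<in> \<O>\<^bsub>G\<^esub>" "snd p \<in> \<O>\<^bsub>G\<^esub>" using coproduct(1)[OF f(1)] by auto
    from sum_coproduct[OF B2[OF this] f(2)]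
    show "(case p of (a1, a2) \<Rightarrow> \<Sum>(b1, b2)\<leftarrow>coproduct G h. B a1 a2 b1 b2) =
        (case p of (a1, a2) \<Rightarrow> lsum (coef h) (\<lambda>y. B a1 a2 y y))"
      by (simp add: case_prod_unfold)
  qed
  also have "\<dots> = lsum (coef f) (\<lambda>x. lsum (coef h) (\<lambda>y. B x x y y))"
  proof (rule sum_coproduct[OF bilinear_formI f(1)])
    have y: "y \<in> \<O>\<^bsub>G\<^esub>" if "coef h y \<noteq> 0" for y using coef_char[OF f(2) that] char_coord by blast
    show "linear_form G (\<lambda>a2. lsum (coef h) (\<lambda>y. B a1 a2 y y))" if "a1 \<in> \<O>\<^bsub>G\<^esub>" for a1
      by (rule linear_form_lsum_family, rule bilinear_formD(1)[OF B1 that]) (use y in auto)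
    show "linear_form G (\<lambda>a1. lsum (coef h) (\<lambda>y. B a1 a2 y y))" if "a2 \<in> \<O>\<^bsub>G\<^esub>" for a2
      by (rule linear_form_lsum_family, rule bilinear_formD(2)[OF B1 that]) (use y in auto)
  qed
  finally show ?thesis .
qed

lemma conv1_char:
  assumes "linear_form G L" "linear_form G M" "x \<in> carrier X"
  shows "conv1 G L M x = L x * M x"
proof -
  have "bilinear_form G (\<lambda>a b. L a * M b)"
    by (rule bilinear_formI) (auto intro: linear_form_cmult assms)
  thus ?thesis unfolding conv1_def using assms(3) by (simp add: sum_coproduct char_coord coef_of_char)
qed

lemma conv2_eq:
  assumes J: "bilinear_form G J" and K: "bilinear_form G K" and f: "f \<in> \<O>\<^bsub>G\<^esub>" "h \<in> \<O>\<^bsub>G\<^esub>"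
  shows "conv2 G J K f h = lsum (coef f) (\<lambda>x. lsum (coef h) (\<lambda>y. J x y * K x y))"
  unfolding conv2_def
proof (rule sum_coproduct2[OF f])
  show "bilinear_form G (\<lambda>a1 a2. J a1 b1 * K a2 b2)" if "b1 \<in> \<O>\<^bsub>G\<^esub>" "b2 \<in> \<O>\<^bsub>G\<^esub>" for b1 b2
    by (rule bilinear_formI) (auto intro: linear_form_cmult bilinear_formD(2)[OF J that(1)] bilinear_formD(2)[OF K that(2)])
  show "bilinear_form G (\<lambda>b1 b2. J a1 b1 * K a2 b2)" if "a1 \<in> \<O>\<^bsub>G\<^esub>" "a2 \<in> \<O>\<^bsub>G\<^esub>" for a1 a2
    by (rule bilinear_formI) (auto intro: linear_form_cmult bilinear_formD(1)[OF J that(1)] bilinear_formD(1)[OF K that(2)])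
qed

lemma conv2_char:
  "bilinear_form G J \<Longrightarrow> bilinear_form G K \<Longrightarrow> x \<in> carrier X \<Longrightarrow> y \<in> carrier X \<Longrightarrow>
    conv2 G J K x y = J x y * K x y"
  by (simp add: conv2_eq char_coord coef_of_char)

lemma bilinear_form_cong:
  assumes "\<And>f h. f \<in> \<O>\<^bsub>G\<^esub> \<Longrightarrow> h \<in> \<O>\<^bsub>G\<^esub> \<Longrightarrow> B f h = C f h" "bilinear_form G C"
  shows "bilinear_form G B"
  using assms coord_add coord_smult unfolding bilinear_form_def linear_form_def by simp

lemma bilinear_conv2:
  assumes "bilinear_form G J" "bilinear_form G K" shows "bilinear_form G (conv2 G J K)"
proof (rule bilinear_form_cong[OF conv2_eq[OF assms]])
  show "bilinear_form G (\<lambda>f h. lsum (coef f) (\<lambda>x. lsum (coef h) (\<lambda>y. J x y * K x y)))"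
  proof (rule bilinear_formI)
    show "linear_form G (\<lambda>h. lsum (coef f) (\<lambda>x. lsum (coef h) (\<lambda>y. J x y * K x y)))" for f
      by (rule linear_form_lsum_family) (rule linear_formI_lsum)
  qed (rule linear_formI_lsum)
qed

lemma conv2_inverse_char:
  assumes "bilinear_form G J" "conv2_inverse G J K" "x \<in> carrier X" "y \<in> carrier X"
  shows "J x y * K x y = 1"
proof -
  have "bilinear_form G K" "conv2 G J K x y = counit G x * counit G y"
    using assms char_coord by (auto simp: conv2_inverse_def)
  thus ?thesis using assms by (simp add: conv2_char counit_char)
qed

lemma conv2_inv_char:
  assumes "bilinear_form G J" "\<exists>K. conv2_inverse G J K"
  shows "bilinear_form G (conv2_inv G J)"
    "x \<in> carrier X \<Longrightarrow> y \<in> carrier X \<Longrightarrow> conv2_inv G J x y = inverse (J x y)"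
proof -
  have inv: "conv2_inverse G J (conv2_inv G J)" unfolding conv2_inv_def by (rule someI_ex[OF assms(2)])
  thus "bilinear_form G (conv2_inv G J)" by (simp add: conv2_inverse_def)
  assume xy: "x \<in> carrier X" "y \<in> carrier X"
  show "conv2_inv G J x y = inverse (J x y)"
    using conv2_inverse_char[OF assms(1) inv xy] by (metis inverse_unique)
qed

lemma bilinear_flip: "bilinear_form G J \<Longrightarrow> bilinear_form G (\<lambda>a b. J b a)"
  by (simp add: bilinear_form_def)

lemma conv2_flip:
  assumes "bilinear_form G J" "bilinear_form G K" "f \<in> \<O>\<^bsub>G\<^esub>" "h \<in> \<O>\<^bsub>G\<^esub>"
  shows "conv2 G (\<lambda>a b. J b a) (\<lambda>a b. K b a) f h = conv2 G J K h f"
  unfolding conv2_eq[OF bilinear_flip[OF assms(1)] bilinear_flip[OF assms(2)] assms(3,4)]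
    conv2_eq[OF assms(1,2,4,3)]
  by (rule lsum_swap)

text \<open>Flipping commutes with convolution, so the flip of an inverse of \<open>J\<close> is an
  inverse of the flip; hence the inverse chosen in \<open>R_form\<close> exists and is the pointwise
  reciprocal on characters.\<close>

lemma R_form_char:
  assumes "bilinear_form G J" "\<exists>K. conv2_inverse G J K"
  shows "bilinear_form G (R_form G J)"
    "x \<in> carrier X \<Longrightarrow> y \<in> carrier X \<Longrightarrow> R_form G J x y = J x y / J y x"
proof -
  obtain K where K: "conv2_inverse G J K" using assms(2) by blast
  hence bK: "bilinear_form G K" by (simp add: conv2_inverse_def)
  have "conv2_inverse G (\<lambda>a b. J b a) (\<lambda>a b. K b a)"
    unfolding conv2_inverse_def
  proof (intro conjI ballI)
    show "bilinear_form G (\<lambda>a b. K b a)" by (rule bilinear_flip[OF bK])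
    fix f h assume fh: "f \<in> \<O>\<^bsub>G\<^esub>" "h \<in> \<O>\<^bsub>G\<^esub>"
    show "conv2 G (\<lambda>a b. J b a) (\<lambda>a b. K b a) f h = counit G f * counit G h"
      unfolding conv2_flip[OF assms(1) bK fh] using K fh by (simp add: conv2_inverse_def)
    show "conv2 G (\<lambda>a b. K b a) (\<lambda>a b. J b a) f h = counit G f * counit G h"
      unfolding conv2_flip[OF bK assms(1) fh] using K fh by (simp add: conv2_inverse_def)
  qed
  hence ex: "\<exists>K. conv2_inverse G (\<lambda>a b. J b a) K" by blast
  note inv = conv2_inv_char[OF bilinear_flip[OF assms(1)] ex]
  show "bilinear_form G (R_form G J)" unfolding R_form_def by (rule bilinear_conv2[OF inv(1) assms(1)])
  show "x \<in> carrier X \<Longrightarrow> y \<in> carrier X \<Longrightarrow> R_form G J x y = J x y / J y x"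
    unfolding R_form_def by (simp add: conv2_char[OF inv(1) assms(1)] inv(2) divide_inverse)
qed

lemma hopf_2_cocycleD:
  assumes "hopf_2_cocycle G J"
  shows "bilinear_form G J" "\<exists>K. conv2_inverse G J K"
  using assms by (simp_all add: hopf_2_cocycle_def)

text \<open>On characters every Sweedler sum collapses to one term, so the Hopf cocycle identity
  becomes the group cocycle identity and convolution invertibility becomes nonvanishing.\<close>

theorem hopf_2_cocycle_group_cocycle:
  assumes J: "hopf_2_cocycle G J" shows "group_2_cocycle X J"
  unfolding group_2_cocycle_def
proof (intro conjI ballI)
  note bil = hopf_2_cocycleD(1)[OF J]
  obtain K where K: "conv2_inverse G J K" using hopf_2_cocycleD(2)[OF J] by blast
  fix x assume x: "x \<in> carrier X"
  show "J x \<one>\<^bsub>X\<^esub> = 1" "J \<one>\<^bsub>X\<^esub> x = 1"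
    using J char_coord[OF x] counit_char[OF x] by (auto simp: hopf_2_cocycle_def)
  fix y assume y: "y \<in> carrier X"
  show "J x y \<noteq> 0" using conv2_inverse_char[OF bil K x y] by auto
  fix z assume z: "z \<in> carrier X"
  note O = char_coord[OF x] char_coord[OF y] char_coord[OF z]
  have "(\<Sum>(a1, a2)\<leftarrow>coproduct G x. \<Sum>(b1, b2)\<leftarrow>coproduct G y. J (a1 * b1) z * J a2 b2) = J (x * y) z * J x y"
  proof (subst sum_coproduct2[OF O(1,2)])
    show "bilinear_form G (\<lambda>a1 a2. J (a1 * b1) z * J a2 b2)" if "b1 \<in> \<O>\<^bsub>G\<^esub>" "b2 \<in> \<O>\<^bsub>G\<^esub>" for b1 b2
      by (rule bilinear_formI) (auto intro!: linear_form_cmult linear_form_mult_arg[where L = "\<lambda>a. J a z"]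
          bilinear_formD(2)[OF bil] O that)
    show "bilinear_form G (\<lambda>b1 b2. J (a1 * b1) z * J a2 b2)" if "a1 \<in> \<O>\<^bsub>G\<^esub>" "a2 \<in> \<O>\<^bsub>G\<^esub>" for a1 a2
      by (rule bilinear_formI) (auto intro!: linear_form_cmult linear_form_mult_arg'[where L = "\<lambda>a. J a z"]
          bilinear_formD[OF bil] O that)
  qed (simp add: coef_of_char x y)
  moreover have "(\<Sum>(b1, b2)\<leftarrow>coproduct G y. \<Sum>(c1, c2)\<leftarrow>coproduct G z. J x (b1 * c1) * J b2 c2) = J x (y * z) * J y z"
  proof (subst sum_coproduct2[OF O(2,3)])
    show "bilinear_form G (\<lambda>a1 a2. J x (a1 * b1) * J a2 b2)" if "b1 \<in> \<O>\<^bsub>G\<^esub>" "b2 \<in> \<O>\<^bsub>G\<^esub>" for b1 b2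
      by (rule bilinear_formI) (auto intro!: linear_form_cmult linear_form_mult_arg[where L = "J x"]
          bilinear_formD[OF bil] O that)
    show "bilinear_form G (\<lambda>b1 b2. J x (a1 * b1) * J a2 b2)" if "a1 \<in> \<O>\<^bsub>G\<^esub>" "a2 \<in> \<O>\<^bsub>G\<^esub>" for a1 a2
      by (rule bilinear_formI) (auto intro!: linear_form_cmult linear_form_mult_arg'[where L = "J x"]
          bilinear_formD[OF bil] O that)
  qed (simp add: coef_of_char y z)
  ultimately show "J x y * J (x \<otimes>\<^bsub>X\<^esub> y) z = J x (y \<otimes>\<^bsub>X\<^esub> z) * J y z"
    using J O unfolding hopf_2_cocycle_def by (simp add: mult.commute)
qed

section \<open>Twisted coordinate algebras as twisted group algebras\<close>

lemma sum_list_fun_apply: "(\<Sum>p\<leftarrow>ps. F p) g = (\<Sum>p\<leftarrow>ps. F p g :: complex)"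
  by (induction ps) simp_all

lemma \<Lambda>_bij: "bij_betw \<Lambda> (carrier (twisted_group_algebra X \<sigma>)) \<O>\<^bsub>G\<^esub>"
proof (rule bij_betw_byWitness[where f' = coef])
  show "\<forall>a\<in>carrier (twisted_group_algebra X \<sigma>). coef (\<Lambda> a) = a"
    by (simp add: twisted_group_algebra_def coef_\<Lambda>)
  show "\<forall>f\<in>\<O>\<^bsub>G\<^esub>. \<Lambda> (coef f) = f" by (simp add: coef)
  show "\<Lambda> ` carrier (twisted_group_algebra X \<sigma>) \<subseteq> \<O>\<^bsub>G\<^esub>"
    unfolding coord_ring_eq lin_span_def twisted_group_algebra_def by auto
  show "coef ` \<O>\<^bsub>G\<^esub> \<subseteq> carrier (twisted_group_algebra X \<sigma>)"
    unfolding twisted_group_algebra_def using coef(1,2) by auto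
qed

text \<open>Serves the right twist, the left twist and the untwisted algebra alike, which differ
  only in the cocycle of the product formula.\<close>

lemma twist_iso:
  assumes \<sigma>: "group_2_cocycle X \<sigma>"
    and B: "carrier B = \<O>\<^bsub>G\<^esub>" "\<And>f h. f \<oplus>\<^bsub>B\<^esub> h = f + h" "\<one>\<^bsub>B\<^esub> = indicator (carrier G)"
      "\<zero>\<^bsub>B\<^esub> = 0" "\<And>c f. c \<odot>\<^bsub>B\<^esub> f = fun_smult c f"
    and mult: "\<And>f h g. f \<in> \<O>\<^bsub>G\<^esub> \<Longrightarrow> h \<in> \<O>\<^bsub>G\<^esub> \<Longrightarrow>
      (f \<otimes>\<^bsub>B\<^esub> h) g = lsum (coef f) (\<lambda>x. lsum (coef h) (\<lambda>y. \<sigma> x y * (x g * y g)))"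
  shows "calg_iso \<Lambda> (twisted_group_algebra X \<sigma>) B"
proof (rule calg_isoI)
  interpret tw: twisted_group X \<sigma> by unfold_locales fact
  show "bij_betw \<Lambda> (carrier tw.A) (carrier B)" unfolding B(1) by (rule \<Lambda>_bij)
  fix a b assume ab: "a \<in> carrier tw.A" "b \<in> carrier tw.A"
  have O: "\<Lambda> a \<in> \<O>\<^bsub>G\<^esub>" "\<Lambda> b \<in> \<O>\<^bsub>G\<^esub>" using ab bij_betwE[OF \<Lambda>_bij, of \<sigma>] by blast+
  have ca: "coef (\<Lambda> a) = a" "coef (\<Lambda> b) = b" using ab by (simp_all add: tw.mem_carrier coef_\<Lambda>)
  show "\<Lambda> (a \<otimes>\<^bsub>tw.A\<^esub> b) = \<Lambda> a \<otimes>\<^bsub>B\<^esub> \<Lambda> b"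
  proof
    fix g
    have "\<Lambda> (a \<otimes>\<^bsub>tw.A\<^esub> b) g = lsum a (\<lambda>x. lsum b (\<lambda>y. \<sigma> x y * (x g * y g)))"
      unfolding \<Lambda>_def tw.lsum_mult[OF ab] by simp
    thus "\<Lambda> (a \<otimes>\<^bsub>tw.A\<^esub> b) g = (\<Lambda> a \<otimes>\<^bsub>B\<^esub> \<Lambda> b) g" unfolding mult[OF O] ca .
  qed
  show "\<Lambda> (a \<oplus>\<^bsub>tw.A\<^esub> b) = \<Lambda> a \<oplus>\<^bsub>B\<^esub> \<Lambda> b"
    using \<Lambda>_add[OF tw.finite_support[OF ab(1)] tw.finite_support[OF ab(2)]] by (simp only: tw.A_simps B)
next
  interpret tw: twisted_group X \<sigma> by unfold_locales fact
  show "\<Lambda> \<one>\<^bsub>tw.A\<^esub> = \<one>\<^bsub>B\<^esub>" by (simp add: \<Lambda>_indicator B)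
  show "\<Lambda> \<zero>\<^bsub>tw.A\<^esub> = \<zero>\<^bsub>B\<^esub>" using \<Lambda>_zero by (simp only: tw.A_simps B)
  show "\<Lambda> (c \<odot>\<^bsub>tw.A\<^esub> a) = c \<odot>\<^bsub>B\<^esub> \<Lambda> a" for c a by (simp only: tw.A_simps B \<Lambda>_smult)
qed

theorem right_twist_iso:
  assumes J: "hopf_2_cocycle G J"
  shows "calg_iso \<Lambda> (twisted_group_algebra X J) (right_twist G J)"
proof (rule twist_iso[OF hopf_2_cocycle_group_cocycle[OF J]])
  note bil = hopf_2_cocycleD(1)[OF J]
  fix f h g assume f: "f \<in> \<O>\<^bsub>G\<^esub>" "h \<in> \<O>\<^bsub>G\<^esub>"
  have "(f \<otimes>\<^bsub>right_twist G J\<^esub> h) g =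
      (\<Sum>(a1, a2)\<leftarrow>coproduct G f. \<Sum>(b1, b2)\<leftarrow>coproduct G h. J a2 b2 * (a1 g * b1 g))"
    by (simp add: right_twist_def sum_list_fun_apply case_prod_unfold) (simp add: fun_smult_def)
  also have "\<dots> = lsum (coef f) (\<lambda>x. lsum (coef h) (\<lambda>y. J x y * (x g * y g)))"
  proof (rule sum_coproduct2[OF f])
    show "bilinear_form G (\<lambda>a1 a2. J a2 b2 * (a1 g * b1 g))" if "b1 \<in> \<O>\<^bsub>G\<^esub>" "b2 \<in> \<O>\<^bsub>G\<^esub>" for b1 b2
      by (rule bilinear_formI) (auto intro!: linear_form_cmult linear_form_eval bilinear_formD[OF bil] that)
    show "bilinear_form G (\<lambda>b1 b2. J a2 b2 * (a1 g * b1 g))" if "a1 \<in> \<O>\<^bsub>G\<^esub>" "a2 \<in> \<O>\<^bsub>G\<^esub>" for a1 a2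
      by (rule bilinear_formI) (auto intro!: linear_form_cmult linear_form_eval bilinear_formD[OF bil] that)
  qed
  finally show "(f \<otimes>\<^bsub>right_twist G J\<^esub> h) g = lsum (coef f) (\<lambda>x. lsum (coef h) (\<lambda>y. J x y * (x g * y g)))" .
qed (simp_all add: right_twist_def coord_algebra_def)

theorem left_twist_iso:
  assumes K: "bilinear_form G K" "group_2_cocycle X K"
  shows "calg_iso \<Lambda> (twisted_group_algebra X K) (left_twist G K)"
proof (rule twist_iso[OF K(2)])
  fix f h g assume f: "f \<in> \<O>\<^bsub>G\<^esub>" "h \<in> \<O>\<^bsub>G\<^esub>"
  have "(f \<otimes>\<^bsub>left_twist G K\<^esub> h) g =
      (\<Sum>(a1, a2)\<leftarrow>coproduct G f. \<Sum>(b1, b2)\<leftarrow>coproduct G h. K a1 b1 * (a2 g * b2 g))"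
    by (simp add: left_twist_def sum_list_fun_apply case_prod_unfold) (simp add: fun_smult_def)
  also have "\<dots> = lsum (coef f) (\<lambda>x. lsum (coef h) (\<lambda>y. K x y * (x g * y g)))"
  proof (rule sum_coproduct2[OF f])
    show "bilinear_form G (\<lambda>a1 a2. K a1 b1 * (a2 g * b2 g))" if "b1 \<in> \<O>\<^bsub>G\<^esub>" "b2 \<in> \<O>\<^bsub>G\<^esub>" for b1 b2
      by (rule bilinear_formI) (auto intro!: linear_form_cmult linear_form_eval bilinear_formD[OF K(1)] that)
    show "bilinear_form G (\<lambda>b1 b2. K a1 b1 * (a2 g * b2 g))" if "a1 \<in> \<O>\<^bsub>G\<^esub>" "a2 \<in> \<O>\<^bsub>G\<^esub>" for a1 a2
      by (rule bilinear_formI) (auto intro!: linear_form_cmult linear_form_eval bilinear_formD[OF K(1)] that)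
  qed
  finally show "(f \<otimes>\<^bsub>left_twist G K\<^esub> h) g = lsum (coef f) (\<lambda>x. lsum (coef h) (\<lambda>y. K x y * (x g * y g)))" .
qed (simp_all add: left_twist_def coord_algebra_def)

end

section \<open>Closed subgroups and quotients\<close>

lemma sub_group_simps [simp]:
  "carrier (sub_group G H) = H" "a \<otimes>\<^bsub>sub_group G H\<^esub> b = a \<otimes>\<^bsub>G\<^esub> b" "\<one>\<^bsub>sub_group G H\<^esub> = \<one>\<^bsub>G\<^esub>"
  "\<O>\<^bsub>sub_group G H\<^esub> = fun_restrict H ` \<O>\<^bsub>G\<^esub>"
  by (simp_all add: sub_group_def)

lemma pullback_linear:
  "pullback A \<phi> (f + g) = pullback A \<phi> f + pullback A \<phi> g"
  "pullback A \<phi> (f * g) = pullback A \<phi> f * pullback A \<phi> g"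
  "pullback A \<phi> (fun_smult c f) = fun_smult c (pullback A \<phi> f)"
  "pullback A \<phi> 0 = 0"
  by (auto simp: pullback_def fun_smult_def fun_eq_iff)

lemma fun_restrict_simps [simp]:
  "h \<in> H \<Longrightarrow> fun_restrict H f h = f h" "h \<notin> H \<Longrightarrow> fun_restrict H f h = 0"
  by (simp_all add: pullback_def)

lemma topspace_zariski:
  assumes "indicator (carrier G) \<in> \<O>\<^bsub>G\<^esub>" shows "topspace (zariski G) = carrier G"
proof -
  have "{g \<in> carrier G. indicator (carrier G) g \<noteq> (0 :: complex)} = carrier G" by auto
  hence "carrier G \<in> {{g \<in> carrier G. f g \<noteq> 0} | f. f \<in> \<O>\<^bsub>G\<^esub>}" using assms by blast
  thus ?thesis unfolding zariski_def topology_generated_by_topspace by blast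
qed

section \<open>Restriction to subgroups and Zariski closedness\<close>

context diagonalizable
begin

lemma inv_char: "x \<in> carrier X \<Longrightarrow> inv\<^bsub>X\<^esub> x = (\<lambda>g. inverse (x g))"
proof
  fix g assume x: "x \<in> carrier X"
  show "(inv\<^bsub>X\<^esub> x) g = inverse (x g)"
  proof (cases "g \<in> carrier G")
    case True
    have "(inv\<^bsub>X\<^esub> x * x) g = indicator (carrier G) g" using X.l_inv[OF x] by simp
    hence "(inv\<^bsub>X\<^esub> x) g * x g = 1" using True by simp
    thus ?thesis using is_charD(2)[OF char_is_char[OF x] True] by (simp add: field_simps)
  next
    case False
    thus ?thesis
      using is_charD(1)[OF char_is_char[OF x] False] is_charD(1)[OF char_is_char[OF X.inv_closed[OF x]] False]
      by simp
  qed
qed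

text \<open>Restrictions of characters span the functions on \<open>H\<close>, and no further
  character fits into their span; so every character of \<open>H\<close> extends to
  \<open>G\<close>.\<close>

lemma sub_group_diagonalizable:
  assumes H: "subgroup H G"
  shows "diagonalizable (sub_group G H)"
    "carrier (char_group (sub_group G H)) = fun_restrict H ` carrier X"
proof -
  interpret H: subgroup H G by fact
  have HG: "h \<in> carrier G" if "h \<in> H" for h using that by (rule H.mem_carrier)
  have 1: "comm_group (sub_group G H)"
    by (rule comm_groupI) (use HG in \<open>auto simp: m_ac intro!: bexI[of _ "inv _"]\<close>)
  let ?C = "fun_restrict H ` carrier X"
  have 2: "is_char (sub_group G H) x" if "x \<in> ?C" for x
    using that HG is_charD(2,3)[OF char_is_char] by (auto simp: is_char_def)
  have 3: "x * y \<in> ?C" if xy: "x \<in> ?C" "y \<in> ?C" for x y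
  proof -
    obtain x' y' where "x' \<in> carrier X" "y' \<in> carrier X" "x = fun_restrict H x'" "y = fun_restrict H y'"
      using xy by auto
    thus ?thesis using X.m_closed[of x' y']
      by (intro image_eqI[of _ _ "x' * y'"]) (simp_all add: pullback_linear)
  qed
  have 4: "indicator (carrier (sub_group G H)) \<in> ?C"
    using X.one_closed HG by (intro image_eqI[of _ _ "indicator (carrier G)"])
      (auto simp: pullback_def indicator_def fun_eq_iff)
  have 5: "(\<lambda>g. inverse (x g)) \<in> ?C" if x: "x \<in> ?C" for x
  proof -
    obtain x' where "x' \<in> carrier X" "x = fun_restrict H x'" using x by auto
    thus ?thesis using X.inv_closed[of x'] inv_char[of x']
      by (intro image_eqI[of _ _ "inv\<^bsub>X\<^esub> x'"]) (auto simp: pullback_def fun_eq_iff)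
  qed
  have 6: "\<O>\<^bsub>sub_group G H\<^esub> = lin_span ?C"
  proof
    have "lin_span (carrier X) \<subseteq> {f. fun_restrict H f \<in> lin_span ?C}"
    proof (rule lin_span_minimal)
      show "carrier X \<subseteq> {f. fun_restrict H f \<in> lin_span ?C}" using lin_span_base by blast
    qed (simp_all only: mem_Collect_eq pullback_linear lin_span_0 lin_span_add lin_span_smult)
    thus "\<O>\<^bsub>sub_group G H\<^esub> \<subseteq> lin_span ?C" by (auto simp: coord_ring_eq)
    show "lin_span ?C \<subseteq> \<O>\<^bsub>sub_group G H\<^esub>"
    proof (rule lin_span_minimal)
      show "?C \<subseteq> \<O>\<^bsub>sub_group G H\<^esub>" using char_coord by auto
      show "0 \<in> \<O>\<^bsub>sub_group G H\<^esub>"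
        using coord_0 by (simp only: sub_group_simps) (metis imageI pullback_linear(4))
      fix f g assume "f \<in> \<O>\<^bsub>sub_group G H\<^esub>" "g \<in> \<O>\<^bsub>sub_group G H\<^esub>"
      then obtain f' g' where fg: "f' \<in> \<O>\<^bsub>G\<^esub>" "g' \<in> \<O>\<^bsub>G\<^esub>" "f = fun_restrict H f'" "g = fun_restrict H g'"
        by auto
      have "f + g = fun_restrict H (f' + g')" by (simp only: fg(3,4) pullback_linear)
      thus "f + g \<in> \<O>\<^bsub>sub_group G H\<^esub>"
        unfolding sub_group_simps by (rule image_eqI[where x = "f' + g'"]) (rule coord_add[OF fg(1,2)])
    next
      fix c f assume "f \<in> \<O>\<^bsub>sub_group G H\<^esub>"
      then obtain f' where f: "f' \<in> \<O>\<^bsub>G\<^esub>" "f = fun_restrict H f'" by auto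
      have "fun_smult c f = fun_restrict H (fun_smult c f')" by (simp only: f(2) pullback_linear)
      thus "fun_smult c f \<in> \<O>\<^bsub>sub_group G H\<^esub>"
        unfolding sub_group_simps by (rule image_eqI[where x = "fun_smult c f'"]) (rule coord_smult[OF f(1)])
    qed
  qed
  show "diagonalizable (sub_group G H)" by (rule diagonalizableI(1)[OF 1 2 3 4 5 6])
  show "carrier (char_group (sub_group G H)) = ?C" by (rule diagonalizableI(2)[OF 1 2 3 4 5 6])
qed

text \<open>Nonvanishing sets form a base, not merely a subbase: the product of two functions is
  nonzero where both are.\<close>

lemma zariski_base:
  assumes "openin (zariski G) U" "t \<in> U"
  shows "\<exists>f\<in>\<O>\<^bsub>G\<^esub>. f t \<noteq> 0 \<and> (\<forall>g\<in>carrier G. f g \<noteq> 0 \<longrightarrow> g \<in> U)"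
proof -
  have "generate_topology_on {{g \<in> carrier G. f g \<noteq> 0} | f. f \<in> \<O>\<^bsub>G\<^esub>} U"
    using assms(1) unfolding zariski_def by (simp add: openin_topology_generated_by_iff)
  thus ?thesis using assms(2)
  proof (induction)
    case (Int a b)
    then obtain f h where "f \<in> \<O>\<^bsub>G\<^esub>" "f t \<noteq> 0" "\<forall>g\<in>carrier G. f g \<noteq> 0 \<longrightarrow> g \<in> a"
      "h \<in> \<O>\<^bsub>G\<^esub>" "h t \<noteq> 0" "\<forall>g\<in>carrier G. h g \<noteq> 0 \<longrightarrow> g \<in> b" by auto
    thus ?case using coord_mult[of f h] by (intro bexI[of _ "f * h"]) auto
  next
    case (UN K)
    thus ?case by blast
  next
    case (Basis s)
    thus ?case by blast
  qed auto
qed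

text \<open>A function \<open>f\<close> vanishing on \<open>H\<close> vanishes at \<open>t\<close>:
  sort its characters by their restriction to \<open>H\<close>. Independence on \<open>H\<close>
  makes the coefficients of each class sum to zero, and the characters of a class agree at
  \<open>t\<close>, since their quotients are trivial on \<open>H\<close>.\<close>

lemma closed_subgroup_memI:
  assumes H: "closed_subgroup G H" and t: "t \<in> carrier G"
    and triv: "\<And>x. x \<in> carrier X \<Longrightarrow> (\<And>h. h \<in> H \<Longrightarrow> x h = 1) \<Longrightarrow> x t = 1"
  shows "t \<in> H"
proof (rule ccontr)
  assume tH: "t \<notin> H"
  have sub: "subgroup H G" and closed: "closedin (zariski G) H" using H by (auto simp: closed_subgroup_def)
  interpret H: subgroup H G by fact
  interpret D: diagonalizable "sub_group G H" by (rule sub_group_diagonalizable[OF sub])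
  have "openin (zariski G) (carrier G - H)"
    using closed topspace_zariski[OF coord_one] by (simp add: closedin_def)
  from zariski_base[OF this, of t] tH t obtain f where f: "f \<in> \<O>\<^bsub>G\<^esub>" "f t \<noteq> 0"
      and f0: "\<And>h. h \<in> H \<Longrightarrow> f h = 0"
    using H.mem_carrier by blast
  let ?I = "{x. coef f x \<noteq> 0}"
  have I: "finite ?I" by (rule coef(1)[OF f(1)])
  have eval: "f g = (\<Sum>x\<in>?I. coef f x * x g)" for g
    using linear_form_lsum[OF linear_form_eval f(1), of g] by (simp add: lsum_def)
  have fiber: "(\<Sum>i\<in>{i \<in> ?I. fun_restrict H i = fun_restrict H j}. coef f i) = 0" if j: "j \<in> ?I" for j
  proof (rule characters_fiber_sums_zero[OF D.is_group I _ _ j])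
    fix i assume "i \<in> ?I"
    hence "i \<in> carrier X" using coef(2)[OF f(1)] by blast
    thus "is_char (sub_group G H) (fun_restrict H i)"
      using D.char_is_char sub_group_diagonalizable(2)[OF sub] by blast
  next
    fix g assume "g \<in> carrier (sub_group G H)"
    thus "(\<Sum>i\<in>?I. coef f i * fun_restrict H i g) = 0" using eval[of g] f0[of g] by simp
  qed
  have "f t = (\<Sum>v\<in>fun_restrict H ` ?I. \<Sum>i\<in>{i \<in> ?I. fun_restrict H i = v}. coef f i * i t)"
    unfolding eval[of t] by (rule sum_fibers[OF I, of "coef f" "\<lambda>i. i t" "fun_restrict H"])
  also have "\<dots> = 0"
  proof (rule sum.neutral, rule ballI)
    fix v assume "v \<in> fun_restrict H ` ?I"
    then obtain j where j: "j \<in> ?I" "v = fun_restrict H j" by blast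
    have jX: "j \<in> carrier X" using j(1) coef(2)[OF f(1)] by blast
    have "i t = j t" if i: "i \<in> ?I" "fun_restrict H i = v" for i
    proof -
      have iX: "i \<in> carrier X" using i(1) coef(2)[OF f(1)] by blast
      have ij: "i * inv\<^bsub>X\<^esub> j \<in> carrier X" using X.m_closed[OF iX X.inv_closed[OF jX]] by simp
      have "(i * inv\<^bsub>X\<^esub> j) h = 1" if h: "h \<in> H" for h
      proof -
        have "i h = j h" using i(2) j(2) h by (metis fun_restrict_simps(1))
        thus ?thesis using is_charD(2)[OF char_is_char[OF jX] H.mem_carrier[OF h]] by (simp add: inv_char[OF jX])
      qed
      from triv[OF ij this] show ?thesis
        using is_charD(2)[OF char_is_char[OF jX] t] by (simp add: inv_char[OF jX] field_simps)
    qed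
    hence "(\<Sum>i\<in>{i \<in> ?I. fun_restrict H i = v}. coef f i * i t) = (\<Sum>i\<in>{i \<in> ?I. fun_restrict H i = v}. coef f i) * j t"
      unfolding sum_distrib_right by (intro sum.cong) auto
    thus "(\<Sum>i\<in>{i \<in> ?I. fun_restrict H i = v}. coef f i * i t) = 0"
      using fiber[OF j(1)] j(2) by simp
  qed
  finally show False using f(2) by simp
qed

end

section \<open>Quotients and annihilators\<close>

lemma quot_group_simps [simp]:
  "carrier (quot_group G H) = rcosets\<^bsub>G\<^esub> H" "C \<otimes>\<^bsub>quot_group G H\<^esub> D = C <#>\<^bsub>G\<^esub> D"
  "\<one>\<^bsub>quot_group G H\<^esub> = H"
  by (simp_all add: quot_group_def FactGroup_def)

locale diagonalizable_subgroup = diagonalizable G + H: subgroup H G for G (structure) and H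
begin

definition pull :: "('a set \<Rightarrow> complex) \<Rightarrow> 'a \<Rightarrow> complex" where
  "pull = pullback (carrier G) (\<lambda>g. H #> g)"

text \<open>The annihilator of \<open>H\<close>; its members are the characters that factor through
  \<open>G/H\<close>.\<close>

definition perp :: "('a \<Rightarrow> complex) set" where
  "perp = {x \<in> carrier X. \<forall>h\<in>H. x h = 1}"

lemma quot_coord_ring:
  "F \<in> \<O>\<^bsub>quot_group G H\<^esub> \<longleftrightarrow> (\<forall>C. C \<notin> rcosets H \<longrightarrow> F C = 0) \<and> pull F \<in> \<O>\<^bsub>G\<^esub>"
  by (simp add: quot_group_def FactGroup_def pull_def)

lemma pull_apply: "g \<in> carrier G \<Longrightarrow> pull F g = F (H #> g)" "g \<notin> carrier G \<Longrightarrow> pull F g = 0"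
  by (simp_all add: pull_def pullback_def)

lemma rcos_mem: "g \<in> carrier G \<Longrightarrow> H #> g \<in> rcosets H"
  by (rule rcosetsI[OF H.subset])

lemma rcos_ex: "C \<in> rcosets H \<Longrightarrow> \<exists>g\<in>carrier G. C = H #> g"
  by (auto simp: RCOSETS_def)

lemma rcos_absorb: "h \<in> H \<Longrightarrow> g \<in> carrier G \<Longrightarrow> H #> (h \<otimes> g) = H #> g"
  by (metis H.rcos_const coset_mult_assoc H.mem_carrier H.subset is_group)

lemma pull_inj:
  assumes "\<And>C. C \<notin> rcosets H \<Longrightarrow> F C = 0" "\<And>C. C \<notin> rcosets H \<Longrightarrow> K C = 0" "pull F = pull K"
  shows "F = K"
proof
  fix C
  show "F C = K C"
  proof (cases "C \<in> rcosets H")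
    case True
    then obtain g where g: "g \<in> carrier G" "C = H #> g" using rcos_ex by blast
    have "pull F g = pull K g" using assms(3) by simp
    thus ?thesis using g by (simp add: pull_apply)
  qed (simp add: assms)
qed

text \<open>The value on a coset is taken at an arbitrary representative, and invariance makes the
  choice immaterial.\<close>

lemma invariant_descends:
  assumes f: "\<And>g. g \<notin> carrier G \<Longrightarrow> f g = 0" "\<And>h g. h \<in> H \<Longrightarrow> g \<in> carrier G \<Longrightarrow> f (h \<otimes> g) = f g"
  shows "\<exists>F. (\<forall>C. C \<notin> rcosets H \<longrightarrow> F C = 0) \<and> pull F = f"
proof -
  define F where "F C = (if C \<in> rcosets H then f (SOME g. g \<in> C) else 0)" for C
  have "pull F g = f g" for g
  proof (cases "g \<in> carrier G")
    case True
    have "(SOME g'. g' \<in> H #> g) \<in> H #> g" using rcos_self[OF True H.subgroup_axioms] by (rule someI)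
    then obtain h where h: "h \<in> H" "(SOME g'. g' \<in> H #> g) = h \<otimes> g" by (auto simp: r_coset_def)
    have "pull F g = f (SOME g'. g' \<in> H #> g)" using rcos_mem[OF True] by (simp add: pull_apply True F_def)
    thus ?thesis using f(2)[OF h(1) True] h(2) by simp
  qed (simp add: pull_apply f)
  hence "pull F = f" by (rule ext)
  thus ?thesis by (intro exI[of _ F]) (simp add: F_def)
qed

text \<open>Translation by \<open>h\<close> multiplies the coefficient of \<open>x\<close> by
  \<open>x h\<close>. Invariance and independence therefore force \<open>x h = 1\<close> on the
  support of the coefficients.\<close>

lemma pull_image: "pull ` \<O>\<^bsub>quot_group G H\<^esub> = {f \<in> \<O>\<^bsub>G\<^esub>. {x. coef f x \<noteq> 0} \<subseteq> perp}"
proof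
  show "pull ` \<O>\<^bsub>quot_group G H\<^esub> \<subseteq> {f \<in> \<O>\<^bsub>G\<^esub>. {x. coef f x \<noteq> 0} \<subseteq> perp}"
  proof
    fix f assume "f \<in> pull ` \<O>\<^bsub>quot_group G H\<^esub>"
    then obtain F where F: "F \<in> \<O>\<^bsub>quot_group G H\<^esub>" "f = pull F" by blast
    have f: "f \<in> \<O>\<^bsub>G\<^esub>" using F by (simp add: quot_coord_ring)
    have "x h = 1" if x: "coef f x \<noteq> 0" and h: "h \<in> H" for x h
    proof -
      have hG: "h \<in> carrier G" using h by (rule H.mem_carrier)
      have "coef f x * x h = coef f x"
      proof (rule sum_chars_unique[OF coef(1,2)[OF f], of "\<lambda>x. coef f x * x h" "coef f" x])
        fix g assume g: "g \<in> carrier G"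
        have ev: "f g = (\<Sum>x | coef f x \<noteq> 0. coef f x * x g)" for g
          using linear_form_lsum[OF linear_form_eval f, of g] by (simp add: lsum_def)
        have "f (h \<otimes> g) = f g" unfolding F(2) using g hG rcos_absorb[OF h g] by (simp add: pull_apply)
        moreover have "f (h \<otimes> g) = (\<Sum>x | coef f x \<noteq> 0. coef f x * x h * x g)"
          unfolding ev[of "h \<otimes> g"]
        proof (rule sum.cong[OF refl])
          fix x assume "x \<in> {x. coef f x \<noteq> 0}"
          hence "x (h \<otimes> g) = x h * x g"
            using is_charD(3)[OF char_is_char[OF coef_char[OF f]] hG g] by blast
          thus "coef f x * x (h \<otimes> g) = coef f x * x h * x g" by simp
        qed
        ultimately show "(\<Sum>x | coef f x \<noteq> 0. coef f x * x h * x g) = (\<Sum>x | coef f x \<noteq> 0. coef f x * x g)"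
          using ev[of g] by simp
      qed (use x in simp)
      thus ?thesis using x by simp
    qed
    thus "f \<in> {f \<in> \<O>\<^bsub>G\<^esub>. {x. coef f x \<noteq> 0} \<subseteq> perp}" using f coef_char[OF f] by (auto simp: perp_def)
  qed
  show "{f \<in> \<O>\<^bsub>G\<^esub>. {x. coef f x \<noteq> 0} \<subseteq> perp} \<subseteq> pull ` \<O>\<^bsub>quot_group G H\<^esub>"
  proof
    fix f assume "f \<in> {f \<in> \<O>\<^bsub>G\<^esub>. {x. coef f x \<noteq> 0} \<subseteq> perp}"
    hence f: "f \<in> \<O>\<^bsub>G\<^esub>" "\<And>x. coef f x \<noteq> 0 \<Longrightarrow> x \<in> perp" by auto
    have inv: "f (h \<otimes> g) = f g" if h: "h \<in> H" and g: "g \<in> carrier G" for h g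
    proof -
      have "x (h \<otimes> g) = x g" if "coef f x \<noteq> 0" for x
        using f(2)[OF that] h g is_charD(3)[OF char_is_char[OF coef_char[OF f(1) that]] H.mem_carrier[OF h] g]
        by (simp add: perp_def)
      thus ?thesis
        unfolding linear_form_lsum[OF linear_form_eval f(1), of "h \<otimes> g"] linear_form_lsum[OF linear_form_eval f(1), of g]
        by (rule lsum_cong)
    qed
    obtain F where F: "\<forall>C. C \<notin> rcosets H \<longrightarrow> F C = 0" "pull F = f"
      using invariant_descends[OF coord_outside[OF f(1)] inv] by blast
    hence "F \<in> \<O>\<^bsub>quot_group G H\<^esub>" using f(1) by (simp add: quot_coord_ring)
    thus "f \<in> pull ` \<O>\<^bsub>quot_group G H\<^esub>" using F(2) by blast
  qed
qed

lemma rcos_mult: "g \<in> carrier G \<Longrightarrow> h \<in> carrier G \<Longrightarrow> (H #> g) <#> (H #> h) = H #> (g \<otimes> h)"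
proof -
  assume "g \<in> carrier G" "h \<in> carrier G"
  moreover have "H \<lhd> G" by (rule subgroup_imp_normal[OF H.subgroup_axioms])
  ultimately show ?thesis by (simp add: normal.rcos_sum)
qed

lemma quot_char_iff:
  "z \<in> carrier (char_group (quot_group G H)) \<longleftrightarrow> (\<forall>C. C \<notin> rcosets H \<longrightarrow> z C = 0) \<and> pull z \<in> perp"
proof
  assume z: "z \<in> carrier (char_group (quot_group G H))"
  hence zO: "z \<in> \<O>\<^bsub>quot_group G H\<^esub>" by (simp add: char_group_def)
  hence pO: "pull z \<in> \<O>\<^bsub>G\<^esub>" and z0: "\<forall>C. C \<notin> rcosets H \<longrightarrow> z C = 0" by (auto simp: quot_coord_ring)
  have nz: "z (H #> g) \<noteq> 0" if "g \<in> carrier G" for g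
    using z rcos_mem[OF that] by (simp add: char_group_def)
  have mult: "z (H #> (g \<otimes> h)) = z (H #> g) * z (H #> h)" if "g \<in> carrier G" "h \<in> carrier G" for g h
    using z rcos_mem[OF that(1)] rcos_mem[OF that(2)] by (simp add: char_group_def flip: rcos_mult[OF that])
  have pX: "pull z \<in> carrier X"
    unfolding char_group_def using pO nz mult by (auto simp: pull_apply)
  have "pull z h = 1" if h: "h \<in> H" for h
  proof -
    have "H #> h = H #> \<one>" using rcos_absorb[OF h one_closed] H.mem_carrier[OF h] by simp
    hence "pull z h = pull z \<one>" using H.mem_carrier[OF h] by (simp add: pull_apply)
    thus ?thesis using is_char_one[OF is_group char_is_char[OF pX]] by simp
  qed
  thus "(\<forall>C. C \<notin> rcosets H \<longrightarrow> z C = 0) \<and> pull z \<in> perp" using z0 pX by (simp add: perp_def)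
next
  assume z: "(\<forall>C. C \<notin> rcosets H \<longrightarrow> z C = 0) \<and> pull z \<in> perp"
  hence pX: "pull z \<in> carrier X" by (simp add: perp_def)
  note ch = char_is_char[OF pX]
  have "z \<in> \<O>\<^bsub>quot_group G H\<^esub>" using z char_coord[OF pX] by (simp add: quot_coord_ring)
  moreover have "z C \<noteq> 0" if "C \<in> rcosets H" for C
    using rcos_ex[OF that] is_charD(2)[OF ch] by (auto simp: pull_apply)
  moreover have "z (C <#> D) = z C * z D" if CD: "C \<in> rcosets H" "D \<in> rcosets H" for C D
  proof -
    obtain g h where "g \<in> carrier G" "C = H #> g" "h \<in> carrier G" "D = H #> h" using CD rcos_ex by meson
    thus ?thesis using is_charD(3)[OF ch, of g h] by (simp add: rcos_mult pull_apply)
  qed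
  ultimately show "z \<in> carrier (char_group (quot_group G H))" by (simp add: char_group_def)
qed

lemma pull_mult: "pull (F * K) = pull F * pull K"
  unfolding pull_def by (rule pullback_linear)

lemma perp_ex:
  assumes "x \<in> perp" shows "\<exists>z. z \<in> carrier (char_group (quot_group G H)) \<and> pull z = x"
proof -
  have x: "x \<in> carrier X" using assms by (simp add: perp_def)
  have inv: "x (h \<otimes> g) = x g" if "h \<in> H" "g \<in> carrier G" for h g
    using is_charD(3)[OF char_is_char[OF x] H.mem_carrier[OF that(1)] that(2)] assms that by (simp add: perp_def)
  obtain z where "\<forall>C. C \<notin> rcosets H \<longrightarrow> z C = 0" "pull z = x"
    using invariant_descends[OF is_charD(1)[OF char_is_char[OF x]] inv] by blast
  thus ?thesis using assms by (intro exI[of _ z]) (simp add: quot_char_iff)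
qed

lemma perp_subgroup: "subgroup perp X"
proof (rule X.subgroupI)
  show "perp \<subseteq> carrier X" by (auto simp: perp_def)
  have "\<one>\<^bsub>X\<^esub> \<in> perp" using X.one_closed H.mem_carrier by (simp add: perp_def)
  thus "perp \<noteq> {}" by blast
  show "inv\<^bsub>X\<^esub> x \<in> perp" if "x \<in> perp" for x
    using that X.inv_closed[of x] by (simp add: perp_def inv_char)
  show "x \<otimes>\<^bsub>X\<^esub> y \<in> perp" if "x \<in> perp" "y \<in> perp" for x y
    using that X.m_closed[of x y] by (simp add: perp_def)
qed

lemma quot_char_comm_group: "comm_group (char_group (quot_group G H))"
proof (rule comm_groupI)
  let ?Z = "char_group (quot_group G H)"
  interpret P: subgroup perp X by (rule perp_subgroup)
  show "z \<otimes>\<^bsub>?Z\<^esub> w \<in> carrier ?Z" if "z \<in> carrier ?Z" "w \<in> carrier ?Z" for z w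
    using that P.m_closed[of "pull z" "pull w"] by (simp add: quot_char_iff pull_mult)
  have one: "pull (indicator (rcosets H)) = indicator (carrier G)"
    by (rule ext) (auto simp: pull_def pullback_def rcos_mem indicator_def)
  thus "\<one>\<^bsub>?Z\<^esub> \<in> carrier ?Z" using P.one_closed by (simp add: quot_char_iff)
  show "\<one>\<^bsub>?Z\<^esub> \<otimes>\<^bsub>?Z\<^esub> z = z" if "z \<in> carrier ?Z" for z
    using that by (auto simp: quot_char_iff fun_eq_iff indicator_def)
  show "\<exists>w\<in>carrier ?Z. w \<otimes>\<^bsub>?Z\<^esub> z = \<one>\<^bsub>?Z\<^esub>" if z: "z \<in> carrier ?Z" for z
  proof -
    have z0: "\<forall>C. C \<notin> rcosets H \<longrightarrow> z C = 0" and pz: "pull z \<in> perp" using z by (simp_all add: quot_char_iff)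
    have pzX: "pull z \<in> carrier X" using pz by (rule P.mem_carrier)
    from perp_ex[OF P.m_inv_closed[OF pz]] obtain w
      where w': "w \<in> carrier ?Z \<and> pull w = inv\<^bsub>X\<^esub> (pull z)" by (elim exE)
    note w = conjunct1[OF w'] conjunct2[OF w']
    have "w * z = indicator (rcosets H)"
    proof (rule pull_inj)
      show "pull (w * z) = pull (indicator (rcosets H))"
        using X.l_inv[OF pzX] one by (simp add: pull_mult w(2))
    qed (use z0 in \<open>simp_all add: indicator_def\<close>)
    thus ?thesis using w(1) by (intro bexI[of _ w]) simp_all
  qed
qed (simp_all add: mult_ac)

lemma quot_coord_ring_closed:
  "F \<in> \<O>\<^bsub>quot_group G H\<^esub> \<Longrightarrow> K \<in> \<O>\<^bsub>quot_group G H\<^esub> \<Longrightarrow> F + K \<in> \<O>\<^bsub>quot_group G H\<^esub>"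
  "F \<in> \<O>\<^bsub>quot_group G H\<^esub> \<Longrightarrow> K \<in> \<O>\<^bsub>quot_group G H\<^esub> \<Longrightarrow> F * K \<in> \<O>\<^bsub>quot_group G H\<^esub>"
  "F \<in> \<O>\<^bsub>quot_group G H\<^esub> \<Longrightarrow> fun_smult c F \<in> \<O>\<^bsub>quot_group G H\<^esub>"
  "0 \<in> \<O>\<^bsub>quot_group G H\<^esub>" "indicator (rcosets H) \<in> \<O>\<^bsub>quot_group G H\<^esub>"
proof -
  show "F \<in> \<O>\<^bsub>quot_group G H\<^esub> \<Longrightarrow> K \<in> \<O>\<^bsub>quot_group G H\<^esub> \<Longrightarrow> F + K \<in> \<O>\<^bsub>quot_group G H\<^esub>"
    unfolding quot_coord_ring unfolding pull_def pullback_linear using coord_add by simp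
  show "F \<in> \<O>\<^bsub>quot_group G H\<^esub> \<Longrightarrow> K \<in> \<O>\<^bsub>quot_group G H\<^esub> \<Longrightarrow> F * K \<in> \<O>\<^bsub>quot_group G H\<^esub>"
    unfolding quot_coord_ring unfolding pull_def pullback_linear using coord_mult by simp
  show "F \<in> \<O>\<^bsub>quot_group G H\<^esub> \<Longrightarrow> fun_smult c F \<in> \<O>\<^bsub>quot_group G H\<^esub>"
    unfolding quot_coord_ring unfolding pull_def pullback_linear using coord_smult by (simp add: fun_smult_def)
  show "0 \<in> \<O>\<^bsub>quot_group G H\<^esub>"
    unfolding quot_coord_ring unfolding pull_def pullback_linear using coord_0 by simp
  have "pull (indicator (rcosets H)) = indicator (carrier G)"
    by (rule ext) (auto simp: pull_def pullback_def rcos_mem indicator_def)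
  thus "indicator (rcosets H) \<in> \<O>\<^bsub>quot_group G H\<^esub>" unfolding quot_coord_ring using coord_one by simp
qed

lemma quot_coord_algebra: "ring (coord_algebra (quot_group G H))" "smult_closed (coord_algebra (quot_group G H))"
proof -
  show "smult_closed (coord_algebra (quot_group G H))"
    using quot_coord_ring_closed(3) by (simp add: smult_closed_def coord_algebra_def)
  show "ring (coord_algebra (quot_group G H))"
  proof (rule ringI)
    show "abelian_group (coord_algebra (quot_group G H))"
    proof (rule abelian_groupI)
      fix F assume F: "F \<in> carrier (coord_algebra (quot_group G H))"
      have "fun_smult (- 1) F + F = 0" by (rule ext) (simp add: fun_smult_def)
      thus "\<exists>K\<in>carrier (coord_algebra (quot_group G H)). K \<oplus>\<^bsub>coord_algebra (quot_group G H)\<^esub> F =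
          \<zero>\<^bsub>coord_algebra (quot_group G H)\<^esub>"
        using F quot_coord_ring_closed(3)[of F "- 1"] unfolding coord_algebra_def
        by (intro bexI[of _ "fun_smult (- 1) F"]) (simp_all only: ring.simps partial_object.simps)
    qed (use quot_coord_ring_closed(1,4) in \<open>simp_all add: coord_algebra_def add_ac\<close>)
    have one: "indicator (rcosets H) * F = F" if "F \<in> \<O>\<^bsub>quot_group G H\<^esub>" for F
      using that by (auto simp: quot_coord_ring fun_eq_iff indicator_def)
    show "monoid (coord_algebra (quot_group G H))"
      by (rule monoidI) (use quot_coord_ring_closed(2,5) one in \<open>simp_all add: coord_algebra_def mult.commute mult.left_commute\<close>)
  qed (simp_all add: coord_algebra_def distrib_left distrib_right)
qed

end

section \<open>Tori\<close>

lemma mult_group_power_simps [simp]: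
  "carrier (mult_group_power k) = {1..k} \<rightarrow>\<^sub>E (UNIV - {0})"
  "z \<otimes>\<^bsub>mult_group_power k\<^esub> w = (\<lambda>i\<in>{1..k}. z i * w i)"
  by (simp_all add: mult_group_power_def)

locale torus_coordinates = group T for T :: "'g alg_group" (structure) +
  fixes k :: nat and \<phi> :: "'g \<Rightarrow> nat \<Rightarrow> complex"
  assumes \<phi>: "alg_group_iso T (mult_group_power k) \<phi>"
begin

lemma \<phi>_bij: "bij_betw \<phi> (carrier T) ({1..k} \<rightarrow>\<^sub>E (UNIV - {0}))"
  using \<phi> by (simp add: alg_group_iso_def iso_def)

lemma \<phi>_closed: "t \<in> carrier T \<Longrightarrow> \<phi> t \<in> {1..k} \<rightarrow>\<^sub>E (UNIV - {0})"
  using bij_betwE[OF \<phi>_bij] by blast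

lemma \<phi>_nonzero: "t \<in> carrier T \<Longrightarrow> i \<in> {1..k} \<Longrightarrow> \<phi> t i \<noteq> 0"
  using \<phi>_closed[of t] by (auto simp: PiE_iff)

lemma \<phi>_mult: "s \<in> carrier T \<Longrightarrow> t \<in> carrier T \<Longrightarrow> \<phi> (s \<otimes> t) = (\<lambda>i\<in>{1..k}. \<phi> s i * \<phi> t i)"
  using \<phi> by (simp add: alg_group_iso_def iso_def hom_def)

lemma comm: "comm_group T"
proof (rule group.group_comm_groupI)
  show "group T" by (rule is_group)
  fix s t assume st: "s \<in> carrier T" "t \<in> carrier T"
  hence "\<phi> (s \<otimes> t) = \<phi> (t \<otimes> s)" by (simp add: \<phi>_mult mult.commute)
  thus "s \<otimes> t = t \<otimes> s" using \<phi>_bij st by (auto simp: bij_betw_def dest: inj_onD)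
qed

definition mono :: "(nat \<Rightarrow> int) \<Rightarrow> 'g \<Rightarrow> complex" where
  "mono n t = (if t \<in> carrier T then \<Prod>i=1..k. \<phi> t i powi n i else 0)"

lemma mono_add: "mono (\<lambda>i. n i + m i) = mono n * mono m"
  using \<phi>_nonzero by (auto simp: mono_def fun_eq_iff prod.distrib[symmetric] power_int_add intro!: prod.cong)

lemma mono_char: "is_char T (mono n)"
  using \<phi>_nonzero by (auto simp: is_char_def mono_def \<phi>_mult prod.distrib[symmetric] power_int_mult_distrib intro!: prod.cong)

lemma coord_ring_T: "\<O>\<^bsub>T\<^esub> = {(\<lambda>t. \<Sum>n\<in>N. c n * mono n t) | N c. finite N}"
proof -
  have pb: "pullback (carrier T) \<phi> (fun_restrict ({1..k} \<rightarrow>\<^sub>E (UNIV - {0}))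
      (\<lambda>z. \<Sum>n\<in>N. c n * (\<Prod>i=1..k. z i powi n i))) = (\<lambda>t. \<Sum>n\<in>N. c n * mono n t)" for N c
    using \<phi>_closed by (auto simp: pullback_def mono_def fun_eq_iff)
  have "\<O>\<^bsub>T\<^esub> = pullback (carrier T) \<phi> ` {fun_restrict ({1..k} \<rightarrow>\<^sub>E (UNIV - {0}))
      (\<lambda>z. \<Sum>n\<in>N. c n * (\<Prod>i=1..k. z i powi n i)) | (N :: (nat \<Rightarrow> int) set) c. finite N}"
    using \<phi> by (simp add: alg_group_iso_def mult_group_power_def)
  also have "\<dots> = {pullback (carrier T) \<phi> (fun_restrict ({1..k} \<rightarrow>\<^sub>E (UNIV - {0}))
      (\<lambda>z. \<Sum>n\<in>N. c n * (\<Prod>i=1..k. z i powi n i))) | (N :: (nat \<Rightarrow> int) set) c. finite N}"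
    by blast
  finally show ?thesis unfolding pb .
qed

lemma coord_ring_TI: "finite N \<Longrightarrow> f = (\<lambda>t. \<Sum>n\<in>N. c n * mono n t) \<Longrightarrow> f \<in> \<O>\<^bsub>T\<^esub>"
  unfolding coord_ring_T mem_Collect_eq by (intro exI[of _ N] exI[of _ c] conjI)

lemma coord_ring_span: "\<O>\<^bsub>T\<^esub> = lin_span (range mono)"
proof
  have "(\<lambda>t. \<Sum>n\<in>N. c n * mono n t) \<in> lin_span (range mono)" if "finite N" for N c
    using that
  proof (induction N)
    case empty
    have "(\<lambda>t. \<Sum>n\<in>{}. c n * mono n t) = 0" by (rule ext) simp
    thus ?case using lin_span_0 by (simp only:)
  next
    case (insert n N)
    have "(\<lambda>t. \<Sum>n\<in>insert n N. c n * mono n t) = fun_smult (c n) (mono n) + (\<lambda>t. \<Sum>n\<in>N. c n * mono n t)"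
      using insert by (intro ext) (simp add: fun_smult_def)
    thus ?case using insert by (simp only: lin_span_add lin_span_smult lin_span_base rangeI)
  qed
  thus "\<O>\<^bsub>T\<^esub> \<subseteq> lin_span (range mono)" unfolding coord_ring_T by blast
  show "lin_span (range mono) \<subseteq> \<O>\<^bsub>T\<^esub>"
  proof (rule lin_span_minimal)
    show "range mono \<subseteq> \<O>\<^bsub>T\<^esub>"
    proof clarify
      fix n
      show "mono n \<in> \<O>\<^bsub>T\<^esub>" by (rule coord_ring_TI[of "{n}" _ "\<lambda>_. 1"]) auto
    qed
    show "0 \<in> \<O>\<^bsub>T\<^esub>" by (rule coord_ring_TI[of "{}" _ "\<lambda>_. 1"]) auto
    fix f g assume "f \<in> \<O>\<^bsub>T\<^esub>" "g \<in> \<O>\<^bsub>T\<^esub>"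
    then obtain N c M d where *: "finite N" "f = (\<lambda>t. \<Sum>n\<in>N. c n * mono n t)"
        "finite M" "g = (\<lambda>t. \<Sum>n\<in>M. d n * mono n t)"
      unfolding coord_ring_T by blast
    have "f + g = (\<lambda>t. \<Sum>n\<in>N \<union> M. ((if n \<in> N then c n else 0) + (if n \<in> M then d n else 0)) * mono n t)"
    proof
      fix t
      have "f t = (\<Sum>n\<in>N \<union> M. (if n \<in> N then c n else 0) * mono n t)"
        unfolding *(2) using *(1,3) by (intro sum.mono_neutral_cong_left) auto
      moreover have "g t = (\<Sum>n\<in>N \<union> M. (if n \<in> M then d n else 0) * mono n t)"
        unfolding *(4) using *(1,3) by (intro sum.mono_neutral_cong_left) auto
      ultimately show "(f + g) t = (\<Sum>n\<in>N \<union> M. ((if n \<in> N then c n else 0) + (if n \<in> M then d n else 0)) * mono n t)"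
        by (simp only: plus_fun_apply distrib_right sum.distrib)
    qed
    moreover have "finite (N \<union> M)" using * by simp
    ultimately show "f + g \<in> \<O>\<^bsub>T\<^esub>" by (rule coord_ring_TI[rotated])
  next
    fix c' f assume "f \<in> \<O>\<^bsub>T\<^esub>"
    then obtain N c where *: "finite N" "f = (\<lambda>t. \<Sum>n\<in>N. c n * mono n t)" unfolding coord_ring_T by blast
    have "fun_smult c' f = (\<lambda>t. \<Sum>n\<in>N. (c' * c n) * mono n t)"
      unfolding *(2) by (rule ext) (simp add: fun_smult_def sum_distrib_left mult.assoc)
    thus "fun_smult c' f \<in> \<O>\<^bsub>T\<^esub>" by (rule coord_ring_TI[OF *(1)])
  qed
qed

lemma diagonalizable: "diagonalizable T" and char_carrier: "carrier (char_group T) = range mono"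
proof -
  have 1: "x * y \<in> range mono" if "x \<in> range mono" "y \<in> range mono" for x y
    using that mono_add[symmetric] by auto
  have "indicator (carrier T) = mono (\<lambda>_. 0)" by (rule ext) (simp add: mono_def indicator_def)
  hence 2: "indicator (carrier T) \<in> range mono" by blast
  have "(\<lambda>g. inverse (mono n g)) = mono (\<lambda>i. - n i)" for n
    by (rule ext) (simp add: mono_def power_int_minus prod_inversef[symmetric] comp_def)
  hence 3: "(\<lambda>g. inverse (x g)) \<in> range mono" if "x \<in> range mono" for x using that by auto
  have 0: "is_char T x" if "x \<in> range mono" for x using that mono_char by auto
  show "diagonalizable T" by (rule diagonalizableI(1)[OF comm 0 1 2 3 coord_ring_span])
  show "carrier (char_group T) = range mono" by (rule diagonalizableI(2)[OF comm 0 1 2 3 coord_ring_span])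
qed

lemma exponential_int:
  fixes h :: "int \<Rightarrow> complex"
  assumes "\<And>a b. h (a + b) = h a * h b" "h 0 = 1"
  shows "h m = h 1 powi m"
proof -
  have nz: "h 1 \<noteq> 0" using assms(1)[of 1 "-1"] assms(2) by auto
  show ?thesis
  proof (induction m rule: int_induct[of _ 0])
    case (step1 i)
    thus ?case using nz by (simp add: assms(1) power_int_add)
  next
    case (step2 i)
    have "h i = h (i - 1) * h 1" using assms(1)[of "i - 1" 1] by simp
    thus ?case using nz step2 by (simp add: power_int_diff field_simps)
  qed (simp add: assms)
qed

text \<open>A homomorphism on the character group is determined by its values on the coordinate
  characters, and these values, being nonzero, are the coordinates of the wanted point.\<close>

lemma ex1_point:
  assumes nz: "\<And>x. x \<in> carrier (char_group T) \<Longrightarrow> \<psi> x \<noteq> 0"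
    and hom: "\<And>x y. x \<in> carrier (char_group T) \<Longrightarrow> y \<in> carrier (char_group T) \<Longrightarrow> \<psi> (x * y) = \<psi> x * \<psi> y"
  shows "\<exists>!t. t \<in> carrier T \<and> (\<forall>x\<in>carrier (char_group T). x t = \<psi> x)"
proof (rule ex_ex1I)
  \<comment> \<open>The \<open>m\<close>-th power of the \<open>j\<close>-th coordinate.\<close>
  define e where "e j m = mono (\<lambda>i. if i = j then m else 0)" for j and m :: int
  have ch: "mono n \<in> carrier (char_group T)" for n by (simp add: char_carrier)
  have hom': "\<psi> (mono (\<lambda>i. n i + m i)) = \<psi> (mono n) * \<psi> (mono m)" for n m
    unfolding mono_add by (rule hom[OF ch ch])
  have zero: "\<psi> (mono (\<lambda>_. 0)) = 1" using hom'[of "\<lambda>_. 0" "\<lambda>_. 0"] nz[OF ch, of "\<lambda>_. 0"] by simp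
  have pw: "\<psi> (e j m) = \<psi> (e j 1) powi m" for j m
  proof (rule exponential_int)
    fix a b :: int
    have "(\<lambda>i. if i = j then a + b else 0) = (\<lambda>i. (if i = j then a else 0) + (if i = j then b else 0))"
      by (rule ext) simp
    thus "\<psi> (e j (a + b)) = \<psi> (e j a) * \<psi> (e j b)" unfolding e_def by (simp only: hom')
    show "\<psi> (e j 0) = 1" unfolding e_def using zero by (simp cong: if_cong)
  qed
  have fin: "\<psi> (mono (\<lambda>i. if i \<in> I then n i else 0)) = (\<Prod>i\<in>I. \<psi> (e i 1) powi n i)" if "finite I" for I n
    using that
  proof (induction I)
    case (insert j I)
    have "(\<lambda>i. if i \<in> insert j I then n i else 0) = (\<lambda>i. (if i = j then n j else 0) + (if i \<in> I then n i else 0))"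
      using insert.hyps by (intro ext) auto
    hence "\<psi> (mono (\<lambda>i. if i \<in> insert j I then n i else 0)) = \<psi> (e j (n j)) * \<psi> (mono (\<lambda>i. if i \<in> I then n i else 0))"
      unfolding e_def by (simp only: hom')
    thus ?case unfolding prod.insert[OF insert.hyps] insert.IH pw[of j "n j"] .
  qed (simp add: zero)
  \<comment> \<open>\<open>mono\<close> reads only the exponents in \<open>{1..k}\<close>, so the
    induction over finite index sets reaches every character.\<close>
  have restr: "mono (\<lambda>i. if i \<in> {1..k} then n i else 0) = mono n" for n
    by (rule ext) (simp add: mono_def)
  have \<psi>: "\<psi> (mono n) = (\<Prod>i\<in>{1..k}. \<psi> (e i 1) powi n i)" for n
    using fin[OF finite_atLeastAtMost, of 1 k n] unfolding restr .
  have "(\<lambda>i\<in>{1..k}. \<psi> (e i 1)) \<in> {1..k} \<rightarrow>\<^sub>E (UNIV - {0})" using nz[OF ch] by (auto simp: e_def)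
  hence "(\<lambda>i\<in>{1..k}. \<psi> (e i 1)) \<in> \<phi> ` carrier T" by (simp only: bij_betw_imp_surj_on[OF \<phi>_bij])
  then obtain t where t: "\<phi> t = (\<lambda>i\<in>{1..k}. \<psi> (e i 1))" "t \<in> carrier T" by (rule imageE) simp
  show "\<exists>t. t \<in> carrier T \<and> (\<forall>x\<in>carrier (char_group T). x t = \<psi> x)"
    using t by (intro exI[of _ t]) (auto simp: char_carrier \<psi> mono_def)
  fix s t assume st: "s \<in> carrier T \<and> (\<forall>x\<in>carrier (char_group T). x s = \<psi> x)"
    "t \<in> carrier T \<and> (\<forall>x\<in>carrier (char_group T). x t = \<psi> x)"
  have coord: "e j 1 r = \<phi> r j" if "j \<in> {1..k}" "r \<in> carrier T" for j r
  proof -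
    have "e j 1 r = (\<Prod>i=1..k. \<phi> r i powi (if i = j then 1 else 0))"
      unfolding e_def mono_def using that by simp
    also have "\<dots> = (\<Prod>i=1..k. if i = j then \<phi> r j else 1)"
      by (rule prod.cong) auto
    finally have "e j 1 r = (\<Prod>i=1..k. if i = j then \<phi> r j else 1)" .
    thus ?thesis using that by simp
  qed
  have "\<phi> s j = \<phi> t j" if j: "j \<in> {1..k}" for j
  proof -
    have "e j 1 s = e j 1 t" using st ch by (simp add: e_def)
    thus ?thesis using st coord[OF j] by simp
  qed
  hence "\<phi> s = \<phi> t" using \<phi>_closed st by (intro PiE_ext[of _ "{1..k}" "\<lambda>_. UNIV - {0}"]) auto
  thus "s = t" using \<phi>_bij st by (auto simp: bij_betw_def dest: inj_onD)
qed

lemma dual_point: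
  assumes "\<And>x. x \<in> carrier (char_group T) \<Longrightarrow> \<psi> x \<noteq> 0"
    and "\<And>x y. x \<in> carrier (char_group T) \<Longrightarrow> y \<in> carrier (char_group T) \<Longrightarrow> \<psi> (x * y) = \<psi> x * \<psi> y"
  shows "dual_point T \<psi> \<in> carrier T" "x \<in> carrier (char_group T) \<Longrightarrow> x (dual_point T \<psi>) = \<psi> x"
proof -
  have ex: "\<exists>!t. t \<in> carrier T \<and> (\<forall>x\<in>carrier (char_group T). x t = \<psi> x)"
    by (rule ex1_point) (use assms in blast)+
  have *: "dual_point T \<psi> \<in> carrier T \<and> (\<forall>x\<in>carrier (char_group T). x (dual_point T \<psi>) = \<psi> x)"
    unfolding dual_point_def using ex by (rule theI')
  show "dual_point T \<psi> \<in> carrier T" using * by (rule conjunct1)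
  show "x \<in> carrier (char_group T) \<Longrightarrow> x (dual_point T \<psi>) = \<psi> x" using conjunct2[OF *] by (rule bspec)
qed

end

section \<open>Supports of cocycles on diagonalizable groups\<close>

text \<open>On characters the flipped cocycle and the reciprocal of \<open>J\<close> have the same
  antisymmetrization, \<open>J y x / J x y\<close>; hence they are cohomologous.\<close>

lemma (in diagonalizable) opposite_right_twist_iso:
  assumes J: "hopf_2_cocycle G J"
  shows "opposite (right_twist G J) \<cong>\<^sub>a\<^sub>l\<^sub>g left_twist G (conv2_inv G J)"
proof -
  interpret tw: twisted_group X J by unfold_locales (rule hopf_2_cocycle_group_cocycle[OF J])
  interpret F: twisted_group X "\<lambda>x y. J y x" by (rule tw.twisted_group_flip)
  note inv = conv2_inv_char[OF hopf_2_cocycleD[OF J]]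
  have K: "group_2_cocycle X (conv2_inv G J)"
    unfolding group_2_cocycle_def
  proof (intro conjI ballI)
    fix x y z assume xyz: "x \<in> carrier X" "y \<in> carrier X" "z \<in> carrier X"
    have cl: "x \<otimes>\<^bsub>X\<^esub> y \<in> carrier X" "y \<otimes>\<^bsub>X\<^esub> z \<in> carrier X" using xyz by blast+
    show "conv2_inv G J x y * conv2_inv G J (x \<otimes>\<^bsub>X\<^esub> y) z = conv2_inv G J x (y \<otimes>\<^bsub>X\<^esub> z) * conv2_inv G J y z"
      unfolding inv(2)[OF xyz(1,2)] inv(2)[OF cl(1) xyz(3)] inv(2)[OF xyz(1) cl(2)] inv(2)[OF xyz(2,3)]
      using tw.cocycle_eq[OF xyz] by (metis inverse_mult_distrib)
  next
    fix x y assume "x \<in> carrier X" "y \<in> carrier X"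
    thus "conv2_inv G J x y \<noteq> 0" using tw.nonzero by (simp add: inv(2))
  next
    fix x assume x: "x \<in> carrier X"
    show "conv2_inv G J x \<one>\<^bsub>X\<^esub> = 1" "conv2_inv G J \<one>\<^bsub>X\<^esub> x = 1"
      unfolding inv(2)[OF x X.one_closed] inv(2)[OF X.one_closed x] tw.normalized(1)[OF x] tw.normalized(2)[OF x] by simp_all
  qed
  have "\<exists>f. (\<forall>x\<in>carrier X. f x \<noteq> 0) \<and>
    (\<forall>x\<in>carrier X. \<forall>y\<in>carrier X. J y x * f (x \<otimes>\<^bsub>X\<^esub> y) = f x * f y * conv2_inv G J x y)"
  proof (rule X.cocycles_cohomologous[OF F.cocycle K])
    fix x y assume xy: "x \<in> carrier X" "y \<in> carrier X"
    show "J y x * conv2_inv G J y x = J x y * conv2_inv G J x y"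
      unfolding inv(2)[OF xy] inv(2)[OF xy(2,1)] using tw.nonzero[OF xy] tw.nonzero[OF xy(2,1)] by simp
  qed
  then obtain f where f: "\<And>x. x \<in> carrier X \<Longrightarrow> f x \<noteq> 0"
    "\<And>x y. x \<in> carrier X \<Longrightarrow> y \<in> carrier X \<Longrightarrow> J y x * f (x \<otimes>\<^bsub>X\<^esub> y) = f x * f y * conv2_inv G J x y"
    by blast
  have "opposite (opposite F.A) = F.A" by (simp add: opposite_def)
  hence "calg_iso id F.A (opposite tw.A)" using calg_iso_opposite[OF F.opposite_iso] by simp
  from calg_iso_trans[OF this calg_iso_opposite[OF right_twist_iso[OF J]]]
  have 1: "calg_iso (\<Lambda> \<circ> id) F.A (opposite (right_twist G J))" .
  note 2 = calg_iso_trans[OF F.coboundary_iso[OF K f] left_twist_iso[OF inv(1) K]]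
  show ?thesis
    by (rule calg_iso_imp_isomorphic[OF calg_iso_trans[OF calg_iso_sym[OF F.ring_A F.smult_closed_twisted 1] 2]])
qed

locale supported_cocycle = diagonalizable G for G (structure) +
  fixes J S JS
  assumes J: "hopf_2_cocycle G J" and supp: "support_with G J S JS"
begin

lemma closed_S: "closed_subgroup G S"
  using supp by (simp add: support_with_def)

lemma subgroup_S: "subgroup S G"
  using closed_S by (simp add: closed_subgroup_def)

lemma JS: "hopf_2_cocycle (sub_group G S) JS"
  using supp by (simp add: support_with_def minimal_cocycle_def)

end

sublocale supported_cocycle \<subseteq> S: diagonalizable_subgroup G S
  by (intro diagonalizable_subgroup.intro diagonalizable_axioms subgroup_S)

sublocale supported_cocycle \<subseteq> D: diagonalizable "sub_group G S"
  by (rule sub_group_diagonalizable(1)[OF subgroup_S])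

sublocale supported_cocycle \<subseteq> tw: twisted_group X J
  by unfold_locales (rule hopf_2_cocycle_group_cocycle[OF J])

sublocale supported_cocycle \<subseteq> twS: twisted_group "char_group (sub_group G S)" JS
  by unfold_locales (rule D.hopf_2_cocycle_group_cocycle[OF JS])

section \<open>Comparison of the forms on the group and on the support\<close>

context supported_cocycle
begin

abbreviation GS where "GS \<equiv> sub_group G S"

abbreviation R where "R \<equiv> R_form G J"

abbreviation RS where "RS \<equiv> R_form GS JS"

abbreviation res where "res \<equiv> fun_restrict S"

lemma XS_eq: "carrier (char_group GS) = res ` carrier X"
  by (rule sub_group_diagonalizable(2)[OF subgroup_S])

lemma res_closed: "x \<in> carrier X \<Longrightarrow> res x \<in> carrier (char_group GS)"
  unfolding XS_eq by (rule imageI)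

lemma R_char: "x \<in> carrier X \<Longrightarrow> y \<in> carrier X \<Longrightarrow> R x y = J x y / J y x"
  by (rule R_form_char(2)[OF hopf_2_cocycleD[OF J]])

lemma RS_char: "x \<in> carrier (char_group GS) \<Longrightarrow> y \<in> carrier (char_group GS) \<Longrightarrow> RS x y = JS x y / JS y x"
  by (rule D.R_form_char(2)[OF D.hopf_2_cocycleD[OF JS]])

lemma R_antisym: "x \<in> carrier X \<Longrightarrow> y \<in> carrier X \<Longrightarrow> R x y = tw.antisym x y"
  unfolding tw.antisym_def by (rule R_char)

lemma RS_antisym: "x \<in> carrier (char_group GS) \<Longrightarrow> y \<in> carrier (char_group GS) \<Longrightarrow> RS x y = twS.antisym x y"
  unfolding twS.antisym_def by (rule RS_char)

lemma X_mult: "x \<in> carrier X \<Longrightarrow> y \<in> carrier X \<Longrightarrow> x * y \<in> carrier X"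
  using X.m_closed[of x y] by simp

text \<open>On characters a gauge transformation is multiplication by a coboundary, with
  \<open>g'\<close> the reciprocal of \<open>g\<close>.\<close>

lemma gauge: "\<exists>g g'. (\<forall>x\<in>carrier X. g x * g' x = 1) \<and>
    (\<forall>x\<in>carrier X. \<forall>y\<in>carrier X. JS (res x) (res y) = g (x * y) * J x y * (g' x * g' y))"
proof -
  obtain g g' where g: "linear_form G g" "linear_form G g'"
    and inv: "\<forall>a\<in>\<O>\<^bsub>G\<^esub>. conv1 G g g' a = counit G a \<and> conv1 G g' g a = counit G a"
    and eq: "\<forall>a\<in>\<O>\<^bsub>G\<^esub>. \<forall>b\<in>\<O>\<^bsub>G\<^esub>.
        JS (res a) (res b) = conv2 G (conv2 G (\<lambda>a b. g (a * b)) J) (\<lambda>a b. g' a * g' b) a b"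
    using supp unfolding support_with_def gauge_equivalent_def by blast
  note bJ = hopf_2_cocycleD(1)[OF J]
  have b1: "bilinear_form G (\<lambda>a b. g (a * b))"
    by (rule bilinear_formI) (auto intro: linear_form_mult_arg linear_form_mult_arg' g)
  have b2: "bilinear_form G (\<lambda>a b. g' a * g' b)"
    by (rule bilinear_formI) (auto intro: linear_form_cmult g)
  have "g x * g' x = 1" if x: "x \<in> carrier X" for x
    using inv char_coord[OF x] conv1_char[OF g x] counit_char[OF x] by simp
  moreover have "JS (res x) (res y) = g (x * y) * J x y * (g' x * g' y)"
    if xy: "x \<in> carrier X" "y \<in> carrier X" for x y
    using eq char_coord[OF xy(1)] char_coord[OF xy(2)]
      conv2_char[OF bilinear_conv2[OF b1 bJ] b2 xy] conv2_char[OF b1 bJ xy] by simp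
  ultimately show ?thesis by blast
qed

text \<open>The coboundary factor is symmetric because multiplication of characters is commutative,
  so it cancels in the antisymmetrization.\<close>

lemma R_restrict:
  assumes "x \<in> carrier X" "y \<in> carrier X" shows "RS (res x) (res y) = R x y"
proof -
  obtain g g' where g: "\<forall>x\<in>carrier X. g x * g' x = 1"
    "\<forall>x\<in>carrier X. \<forall>y\<in>carrier X. JS (res x) (res y) = g (x * y) * J x y * (g' x * g' y)"
    using gauge by (elim exE conjE)
  have nz: "g (x * y) \<noteq> 0" "g' x \<noteq> 0" "g' y \<noteq> 0"
    using g(1) X_mult[OF assms] assms by (metis mult_zero_left mult_zero_right zero_neq_one)+
  have "RS (res x) (res y) = (g (x * y) * J x y * (g' x * g' y)) / (g (y * x) * J y x * (g' y * g' x))"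
    unfolding RS_char[OF res_closed[OF assms(1)] res_closed[OF assms(2)]] using g(2) assms by simp
  also have "\<dots> = J x y / J y x"
    using nz by (simp add: mult.commute[of y x] field_simps)
  finally show ?thesis unfolding R_char[OF assms] .
qed

text \<open>The first argument enters linearly and the characters span, so nondegeneracy may be
  tested on them.\<close>

lemma minimal:
  assumes f: "f \<in> \<O>\<^bsub>GS\<^esub>" and zero: "\<And>w. w \<in> carrier (char_group GS) \<Longrightarrow> RS w f = 0"
  shows "f = 0"
proof -
  note bil = D.R_form_char(1)[OF D.hopf_2_cocycleD[OF JS]]
  have "RS b f = 0" if b: "b \<in> \<O>\<^bsub>GS\<^esub>" for b
  proof -
    have "RS b f = lsum (D.coef b) (\<lambda>w. RS w f)"
      by (rule D.linear_form_lsum[OF D.bilinear_formD(2)[OF bil f] b])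
    also have "\<dots> = lsum (D.coef b) (\<lambda>w. 0)"
      by (rule lsum_cong) (rule zero[OF D.coef_char[OF b]])
    finally show ?thesis by simp
  qed
  hence "f \<in> {a \<in> \<O>\<^bsub>GS\<^esub>. \<forall>b\<in>\<O>\<^bsub>GS\<^esub>. RS b a = 0}" using f by blast
  thus ?thesis using supp unfolding support_with_def minimal_cocycle_def by blast
qed

text \<open>Nondegeneracy is applied to the function \<open>x - 1\<close>, which pairs to
  \<open>1 - 1\<close> with every character.\<close>

lemma radical_trivial:
  assumes x: "x \<in> carrier (char_group GS)" and triv: "\<And>w. w \<in> carrier (char_group GS) \<Longrightarrow> RS w x = 1"
  shows "x = indicator S"
proof -
  note bil = D.R_form_char(1)[OF D.hopf_2_cocycleD[OF JS]]
  let ?one = "indicator S :: 'a \<Rightarrow> complex"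
  have one: "?one \<in> carrier (char_group GS)" using D.X.one_closed by simp
  note O = D.char_coord[OF x] D.coord_smult[OF D.char_coord[OF one], of "- 1"]
  have "x + fun_smult (- 1) ?one = 0"
  proof (rule minimal[OF D.coord_add[OF O]])
    fix w assume w: "w \<in> carrier (char_group GS)"
    note L = D.bilinear_formD(1)[OF bil D.char_coord[OF w]]
    have "RS w ?one = 1" using RS_antisym[OF w one] twS.antisym_one(2)[OF w] by simp
    thus "RS w (x + fun_smult (- 1) ?one) = 0"
      unfolding D.linear_formD(1)[OF L O] D.linear_formD(2)[OF L D.char_coord[OF one]] triv[OF w] by simp
  qed
  hence "(x + fun_smult (- 1) ?one) s = 0" for s by (simp only: zero_fun_apply)
  hence "x s = ?one s" for s by (simp add: fun_smult_def)
  thus ?thesis by (rule ext)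
qed

lemma res_eq_one_iff: "x \<in> carrier X \<Longrightarrow> res x = indicator S \<longleftrightarrow> x \<in> S.perp"
proof
  assume x: "x \<in> carrier X"
  show "x \<in> S.perp" if "res x = indicator S"
  proof -
    have "x s = 1" if "s \<in> S" for s
      using fun_cong[OF \<open>res x = indicator S\<close>, of s] that by simp
    thus ?thesis using x by (simp add: S.perp_def)
  qed
  show "res x = indicator S" if "x \<in> S.perp"
  proof
    fix s show "res x s = indicator S s" using that by (cases "s \<in> S") (auto simp: S.perp_def)
  qed
qed

text \<open>Symmetry of \<open>J\<close> at \<open>x\<close> means that the form is trivial at
  \<open>x\<close>. Restriction to \<open>S\<close> preserves the form and is surjective on
  characters, so this says that \<open>x\<close> restricts to the radical over \<open>S\<close>,
  which is trivial.\<close>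

lemma radical_iff:
  assumes x: "x \<in> carrier X"
  shows "(\<forall>y\<in>carrier X. J x y = J y x) \<longleftrightarrow> x \<in> S.perp"
proof
  assume sym: "\<forall>y\<in>carrier X. J x y = J y x"
  have "res x = indicator S"
  proof (rule radical_trivial[OF res_closed[OF x]])
    fix w assume "w \<in> carrier (char_group GS)"
    then obtain y where y: "y \<in> carrier X" "w = res y" unfolding XS_eq by blast
    have "R y x = 1" using sym y(1) x tw.nonzero[OF x y(1)] by (simp add: R_char)
    thus "RS w (res x) = 1" unfolding y(2) R_restrict[OF y(1) x] .
  qed
  thus "x \<in> S.perp" using res_eq_one_iff[OF x] by blast
next
  assume "x \<in> S.perp"
  hence one: "res x = indicator S" using res_eq_one_iff[OF x] by blast
  show "\<forall>y\<in>carrier X. J x y = J y x"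
  proof
    fix y assume y: "y \<in> carrier X"
    have "R x y = RS (indicator S) (res y)" using R_restrict[OF x y] one by simp
    also have "\<dots> = 1"
      using RS_antisym[OF D.X.one_closed res_closed[OF y]] twS.antisym_one(1)[OF res_closed[OF y]] by simp
    finally show "J x y = J y x" using R_char[OF x y] tw.nonzero[OF y x] by simp
  qed
qed

text \<open>By \<open>mem_center\<close> only characters in the radical occur in a central element,
  and \<open>radical_iff\<close> identifies the radical with the annihilator of
  \<open>S\<close>.\<close>

lemma center_carrier:
  "carrier (alg_center (right_twist G J)) = S.pull ` \<O>\<^bsub>quot_group G S\<^esub>"
proof -
  note iso = right_twist_iso[OF J]
  have carr: "carrier (right_twist G J) = \<O>\<^bsub>G\<^esub>" by (simp add: right_twist_def coord_algebra_def)
  have "(\<forall>h\<in>\<O>\<^bsub>G\<^esub>. f \<otimes>\<^bsub>right_twist G J\<^esub> h = h \<otimes>\<^bsub>right_twist G J\<^esub> f) \<longleftrightarrow> {x. coef f x \<noteq> 0} \<subseteq> S.perp"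
    if f: "f \<in> \<O>\<^bsub>G\<^esub>" for f
  proof -
    have cf: "coef f \<in> carrier tw.A" using coef(1,2)[OF f] by (simp add: tw.mem_carrier)
    have "(\<forall>h\<in>\<O>\<^bsub>G\<^esub>. f \<otimes>\<^bsub>right_twist G J\<^esub> h = h \<otimes>\<^bsub>right_twist G J\<^esub> f) \<longleftrightarrow>
        (\<forall>b\<in>carrier tw.A. coef f \<otimes>\<^bsub>tw.A\<^esub> b = b \<otimes>\<^bsub>tw.A\<^esub> coef f)"
    proof
      assume c: "\<forall>h\<in>\<O>\<^bsub>G\<^esub>. f \<otimes>\<^bsub>right_twist G J\<^esub> h = h \<otimes>\<^bsub>right_twist G J\<^esub> f"
      show "\<forall>b\<in>carrier tw.A. coef f \<otimes>\<^bsub>tw.A\<^esub> b = b \<otimes>\<^bsub>tw.A\<^esub> coef f"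
      proof
        fix b assume b: "b \<in> carrier tw.A"
        have "\<Lambda> b \<in> \<O>\<^bsub>G\<^esub>" using calg_isoD(2)[OF iso b] carr by simp
        hence "\<Lambda> (coef f \<otimes>\<^bsub>tw.A\<^esub> b) = \<Lambda> (b \<otimes>\<^bsub>tw.A\<^esub> coef f)"
          unfolding calg_isoD(3)[OF iso cf b] calg_isoD(3)[OF iso b cf] coef(3)[OF f] using c by blast
        thus "coef f \<otimes>\<^bsub>tw.A\<^esub> b = b \<otimes>\<^bsub>tw.A\<^esub> coef f"
          by (rule calg_isoD(8)[OF iso tw.mult_closed[OF cf b] tw.mult_closed[OF b cf]])
      qed
    next
      assume c: "\<forall>b\<in>carrier tw.A. coef f \<otimes>\<^bsub>tw.A\<^esub> b = b \<otimes>\<^bsub>tw.A\<^esub> coef f"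
      show "\<forall>h\<in>\<O>\<^bsub>G\<^esub>. f \<otimes>\<^bsub>right_twist G J\<^esub> h = h \<otimes>\<^bsub>right_twist G J\<^esub> f"
      proof
        fix h assume h: "h \<in> \<O>\<^bsub>G\<^esub>"
        have ch: "coef h \<in> carrier tw.A" using coef(1,2)[OF h] by (simp add: tw.mem_carrier)
        have "\<Lambda> (coef f \<otimes>\<^bsub>tw.A\<^esub> coef h) = \<Lambda> (coef h \<otimes>\<^bsub>tw.A\<^esub> coef f)" using c ch by simp
        thus "f \<otimes>\<^bsub>right_twist G J\<^esub> h = h \<otimes>\<^bsub>right_twist G J\<^esub> f"
          unfolding calg_isoD(3)[OF iso cf ch] calg_isoD(3)[OF iso ch cf] coef(3)[OF f] coef(3)[OF h] .
      qed
    qed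
    also have "\<dots> \<longleftrightarrow> (\<forall>x y. coef f x \<noteq> 0 \<longrightarrow> y \<in> carrier X \<longrightarrow> J x y = J y x)"
      by (rule tw.mem_center[OF cf])
    also have "\<dots> \<longleftrightarrow> {x. coef f x \<noteq> 0} \<subseteq> S.perp"
      using radical_iff coef_char[OF f] by blast
    finally show ?thesis .
  qed
  thus ?thesis unfolding S.pull_image alg_center_def using carr by auto
qed

text \<open>The inclusion of \<open>center_carrier\<close> need not be multiplicative, because the
  center carries the twisted product. Rescaling the coefficients by the gauge function
  \<open>g'\<close> repairs this.\<close>

lemma center_iso: "alg_center (right_twist G J) \<cong>\<^sub>a\<^sub>l\<^sub>g coord_algebra (quot_group G S)"
proof -
  let ?Q = "quot_group G S"
  let ?Z = "alg_center (right_twist G J)"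
  obtain g g' where g: "\<forall>x\<in>carrier X. g x * g' x = 1"
    "\<forall>x\<in>carrier X. \<forall>y\<in>carrier X. JS (res x) (res y) = g (x * y) * J x y * (g' x * g' y)"
    using gauge by (elim exE conjE)
  have ginv: "g' x \<noteq> 0" "g x = inverse (g' x)" if "x \<in> carrier X" for x
  proof -
    have "g x * g' x = 1" using g(1) that by blast
    thus "g' x \<noteq> 0" by auto
    thus "g x = inverse (g' x)" using \<open>g x * g' x = 1\<close> by (simp add: field_simps)
  qed
  have perpX: "x \<in> carrier X" if "x \<in> S.perp" for x using that by (simp add: S.perp_def)
  interpret P: subgroup S.perp X by (rule S.perp_subgroup)
  \<comment> \<open>Both restrictions to \<open>S\<close> are the unit, where \<open>JS\<close> is
    1; the gauge identity thus exhibits \<open>J\<close> on the annihilator as a coboundary.\<close>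
  have J_perp: "g' (x * y) = g' x * g' y * J x y" if xy: "x \<in> S.perp" "y \<in> S.perp" for x y
  proof -
    note xX = perpX[OF xy(1)] and yX = perpX[OF xy(2)]
    have "JS (res x) (res y) = 1"
      using xy res_eq_one_iff[OF xX] res_eq_one_iff[OF yX] twS.normalized(1)[OF D.X.one_closed] by simp
    hence "inverse (g' (x * y)) * J x y * (g' x * g' y) = 1"
      using g(2) xX yX ginv(2)[OF X_mult[OF xX yX]] by simp
    thus ?thesis using ginv(1)[OF X_mult[OF xX yX]] by (simp add: field_simps)
  qed
  have g'1: "g' (indicator (carrier G)) = 1"
    using J_perp[OF P.one_closed P.one_closed] tw.normalized(1)[OF X.one_closed]
      ginv(1)[OF X.one_closed] X.l_one[OF X.one_closed] by simp
  \<comment> \<open>The constant cocycle gives the ordinary product, which is thereby computed with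
    the same pairing formula.\<close>
  interpret one: twisted_group X "\<lambda>_ _. 1" by unfold_locales (simp add: group_2_cocycle_def)
  note [simp del] = one.nonzero one.normalized
  have iso1: "calg_iso \<Lambda> one.A (coord_algebra G)"
  proof (rule twist_iso[OF one.cocycle])
    fix f h t assume f: "f \<in> \<O>\<^bsub>G\<^esub>" "h \<in> \<O>\<^bsub>G\<^esub>"
    have "lsum (coef f) (\<lambda>x. lsum (coef h) (\<lambda>y. 1 * (x t * y t))) = lsum (coef f) (\<lambda>x. x t) * lsum (coef h) (\<lambda>y. y t)"
      by (simp only: mult_1 lsum_mult_right)
    also have "\<dots> = f t * h t"
      using linear_form_lsum[OF linear_form_eval f(1), of t] linear_form_lsum[OF linear_form_eval f(2), of t] by simp
    finally show "(f \<otimes>\<^bsub>coord_algebra G\<^esub> h) t = lsum (coef f) (\<lambda>x. lsum (coef h) (\<lambda>y. 1 * (x t * y t)))"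
      by (simp add: coord_algebra_def)
  qed (simp_all add: coord_algebra_def)
  note isoJ = right_twist_iso[OF J]
  define w where "w c a x = c x * a x" for c a :: "('a \<Rightarrow> complex) \<Rightarrow> complex" and x
  define V where "V = {a. finite {x. a x \<noteq> 0} \<and> {x. a x \<noteq> (0::complex)} \<subseteq> S.perp}"
  have VX: "finite {x. a x \<noteq> 0}" "{x. a x \<noteq> 0} \<subseteq> carrier X" if "a \<in> V" for a
    using that perpX unfolding V_def by blast+
  have wV: "w c a \<in> V" if "a \<in> V" for c a
    using that unfolding V_def w_def by (auto intro: finite_subset)
  have lsum_w: "lsum (w g' a) k = lsum a (\<lambda>x. g' x * k x)" if "a \<in> V" for a k
    unfolding w_def using ginv(1) VX(2)[OF that] by (intro lsum_weight) blast
  have w_inverse: "w g (w g' a) = a" "w g' (w g a) = a" if a: "a \<in> V" for a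
  proof -
    have "g x * (g' x * a x) = a x" "g' x * (g x * a x) = a x" for x
    proof -
      have "a x = 0 \<or> g x * g' x = 1" using VX(2)[OF a] g(1) by blast
      thus "g x * (g' x * a x) = a x" "g' x * (g x * a x) = a x"
        by (auto simp: mult.assoc[symmetric] mult.commute[of "g' x"])
    qed
    thus "w g (w g' a) = a" "w g' (w g a) = a" unfolding w_def by auto
  qed
  have w_mult: "w g' (a \<otimes>\<^bsub>one.A\<^esub> b) = w g' a \<otimes>\<^bsub>tw.A\<^esub> w g' b" "a \<otimes>\<^bsub>one.A\<^esub> b \<in> V" if ab: "a \<in> V" "b \<in> V" for a b
  proof -
    have A: "a \<in> carrier one.A" "b \<in> carrier one.A" using VX[OF ab(1)] VX[OF ab(2)] by (simp_all add: one.mem_carrier)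
    have B: "w g' a \<in> carrier tw.A" "w g' b \<in> carrier tw.A"
      using VX[OF wV[OF ab(1)]] VX[OF wV[OF ab(2)]] by (simp_all add: tw.mem_carrier)
    have "{z. (a \<otimes>\<^bsub>one.A\<^esub> b) z \<noteq> 0} \<subseteq> S.perp"
    proof (rule order_trans[OF one.mult_support image_subsetI])
      fix p assume "p \<in> {x. a x \<noteq> 0} \<times> {y. b y \<noteq> 0}"
      hence "fst p \<in> S.perp" "snd p \<in> S.perp" using ab unfolding V_def by auto
      thus "fst p \<otimes>\<^bsub>X\<^esub> snd p \<in> S.perp" by (rule P.m_closed)
    qed
    thus V: "a \<otimes>\<^bsub>one.A\<^esub> b \<in> V" using one.finite_support[OF one.mult_closed[OF A]] by (simp add: V_def)
    show "w g' (a \<otimes>\<^bsub>one.A\<^esub> b) = w g' a \<otimes>\<^bsub>tw.A\<^esub> w g' b"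
    proof (rule lsum_eqI)
      fix k
      have "lsum (w g' (a \<otimes>\<^bsub>one.A\<^esub> b)) k = lsum a (\<lambda>x. lsum b (\<lambda>y. g' (x * y) * k (x * y)))"
        unfolding lsum_w[OF V] one.lsum_mult[OF A] by simp
      also have "\<dots> = lsum a (\<lambda>x. g' x * lsum b (\<lambda>y. g' y * (J x y * k (x * y))))"
        unfolding lsum_mult_right(1)[symmetric]
      proof (intro lsum_cong)
        fix x y assume "a x \<noteq> 0" "b y \<noteq> 0"
        hence "x \<in> S.perp" "y \<in> S.perp" using ab unfolding V_def by blast+
        thus "g' (x * y) * k (x * y) = g' x * (g' y * (J x y * k (x * y)))" by (simp add: J_perp)
      qed
      also have "\<dots> = lsum (w g' a \<otimes>\<^bsub>tw.A\<^esub> w g' b) k"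
        unfolding tw.lsum_mult[OF B] lsum_w[OF ab(1)] lsum_w[OF ab(2)] by simp
      finally show "lsum (w g' (a \<otimes>\<^bsub>one.A\<^esub> b)) k = lsum (w g' a \<otimes>\<^bsub>tw.A\<^esub> w g' b) k" .
    qed (rule VX(1)[OF wV[OF V]], rule tw.finite_support[OF tw.mult_closed[OF B]])
  qed
  have coefV: "coef f \<in> V" if "f \<in> S.pull ` \<O>\<^bsub>?Q\<^esub>" for f
    using that coef(1)[of f] unfolding S.pull_image V_def by simp
  have \<Lambda>V: "\<Lambda> a \<in> S.pull ` \<O>\<^bsub>?Q\<^esub>" if a: "a \<in> V" for a
  proof -
    have "\<Lambda> a \<in> \<O>\<^bsub>G\<^esub>" using VX[OF a] unfolding coord_ring_eq lin_span_def by blast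
    thus ?thesis using a coef_\<Lambda>[OF VX[OF a]] unfolding S.pull_image V_def by simp
  qed
  \<comment> \<open>Expand the pulled back function in characters, rescale by \<open>g'\<close> and
    sum up again. The map starts on the side of \<open>G/S\<close>, where the ring axioms used for
    inverting it are at hand.\<close>
  define h where "h F = \<Lambda> (w g' (coef (S.pull F)))" for F
  have pullV: "coef (S.pull F) \<in> V" if "F \<in> \<O>\<^bsub>?Q\<^esub>" for F using that coefV by blast
  have pullO: "S.pull F \<in> \<O>\<^bsub>G\<^esub>" if "F \<in> \<O>\<^bsub>?Q\<^esub>" for F using that by (simp add: S.quot_coord_ring)
  have carrQ: "carrier (coord_algebra ?Q) = \<O>\<^bsub>?Q\<^esub>" by (simp add: coord_algebra_def)
  have "calg_iso h (coord_algebra ?Q) ?Z"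
  proof (rule calg_isoI)
    show "bij_betw h (carrier (coord_algebra ?Q)) (carrier ?Z)"
      unfolding carrQ center_carrier bij_betw_def
    proof
      show "inj_on h \<O>\<^bsub>?Q\<^esub>"
      proof (rule inj_onI)
        fix F K assume F: "F \<in> \<O>\<^bsub>?Q\<^esub>" and K: "K \<in> \<O>\<^bsub>?Q\<^esub>" and eq: "h F = h K"
        have "coef (h F) = w g' (coef (S.pull F))" "coef (h K) = w g' (coef (S.pull K))"
          unfolding h_def by (rule coef_\<Lambda>[OF VX[OF wV[OF pullV[OF F]]]] coef_\<Lambda>[OF VX[OF wV[OF pullV[OF K]]]])+
        hence "w g (w g' (coef (S.pull F))) = w g (w g' (coef (S.pull K)))" using eq by simp
        hence "coef (S.pull F) = coef (S.pull K)"
          unfolding w_inverse(1)[OF pullV[OF F]] w_inverse(1)[OF pullV[OF K]] .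
        hence "\<Lambda> (coef (S.pull F)) = \<Lambda> (coef (S.pull K))" by simp
        hence eq': "S.pull F = S.pull K" unfolding coef(3)[OF pullO[OF F]] coef(3)[OF pullO[OF K]] .
        show "F = K"
          by (rule S.pull_inj[OF _ _ eq']) (use F K in \<open>simp_all add: S.quot_coord_ring\<close>)
      qed
      show "h ` \<O>\<^bsub>?Q\<^esub> = S.pull ` \<O>\<^bsub>?Q\<^esub>"
      proof
        show "h ` \<O>\<^bsub>?Q\<^esub> \<subseteq> S.pull ` \<O>\<^bsub>?Q\<^esub>"
          unfolding h_def using \<Lambda>V[OF wV[OF pullV]] by blast
        show "S.pull ` \<O>\<^bsub>?Q\<^esub> \<subseteq> h ` \<O>\<^bsub>?Q\<^esub>"
        proof
          fix f assume f: "f \<in> S.pull ` \<O>\<^bsub>?Q\<^esub>"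
          have wf: "w g (coef f) \<in> V" by (rule wV[OF coefV[OF f]])
          obtain F where F: "F \<in> \<O>\<^bsub>?Q\<^esub>" "S.pull F = \<Lambda> (w g (coef f))" using \<Lambda>V[OF wf] by (metis imageE)
          have "h F = \<Lambda> (w g' (w g (coef f)))" unfolding h_def F(2) coef_\<Lambda>[OF VX[OF wf]] ..
          also have "\<dots> = f"
            unfolding w_inverse(2)[OF coefV[OF f]] using f S.pull_image coef(3) by blast
          finally show "f \<in> h ` \<O>\<^bsub>?Q\<^esub>" using F(1) by blast
        qed
      qed
    qed
  next
    fix F K assume "F \<in> carrier (coord_algebra ?Q)" "K \<in> carrier (coord_algebra ?Q)"
    hence F: "F \<in> \<O>\<^bsub>?Q\<^esub>" and K: "K \<in> \<O>\<^bsub>?Q\<^esub>" by (simp_all add: carrQ)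
    note Va = pullV[OF F] and Vb = pullV[OF K]
    have A: "coef (S.pull F) \<in> carrier one.A" "coef (S.pull K) \<in> carrier one.A"
      using VX[OF Va] VX[OF Vb] by (simp_all add: one.mem_carrier)
    have B: "w g' (coef (S.pull F)) \<in> carrier tw.A" "w g' (coef (S.pull K)) \<in> carrier tw.A"
      using VX[OF wV[OF Va]] VX[OF wV[OF Vb]] by (simp_all add: tw.mem_carrier)
    have "\<Lambda> (coef (S.pull F) \<otimes>\<^bsub>one.A\<^esub> coef (S.pull K)) = S.pull F * S.pull K"
      unfolding calg_isoD(3)[OF iso1 A] coef(3)[OF pullO[OF F]] coef(3)[OF pullO[OF K]]
      by (simp add: coord_algebra_def)
    hence "coef (S.pull F * S.pull K) = coef (S.pull F) \<otimes>\<^bsub>one.A\<^esub> coef (S.pull K)"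
      using coef_\<Lambda>[OF VX[OF w_mult(2)[OF Va Vb]]] by (simp only:)
    hence "h (F * K) = \<Lambda> (w g' (coef (S.pull F)) \<otimes>\<^bsub>tw.A\<^esub> w g' (coef (S.pull K)))"
      unfolding h_def S.pull_mult by (simp only: w_mult(1)[OF Va Vb])
    also have "\<dots> = h F \<otimes>\<^bsub>right_twist G J\<^esub> h K"
      unfolding h_def by (rule calg_isoD(3)[OF isoJ B])
    finally show "h (F \<otimes>\<^bsub>coord_algebra ?Q\<^esub> K) = h F \<otimes>\<^bsub>?Z\<^esub> h K"
      by (simp add: coord_algebra_def alg_center_def)
    have "w g' (a + b) = w g' a + w g' b" for a b by (rule ext) (simp add: w_def algebra_simps)
    hence "h (F + K) = \<Lambda> (w g' (coef (S.pull F)) + w g' (coef (S.pull K)))"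
      unfolding h_def S.pull_def pullback_linear unfolding S.pull_def[symmetric] coef_add[OF pullO[OF F] pullO[OF K]]
      by (simp only:)
    also have "\<dots> = h F + h K"
      unfolding h_def by (rule \<Lambda>_add[OF VX(1)[OF wV[OF Va]] VX(1)[OF wV[OF Vb]]])
    finally show "h (F \<oplus>\<^bsub>coord_algebra ?Q\<^esub> K) = h F \<oplus>\<^bsub>?Z\<^esub> h K"
      by (simp add: coord_algebra_def alg_center_def right_twist_def)
  next
    fix c F assume "F \<in> carrier (coord_algebra ?Q)"
    hence F: "F \<in> \<O>\<^bsub>?Q\<^esub>" by (simp add: carrQ)
    have "w g' (fun_smult c a) = fun_smult c (w g' a)" for a by (rule ext) (simp add: w_def fun_smult_def)
    hence "h (fun_smult c F) = \<Lambda> (fun_smult c (w g' (coef (S.pull F))))"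
      unfolding h_def S.pull_def pullback_linear unfolding S.pull_def[symmetric] coef_smult[OF pullO[OF F]]
      by (simp only:)
    hence "h (fun_smult c F) = fun_smult c (h F)" unfolding h_def by (simp only: \<Lambda>_smult)
    thus "h (c \<odot>\<^bsub>coord_algebra ?Q\<^esub> F) = c \<odot>\<^bsub>?Z\<^esub> h F"
      by (simp add: coord_algebra_def alg_center_def right_twist_def)
  next
    have pone: "S.pull (indicator (rcosets S)) = indicator (carrier G)"
      by (rule ext) (auto simp: S.pull_def pullback_def S.rcos_mem indicator_def)
    have "coef (indicator (carrier G)) = indicator {indicator (carrier G)}"
      using coef_of_char[OF X.one_closed] by simp
    moreover have "w g' (indicator {indicator (carrier G)}) = indicator {indicator (carrier G)}"
    proof
      fix x :: "'a \<Rightarrow> complex"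
      show "w g' (indicator {indicator (carrier G)}) x = indicator {indicator (carrier G)} x"
        using g'1 by (cases "x = indicator (carrier G)") (simp_all add: w_def)
    qed
    ultimately have "h (indicator (rcosets S)) = indicator (carrier G)"
      unfolding h_def pone by (simp only: \<Lambda>_indicator)
    thus "h \<one>\<^bsub>coord_algebra ?Q\<^esub> = \<one>\<^bsub>?Z\<^esub>"
      by (simp add: coord_algebra_def alg_center_def right_twist_def)
    have "coef (\<Lambda> 0) = 0" by (rule coef_\<Lambda>) simp_all
    hence "coef 0 = 0" by (simp only: \<Lambda>_zero)
    moreover have "w g' 0 = 0" by (rule ext) (simp add: w_def)
    ultimately have "h 0 = 0" unfolding h_def S.pull_def pullback_linear by (simp only: \<Lambda>_zero)
    thus "h \<zero>\<^bsub>coord_algebra ?Q\<^esub> = \<zero>\<^bsub>?Z\<^esub>"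
      by (simp only: coord_algebra_def alg_center_def right_twist_def ring.simps partial_object.simps monoid.simps)
  qed
  from calg_iso_sym[OF S.quot_coord_algebra this] show ?thesis by (rule calg_iso_imp_isomorphic)
qed

text \<open>A regular function vanishing on the points \<open>R(x, ?)\<close> is, after restriction to \<open>S\<close>, in the kernel of
  \<open>R\<close>; so density in \<open>S\<close> is the minimality of \<open>JS\<close>.\<close>

lemma support_closure:
  assumes pt: "\<And>x. x \<in> carrier X \<Longrightarrow> pt x \<in> carrier G"
    "\<And>x y. x \<in> carrier X \<Longrightarrow> y \<in> carrier X \<Longrightarrow> y (pt x) = R x y"
  shows "S = zariski G closure_of (pt ` carrier X)"
proof
  have "pt ` carrier X \<subseteq> S"
  proof (rule image_subsetI)
    fix x assume x: "x \<in> carrier X"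
    \<comment> \<open>A closed subgroup is cut out by its annihilator, and the characters in the
      annihilator of \<open>S\<close> pair trivially with every \<open>x\<close>.\<close>
    show "pt x \<in> S"
    proof (rule closed_subgroup_memI[OF closed_S pt(1)[OF x]])
      fix y assume y: "y \<in> carrier X" and "\<And>h. h \<in> S \<Longrightarrow> y h = 1"
      hence "y \<in> S.perp" by (simp add: S.perp_def)
      hence "J y x = J x y" using radical_iff[OF y] x by blast
      thus "y (pt x) = 1" using pt(2)[OF x y] R_char[OF x y] tw.nonzero[OF y x] by simp
    qed
  qed
  thus "zariski G closure_of (pt ` carrier X) \<subseteq> S"
    using closed_S by (intro closure_of_minimal) (simp_all add: closed_subgroup_def)
  show "S \<subseteq> zariski G closure_of (pt ` carrier X)"
  proof
    fix s assume s: "s \<in> S"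
    have sG: "s \<in> carrier G" using s by (rule S.H.mem_carrier)
    have "\<exists>y\<in>pt ` carrier X. y \<in> U" if U: "s \<in> U" "openin (zariski G) U" for U
    proof (rule ccontr)
      assume none: "\<not> (\<exists>y\<in>pt ` carrier X. y \<in> U)"
      from zariski_base[OF U(2,1)] obtain f where f: "f \<in> \<O>\<^bsub>G\<^esub>" "f s \<noteq> 0"
        "\<And>t. t \<in> carrier G \<Longrightarrow> f t \<noteq> 0 \<Longrightarrow> t \<in> U" by blast
      have van: "f (pt x) = 0" if "x \<in> carrier X" for x using f(3)[OF pt(1)[OF that]] none that by blast
      have rf: "res f \<in> \<O>\<^bsub>GS\<^esub>" using f(1) by simp
      note bil = D.R_form_char(1)[OF D.hopf_2_cocycleD[OF JS]]
      have "res f = 0"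
      proof (rule minimal[OF rf])
        fix v assume v: "v \<in> carrier (char_group GS)"
        then obtain x where x: "x \<in> carrier X" "v = res x" unfolding XS_eq by blast
        note L = D.bilinear_formD(1)[OF bil D.char_coord[OF v]]
        \<comment> \<open>The pairing with \<open>v\<close> is linear in \<open>f\<close> and is
          evaluation at \<open>pt x\<close> on characters, hence on all regular functions.\<close>
        have "linear_form G (\<lambda>f. RS v (res f))"
          using D.linear_formD[OF L] unfolding linear_form_def pullback_linear by simp
        from linear_form_lsum[OF this f(1)]
        have "RS v (res f) = lsum (coef f) (\<lambda>y. RS v (res y))" .
        also have "\<dots> = lsum (coef f) (\<lambda>y. y (pt x))"
          by (rule lsum_cong) (simp add: x R_restrict[OF x(1) coef_char[OF f(1)]] pt(2)[OF x(1) coef_char[OF f(1)]])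
        also have "\<dots> = f (pt x)" using linear_form_lsum[OF linear_form_eval f(1), of "pt x"] by simp
        finally show "RS v (res f) = 0" using van[OF x(1)] by simp
      qed
      hence "res f s = 0" by (simp only: zero_fun_apply)
      thus False using f(2) s by simp
    qed
    thus "s \<in> zariski G closure_of (pt ` carrier X)"
      using sG topspace_zariski[OF coord_one] by (auto simp: in_closure_of)
  qed
qed

section \<open>The algebra of the support\<close>

lemma simple_support: "simple_algebra (right_twist GS JS)"
proof -
  have "simple_algebra twS.A"
  proof (rule twS.simple_A)
    fix x assume x: "x \<in> carrier (char_group GS)" and sym: "\<And>y. y \<in> carrier (char_group GS) \<Longrightarrow> JS x y = JS y x"
    have "x = indicator S"
    proof (rule radical_trivial[OF x])
      fix v assume v: "v \<in> carrier (char_group GS)"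
      show "RS v x = 1" using RS_char[OF v x] sym[OF v] twS.nonzero[OF v x] by simp
    qed
    thus "x = \<one>\<^bsub>char_group GS\<^esub>" by simp
  qed
  thus ?thesis by (rule simple_algebra_transfer[OF _ D.right_twist_iso[OF JS]])
qed

lemma right_twist_isoI:
  assumes "calg_iso h twS.A B" shows "right_twist GS JS \<cong>\<^sub>a\<^sub>l\<^sub>g B"
  by (rule calg_iso_imp_isomorphic[OF calg_iso_trans[OF
      calg_iso_sym[OF twS.ring_A twS.smult_closed_twisted D.right_twist_iso[OF JS]] assms]])

text \<open>The condition on \<open>\<sigma>\<close> is that its antisymmetrization be that of
  \<open>JS\<close>, so the two cocycles differ by a coboundary.\<close>

lemma support_twisted_group_algebra:
  assumes \<sigma>: "group_2_cocycle (char_group GS) \<sigma>"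
    and R: "\<And>x y. x \<in> carrier (char_group GS) \<Longrightarrow> y \<in> carrier (char_group GS) \<Longrightarrow> \<sigma> x y = RS x y * \<sigma> y x"
  shows "right_twist GS JS \<cong>\<^sub>a\<^sub>l\<^sub>g twisted_group_algebra (char_group GS) \<sigma>"
proof -
  have "\<exists>f. (\<forall>x\<in>carrier (char_group GS). f x \<noteq> 0) \<and>
    (\<forall>x\<in>carrier (char_group GS). \<forall>y\<in>carrier (char_group GS).
      JS x y * f (x \<otimes>\<^bsub>char_group GS\<^esub> y) = f x * f y * \<sigma> x y)"
  proof (rule D.X.cocycles_cohomologous[OF twS.cocycle \<sigma>])
    fix x y assume xy: "x \<in> carrier (char_group GS)" "y \<in> carrier (char_group GS)"
    show "JS x y * \<sigma> y x = JS y x * \<sigma> x y"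
      using R[OF xy] RS_char[OF xy] twS.nonzero[OF xy(2,1)] by simp
  qed
  then obtain f where f: "\<And>x. x \<in> carrier (char_group GS) \<Longrightarrow> f x \<noteq> 0"
    "\<And>x y. x \<in> carrier (char_group GS) \<Longrightarrow> y \<in> carrier (char_group GS) \<Longrightarrow>
      JS x y * f (x \<otimes>\<^bsub>char_group GS\<^esub> y) = f x * f y * \<sigma> x y" by blast
  show ?thesis by (rule right_twist_isoI[OF twS.coboundary_iso[OF \<sigma> f]])
qed

text \<open>Composition with the splitting is a section of the restriction from characters of
  \<open>S\<close> to those of \<open>S0\<close>, whose kernel consists of the characters inflated
  from \<open>S/S0\<close>. Thus the character group of \<open>S\<close> is a product, and
  \<open>crossed_split\<close> applies to \<open>JS\<close>.\<close>

lemma support_crossed_product: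
  assumes S0S: "S0 \<subseteq> S"
    and p: "alg_group_hom G (sub_group G S0) p" "\<And>s. s \<in> S0 \<Longrightarrow> p s = s"
    and y: "freely_generates (char_group (sub_group G S0)) l y"
    and q: "\<And>i j. i \<in> {1..l} \<Longrightarrow> j \<in> {1..l} \<Longrightarrow>
      q i j = R (pullback (carrier G) p (y i)) (pullback (carrier G) p (y j))"
    and inflate: "inflate = pullback S (\<lambda>s. S0 #>\<^bsub>GS\<^esub> s)"
  shows "right_twist GS JS \<cong>\<^sub>a\<^sub>l\<^sub>g
     crossed_product (E_alg l q) (char_group (quot_group GS S0))
       (\<lambda>\<chi>. E_scale l q (\<lambda>i. RS (inflate \<chi>) (pullback S p (y i)))) (\<lambda>\<chi> \<psi>. JS (inflate \<chi>) (inflate \<psi>))"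
proof -
  have phom: "p g \<in> S0" "p (g \<otimes> h) = p g \<otimes> p h" if "g \<in> carrier G" "h \<in> carrier G" for g h
    using p(1) that by (auto simp: alg_group_hom_def hom_def)
  have S0G: "s \<in> carrier G" if "s \<in> S0" for s using S0S that S.H.mem_carrier by blast
  \<comment> \<open>The retraction exhibits \<open>S0\<close> as the image of a homomorphism, hence
    as a subgroup.\<close>
  have im: "S0 = p ` carrier G"
  proof
    show "S0 \<subseteq> p ` carrier G"
    proof
      fix s assume s: "s \<in> S0"
      show "s \<in> p ` carrier G" using p(2)[OF s, symmetric] S0G[OF s] by (rule image_eqI)
    qed
    show "p ` carrier G \<subseteq> S0" using phom(1) by blast
  qed
  have subG: "subgroup S0 G"
  proof -
    have "group_hom G G p"
      by (rule group_hom.intro[OF is_group is_group group_hom_axioms.intro])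
        (use phom S0G in \<open>auto simp: hom_def\<close>)
    thus ?thesis unfolding im by (rule group_hom.img_is_subgroup)
  qed
  interpret S0: subgroup S0 G by (rule subG)
  have subGS: "subgroup S0 GS"
  proof (rule D.subgroupI)
    show "S0 \<subseteq> carrier GS" using S0S by simp
    show "S0 \<noteq> {}" using S0.one_closed by blast
    show "inv\<^bsub>GS\<^esub> s \<in> S0" if s: "s \<in> S0" for s
    proof -
      have "inv\<^bsub>GS\<^esub> s = inv s"
        by (rule D.inv_equality) (use s S0S S0G in \<open>auto simp: l_inv intro: S.H.m_inv_closed\<close>)
      thus ?thesis using S0.m_inv_closed[OF s] by simp
    qed
    show "s \<otimes>\<^bsub>GS\<^esub> t \<in> S0" if "s \<in> S0" "t \<in> S0" for s t using that by simp
  qed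
  let ?Y = "char_group (sub_group G S0)"
  let ?Z = "char_group (quot_group GS S0)"
  interpret D0: diagonalizable "sub_group G S0" by (rule sub_group_diagonalizable(1)[OF subG])
  interpret Q: diagonalizable_subgroup GS S0
    by (intro diagonalizable_subgroup.intro D.diagonalizable_axioms subGS)
  interpret Z: comm_group ?Z by (rule Q.quot_char_comm_group)
  have pull: "Q.pull = inflate" unfolding Q.pull_def inflate by simp
  \<comment> \<open>Composition with the splitting extends a character from \<open>S0\<close> to
    \<open>S\<close> and even to \<open>G\<close>; this relates \<open>q\<close>, given by the form
    on \<open>G\<close>, to \<open>JS\<close>.\<close>
  define \<iota> where "\<iota> = (pullback S p :: ('a \<Rightarrow> complex) \<Rightarrow> 'a \<Rightarrow> complex)"
  have ext: "pullback (carrier G) p a \<in> carrier X" "\<iota> a = res (pullback (carrier G) p a)" if a: "a \<in> carrier ?Y" for a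
  proof -
    note ch = D0.char_is_char[OF a]
    have aO: "pullback (carrier G) p a \<in> \<O>\<^bsub>G\<^esub>"
      using p(1) D0.char_coord[OF a] unfolding alg_group_hom_def by blast
    have nz: "a (p g) \<noteq> 0" if "g \<in> carrier G" for g using is_charD(2)[OF ch] phom(1)[OF that that] by simp
    have mult: "a (p (g \<otimes> h)) = a (p g) * a (p h)" if "g \<in> carrier G" "h \<in> carrier G" for g h
      using is_charD(3)[OF ch, of "p g" "p h"] phom[OF that] phom(1)[OF that(2,1)] by simp
    show "pullback (carrier G) p a \<in> carrier X"
      using aO nz mult unfolding char_group_def by (simp add: pullback_def)
    show "\<iota> a = res (pullback (carrier G) p a)"
      unfolding \<iota>_def using S.H.mem_carrier by (auto simp: pullback_def fun_eq_iff)
  qed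
  have \<iota>_closed: "\<iota> a \<in> carrier (char_group GS)" if "a \<in> carrier ?Y" for a
    using res_closed[OF ext(1)[OF that]] ext(2)[OF that] by simp
  have \<iota>_mult: "\<iota> (a * b) = \<iota> a * \<iota> b" for a b unfolding \<iota>_def by (rule pullback_linear)
  have \<iota>_S0: "\<iota> a s = a s" if "s \<in> S0" for a s
    using that S0S p(2)[OF that] by (auto simp: \<iota>_def pullback_def)
  have \<iota>_one: "\<iota> (indicator S0) = indicator S"
  proof
    fix s show "\<iota> (indicator S0) s = indicator S s"
      using phom(1)[of s s] S.H.mem_carrier[of s] by (cases "s \<in> S") (simp_all add: \<iota>_def pullback_def)
  qed
  interpret tY: twisted_group ?Y "\<lambda>a b. JS (\<iota> a) (\<iota> b)"
  proof (unfold_locales, unfold group_2_cocycle_def, intro conjI ballI)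
    fix a b c assume abc: "a \<in> carrier ?Y" "b \<in> carrier ?Y" "c \<in> carrier ?Y"
    show "JS (\<iota> a) (\<iota> b) * JS (\<iota> (a \<otimes>\<^bsub>?Y\<^esub> b)) (\<iota> c) = JS (\<iota> a) (\<iota> (b \<otimes>\<^bsub>?Y\<^esub> c)) * JS (\<iota> b) (\<iota> c)"
      using twS.cocycle_eq[OF \<iota>_closed[OF abc(1)] \<iota>_closed[OF abc(2)] \<iota>_closed[OF abc(3)]]
      by (simp add: \<iota>_mult)
  next
    fix a b assume "a \<in> carrier ?Y" "b \<in> carrier ?Y"
    thus "JS (\<iota> a) (\<iota> b) \<noteq> 0" using twS.nonzero[OF \<iota>_closed \<iota>_closed] by blast
  next
    fix a assume a: "a \<in> carrier ?Y"
    show "JS (\<iota> a) (\<iota> \<one>\<^bsub>?Y\<^esub>) = 1" "JS (\<iota> \<one>\<^bsub>?Y\<^esub>) (\<iota> a) = 1"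
      using twS.normalized[OF \<iota>_closed[OF a]] by (simp_all add: \<iota>_one)
  qed
  interpret fY: free_comm_group ?Y l y by unfold_locales (rule y)
  interpret E: free_twisted ?Y l y "\<lambda>a b. JS (\<iota> a) (\<iota> b)" q
  proof unfold_locales
    fix i j assume ij: "i \<in> {1..l}" "j \<in> {1..l}"
    note yi = fY.gen_closed[OF ij(1)] and yj = fY.gen_closed[OF ij(2)]
    have "q i j = RS (\<iota> (y i)) (\<iota> (y j))"
      unfolding q[OF ij] ext(2)[OF yi] ext(2)[OF yj] by (rule R_restrict[OF ext(1)[OF yi] ext(1)[OF yj], symmetric])
    also have "\<dots> = JS (\<iota> (y i)) (\<iota> (y j)) / JS (\<iota> (y j)) (\<iota> (y i))"
      by (rule RS_char[OF \<iota>_closed[OF yi] \<iota>_closed[OF yj]])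
    finally show "q i j = tY.antisym (y i) (y j)" unfolding tY.antisym_def .
  qed
  have z_perp: "inflate z \<in> carrier (char_group GS)" "\<And>s. s \<in> S0 \<Longrightarrow> inflate z s = 1" if "z \<in> carrier ?Z" for z
    using that unfolding Q.quot_char_iff pull Q.perp_def by blast+
  have z_out: "z C = 0" if "z \<in> carrier ?Z" "C \<notin> rcosets\<^bsub>GS\<^esub> S0" for z C
    using that unfolding Q.quot_char_iff by blast
  interpret C: crossed_split "char_group GS" JS ?Y l y \<iota> q ?Z inflate
    "\<lambda>\<chi> i. RS (inflate \<chi>) (pullback S p (y i))" "\<lambda>\<chi> \<psi>. JS (inflate \<chi>) (inflate \<psi>)"
  proof unfold_locales
    show "\<iota> a \<in> carrier (char_group GS)" if "a \<in> carrier ?Y" for a using that by (rule \<iota>_closed)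
    show "\<iota> (a \<otimes>\<^bsub>?Y\<^esub> b) = \<iota> a \<otimes>\<^bsub>char_group GS\<^esub> \<iota> b" for a b by (simp add: \<iota>_mult)
    show "inflate z \<in> carrier (char_group GS)" if "z \<in> carrier ?Z" for z using that by (rule z_perp)
    show "inflate (z \<otimes>\<^bsub>?Z\<^esub> v) = inflate z \<otimes>\<^bsub>char_group GS\<^esub> inflate v" for z v
      unfolding inflate by (simp add: pullback_linear)
    show "RS (inflate z) (pullback S p (y i)) = twS.antisym (inflate z) (\<iota> (y i))"
      if "z \<in> carrier ?Z" "i \<in> {1..l}" for z i
      using RS_antisym[OF z_perp(1)[OF that(1)] \<iota>_closed[OF fY.gen_closed[OF that(2)]]] unfolding \<iota>_def .
    show "bij_betw (\<lambda>(a, z). \<iota> a \<otimes>\<^bsub>char_group GS\<^esub> inflate z) (carrier ?Y \<times> carrier ?Z) (carrier (char_group GS))"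
      unfolding bij_betw_def
    proof
      show "inj_on (\<lambda>(a, z). \<iota> a \<otimes>\<^bsub>char_group GS\<^esub> inflate z) (carrier ?Y \<times> carrier ?Z)"
      proof (rule inj_onI, clarify)
        fix a z b v assume a: "a \<in> carrier ?Y" and b: "b \<in> carrier ?Y" and z: "z \<in> carrier ?Z" and v: "v \<in> carrier ?Z"
          and "\<iota> a \<otimes>\<^bsub>char_group GS\<^esub> inflate z = \<iota> b \<otimes>\<^bsub>char_group GS\<^esub> inflate v"
        hence eq: "\<iota> a * inflate z = \<iota> b * inflate v" by simp
        \<comment> \<open>Restriction to \<open>S0\<close> kills the inflated factor and recovers
          \<open>a\<close>.\<close>
        have "a s = b s" if s: "s \<in> S0" for s
          using fun_cong[OF eq, of s] by (simp add: \<iota>_S0[OF s] z_perp(2)[OF z s] z_perp(2)[OF v s])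
        hence ab: "a = b"
          by (intro is_char_ext[OF D0.char_is_char[OF a] D0.char_is_char[OF b]]) simp
        have "inflate z s = inflate v s" if s: "s \<in> S" for s
          using fun_cong[OF eq, of s] is_charD(2)[OF D.char_is_char[OF \<iota>_closed[OF b]], of s] s ab by simp
        hence "inflate z = inflate v"
          by (intro is_char_ext[OF D.char_is_char[OF z_perp(1)[OF z]] D.char_is_char[OF z_perp(1)[OF v]]]) simp
        hence "Q.pull z = Q.pull v" unfolding pull .
        hence "z = v" by (intro Q.pull_inj z_out[OF z] z_out[OF v])
        thus "a = b \<and> z = v" using ab by blast
      qed
      show "(\<lambda>(a, z). \<iota> a \<otimes>\<^bsub>char_group GS\<^esub> inflate z) ` (carrier ?Y \<times> carrier ?Z) = carrier (char_group GS)"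
      proof
        show "(\<lambda>(a, z). \<iota> a \<otimes>\<^bsub>char_group GS\<^esub> inflate z) ` (carrier ?Y \<times> carrier ?Z) \<subseteq> carrier (char_group GS)"
          by (rule image_subsetI) (use D.X.m_closed[OF \<iota>_closed z_perp(1)] in \<open>simp add: case_prod_unfold mem_Times_iff\<close>)
        show "carrier (char_group GS) \<subseteq> (\<lambda>(a, z). \<iota> a \<otimes>\<^bsub>char_group GS\<^esub> inflate z) ` (carrier ?Y \<times> carrier ?Z)"
        proof
          fix v assume v: "v \<in> carrier (char_group GS)"
          then obtain x where x: "x \<in> carrier X" "v = res x" unfolding XS_eq by blast
          define a where "a = fun_restrict S0 x"
          have a: "a \<in> carrier ?Y" unfolding a_def sub_group_diagonalizable(2)[OF subG] using x(1) by (rule imageI)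
          note ia = \<iota>_closed[OF a]
          \<comment> \<open>Dividing \<open>v\<close> by the extension of its restriction leaves a
            character trivial on \<open>S0\<close>, which is therefore inflated from the
            quotient.\<close>
          let ?w = "v * inv\<^bsub>char_group GS\<^esub> (\<iota> a)"
          have w: "?w \<in> carrier (char_group GS)" using D.X.m_closed[OF v D.X.inv_closed[OF ia]] by simp
          have "?w s = 1" if s: "s \<in> S0" for s
          proof -
            have "v s = a s" using s S0S unfolding x(2) a_def by auto
            moreover have "a s \<noteq> 0" using is_charD(2)[OF D0.char_is_char[OF a], of s] s by simp
            ultimately show ?thesis using s by (simp add: D.inv_char[OF ia] \<iota>_S0)
          qed
          hence "?w \<in> Q.perp" using w by (simp add: Q.perp_def)
          from Q.perp_ex[OF this] obtain z where z': "z \<in> carrier ?Z \<and> Q.pull z = ?w" by (elim exE)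
          note z = conjunct1[OF z'] conjunct2[OF z', unfolded pull]
          have "v = \<iota> a * inflate z"
          proof
            fix s
            show "v s = (\<iota> a * inflate z) s"
            proof (cases "s \<in> S")
              case True
              thus ?thesis unfolding z(2)
                using is_charD(2)[OF D.char_is_char[OF ia], of s] by (simp add: D.inv_char[OF ia])
            next
              case False
              thus ?thesis
                using is_charD(1)[OF D.char_is_char[OF ia], of s] is_charD(1)[OF D.char_is_char[OF v], of s] by simp
            qed
          qed
          thus "v \<in> (\<lambda>(a, z). \<iota> a \<otimes>\<^bsub>char_group GS\<^esub> inflate z) ` (carrier ?Y \<times> carrier ?Z)"
            using a z(1) by (intro image_eqI[of _ _ "(a, z)"]) simp_all
        qed
      qed
    qed
  qed simp_all
  show ?thesis by (rule right_twist_isoI[OF C.crossed_product_iso_inv])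
qed

end

theorem theorem4p3:
  fixes T :: "'g alg_group" and k l :: nat
    and x y :: "nat \<Rightarrow> 'g \<Rightarrow> complex"
    and J JS :: "'g form2"
    and S S0 :: "'g set"
    and p :: "'g \<Rightarrow> 'g"
    and lam lam0 :: "nat \<Rightarrow> nat \<Rightarrow> complex"
    and inflate :: "('g set \<Rightarrow> complex) \<Rightarrow> 'g \<Rightarrow> complex"
  assumes T: "torus T k"
    and x: "freely_generates (char_group T) k x"
    and J: "hopf_2_cocycle T J"
    and S: "support_with T J S JS"
    and l: "krull_dim (zariski (sub_group T S)) = enat l"
    and S0: "S0 = identity_component (sub_group T S)"
    \<comment> \<open>the splitting of the inclusion of \<open>S0\<close> into \<open>T\<close>\<close>
    and p: "alg_group_hom T (sub_group T S0) p" "\<forall>s\<in>S0. p s = s"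
    and y: "freely_generates (char_group (sub_group T S0)) l y"
    and lam: "\<forall>i\<in>{1..k}. \<forall>j\<in>{1..k}. lam i j = R_form T J (x i) (x j)"
    and lam0: "\<forall>i\<in>{1..l}. \<forall>j\<in>{1..l}. lam0 i j =
                 R_form T J (pullback (carrier T) p (y i)) (pullback (carrier T) p (y j))"
    \<comment> \<open>the embedding of functions on \<open>S/S0\<close> into functions on \<open>S\<close>\<close>
    and inflate: "inflate = pullback S (\<lambda>s. S0 #>\<^bsub>sub_group T S\<^esub> s)"
  shows "
    \<comment> \<open>1)\<close>
    (right_twist T J \<cong>\<^sub>a\<^sub>l\<^sub>g E_alg k lam) \<and>
    (nc_noetherian (right_twist T J)) \<and>
    (nc_domain (right_twist T J)) \<and>
    (carrier (alg_center (right_twist T J)) =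
       pullback (carrier T) (\<lambda>t. S #>\<^bsub>T\<^esub> t) ` \<O>\<^bsub>quot_group T S\<^esub>) \<and>
    (alg_center (right_twist T J) \<cong>\<^sub>a\<^sub>l\<^sub>g coord_algebra (quot_group T S)) \<and>
    \<comment> \<open>2)\<close>
    (\<exists>b. alternating_bicharacter (char_group T) b \<and>
       (\<forall>i\<in>{1..k}. \<forall>j\<in>{1..k}. b (x i) (x j) = lam i j) \<and>
       S = zariski T closure_of ((\<lambda>\<chi>. dual_point T (b \<chi>)) ` carrier (char_group T))) \<and>
    \<comment> \<open>3); the first conjunct says that the form on X(S) is the one induced by that on X(T)\<close>
    (\<forall>\<chi>\<in>carrier (char_group T). \<forall>\<psi>\<in>carrier (char_group T).
       R_form (sub_group T S) JS (fun_restrict S \<chi>) (fun_restrict S \<psi>) = R_form T J \<chi> \<psi>) \<and>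
    (\<exists>\<sigma>. group_2_cocycle (char_group (sub_group T S)) \<sigma> \<and>
       (\<forall>\<chi>\<in>carrier (char_group (sub_group T S)). \<forall>\<psi>\<in>carrier (char_group (sub_group T S)).
          \<sigma> \<chi> \<psi> = R_form (sub_group T S) JS \<chi> \<psi> * \<sigma> \<psi> \<chi>)) \<and>
    (\<forall>\<sigma>. group_2_cocycle (char_group (sub_group T S)) \<sigma> \<and>
       (\<forall>\<chi>\<in>carrier (char_group (sub_group T S)). \<forall>\<psi>\<in>carrier (char_group (sub_group T S)).
          \<sigma> \<chi> \<psi> = R_form (sub_group T S) JS \<chi> \<psi> * \<sigma> \<psi> \<chi>) \<longrightarrow>
       right_twist (sub_group T S) JS \<cong>\<^sub>a\<^sub>l\<^sub>g twisted_group_algebra (char_group (sub_group T S)) \<sigma>) \<and>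
    (right_twist (sub_group T S) JS \<cong>\<^sub>a\<^sub>l\<^sub>g
       crossed_product (E_alg l lam0) (char_group (quot_group (sub_group T S) S0))
         (\<lambda>\<chi>. E_scale l lam0
            (\<lambda>i. R_form (sub_group T S) JS (inflate \<chi>) (pullback S p (y i))))
         (\<lambda>\<chi> \<psi>. JS (inflate \<chi>) (inflate \<psi>))) \<and>
    (simple_algebra (right_twist (sub_group T S) JS)) \<and>
    \<comment> \<open>4)\<close>
    (opposite (right_twist T J) \<cong>\<^sub>a\<^sub>l\<^sub>g left_twist T (conv2_inv T J))"
proof -
  obtain \<phi> where G: "group T" and \<phi>: "alg_group_iso T (mult_group_power k) \<phi>"
    using T unfolding torus_def by blast
  interpret tc: torus_coordinates T k \<phi>
    by (intro torus_coordinates.intro torus_coordinates_axioms.intro G \<phi>)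
  interpret D: diagonalizable T by (rule tc.diagonalizable)
  interpret sc: supported_cocycle T J S JS by unfold_locales (rule J S)+
  interpret fx: free_comm_group D.X k x by unfold_locales (rule x)
  interpret E: free_twisted D.X k x J lam
  proof unfold_locales
    fix i j assume ij: "i \<in> {1..k}" "j \<in> {1..k}"
    show "lam i j = sc.tw.antisym (x i) (x j)"
      using lam ij sc.R_antisym[OF fx.gen_closed[OF ij(1)] fx.gen_closed[OF ij(2)]] by simp
  qed
  note iso = D.right_twist_iso[OF J]
  have 1: "right_twist T J \<cong>\<^sub>a\<^sub>l\<^sub>g E_alg k lam"
    by (rule calg_iso_imp_isomorphic[OF calg_iso_trans[OF
        calg_iso_sym[OF sc.tw.ring_A sc.tw.smult_closed_twisted iso]
        calg_iso_sym[OF E.ring_E E.smult_closed_E E.calg_iso_E]]])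
  have 2: "nc_noetherian (right_twist T J)"
    by (rule nc_noetherian_transfer[OF fx.twisted_nc_noetherian[OF sc.tw.cocycle] iso])
  have 3: "nc_domain (right_twist T J)"
    by (rule nc_domain_transfer[OF fx.twisted_noetherian_domain(2)[OF sc.tw.cocycle] iso])
  have 4: "carrier (alg_center (right_twist T J)) =
      pullback (carrier T) (\<lambda>t. S #>\<^bsub>T\<^esub> t) ` \<O>\<^bsub>quot_group T S\<^esub>"
    using sc.center_carrier unfolding sc.S.pull_def .
  have R_mult: "R_form T J \<chi> (\<psi> * \<omega>) = R_form T J \<chi> \<psi> * R_form T J \<chi> \<omega>"
    if "\<chi> \<in> carrier D.X" "\<psi> \<in> carrier D.X" "\<omega> \<in> carrier D.X" for \<chi> \<psi> \<omega>
    using that sc.tw.antisym_mult_right[OF that] by (simp add: sc.R_antisym sc.X_mult)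
  have R_nonzero: "R_form T J \<chi> \<psi> \<noteq> 0" if "\<chi> \<in> carrier D.X" "\<psi> \<in> carrier D.X" for \<chi> \<psi>
    using that sc.tw.antisym_nonzero[OF that] by (simp add: sc.R_antisym)
  have alt: "alternating_bicharacter D.X (R_form T J)"
    using sc.tw.alternating_antisym unfolding alternating_bicharacter_def
    by (simp add: sc.R_antisym sc.X_mult)
  have closure: "S = zariski T closure_of ((\<lambda>\<chi>. dual_point T (R_form T J \<chi>)) ` carrier D.X)"
  proof (rule sc.support_closure)
    fix \<chi> assume \<chi>: "\<chi> \<in> carrier D.X"
    \<comment> \<open>For fixed \<open>\<chi>\<close> the form is a nowhere vanishing homomorphism
      on the character group, hence evaluation at a unique point of the torus.\<close>
    note dual = tc.dual_point[where \<psi> = "R_form T J \<chi>", OF R_nonzero[OF \<chi>] R_mult[OF \<chi>]]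
    show "dual_point T (R_form T J \<chi>) \<in> carrier T" by (rule dual(1))
    fix \<psi> assume "\<psi> \<in> carrier D.X"
    thus "\<psi> (dual_point T (R_form T J \<chi>)) = R_form T J \<chi> \<psi>" using dual(2)[where x = \<psi>] by simp
  qed
  have 5: "\<exists>b. alternating_bicharacter D.X b \<and>
       (\<forall>i\<in>{1..k}. \<forall>j\<in>{1..k}. b (x i) (x j) = lam i j) \<and>
       S = zariski T closure_of ((\<lambda>\<chi>. dual_point T (b \<chi>)) ` carrier D.X)"
    using alt closure lam by (intro exI[of _ "R_form T J"]) simp
  have 6: "\<forall>\<chi>\<in>carrier D.X. \<forall>\<psi>\<in>carrier D.X.
       R_form (sub_group T S) JS (fun_restrict S \<chi>) (fun_restrict S \<psi>) = R_form T J \<chi> \<psi>"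
    using sc.R_restrict by blast
  \<comment> \<open>\<open>JS\<close> itself is such a cocycle.\<close>
  have 7: "\<exists>\<sigma>. group_2_cocycle sc.D.X \<sigma> \<and>
       (\<forall>\<chi>\<in>carrier sc.D.X. \<forall>\<psi>\<in>carrier sc.D.X. \<sigma> \<chi> \<psi> = R_form (sub_group T S) JS \<chi> \<psi> * \<sigma> \<psi> \<chi>)"
    using sc.twS.cocycle sc.twS.nonzero by (intro exI[of _ JS] conjI ballI) (simp_all add: sc.RS_char)
  have 8: "\<forall>\<sigma>. group_2_cocycle sc.D.X \<sigma> \<and>
       (\<forall>\<chi>\<in>carrier sc.D.X. \<forall>\<psi>\<in>carrier sc.D.X. \<sigma> \<chi> \<psi> = R_form (sub_group T S) JS \<chi> \<psi> * \<sigma> \<psi> \<chi>) \<longrightarrow>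
       right_twist (sub_group T S) JS \<cong>\<^sub>a\<^sub>l\<^sub>g twisted_group_algebra sc.D.X \<sigma>"
    using sc.support_twisted_group_algebra by blast
  have S0S: "S0 \<subseteq> S"
    using connected_component_of_subset_topspace[of "zariski (sub_group T S)"]
      topspace_zariski[OF sc.D.coord_one] unfolding S0 identity_component_def by simp
  have 9: "right_twist (sub_group T S) JS \<cong>\<^sub>a\<^sub>l\<^sub>g
       crossed_product (E_alg l lam0) (char_group (quot_group (sub_group T S) S0))
         (\<lambda>\<chi>. E_scale l lam0
            (\<lambda>i. R_form (sub_group T S) JS (inflate \<chi>) (pullback S p (y i))))
         (\<lambda>\<chi> \<psi>. JS (inflate \<chi>) (inflate \<psi>))"
    by (rule sc.support_crossed_product[OF S0S p(1) _ y _ inflate]) (use p(2) lam0 in blast)+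
  show ?thesis
    by (intro conjI 1 2 3 4 5 6 7 8 9 sc.center_iso sc.simple_support D.opposite_right_twist_iso[OF J])
qed

end
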